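(* Let $N, P, A_1, A_2 \ge 0$, $C_0>0$ and $\lambda\in\mathbb{C}$. Put $\beta_c = \max\{2-2P, \tfrac{4-2N}{3}\}$ and $\beta_0=\max\{\beta_c,1\}$. There exist positive constants $\tilde C_5$ (depending only on $n$), $C_6$ (depending only on $n,N,P$), $C_7$ (depending only on $n,N,P,A_1,A_2$) and $R_0$ (depending only on $n,N,P,\lambda,A_1,A_2,C_0$) such that the following holds. Let $V:\mathbb{R}^n\to\mathbb{C}$ and $W:\mathbb{R}^n\to\mathbb{C}^n$ satisfy $|V(x)|\le A_1\langle x\rangle^{-N}$ and $|W(x)|\le A_2\langle x\rangle^{-P}$ on $\mathbb{R}^n$, and let $u$ be a solution of $$-\Delta u + W\cdot\nabla u + Vu=\lambda u\quad\text{in }\mathbb{R}^n$$ with $\|u\|_{L^\infty(\mathbb{R}^n)}\le C_0$ and $u(0)\ge 1$. Define $\mathbf{M}(R)=\inf_{|x_0|=R}\|u\|_{L^2(B_1(x_0))}$. Then for all $R\ge R_0$: (a) if $\beta_c>1$ (so $\beta_0=\beta_c$), then $$\mathbf{M}(R)\ge \tilde C_5\exp\left(-C_7R^{\beta_0}(\log R)^{C_6}\right);$$ (b) if $\beta_c<1$ (so $\beta_0=1$), then $$\mathbf{M}(R)\ge \tilde C_5\exp\left(-C_7R(\log R)^{C_6\log\log R}\right).$$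
   Context: $\langle x\rangle=\sqrt{1+|x|^2}$. $B_1(x_0)$ is the ball of radius 1 centred at $x_0\in\mathbb{R}^n$. The functions $u$, $V$, $W$ are (measurable and) complex-valued. Solutions are understood in the usual weak sense (so, since $V,W$ are bounded, $u$ has a continuous representative). The condition $u(0)\ge1$ means that $u(0)$ is real and at least $1$. *)

theory Defs
  imports "HOL-Analysis.Analysis" "HOL-Probability.Essential_Supremum"
begin

definition japanese_bracket :: "'a::real_normed_vector \<Rightarrow> real" where
  "japanese_bracket x = sqrt (1 + (norm x)\<^sup>2)"

definition beta_c :: "real \<Rightarrow> real \<Rightarrow> real" where
  "beta_c N P = max (2 - 2 * P) ((4 - 2 * N) / 3)"

definition beta_0 :: "real \<Rightarrow> real \<Rightarrow> real" where
  "beta_0 N P = max (beta_c N P) 1"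

text \<open>Functions of class \<open>C\<^sup>k\<close> on the whole space: the iterated directional derivatives
  up to order \<open>k\<close> exist as values of Frechet derivatives, and are continuous.\<close>

fun C_k :: "nat \<Rightarrow> ('a::real_normed_vector \<Rightarrow> 'b::real_normed_vector) \<Rightarrow> bool" where
  "C_k 0 f \<longleftrightarrow> continuous_on UNIV f"
| "C_k (Suc k) f \<longleftrightarrow>
     (\<forall>x. f differentiable (at x)) \<and> (\<forall>v. C_k k (\<lambda>x. frechet_derivative f (at x) v))"

definition test_function :: "('a::real_normed_vector \<Rightarrow> 'b::real_normed_vector) \<Rightarrow> bool" where
  "test_function \<phi> \<longleftrightarrow> (\<forall>k. C_k k \<phi>) \<and> compact (closure {x. \<phi> x \<noteq> 0})"

definition partial_deriv :: "'n \<Rightarrow> (real^'n \<Rightarrow> complex) \<Rightarrow> real^'n \<Rightarrow> complex" where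
  "partial_deriv i f x = frechet_derivative f (at x) (axis i 1)"

definition L2_loc :: "('a::euclidean_space \<Rightarrow> 'b::euclidean_space) \<Rightarrow> bool" where
  "L2_loc f \<longleftrightarrow> f \<in> borel_measurable lebesgue \<and>
     (\<forall>K. compact K \<longrightarrow> set_integrable lebesgue K (\<lambda>x. (norm (f x))\<^sup>2))"

definition weak_gradient :: "(real^'n \<Rightarrow> complex) \<Rightarrow> (real^'n \<Rightarrow> complex^'n) \<Rightarrow> bool" where
  "weak_gradient u G \<longleftrightarrow> (\<forall>\<phi> i. test_function \<phi> \<longrightarrow>
     (LINT x|lebesgue. u x * partial_deriv i \<phi> x) = - (LINT x|lebesgue. G x $ i * \<phi> x))"

text \<open>\<open>u\<close> is an \<open>H\<^sup>1\<^sub>l\<^sub>o\<^sub>c\<close> weak solution of \<open>-\<Delta>u + W\<cdot>\<nabla>u + Vu = \<lambda>u\<close> on the whole space, with \<open>G = \<nabla>u\<close>.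
  The products \<open>\<nabla>u\<cdot>\<nabla>\<phi>\<close> and \<open>W\<cdot>\<nabla>u\<close> are bilinear (no complex conjugation).
  The definition is meant for locally bounded measurable \<open>V\<close> and \<open>W\<close>, for which
  both integrands are integrable.\<close>

definition weak_solution ::
    "(real^'n \<Rightarrow> complex) \<Rightarrow> (real^'n \<Rightarrow> complex^'n) \<Rightarrow> complex \<Rightarrow> (real^'n \<Rightarrow> complex) \<Rightarrow> bool" where
  "weak_solution V W lam u \<longleftrightarrow> L2_loc u \<and>
     (\<exists>G. L2_loc G \<and> weak_gradient u G \<and>
       (\<forall>\<phi>. test_function \<phi> \<longrightarrow>
         (LINT x|lebesgue. (\<Sum>i\<in>UNIV. G x $ i * partial_deriv i \<phi> x)
            + (\<Sum>i\<in>UNIV. W x $ i * G x $ i) * \<phi> x + V x * u x * \<phi> x)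
         = (LINT x|lebesgue. lam * u x * \<phi> x)))"

definition continuous_representative :: "('a::euclidean_space \<Rightarrow> complex) \<Rightarrow> ('a \<Rightarrow> complex) \<Rightarrow> bool" where
  "continuous_representative u v \<longleftrightarrow> continuous_on UNIV v \<and> (AE x in lebesgue. u x = v x)"

definition Linf_norm :: "('a::euclidean_space \<Rightarrow> complex) \<Rightarrow> ereal" where
  "Linf_norm u = esssup lebesgue (\<lambda>x. ereal (cmod (u x)))"

text \<open>Meaningful for \<open>u\<close> square integrable on \<open>S\<close>; the Bochner integral is 0 otherwise.\<close>

definition L2_norm_on :: "'a::euclidean_space set \<Rightarrow> ('a \<Rightarrow> complex) \<Rightarrow> real" where
  "L2_norm_on S u = sqrt (LINT x:S|lebesgue. (cmod (u x))\<^sup>2)"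

definition M_inf :: "('a::euclidean_space \<Rightarrow> complex) \<Rightarrow> real \<Rightarrow> real" where
  "M_inf u R = (INF x0\<in>{x0. norm x0 = R}. L2_norm_on (ball x0 1) u)"

end

theory Submission
  imports Defs
begin

text \<open>A single Carleman inequality replaces an iteration over scales. Fix \<open>x\<^sub>0\<close> with \<open>|x\<^sub>0| = R\<close>. The weight is radial about
  \<open>x\<^sub>0\<close> and decreasing, so an estimate on an annulus around \<open>x\<^sub>0\<close> compares the mass of \<open>u\<close> near the origin (at distance
  about \<open>R\<close>) with the mass in \<open>B\<^sub>1(x\<^sub>0)\<close>, while the error at distance between \<open>2R\<close> and \<open>3R\<close> is negligible since \<open>u\<close> is bounded.
  The potentials are large only near the origin, hence only near the sphere \<open>r = R\<close>, and there the weight is strictly convex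
  in \<open>ln r\<close>. The lower order terms are absorbed as soon as the parameter of the weight is \<open>R\<^sup>\<beta> ln R\<close> with \<open>\<beta> = \<beta>\<^sub>0\<close>, which
  gives \<open>\<parallel>u\<parallel> \<ge> exp (- R\<^sup>\<beta> (ln R)\<^sup>4)\<close> on \<open>B\<^sub>1(x\<^sub>0)\<close>; this implies both cases. The mass near the origin is bounded below by the
  mean value inequality for \<open>|u|\<^sup>2\<close>, a subsolution of \<open>\<Delta> + \<Gamma>\<close>. All this is carried out for \<open>C\<^sup>2\<close> functions and transferred
  to weak solutions by mollification.\<close>

section \<open>Gradients and the divergence theorem\<close>

text \<open>The exponents of the theorem are those at which the lower order terms fit under the
  gains of the Carleman inequality. Its left side controls \<open>q * |grad w|^2\<close> and
  \<open>p^2 * q * |w|^2 / r^2\<close>, while the equation puts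
  \<open>r^2 * |W|^2 * |grad w|^2\<close> and \<open>r^2 * |V|^2 * |w|^2\<close> on the right. With
  \<open>q\<close> equal to \<kappa> r / <r - R>, \<open>p\<close> of size \<kappa> ln R, <r - R>
  \<le> <x> and r at most of order R, both are absorbed once <x>^(1-2P) and <x>^(1-2N) stay below
  R^(\<beta>-1) and R^(3\<beta>-3), up to logarithms. As <x> may lie anywhere between 1 and 5R, this
  asks for \<beta> \<ge> 1, \<beta> \<ge> 2-2P and \<beta> \<ge> (4-2N)/3. The profile 1/<r - R> is
  borderline: its antiderivative is an arsinh, so \<open>p\<close> varies only by logarithms. The
  factor ln R inside \<kappa> outgrows every constant, hence A1, A2, \<lambda> and C0 influence R0
  only. For non-real \<lambda> the real part joins the symmetric part of the conjugated operator,
  and i Im \<lambda> acts as a skew map for the real inner product of the complex plane.\<close>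

definition has_grad :: "(real^'n \<Rightarrow> 'b::real_normed_vector) \<Rightarrow> ('n \<Rightarrow> 'b) \<Rightarrow> real^'n \<Rightarrow> bool" where
  "has_grad f g x \<longleftrightarrow> (f has_derivative (\<lambda>h. \<Sum>i\<in>UNIV. h $ i *\<^sub>R g i)) (at x)"

lemma has_grad_add:
  assumes "has_grad f f' x" "has_grad g g' x"
  shows "has_grad (\<lambda>x. f x + g x) (\<lambda>i. f' i + g' i) x"
  using has_derivative_add[OF assms[unfolded has_grad_def]]
  by (simp add: has_grad_def scaleR_add_right sum.distrib)

lemma has_grad_diff:
  assumes "has_grad f f' x" "has_grad g g' x"
  shows "has_grad (\<lambda>x. f x - g x) (\<lambda>i. f' i - g' i) x"
  using has_derivative_diff[OF assms[unfolded has_grad_def]]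
  by (simp add: has_grad_def scaleR_diff_right sum_subtractf)

lemma has_grad_const: "has_grad (\<lambda>x. c) (\<lambda>i. 0) x"
  by (simp add: has_grad_def)

lemma has_grad_sum:
  assumes "\<And>j. j \<in> S \<Longrightarrow> has_grad (f j) (f' j) x"
  shows "has_grad (\<lambda>x. \<Sum>j\<in>S. f j x) (\<lambda>i. \<Sum>j\<in>S. f' j i) x"
proof -
  have "((\<lambda>x. \<Sum>j\<in>S. f j x) has_derivative (\<lambda>h. \<Sum>j\<in>S. \<Sum>i\<in>UNIV. h $ i *\<^sub>R f' j i)) (at x)"
    using assms by (intro has_derivative_sum) (simp add: has_grad_def)
  then show ?thesis
    unfolding has_grad_def by (subst (asm) sum.swap) (simp add: scaleR_sum_right)
qed

text \<open>One product rule serves scalar multiples, products and inner products. The order of its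
  two summands reappears in all derivative formulas that are matched syntactically later.\<close>

lemma has_grad_bilinear:
  assumes "bounded_bilinear pr" "has_grad f f' x" "has_grad g g' x"
  shows "has_grad (\<lambda>x. pr (f x) (g x)) (\<lambda>i. pr (f x) (g' i) + pr (f' i) (g x)) x"
proof -
  interpret bounded_bilinear pr by fact
  show ?thesis
    using FDERIV[OF assms(2,3)[unfolded has_grad_def]]
    by (simp add: has_grad_def sum_left sum_right scaleR_left scaleR_right
        scaleR_add_right sum.distrib)
qed

lemmas has_grad_scaleR = has_grad_bilinear[OF bounded_bilinear_scaleR]
lemmas has_grad_mult = has_grad_bilinear[OF bounded_bilinear_mult]
lemmas has_grad_inner = has_grad_bilinear[OF bounded_bilinear_inner]

lemma has_grad_bounded_linear:
  assumes "bounded_linear T" "has_grad f f' x"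
  shows "has_grad (\<lambda>x. T (f x)) (\<lambda>i. T (f' i)) x"
proof -
  interpret bounded_linear T by fact
  show ?thesis
    using has_derivative[OF assms(2)[unfolded has_grad_def]]
    by (simp add: has_grad_def sum scaleR)
qed

lemma has_grad_field:
  fixes g :: "real \<Rightarrow> real"
  assumes "(g has_field_derivative d) (at (f x))" "has_grad f f' x"
  shows "has_grad (\<lambda>x. g (f x)) (\<lambda>i. d * f' i) x"
proof -
  have "((\<lambda>x. g (f x)) has_derivative (\<lambda>h. d * (\<Sum>i\<in>UNIV. h $ i *\<^sub>R f' i))) (at x)"
    using has_derivative_compose[OF assms(2)[unfolded has_grad_def]
        assms(1)[unfolded has_field_derivative_def]]
    by simp
  then show ?thesis
    by (simp add: has_grad_def sum_distrib_left mult_ac)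
qed

lemma has_grad_nth: "has_grad (\<lambda>x. x $ i - c $ i) (\<lambda>j. if j = i then 1 else 0) x"
proof -
  have "((\<lambda>x. x $ i - c $ i) has_derivative (\<lambda>h. h $ i)) (at x)"
    by (auto intro!: derivative_eq_intros bounded_linear_imp_has_derivative bounded_linear_vec_nth)
  moreover have "h $ i = (\<Sum>j\<in>UNIV. h $ j *\<^sub>R (if j = i then 1 else 0))" for h :: "real^'a"
    by (simp add: if_distrib cong: if_cong)
  ultimately show ?thesis
    by (simp add: has_grad_def)
qed

lemma inner_cart: "(x :: real^'n) \<bullet> y = (\<Sum>i\<in>UNIV. x $ i * y $ i)"
  by (simp add: inner_vec_def)

lemma norm_cart_sq: "(norm (x :: real^'n))\<^sup>2 = (\<Sum>i\<in>UNIV. (x $ i)\<^sup>2)"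
  by (simp add: norm_vec_def L2_set_def sum_nonneg)

lemma has_grad_norm:
  assumes "x \<noteq> c"
  shows "has_grad (\<lambda>x. norm (x - c)) (\<lambda>i. (x $ i - c $ i) / norm (x - c)) x"
proof -
  have "((\<lambda>x. norm (x - c)) has_derivative (\<lambda>h. h \<bullet> sgn (x - c))) (at x)"
    using has_derivative_compose[OF _ has_derivative_norm, of "\<lambda>x. x - c" "\<lambda>h. h" x UNIV] assms
      has_derivative_diff[OF has_derivative_ident has_derivative_const, of c "at x"]
    by simp
  moreover have "h \<bullet> sgn (x - c) = (\<Sum>i\<in>UNIV. h $ i *\<^sub>R ((x $ i - c $ i) / norm (x - c)))" for h
    by (simp add: inner_cart sgn_div_norm divide_inverse mult_ac)
  ultimately show ?thesis
    by (simp add: has_grad_def)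
qed

lemma has_grad_norm_sq:
  "has_grad (\<lambda>x. (norm (x - c))\<^sup>2) (\<lambda>i. 2 * (x $ i - c $ i)) x"
proof -
  have "((\<lambda>x. (x - c) \<bullet> (x - c)) has_derivative (\<lambda>h. 2 * (h \<bullet> (x - c)))) (at x)"
    by (auto intro!: derivative_eq_intros simp: inner_commute)
  moreover have "2 * (h \<bullet> (x - c)) = (\<Sum>i\<in>UNIV. h $ i *\<^sub>R (2 * (x $ i - c $ i)))" for h
    by (simp add: inner_cart sum_distrib_left mult_ac)
  ultimately show ?thesis
    unfolding has_grad_def by (simp add: dot_square_norm)
qed

lemma has_grad_radial:
  assumes "x \<noteq> c" "(g has_field_derivative d) (at (norm (x - c)))"
  shows "has_grad (\<lambda>x. g (norm (x - c))) (\<lambda>i. d / norm (x - c) * (x $ i - c $ i)) x"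
  using has_grad_field[where f = "\<lambda>x. norm (x - c)", OF assms(2) has_grad_norm[OF assms(1)]] by simp

lemma has_grad_cong:
  assumes "has_grad f g x" "\<And>i. g i = g' i"
  shows "has_grad f g' x"
  using assms by (simp add: has_grad_def)

lemma has_grad_unique:
  assumes "has_grad f g x" "has_grad f g' x"
  shows "g = g'"
proof
  fix i
  have "(\<lambda>h. \<Sum>i\<in>UNIV. h $ i *\<^sub>R g i) = (\<lambda>h. \<Sum>i\<in>UNIV. h $ i *\<^sub>R g' i)"
    using assms has_derivative_unique unfolding has_grad_def by blast
  then have "(\<Sum>j\<in>UNIV. axis i (1::real) $ j *\<^sub>R g j) = (\<Sum>j\<in>UNIV. axis i (1::real) $ j *\<^sub>R g' j)"
    by metis
  then show "g i = g' i"
    by (simp add: axis_def if_distrib if_distribR cong: if_cong)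
qed

lemma has_grad_transform:
  assumes "has_grad f g x" "open U" "x \<in> U" "\<And>y. y \<in> U \<Longrightarrow> f y = f2 y"
  shows "has_grad f2 g x"
  using has_derivative_transform_within_open[OF assms(1)[unfolded has_grad_def] assms(2,3,4)]
  by (simp add: has_grad_def)

lemma has_grad_continuous: "has_grad f g x \<Longrightarrow> isCont f x"
  by (auto simp: has_grad_def intro: has_derivative_continuous)

lemma has_grad_direction:
  assumes "has_grad f g (x + t *\<^sub>R axis i 1)"
  shows "((\<lambda>t. f (x + t *\<^sub>R axis i 1)) has_vector_derivative g i) (at t)"
proof -
  have "((\<lambda>t. x + t *\<^sub>R axis i 1) has_derivative (\<lambda>s. s *\<^sub>R axis i 1)) (at t)"
    by (auto intro!: derivative_eq_intros)
  then have "((\<lambda>t. f (x + t *\<^sub>R axis i 1)) has_derivative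
      (\<lambda>s. \<Sum>j\<in>UNIV. (s *\<^sub>R axis i (1::real)) $ j *\<^sub>R g j)) (at t)"
    using has_derivative_compose[of "\<lambda>t. x + t *\<^sub>R axis i 1" _ t UNIV f] assms
    unfolding has_grad_def by fastforce
  then show ?thesis
    by (simp add: has_vector_derivative_def axis_def if_distrib if_distribR cong: if_cong)
qed

section \<open>The divergence theorem for compactly supported fields\<close>

lemma lborel_integral_shift:
  fixes f :: "'a::euclidean_space \<Rightarrow> 'b::{banach, second_countable_topology}"
  assumes "f \<in> borel_measurable borel"
  shows "(LINT x|lborel. f (x + c)) = (LINT x|lborel. f x)"
proof -
  have "(LINT x|lborel. f x) = (LINT x|distr lborel borel ((+) c). f x)"
    by (simp add: lborel_distr_plus)
  also have "\<dots> = (LINT x|lborel. f (c + x))"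
    using assms by (intro integral_distr) auto
  finally show ?thesis
    by (simp add: add.commute)
qed

lemma integrable_compact_support:
  fixes f :: "'a::euclidean_space \<Rightarrow> 'b::{banach, second_countable_topology}"
  assumes "continuous_on UNIV f" "compact K" "\<And>x. x \<notin> K \<Longrightarrow> f x = 0"
  shows "integrable lborel f"
proof -
  have "integrable lborel (\<lambda>x. indicator K x *\<^sub>R f x)"
    using assms borel_integrable_compact continuous_on_subset by blast
  moreover have "indicator K x *\<^sub>R f x = f x" for x
    using assms(3) by (cases "x \<in> K") auto
  ultimately show ?thesis
    by simp
qed

text \<open>Translation invariance makes the integral of \<open>f (x + t *\<^sub>R axis i 1)\<close>
  independent of \<open>t\<close>; differentiating under the integral at \<open>t = 0\<close> gives
  the claim without iterated integrals.\<close>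

lemma integral_partial_zero_global:
  fixes f :: "real^'n \<Rightarrow> real"
  assumes grad: "\<And>x. has_grad f (g x) x"
    and cont: "continuous_on UNIV (\<lambda>x. g x i)"
    and K: "compact K" "\<And>x. x \<notin> K \<Longrightarrow> f x = 0"
  shows "(LINT x|lborel. g x i) = 0"
proof -
  have contf: "continuous_on UNIV f"
    using has_grad_continuous[OF grad] by (simp add: continuous_at_imp_continuous_on)
  let ?e = "axis i 1 :: real^'n"
  obtain B where B: "\<And>x. x \<in> K \<Longrightarrow> norm x \<le> B"
    using compact_imp_bounded[OF K(1)] by (auto simp: bounded_iff)
  obtain a b where ab: "cball 0 (B + 2) \<subseteq> cbox a (b :: real^'n)"
    using bounded_subset_cbox_symmetric[OF bounded_cball[of "0::real^'n" "B + 2"]] by metis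
  \<comment> \<open>The box exceeds the support by 2, so a shift by at most 1 still leaves zero
    outside the box.\<close>
  have shift0: "f (x + t *\<^sub>R ?e) = 0" if "x \<notin> cbox a b" "t \<in> {-1..1}" for x t
  proof (rule K(2))
    have "norm x > B + 2"
      using that(1) ab by force
    moreover have "norm (x + t *\<^sub>R ?e) \<ge> norm x - norm (t *\<^sub>R ?e)"
      by (metis norm_diff_ineq)
    moreover have "norm (t *\<^sub>R ?e) \<le> 1"
      using that(2) by (simp add: abs_le_iff)
    ultimately show "x + t *\<^sub>R ?e \<notin> K"
      using B by fastforce
  qed
  have const: "integral (cbox a b) (\<lambda>x. f (x + t *\<^sub>R ?e)) = (LINT x|lborel. f x)" if "t \<in> {-1..1}" for t
  proof -
    have c: "continuous_on UNIV (\<lambda>x. f (x + t *\<^sub>R ?e))"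
      by (intro continuous_on_compose2[OF contf] continuous_intros) auto
    have "integral (cbox a b) (\<lambda>x. f (x + t *\<^sub>R ?e)) = integral UNIV (\<lambda>x. f (x + t *\<^sub>R ?e))"
      by (subst integral_restrict_UNIV[symmetric])
        (use shift0 that in \<open>auto intro!: integral_cong\<close>)
    also have "\<dots> = (LINT x|lborel. f (x + t *\<^sub>R ?e))"
      using shift0 that by (intro integral_lborel integrable_compact_support[OF c, of "cbox a b"]) auto
    also have "\<dots> = (LINT x|lborel. f x)"
      by (rule lborel_integral_shift) (use contf in \<open>simp add: borel_measurable_continuous_onI\<close>)
    finally show ?thesis .
  qed
  have "((\<lambda>t. integral (cbox a b) (\<lambda>x. f (x + t *\<^sub>R ?e))) has_vector_derivative
     integral (cbox a b) (\<lambda>x. g (x + 0 *\<^sub>R ?e) i)) (at 0 within {-1..1})"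
  proof (rule leibniz_rule_vector_derivative)
    show "((\<lambda>t. f (x + t *\<^sub>R ?e)) has_vector_derivative g (x + t *\<^sub>R ?e) i) (at t within {-1..1})" for x t
      using has_grad_direction[OF grad] has_vector_derivative_at_within by blast
    show "(\<lambda>x. f (x + t *\<^sub>R ?e)) integrable_on cbox a b" for t
      by (intro integrable_continuous continuous_on_compose2[OF contf] continuous_intros) auto
    show "continuous_on ({-1..1} \<times> cbox a b) (\<lambda>(t, x). g (x + t *\<^sub>R ?e) i)"
      unfolding split_beta
      by (rule continuous_on_compose2[OF cont]) (auto intro!: continuous_intros)
  qed auto
  moreover have "((\<lambda>t. integral (cbox a b) (\<lambda>x. f (x + t *\<^sub>R ?e))) has_vector_derivative 0)
      (at 0 within {-1..1})"
    using const by (intro has_vector_derivative_transform[OF _ _ has_vector_derivative_const]) auto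
  ultimately have "integral (cbox a b) (\<lambda>x. g (x + 0 *\<^sub>R ?e) i) = 0"
    by (rule vector_derivative_unique_within[rotated]) (simp add: trivial_limit_within islimpt_Icc)
  moreover have g0: "g x i = 0" if "x \<notin> K" for x
  proof -
    have "has_grad f (\<lambda>i. 0) x"
      by (rule has_grad_transform[OF has_grad_const, of "- K" x 0])
        (use K that in \<open>auto simp: compact_imp_closed open_Compl\<close>)
    then show ?thesis
      using has_grad_unique[OF grad] by (metis (full_types))
  qed
  moreover have "(LINT x|lborel. g x i) = integral (cbox a b) (\<lambda>x. g x i)"
  proof -
    have "K \<subseteq> cbox a b"
      using ab B by (force simp: subset_iff)
    then have "integral (cbox a b) (\<lambda>x. g x i) = integral UNIV (\<lambda>x. g x i)"
      by (subst integral_restrict_UNIV[symmetric]) (use g0 in \<open>force intro!: integral_cong\<close>)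
    then show ?thesis
      using integral_lborel[OF integrable_compact_support[OF cont K(1)]] g0 by simp
  qed
  ultimately show ?thesis
    by simp
qed

lemma grad_zero_outside:
  assumes "has_grad f g x" "open U" "x \<in> U" "compact K" "x \<notin> K" "\<And>x. x \<in> U - K \<Longrightarrow> f x = 0"
  shows "g i = 0"
proof -
  have "has_grad f (\<lambda>i. 0) x"
    by (rule has_grad_transform[OF has_grad_const, of "U - K" x 0])
      (use assms in \<open>auto simp: compact_imp_closed open_Diff\<close>)
  then show ?thesis
    using has_grad_unique[OF assms(1)] by (metis (full_types))
qed

text \<open>Extension by zero reduces this to the global case. The open set \<open>U\<close> is
  present because the fields of the Carleman identity are singular at the centre of the
  weight.\<close>

lemma integral_partial_zero:
  fixes f :: "real^'n \<Rightarrow> real"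
  assumes U: "open U" and grad: "\<And>x. x \<in> U \<Longrightarrow> has_grad f (g x) x"
    and cont: "continuous_on U (\<lambda>x. g x i)"
    and K: "compact K" "K \<subseteq> U" "\<And>x. x \<in> U - K \<Longrightarrow> f x = 0"
  shows "set_integrable lborel K (\<lambda>x. g x i)" "(LINT x:K|lborel. g x i) = 0"
proof -
  let ?f = "\<lambda>x. if x \<in> K then f x else 0"
  let ?g = "\<lambda>x j. if x \<in> K then g x j else 0"
  have g0: "g x j = 0" if "x \<in> U - K" for x j
    using grad_zero_outside[OF grad U _ K(1) _ K(3)] that by auto
  have clK: "closed K"
    using K(1) compact_imp_closed by blast
  have g: "has_grad ?f (?g x) x" for x
  proof (cases "x \<in> U")
    case True
    have "has_grad ?f (g x) x"
      by (rule has_grad_transform[OF grad[OF True] U True]) (use K in auto)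
    moreover have "g x = ?g x"
      using True g0 by auto
    ultimately show ?thesis
      by metis
  next
    case False
    then have "x \<notin> K"
      using K by auto
    have "has_grad ?f (\<lambda>i. 0) x"
      by (rule has_grad_transform[OF has_grad_const, of "- K" x 0])
        (use \<open>x \<notin> K\<close> clK in auto)
    then show ?thesis
      using \<open>x \<notin> K\<close> by simp
  qed
  have c: "continuous_on UNIV (\<lambda>x. ?g x i)"
  proof -
    \<comment> \<open>Both sets are open and cover the space since \<open>K \<subseteq> U\<close>,
      so continuity can be glued.\<close>
    have "continuous_on (U \<union> - K) (\<lambda>x. ?g x i)"
    proof (rule continuous_on_open_Un)
      show "continuous_on U (\<lambda>x. ?g x i)"
        by (rule continuous_on_eq[OF cont]) (use g0 in auto)
      show "continuous_on (- K) (\<lambda>x. ?g x i)"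
        by (rule continuous_on_eq[OF continuous_on_const[of _ 0]]) auto
    qed (use U clK in auto)
    moreover have "U \<union> - K = UNIV"
      using K by auto
    ultimately show ?thesis
      by simp
  qed
  have *: "indicator K x *\<^sub>R g x i = ?g x i" for x
    by auto
  show "set_integrable lborel K (\<lambda>x. g x i)"
    unfolding set_integrable_def * by (rule integrable_compact_support[OF c K(1)]) auto
  show "(LINT x:K|lborel. g x i) = 0"
    using integral_partial_zero_global[where f = ?f and g = ?g and i = i, OF g c K(1)]
    unfolding set_lebesgue_integral_def * by simp
qed

lemma integral_divergence_zero:
  fixes X :: "'n \<Rightarrow> real^'n \<Rightarrow> real"
  assumes U: "open U" and grad: "\<And>x i. x \<in> U \<Longrightarrow> has_grad (X i) (DX x i) x"
    and cont: "\<And>i. continuous_on U (\<lambda>x. DX x i i)"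
    and K: "compact K" "K \<subseteq> U" "\<And>x i. x \<in> U - K \<Longrightarrow> X i x = 0"
  shows "(LINT x:K|lborel. \<Sum>i\<in>UNIV. DX x i i) = 0"
proof -
  have "set_integrable lborel K (\<lambda>x. DX x i i)" "(LINT x:K|lborel. DX x i i) = 0" for i
    using integral_partial_zero[OF U grad cont K(1,2)] K(3) by blast+
  note * = this
  have "(LINT x:K|lborel. \<Sum>i\<in>UNIV. DX x i i) = (\<Sum>i\<in>UNIV. LINT x:K|lborel. DX x i i)"
    unfolding set_lebesgue_integral_def scaleR_sum_right
    by (rule Bochner_Integration.integral_sum) (use *(1) in \<open>simp add: set_integrable_def\<close>)
  then show ?thesis
    using *(2) by simp
qed

section \<open>Functions of class C2 with explicit derivatives, and Green's identity\<close>

text \<open>The derivatives are explicit arguments, so that a Laplacian is the plain sum of the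
  \<open>D2f i i\<close> and product rules become formulas. Symmetry of the Hessian is recorded
  because the divergence computation exchanges indices.\<close>

definition C2_on ::
  "(real^'n) set \<Rightarrow> (real^'n \<Rightarrow> 'b::real_normed_vector) \<Rightarrow> ('n \<Rightarrow> real^'n \<Rightarrow> 'b) \<Rightarrow>
    ('n \<Rightarrow> 'n \<Rightarrow> real^'n \<Rightarrow> 'b) \<Rightarrow> bool" where
  "C2_on U f Df D2f \<longleftrightarrow>
     (\<forall>x\<in>U. has_grad f (\<lambda>i. Df i x) x \<and>
       (\<forall>i. has_grad (Df i) (\<lambda>j. D2f i j x) x) \<and> (\<forall>i j. D2f i j x = D2f j i x)) \<and>
     (\<forall>i j. continuous_on U (D2f i j))"

lemma C2_onD:
  assumes "C2_on U f Df D2f"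
  shows "x \<in> U \<Longrightarrow> has_grad f (\<lambda>i. Df i x) x"
    and "x \<in> U \<Longrightarrow> has_grad (Df i) (\<lambda>j. D2f i j x) x"
    and "x \<in> U \<Longrightarrow> D2f i j x = D2f j i x"
    and "continuous_on U (D2f i j)"
  using assms unfolding C2_on_def by blast+

lemma has_grad_continuous_on:
  assumes "\<And>x. x \<in> U \<Longrightarrow> has_grad f (g x) x"
  shows "continuous_on U f"
  using has_grad_continuous[OF assms] by (simp add: continuous_at_imp_continuous_on)

lemma C2_on_continuous:
  assumes "C2_on U f Df D2f"
  shows "continuous_on U f" "continuous_on U (Df i)" "continuous_on U (D2f i j)"
  using has_grad_continuous_on[of U, OF C2_onD(1)[OF assms]]
    has_grad_continuous_on[of U, OF C2_onD(2)[OF assms]] C2_onD(4)[OF assms]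
  by auto

lemma C2_on_subset: "C2_on U f Df D2f \<Longrightarrow> V \<subseteq> U \<Longrightarrow> C2_on V f Df D2f"
  unfolding C2_on_def by (meson continuous_on_subset subsetD)

lemma C2_on_zero:
  assumes "C2_on U f Df D2f" "open U" "compact K" "\<And>x. x \<in> U - K \<Longrightarrow> f x = 0" "x \<in> U - K"
  shows "f x = 0" "Df i x = 0" "D2f i j x = 0"
proof -
  show "f x = 0"
    using assms by blast
  have D: "Df i x = 0" if "x \<in> U - K" for x i
    using grad_zero_outside[OF C2_onD(1)[OF assms(1)] assms(2) _ assms(3) _ assms(4)] that by blast
  then show "Df i x = 0"
    using assms(5) by blast
  show "D2f i j x = 0"
    using grad_zero_outside[OF C2_onD(2)[OF assms(1)] assms(2) _ assms(3) _ D] assms(5) by blast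
qed

lemma C2_on_scaleR:
  fixes f :: "real^'n \<Rightarrow> real" and w :: "real^'n \<Rightarrow> 'b::real_normed_vector"
  assumes f: "C2_on U f Df D2f" and w: "C2_on U w Dw D2w"
  shows "C2_on U (\<lambda>x. f x *\<^sub>R w x) (\<lambda>i x. f x *\<^sub>R Dw i x + Df i x *\<^sub>R w x)
    (\<lambda>i j x. f x *\<^sub>R D2w i j x + Df j x *\<^sub>R Dw i x + (Df i x *\<^sub>R Dw j x + D2f i j x *\<^sub>R w x))"
  unfolding C2_on_def
proof (intro conjI ballI allI)
  fix x i j
  assume x: "x \<in> U"
  show "has_grad (\<lambda>x. f x *\<^sub>R w x) (\<lambda>i. f x *\<^sub>R Dw i x + Df i x *\<^sub>R w x) x"
    using x by (intro has_grad_scaleR C2_onD(1)[OF f] C2_onD(1)[OF w])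
  show "has_grad (\<lambda>x. f x *\<^sub>R Dw i x + Df i x *\<^sub>R w x)
    (\<lambda>j. f x *\<^sub>R D2w i j x + Df j x *\<^sub>R Dw i x + (Df i x *\<^sub>R Dw j x + D2f i j x *\<^sub>R w x)) x"
    using x by (intro has_grad_add has_grad_scaleR C2_onD(1,2)[OF f] C2_onD(1,2)[OF w])
  show "f x *\<^sub>R D2w i j x + Df j x *\<^sub>R Dw i x + (Df i x *\<^sub>R Dw j x + D2f i j x *\<^sub>R w x) =
    f x *\<^sub>R D2w j i x + Df i x *\<^sub>R Dw j x + (Df j x *\<^sub>R Dw i x + D2f j i x *\<^sub>R w x)"
    using C2_onD(3)[OF f x, of i j] C2_onD(3)[OF w x, of i j] by simp
next
  fix i j
  show "continuous_on U (\<lambda>x. f x *\<^sub>R D2w i j x + Df j x *\<^sub>R Dw i x + (Df i x *\<^sub>R Dw j x + D2f i j x *\<^sub>R w x))"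
    by (intro continuous_intros C2_on_continuous[OF f] C2_on_continuous[OF w])
qed

text \<open>Divergence theorem for the field \<open>|w|^2 grad \<psi> - \<psi> grad |w|^2\<close>.
  Only \<open>w\<close>, its gradient and its Laplacian occur, so the identity survives limits in
  which just these three converge.\<close>

lemma integral_laplacian_by_parts:
  fixes w :: "real^'n \<Rightarrow> 'b::real_inner" and \<psi> :: "real^'n \<Rightarrow> real"
  assumes U: "open U" and K: "compact K" "K \<subseteq> U"
    and w: "C2_on U w Dw D2w" and \<psi>: "C2_on U \<psi> D\<psi> D2\<psi>"
    and supp: "\<And>x. x \<in> U - K \<Longrightarrow> \<psi> x = 0"
  shows "(LINT x:K|lborel. (\<Sum>i\<in>UNIV. (norm (w x))\<^sup>2 * D2\<psi> i i x
      - 2 * \<psi> x * ((norm (Dw i x))\<^sup>2 + w x \<bullet> D2w i i x))) = 0"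
proof -
  let ?X = "\<lambda>i x. (w x \<bullet> w x) * D\<psi> i x - 2 * (\<psi> x * (w x \<bullet> Dw i x))"
  let ?D = "\<lambda>x i j. ((w x \<bullet> w x) * D2\<psi> i j x + (w x \<bullet> Dw j x + Dw j x \<bullet> w x) * D\<psi> i x)
     - ((2 * (\<psi> x * (w x \<bullet> D2w i j x + Dw j x \<bullet> Dw i x) + D\<psi> j x * (w x \<bullet> Dw i x)))
        + 0 * (\<psi> x * (w x \<bullet> Dw i x)))"
  have "(LINT x:K|lborel. (\<Sum>i\<in>UNIV. ?D x i i)) = 0"
  proof (rule integral_divergence_zero[OF U _ _ K, where X = ?X and DX = ?D])
    show "has_grad (?X i) (?D x i) x" if "x \<in> U" for x i
      using that
      by (intro has_grad_diff has_grad_mult has_grad_inner has_grad_const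
          C2_onD(1,2)[OF w] C2_onD(1,2)[OF \<psi>])
    show "continuous_on U (\<lambda>x. ?D x i i)" for i
      by (intro continuous_intros C2_on_continuous[OF w] C2_on_continuous[OF \<psi>])
    show "?X i x = 0" if "x \<in> U - K" for i x
      using C2_on_zero(1,2)[OF \<psi> U K(1) supp that] by simp
  qed
  moreover have "?D x i i = (norm (w x))\<^sup>2 * D2\<psi> i i x
      - 2 * \<psi> x * ((norm (Dw i x))\<^sup>2 + w x \<bullet> D2w i i x)" for x i
    by (simp add: power2_norm_eq_inner inner_commute algebra_simps)
  ultimately show ?thesis
    by simp
qed

text \<open>The vector field of the Carleman identity. Here \<open>Y\<close>, \<open>Y2\<close> are the first and second partial
  derivatives of \<open>y\<close>, \<open>z\<close> is the position relative to the centre, \<open>E\<close> is the radial derivative \<open>z \<cdot> \<nabla>y\<close>,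
  \<open>\<rho>\<close> is \<open>1/|z|\<^sup>2\<close>, and \<open>a\<close> is the multiplier.\<close>

lemma carleman_divergence_algebra:
  fixes Y :: "'n::finite \<Rightarrow> 'b::real_inner" and z :: "'n \<Rightarrow> real"
  assumes J: "linear J" "\<And>v. v \<bullet> J v = 0"
    and sym: "\<And>i j. Y2 i j = Y2 j i"
    and \<rho>: "\<rho> * (\<Sum>i\<in>UNIV. (z i)\<^sup>2) = 1"
    and n: "n = real CARD('n)"
    and m: "m = (n - 2) * p - 2 * q"
    and E: "E = (\<Sum>k\<in>UNIV. z k *\<^sub>R Y k)"
    and a: "a = (2 * p) *\<^sub>R E + m *\<^sub>R y + r2 *\<^sub>R J y" and r2: "r2 = (\<Sum>i\<in>UNIV. (z i)\<^sup>2)"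
    and a': "\<And>j. a' j = (2 * p) *\<^sub>R (\<Sum>k\<in>UNIV. z k *\<^sub>R Y2 k j + (if j = k then 1 else 0) *\<^sub>R Y k)
       + (- 2 * q * \<rho> * z j) *\<^sub>R E + (m *\<^sub>R Y j + (m1 * z j) *\<^sub>R y) + (r2 *\<^sub>R J (Y j) + (2 * z j) *\<^sub>R J y)"
    and N: "N = (\<Sum>k\<in>UNIV. Y k \<bullet> Y k)"
    and s: "s = lr * p + p^3 * \<rho>" and \<sigma>: "\<sigma> = - lr * q * \<rho> - 3 * p\<^sup>2 * q * \<rho>\<^sup>2 - 2 * p^3 * \<rho>\<^sup>2"
  shows "(\<Sum>i\<in>UNIV. 2 * (Y i \<bullet> a' i + Y2 i i \<bullet> a)
      - 2 * (p * z i * (\<Sum>k\<in>UNIV. 2 * (Y k \<bullet> Y2 k i)) + (p - q * \<rho> * z i * z i) * N)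
      - (m1 * z i * (2 * (y \<bullet> Y i)) + (m1 + m2 * z i * z i) * (y \<bullet> y))
      + 2 * (s * z i * (2 * (y \<bullet> Y i)) + (s + \<sigma> * z i * z i) * (y \<bullet> y)))
    = 2 * (((\<Sum>i\<in>UNIV. Y2 i i) + (lr + p\<^sup>2 * \<rho>) *\<^sub>R y) \<bullet> a)
      - (4 * q * \<rho> * (E \<bullet> E) + 2 * q * N - 4 * (E \<bullet> J y) + (m2 * r2 + n * m1) * (y \<bullet> y)
         - lr * (4 * p + 2 * q) * (y \<bullet> y) + 2 * p\<^sup>2 * q * \<rho> * (y \<bullet> y))"
proof -
  \<comment> \<open>Collects the second derivatives apart from the Laplacian: \<open>T\<close>
    enters as \<open>4 * p * T\<close> through \<open>Y i \<bullet> a' i\<close> and as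
    \<open>- 4 * p * T\<close> through the derivative of \<open>N\<close>, and cancels.\<close>
  define T where "T = (\<Sum>i\<in>UNIV. \<Sum>k\<in>UNIV. z i * (Y k \<bullet> Y2 k i))"
  have zz: "(\<Sum>i\<in>UNIV. z i * z i) = r2"
    by (simp add: r2 power2_eq_square)
  have YE: "(\<Sum>i\<in>UNIV. z i * (Y i \<bullet> v)) = E \<bullet> v" for v
    by (simp add: E inner_sum_left)
  have yE: "(\<Sum>i\<in>UNIV. z i * (y \<bullet> Y i)) = E \<bullet> y"
    using YE[of y] by (simp add: inner_commute)
  have YJ: "Y i \<bullet> J (Y i) = 0" for i
    by (rule J)
  have T1: "(\<Sum>i\<in>UNIV. Y i \<bullet> (\<Sum>k\<in>UNIV. z k *\<^sub>R Y2 k i)) = T"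
    unfolding T_def
    by (subst sum.swap) (simp add: inner_sum_right sym)
  have T2: "(\<Sum>i\<in>UNIV. z i * (2 * (\<Sum>k\<in>UNIV. Y k \<bullet> Y2 k i))) = 2 * T"
    by (simp add: T_def sum_distrib_left mult_ac)
  define Q where "Q i = (\<Sum>k\<in>UNIV. 2 * (Y k \<bullet> Y2 k i))" for i
  have delta: "(\<Sum>k\<in>UNIV. (if i = k then 1 else 0) *\<^sub>R Y k) = Y i" for i
    by (simp add: if_distrib if_distribR cong: if_cong)
  have A: "(\<Sum>i\<in>UNIV. Y i \<bullet> a' i) = 2 * p * (T + N) - 2 * q * \<rho> * (E \<bullet> E) + m * N + m1 * (E \<bullet> y) + 2 * (E \<bullet> J y)"
  proof -
    have "Y i \<bullet> a' i = 2 * p * (Y i \<bullet> (\<Sum>k\<in>UNIV. z k *\<^sub>R Y2 k i)) + 2 * p * (Y i \<bullet> Y i)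
        - 2 * q * \<rho> * (z i * (Y i \<bullet> E)) + m * (Y i \<bullet> Y i) + m1 * (z i * (Y i \<bullet> y)) + 2 * (z i * (Y i \<bullet> J y))" for i
      by (simp add: a' sum.distrib delta inner_add_right YJ algebra_simps)
    then show ?thesis
      unfolding N by (simp only: sum.distrib sum_subtractf sum_distrib_left[symmetric] T1 YE)
        (simp add: algebra_simps)
  qed
  have "(\<Sum>i\<in>UNIV. 2 * (Y i \<bullet> a' i + Y2 i i \<bullet> a)
      - 2 * (p * z i * (\<Sum>k\<in>UNIV. 2 * (Y k \<bullet> Y2 k i)) + (p - q * \<rho> * z i * z i) * N)
      - (m1 * z i * (2 * (y \<bullet> Y i)) + (m1 + m2 * z i * z i) * (y \<bullet> y))
      + 2 * (s * z i * (2 * (y \<bullet> Y i)) + (s + \<sigma> * z i * z i) * (y \<bullet> y)))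
    = (\<Sum>i\<in>UNIV. 2 * (Y i \<bullet> a' i) + 2 * (Y2 i i \<bullet> a)
      - 2 * p * (z i * (\<Sum>k\<in>UNIV. 2 * (Y k \<bullet> Y2 k i))) - 2 * p * N + 2 * q * \<rho> * N * (z i * z i)
      - 2 * m1 * (z i * (y \<bullet> Y i)) - m1 * (y \<bullet> y) - m2 * (y \<bullet> y) * (z i * z i)
      + 4 * s * (z i * (y \<bullet> Y i)) + 2 * s * (y \<bullet> y) + 2 * \<sigma> * (y \<bullet> y) * (z i * z i))"
    unfolding Q_def[symmetric] by (rule sum.cong) (simp_all add: algebra_simps)
  also have "\<dots> = 2 * (\<Sum>i\<in>UNIV. Y i \<bullet> a' i) + 2 * ((\<Sum>i\<in>UNIV. Y2 i i) \<bullet> a)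
      - 2 * p * (2 * T) - 2 * p * N * n + 2 * q * \<rho> * N * r2
      - 2 * m1 * (E \<bullet> y) - m1 * (y \<bullet> y) * n - m2 * (y \<bullet> y) * r2
      + 4 * s * (E \<bullet> y) + 2 * s * (y \<bullet> y) * n + 2 * \<sigma> * (y \<bullet> y) * r2"
    unfolding sum.distrib sum_subtractf sum_distrib_left[symmetric] T2 zz yE
    by (simp add: inner_sum_left n)
  also have "\<dots> = 2 * (((\<Sum>i\<in>UNIV. Y2 i i) + (lr + p\<^sup>2 * \<rho>) *\<^sub>R y) \<bullet> a)
      - (4 * q * \<rho> * (E \<bullet> E) + 2 * q * N - 4 * (E \<bullet> J y) + (m2 * r2 + n * m1) * (y \<bullet> y)
         - lr * (4 * p + 2 * q) * (y \<bullet> y) + 2 * p\<^sup>2 * q * \<rho> * (y \<bullet> y))"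
  proof -
    \<comment> \<open>The \<open>J\<close> part of the multiplier is orthogonal to \<open>y\<close>.
      What remains, times \<open>2 * (lr + p^2 * \<rho>)\<close>, has the part
      \<open>4 * s * (E \<bullet> y)\<close>; this is what \<open>s\<close> was chosen to
      match.\<close>
    have ya: "y \<bullet> a = 2 * p * (E \<bullet> y) + m * (y \<bullet> y)"
      using J(2)[of y] by (simp add: a inner_add_right inner_commute)
    have \<rho>r: "\<rho> * r2 = 1"
      using \<rho> r2 by simp
    have h1: "2 * q * \<rho> * N * r2 = 2 * q * N"
      using \<rho>r by (simp add: mult_ac)
    have h2: "2 * \<sigma> * (y \<bullet> y) * r2 = 2 * (- lr * q - 3 * p\<^sup>2 * q * \<rho> - 2 * p^3 * \<rho>) * (y \<bullet> y)"
    proof -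
      have "\<sigma> * r2 = (- lr * q - 3 * p\<^sup>2 * q * \<rho> - 2 * p^3 * \<rho>) * (\<rho> * r2)"
        unfolding \<sigma> by (simp add: algebra_simps power2_eq_square)
      then show ?thesis
        using \<rho>r by (simp add: mult_ac)
    qed
    show ?thesis
      unfolding h1 h2 A s m inner_add_left inner_scaleR_left ya
      by (simp add: algebra_simps power2_eq_square power3_eq_cube)
  qed
  finally show ?thesis .
qed

section \<open>The Carleman identity for radial weights\<close>

lemma has_grad_inverse_norm_sq:
  assumes "x \<noteq> c"
  shows "has_grad (\<lambda>x. 1 / (norm (x - c))\<^sup>2) (\<lambda>i. - 2 * (1 / (norm (x - c))\<^sup>2)\<^sup>2 * (x $ i - c $ i)) x"
proof -
  have d: "((\<lambda>s::real. 1 / s) has_field_derivative - 1 / s\<^sup>2) (at s)" if "s \<noteq> 0" for s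
    using that by (auto intro!: derivative_eq_intros simp: power2_eq_square)
  have "has_grad (\<lambda>x. 1 / (norm (x - c))\<^sup>2)
      (\<lambda>i. - 1 / ((norm (x - c))\<^sup>2)\<^sup>2 * (2 * (x $ i - c $ i))) x"
    by (rule has_grad_field[where g = "\<lambda>s. 1 / s" and f = "\<lambda>x. (norm (x - c))\<^sup>2", OF d has_grad_norm_sq])
      (use assms in simp)
  then show ?thesis
    by (rule has_grad_cong) (simp add: power_one_over)
qed

text \<open>A weight \<open>exp \<phi>\<close> that is radial about \<open>c\<close>. In the logarithmic variable \<open>t = ln |x - c|\<close> one has
  \<open>p = - d\<phi>/dt\<close> and \<open>q = - dp/dt\<close>, so that \<open>q > 0\<close> is convexity of \<open>\<phi>\<close> in \<open>t\<close>. The function \<open>m\<close> is the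
  zeroth order coefficient of the multiplier, with gradient \<open>m1 (x - c)\<close>, and \<open>m2 (x - c)\<close> is the
  gradient of \<open>m1\<close>.\<close>

locale radial_weight =
  fixes c :: "real^'n" and \<phi> p q m1 m2 :: "real^'n \<Rightarrow> real"
  assumes grad_\<phi>: "\<And>x. x \<noteq> c \<Longrightarrow> has_grad \<phi> (\<lambda>i. - p x * (1 / (norm (x - c))\<^sup>2) * (x $ i - c $ i)) x"
    and grad_p: "\<And>x. x \<noteq> c \<Longrightarrow> has_grad p (\<lambda>i. - q x * (1 / (norm (x - c))\<^sup>2) * (x $ i - c $ i)) x"
    and grad_m: "\<And>x. x \<noteq> c \<Longrightarrow>
      has_grad (\<lambda>x. (real CARD('n) - 2) * p x - 2 * q x) (\<lambda>i. m1 x * (x $ i - c $ i)) x"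
    and grad_m1: "\<And>x. x \<noteq> c \<Longrightarrow> has_grad m1 (\<lambda>i. m2 x * (x $ i - c $ i)) x"
    and cont_q: "continuous_on (- {c}) q"
    and cont_m2: "continuous_on (- {c}) m2"
begin

abbreviation "z i x \<equiv> x $ i - c $ i"
abbreviation "r2 x \<equiv> (norm (x - c))\<^sup>2"
abbreviation "\<rho> x \<equiv> 1 / (norm (x - c))\<^sup>2"

text \<open>Conjugation by \<open>exp \<phi>\<close>, multiplied by \<open>r2\<close>, produces the
  zeroth order coefficient \<open>(n - 2) * p - q\<close>. Subtracting one further \<open>q\<close>
  makes the gradient term of the quadratic form \<open>2 * q * |grad y|^2\<close> instead of zero;
  the compensating \<open>q * y\<close> is treated as an error.\<close>

definition m :: "real^'n \<Rightarrow> real" where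
  "m x = (real CARD('n) - 2) * p x - 2 * q x"

text \<open>Up to the summand \<open>q * y\<close>, this is what \<open>r2\<close> times the
  conjugated operator contains besides \<open>r2\<close> times the symmetric part, namely the
  Laplacian of \<open>y\<close> plus \<open>(lr + p^2 * \<rho>) * y\<close>. The skew map
  \<open>J\<close> carries the imaginary part of \<lambda>.\<close>

definition multiplier ::
    "('b \<Rightarrow> 'b) \<Rightarrow> (real^'n \<Rightarrow> 'b) \<Rightarrow> ('n \<Rightarrow> real^'n \<Rightarrow> 'b) \<Rightarrow> real^'n \<Rightarrow> 'b::real_inner" where
  "multiplier J y Y x = (2 * p x) *\<^sub>R (\<Sum>k\<in>UNIV. z k x *\<^sub>R Y k x) + m x *\<^sub>R y x + r2 x *\<^sub>R J (y x)"

text \<open>\<open>E\<close> is the derivative of \<open>y\<close> along the position relative to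
  the centre. The factor \<open>m2 * r2 + n * m1\<close> is the Laplacian of \<open>m\<close>,
  because the gradient of \<open>m\<close> is \<open>m1\<close> times that position.\<close>

definition carleman_form ::
    "real \<Rightarrow> ('b \<Rightarrow> 'b) \<Rightarrow> (real^'n \<Rightarrow> 'b) \<Rightarrow> ('n \<Rightarrow> real^'n \<Rightarrow> 'b::real_inner) \<Rightarrow> real^'n \<Rightarrow> real" where
  "carleman_form lr J y Y x =
    (let E = (\<Sum>k\<in>UNIV. z k x *\<^sub>R Y k x) in
      4 * q x * \<rho> x * (E \<bullet> E) + 2 * q x * (\<Sum>k\<in>UNIV. Y k x \<bullet> Y k x) - 4 * (E \<bullet> J (y x))
      + (m2 x * r2 x + real CARD('n) * m1 x) * (y x \<bullet> y x)
      - lr * (4 * p x + 2 * q x) * (y x \<bullet> y x) + 2 * (p x)\<^sup>2 * q x * \<rho> x * (y x \<bullet> y x))"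

lemma sum_z_sq: "(\<Sum>i\<in>UNIV. (z i x)\<^sup>2) = r2 x"
  by (simp add: norm_cart_sq)

lemma cont_p: "continuous_on (- {c}) p"
  by (rule has_grad_continuous_on[OF grad_p]) auto

lemma cont_\<phi>: "continuous_on (- {c}) \<phi>"
  by (rule has_grad_continuous_on[OF grad_\<phi>]) auto

lemma cont_m: "continuous_on (- {c}) m"
  unfolding m_def by (intro continuous_intros cont_p cont_q)

lemma cont_m1: "continuous_on (- {c}) m1"
  by (rule has_grad_continuous_on[OF grad_m1]) auto

text \<open>Twice the pairing of the symmetric part with the multiplier differs from the quadratic
  form by a divergence. The field is supported in \<open>K\<close>, away from the singular point, so
  its divergence integrates to zero.\<close>

lemma carleman_identity:
  fixes y :: "real^'n \<Rightarrow> 'b::real_inner"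
  assumes J: "bounded_linear J" "\<And>v. v \<bullet> J v = 0"
    and K: "compact K" "c \<notin> K"
    and y: "C2_on (- {c}) y Y Y2"
    and supp: "\<And>x. x \<in> - {c} - K \<Longrightarrow> y x = 0"
  shows "(LINT x:K|lborel. 2 * (((\<Sum>i\<in>UNIV. Y2 i i x) + (lr + (p x)\<^sup>2 * \<rho> x) *\<^sub>R y x) \<bullet> multiplier J y Y x)
      - carleman_form lr J y Y x) = 0"
proof -
  define U where "U = - {c}"
  define Ey where "Ey x = (\<Sum>k\<in>UNIV. z k x *\<^sub>R Y k x)" for x
  define Ey' where "Ey' j x = (\<Sum>k\<in>UNIV. z k x *\<^sub>R Y2 k j x + (if j = k then 1 else 0) *\<^sub>R Y k x)" for j x
  define a where "a x = (2 * p x) *\<^sub>R Ey x + m x *\<^sub>R y x + r2 x *\<^sub>R J (y x)" for x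
  define a' where "a' j x = (2 * p x) *\<^sub>R Ey' j x + (- 2 * q x * \<rho> x * z j x) *\<^sub>R Ey x
      + (m x *\<^sub>R Y j x + (m1 x * z j x) *\<^sub>R y x) + (r2 x *\<^sub>R J (Y j x) + (2 * z j x) *\<^sub>R J (y x))" for j x
  define N where "N x = (\<Sum>k\<in>UNIV. Y k x \<bullet> Y k x)" for x
  define N' where "N' j x = (\<Sum>k\<in>UNIV. 2 * (Y k x \<bullet> Y2 k j x))" for j x
  define s where "s x = lr * p x + (p x)^3 * \<rho> x" for x
  define \<sigma> where "\<sigma> x = - lr * q x * \<rho> x - 3 * (p x)\<^sup>2 * q x * (\<rho> x)\<^sup>2 - 2 * (p x)^3 * (\<rho> x)\<^sup>2" for x
  have U: "open U"
    by (simp add: U_def open_Compl)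
  have y: "C2_on U y Y Y2"
    using y by (simp add: U_def)
  have gm: "has_grad m (\<lambda>i. m1 x * z i x) x" if "x \<in> U" for x
    using grad_m[of x] that by (simp add: m_def[abs_def] U_def)
  have gE: "has_grad Ey (\<lambda>j. Ey' j x) x" if "x \<in> U" for x
    unfolding Ey_def[abs_def] Ey'_def
    by (rule has_grad_sum, rule has_grad_scaleR[OF has_grad_nth C2_onD(2)[OF y that]])
  have ga: "has_grad a (\<lambda>j. a' j x) x" if x: "x \<in> U" for x
  proof -
    have "has_grad a (\<lambda>j. ((2 * p x) *\<^sub>R Ey' j x + (2 * (- q x * \<rho> x * z j x) + 0 * p x) *\<^sub>R Ey x)
        + (m x *\<^sub>R Y j x + (m1 x * z j x) *\<^sub>R y x)
        + (r2 x *\<^sub>R J (Y j x) + (2 * z j x) *\<^sub>R J (y x))) x"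
      unfolding a_def[abs_def] using x
      by (intro has_grad_add has_grad_scaleR has_grad_mult gE gm has_grad_const
            has_grad_norm_sq has_grad_bounded_linear[OF J(1)] C2_onD(1)[OF y] grad_p)
         (auto simp: U_def)
    then show ?thesis
      by (rule has_grad_cong) (simp add: a'_def algebra_simps)
  qed
  have gN: "has_grad N (\<lambda>j. N' j x) x" if "x \<in> U" for x
  proof -
    have "has_grad N (\<lambda>j. \<Sum>k\<in>UNIV. Y k x \<bullet> Y2 k j x + Y2 k j x \<bullet> Y k x) x"
      unfolding N_def[abs_def]
      by (rule has_grad_sum, rule has_grad_inner[OF C2_onD(2)[OF y that] C2_onD(2)[OF y that]])
    then show ?thesis
      by (rule has_grad_cong) (simp add: N'_def inner_commute)
  qed
  have gs: "has_grad s (\<lambda>j. \<sigma> x * z j x) x" if x: "x \<in> U" for x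
  proof -
    have "((\<lambda>t. t^3) has_field_derivative 3 * (p x)\<^sup>2) (at (p x))"
      by (auto intro!: derivative_eq_intros)
    then have p3: "has_grad (\<lambda>x. (p x)^3) (\<lambda>i. 3 * (p x)\<^sup>2 * (- q x * \<rho> x * z i x)) x"
      using x grad_p[of x] by (intro has_grad_field[where g = "\<lambda>t. t^3"]) (auto simp: U_def)
    have "has_grad s (\<lambda>j. (lr * (- q x * \<rho> x * z j x) + 0 * p x)
        + ((p x)^3 * (- 2 * (\<rho> x)\<^sup>2 * z j x) + 3 * (p x)\<^sup>2 * (- q x * \<rho> x * z j x) * \<rho> x)) x"
      unfolding s_def[abs_def] using x
      by (intro has_grad_add has_grad_mult has_grad_const grad_p p3 has_grad_inverse_norm_sq)
         (auto simp: U_def)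
    moreover have "(lr * (- Q * r * w) + 0 * P) + (P^3 * (- 2 * r\<^sup>2 * w) + 3 * P\<^sup>2 * (- Q * r * w) * r)
        = (- lr * Q * r - 3 * P\<^sup>2 * Q * r\<^sup>2 - 2 * P^3 * r\<^sup>2) * w" for P Q r w :: real
      by (simp add: algebra_simps power2_eq_square)
    ultimately show ?thesis
      unfolding \<sigma>_def by (rule has_grad_cong)
  qed
  \<comment> \<open>The first term integrates the pairing of the Laplacian with the multiplier by
    parts. The others remove what this leaves: the gradient of \<open>|Y|^2\<close> along
    \<open>z\<close>, the product of \<open>y\<close> and \<open>Y\<close> caused by the gradient of
    \<open>m\<close>, and the same product coming from the potential
    \<open>lr + p^2 * \<rho>\<close>.\<close>
  define X where "X i x = 2 * (Y i x \<bullet> a x) - 2 * (p x * z i x * N x)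
      - m1 x * z i x * (y x \<bullet> y x) + 2 * (s x * z i x * (y x \<bullet> y x))" for i x
  define DX where "DX x i j = 2 * (Y i x \<bullet> a' j x + Y2 i j x \<bullet> a x)
      - 2 * (p x * z i x * N' j x + ((if j = i then p x else 0) - q x * \<rho> x * z j x * z i x) * N x)
      - (m1 x * z i x * (2 * (y x \<bullet> Y j x)) + ((if j = i then m1 x else 0) + m2 x * z j x * z i x) * (y x \<bullet> y x))
      + 2 * (s x * z i x * (2 * (y x \<bullet> Y j x)) + ((if j = i then s x else 0) + \<sigma> x * z j x * z i x) * (y x \<bullet> y x))"
    for x i j
  have gX: "has_grad (X i) (DX x i) x" if x: "x \<in> U" for x i
  proof -
    have yy: "has_grad (\<lambda>x. y x \<bullet> y x) (\<lambda>j. y x \<bullet> Y j x + Y j x \<bullet> y x) x"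
      by (intro has_grad_inner C2_onD(1)[OF y] x)
    have pz: "has_grad (\<lambda>x. p x * z i x) (\<lambda>j. p x * (if j = i then 1 else 0) + (- q x * \<rho> x * z j x) * z i x) x"
      using x by (intro has_grad_mult has_grad_nth grad_p) (auto simp: U_def)
    have mz: "has_grad (\<lambda>x. m1 x * z i x) (\<lambda>j. m1 x * (if j = i then 1 else 0) + (m2 x * z j x) * z i x) x"
      using x by (intro has_grad_mult has_grad_nth grad_m1) (auto simp: U_def)
    have sz: "has_grad (\<lambda>x. s x * z i x) (\<lambda>j. s x * (if j = i then 1 else 0) + (\<sigma> x * z j x) * z i x) x"
      using x by (intro has_grad_mult has_grad_nth gs)
    have "has_grad (X i) (\<lambda>j. (2 * (Y i x \<bullet> a' j x + Y2 i j x \<bullet> a x) + 0 * (Y i x \<bullet> a x))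
      - (2 * ((p x * z i x) * N' j x + (p x * (if j = i then 1 else 0) + (- q x * \<rho> x * z j x) * z i x) * N x)
          + 0 * (p x * z i x * N x))
      - ((m1 x * z i x) * (y x \<bullet> Y j x + Y j x \<bullet> y x)
          + (m1 x * (if j = i then 1 else 0) + (m2 x * z j x) * z i x) * (y x \<bullet> y x))
      + (2 * ((s x * z i x) * (y x \<bullet> Y j x + Y j x \<bullet> y x)
          + (s x * (if j = i then 1 else 0) + (\<sigma> x * z j x) * z i x) * (y x \<bullet> y x))
          + 0 * (s x * z i x * (y x \<bullet> y x)))) x"
      unfolding X_def[abs_def]
      by (rule has_grad_add[OF has_grad_diff[OF has_grad_diff[OF
            has_grad_mult[OF has_grad_const has_grad_inner[OF C2_onD(2)[OF y x] ga[OF x]]]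
            has_grad_mult[OF has_grad_const has_grad_mult[OF pz gN[OF x]]]]
            has_grad_mult[OF mz yy]]
            has_grad_mult[OF has_grad_const has_grad_mult[OF sz yy]]])
    then show ?thesis
      by (rule has_grad_cong) (simp add: DX_def inner_commute)
  qed
  have "(LINT x:K|lborel. \<Sum>i\<in>UNIV. DX x i i) = 0"
  proof (rule integral_divergence_zero[OF U gX _ K(1)])
    have cw: "continuous_on U p" "continuous_on U q" "continuous_on U m"
        "continuous_on U m1" "continuous_on U m2"
      using cont_p cont_q cont_m cont_m1 cont_m2 by (auto simp: U_def)
    note cy = C2_on_continuous[OF y]
    have cJ: "continuous_on U (\<lambda>x. J (f x))" if "continuous_on U f" for f
      using bounded_linear.continuous_on[OF J(1) that] .
    have c\<rho>: "continuous_on U \<rho>"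
      by (intro continuous_intros) (auto simp: U_def)
    have cE: "continuous_on U Ey"
      unfolding Ey_def[abs_def] by (intro continuous_intros cy)
    have cE': "continuous_on U (Ey' i)" for i
      unfolding Ey'_def[abs_def] by (intro continuous_on_sum continuous_on_add continuous_on_scaleR
          continuous_on_diff continuous_on_component continuous_on_id continuous_on_const cy)
    have ca: "continuous_on U a"
      unfolding a_def[abs_def] by (intro continuous_intros cw cy cE cJ)
    have ca': "continuous_on U (a' i)" for i
      unfolding a'_def[abs_def] by (intro continuous_on_add continuous_on_mult continuous_on_scaleR
          continuous_on_diff continuous_on_component continuous_on_id continuous_on_const
          continuous_on_power continuous_on_norm cw cy cE cE' cJ c\<rho>)
    have cN: "continuous_on U N" and cN': "continuous_on U (N' i)" for i
      unfolding N_def[abs_def] N'_def[abs_def] by (intro continuous_intros cy)+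
    have cs: "continuous_on U s" and c\<sigma>: "continuous_on U \<sigma>"
      unfolding s_def[abs_def] \<sigma>_def[abs_def]
      by (intro continuous_on_add continuous_on_mult continuous_on_diff continuous_on_const
          continuous_on_power cw c\<rho>)+
    show "continuous_on U (\<lambda>x. DX x i i)" for i
      unfolding DX_def simp_thms if_True
      by (intro continuous_on_add continuous_on_mult continuous_on_diff continuous_on_const
          continuous_on_component continuous_on_id continuous_on_inner cw cy c\<rho> ca ca' cN cN' cs c\<sigma>)
    show "K \<subseteq> U"
      using K by (auto simp: U_def)
    show "X i x = 0" if "x \<in> U - K" for i x
      using C2_on_zero(1,2)[OF y U K(1) _ that] supp
      by (simp add: X_def N_def U_def)
  qed
  moreover have "(\<Sum>i\<in>UNIV. DX x i i) =
      2 * (((\<Sum>i\<in>UNIV. Y2 i i x) + (lr + (p x)\<^sup>2 * \<rho> x) *\<^sub>R y x) \<bullet> multiplier J y Y x)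
      - carleman_form lr J y Y x" if "x \<in> K" for x
  proof -
    have x: "x \<noteq> c" "x \<in> U"
      using that K by (auto simp: U_def)
    have "(\<Sum>i\<in>UNIV. 2 * (Y i x \<bullet> a' i x + Y2 i i x \<bullet> a x)
      - 2 * (p x * z i x * (\<Sum>k\<in>UNIV. 2 * (Y k x \<bullet> Y2 k i x)) + (p x - q x * \<rho> x * z i x * z i x) * N x)
      - (m1 x * z i x * (2 * (y x \<bullet> Y i x)) + (m1 x + m2 x * z i x * z i x) * (y x \<bullet> y x))
      + 2 * (s x * z i x * (2 * (y x \<bullet> Y i x)) + (s x + \<sigma> x * z i x * z i x) * (y x \<bullet> y x)))
    = 2 * (((\<Sum>i\<in>UNIV. Y2 i i x) + (lr + (p x)\<^sup>2 * \<rho> x) *\<^sub>R y x) \<bullet> a x)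
      - (4 * q x * \<rho> x * (Ey x \<bullet> Ey x) + 2 * q x * N x - 4 * (Ey x \<bullet> J (y x))
         + (m2 x * r2 x + real CARD('n) * m1 x) * (y x \<bullet> y x)
         - lr * (4 * p x + 2 * q x) * (y x \<bullet> y x) + 2 * (p x)\<^sup>2 * q x * \<rho> x * (y x \<bullet> y x))"
      by (rule carleman_divergence_algebra[where z = "\<lambda>i. z i x" and Y = "\<lambda>i. Y i x" and ?Y2.0 = "\<lambda>i j. Y2 i j x"
            and a' = "\<lambda>j. a' j x" and J = J and m = "m x" and n = "real CARD('n)" and ?r2.0 = "r2 x"])
        (use x J C2_onD(3)[OF y] in \<open>auto simp: bounded_linear.linear sum_z_sq m_def Ey_def Ey'_def a_def a'_def N_def
            s_def \<sigma>_def\<close>)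
    then show ?thesis
      by (simp add: DX_def N'_def multiplier_def carleman_form_def Let_def a_def Ey_def N_def)
  qed
  ultimately show ?thesis
    using K(1) by (subst set_lebesgue_integral_cong[where g = "\<lambda>x. \<Sum>i\<in>UNIV. DX x i i"])
      (auto simp: compact_imp_closed)
qed

end

section \<open>Coercivity and the Carleman inequality for C2 functions\<close>

text \<open>The sum \<open>|r2 S + q y|^2 + |a + q y|^2\<close> is nonnegative and equals the full
  square minus \<open>2 * r2 * (S \<bullet> a)\<close> plus \<open>q^2 * |y|^2\<close>. So the
  leftover \<open>q * y\<close> costs only its own square.\<close>

lemma carleman_square_bound:
  fixes S a y :: "'b::real_inner"
  assumes "\<rho> \<ge> 0" "\<rho> * r2 = 1"
  shows "2 * (S \<bullet> a) - \<rho> * q\<^sup>2 * (norm y)\<^sup>2 \<le> \<rho> * (norm (r2 *\<^sub>R S + a + q *\<^sub>R y))\<^sup>2"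
proof -
  have "0 \<le> (norm (r2 *\<^sub>R S + q *\<^sub>R y))\<^sup>2 + (norm (a + q *\<^sub>R y))\<^sup>2"
    by simp
  also have "\<dots> = (norm (r2 *\<^sub>R S + a + q *\<^sub>R y))\<^sup>2 - 2 * (r2 * (S \<bullet> a)) + q\<^sup>2 * (norm y)\<^sup>2"
    unfolding power2_norm_eq_inner
    by (simp add: inner_add_left inner_add_right inner_commute algebra_simps power2_eq_square)
  finally have "2 * (r2 * (S \<bullet> a)) - q\<^sup>2 * (norm y)\<^sup>2 \<le> (norm (r2 *\<^sub>R S + a + q *\<^sub>R y))\<^sup>2"
    by simp
  then have "\<rho> * (2 * (r2 * (S \<bullet> a)) - q\<^sup>2 * (norm y)\<^sup>2) \<le> \<rho> * (norm (r2 *\<^sub>R S + a + q *\<^sub>R y))\<^sup>2"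
    using assms(1) by (rule mult_left_mono)
  moreover have "\<rho> * (2 * (r2 * (S \<bullet> a)) - q\<^sup>2 * (norm y)\<^sup>2) = (\<rho> * r2) * (2 * (S \<bullet> a)) - \<rho> * q\<^sup>2 * (norm y)\<^sup>2"
    by (simp add: algebra_simps)
  ultimately show ?thesis
    by (simp add: assms(2))
qed

text \<open>\<open>A\<close>, \<open>B\<close>, \<open>N\<close> and \<open>EJ\<close> stand for the
  norm of \<open>E\<close>, the norm of \<open>y\<close>, the squared gradient and
  \<open>E \<bullet> J y\<close>. With \<open>T = p^2 * q * \<rho>\<close> the form offers
  \<open>2 * T * B^2\<close>. The terms with \<open>lr\<close>, \<open>M\<close> and
  \<open>q^2\<close> cost at most 1/2, 1/4 and 1/4 of \<open>T\<close>, and the skew cross term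
  costs another 1/4 besides \<open>4 * q * \<rho> * A^2\<close>.\<close>

lemma carleman_form_coercive:
  fixes p q \<rho> r2 l lr M A B N EJ :: real
  assumes pq: "p > 0" "q > 0" and \<rho>: "\<rho> > 0" "\<rho> * r2 = 1"
    and l: "l \<ge> 0" "\<bar>lr\<bar> \<le> l" "16 * l * r2 \<le> p * q" "8 * l * r2 \<le> p\<^sup>2"
    and q4: "4 * q \<le> p\<^sup>2" and M: "4 * \<bar>M\<bar> * r2 \<le> p\<^sup>2 * q"
    and EJ: "EJ \<le> A * (l * B)"
  shows "2 * q * N + p\<^sup>2 * q * \<rho> / 2 * B\<^sup>2 \<le> 4 * q * \<rho> * A\<^sup>2 + 2 * q * N - 4 * EJ
     + M * B\<^sup>2 - lr * (4 * p + 2 * q) * B\<^sup>2 + 2 * p\<^sup>2 * q * \<rho> * B\<^sup>2 - \<rho> * q\<^sup>2 * B\<^sup>2"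
proof -
  define T where "T = p\<^sup>2 * q * \<rho>"
  have scale: "u \<le> v * \<rho>" if "u * r2 \<le> v" for u v
  proof -
    have "u * (\<rho> * r2) \<le> v * \<rho>"
      using mult_right_mono[OF that, of \<rho>] \<rho>(1) by (simp add: mult_ac)
    then show ?thesis
      by (simp add: \<rho>(2))
  qed
  have B2: "0 \<le> B\<^sup>2"
    by simp
  have l1: "16 * l \<le> p * q * \<rho>"
    using scale l(3) by blast
  have "lr * (4 * p + 2 * q) \<le> l * (4 * p + 2 * q)"
    using l pq by (intro mult_right_mono) auto
  moreover have "4 * (l * p) \<le> T / 4"
    using mult_right_mono[OF l1, of p] pq by (simp add: T_def power2_eq_square mult_ac)
  moreover have "2 * (l * q) \<le> T / 4"
    using mult_right_mono[OF scale[OF l(4)], of q] pq by (simp add: T_def power2_eq_square mult_ac)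
  ultimately have t1: "lr * (4 * p + 2 * q) \<le> T / 2"
    by (simp add: algebra_simps)
  have t2: "- M \<le> T / 4"
    using scale[OF M] by (simp add: T_def)
  have t3: "\<rho> * q\<^sup>2 \<le> T / 4"
    using mult_right_mono[OF q4, of "q * \<rho>"] pq \<rho> by (simp add: T_def power2_eq_square mult_ac)
  \<comment> \<open>Young's inequality, as the square of
    \<open>2 * |A| - p * |B| / 2\<close>.\<close>
  have t4: "4 * (A * (l * B)) \<le> 4 * q * \<rho> * A\<^sup>2 + T / 4 * B\<^sup>2"
  proof -
    have "4 * l \<le> p * q * \<rho>"
      using l1 l(1) by linarith
    have "0 \<le> (2 * \<bar>A\<bar> - p * \<bar>B\<bar> / 2)\<^sup>2 * (q * \<rho>)"
      using pq \<rho> by simp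
    moreover have "(2 * \<bar>A\<bar> - p * \<bar>B\<bar> / 2)\<^sup>2 = 4 * A\<^sup>2 - 2 * p * (\<bar>A\<bar> * \<bar>B\<bar>) + p\<^sup>2 * B\<^sup>2 / 4"
      by (simp add: power2_diff power_mult_distrib power_divide)
    ultimately have "0 \<le> (4 * A\<^sup>2 - 2 * p * (\<bar>A\<bar> * \<bar>B\<bar>) + p\<^sup>2 * B\<^sup>2 / 4) * (q * \<rho>)"
      by metis
    then have "2 * (p * q * \<rho>) * (\<bar>A\<bar> * \<bar>B\<bar>) \<le> 4 * q * \<rho> * A\<^sup>2 + T / 4 * B\<^sup>2"
      by (simp add: T_def algebra_simps)
    moreover have "4 * (A * (l * B)) \<le> 4 * l * (\<bar>A\<bar> * \<bar>B\<bar>)"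
      using mult_left_mono[OF abs_ge_self[of "A * B"] l(1)] by (simp add: abs_mult mult_ac)
    moreover have "4 * l * (\<bar>A\<bar> * \<bar>B\<bar>) \<le> (p * q * \<rho>) * (\<bar>A\<bar> * \<bar>B\<bar>)"
      using \<open>4 * l \<le> p * q * \<rho>\<close> by (intro mult_right_mono) auto
    moreover have "0 \<le> (p * q * \<rho>) * (\<bar>A\<bar> * \<bar>B\<bar>)"
      using pq \<rho> by simp
    ultimately show ?thesis
      by linarith
  qed
  define D where "D = T * B\<^sup>2"
  have "lr * (4 * p + 2 * q) * B\<^sup>2 \<le> D / 2" "- (M * B\<^sup>2) \<le> D / 4" "\<rho> * q\<^sup>2 * B\<^sup>2 \<le> D / 4"
    using mult_right_mono[OF t1 B2] mult_right_mono[OF t2 B2] mult_right_mono[OF t3 B2]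
    by (simp_all add: D_def)
  moreover have "2 * p\<^sup>2 * q * \<rho> * B\<^sup>2 = 2 * D" "p\<^sup>2 * q * \<rho> / 2 * B\<^sup>2 = D / 2"
    by (simp_all add: D_def T_def)
  moreover have "0 \<le> D"
    using pq \<rho> by (simp add: D_def T_def)
  moreover have "4 * (A * (l * B)) \<le> 4 * q * \<rho> * A\<^sup>2 + D / 4"
    using t4 by (simp add: D_def)
  \<comment> \<open>Stated with fresh variables so that the budget
    \<open>2 - 1/2 - 1/4 - 1/4 - 1/4 \<ge> 1/2\<close> is pure linear arithmetic.\<close>
  moreover have "x8 + x5 \<le> x7 + x8 - 4 * EJ + x2 - x1 + x4 - x3"
    if "x1 \<le> D / 2" "- x2 \<le> D / 4" "x3 \<le> D / 4" "x4 = 2 * D" "x5 = D / 2" "0 \<le> D"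
      "4 * x6 \<le> x7 + D / 4" "EJ \<le> x6" for x1 x2 x3 x4 x5 x6 x7 x8 :: real
    using that by linarith
  ultimately show ?thesis
    using EJ by blast
qed

context radial_weight
begin

lemma C2_on_exp_weight:
  "C2_on (- {c}) (\<lambda>x. exp (\<phi> x)) (\<lambda>i x. exp (\<phi> x) * (- p x * \<rho> x * z i x))
    (\<lambda>i j x. exp (\<phi> x) * (((p x)\<^sup>2 * (\<rho> x)\<^sup>2 + q x * (\<rho> x)\<^sup>2 + 2 * p x * (\<rho> x)\<^sup>2) * z i x * z j x
        - (if j = i then p x * \<rho> x else 0)))"
  unfolding C2_on_def
proof (intro conjI ballI allI)
  fix x i j
  assume "x \<in> - {c}"
  then have x: "x \<noteq> c"
    by simp
  show e: "has_grad (\<lambda>x. exp (\<phi> x)) (\<lambda>i. exp (\<phi> x) * (- p x * \<rho> x * z i x)) x"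
    by (rule has_grad_field[where g = exp and f = \<phi>, OF DERIV_exp grad_\<phi>[OF x]])
  have np: "has_grad (\<lambda>x. - p x) (\<lambda>i. - (- q x * \<rho> x * z i x)) x"
    using has_grad_diff[OF has_grad_const[of 0] grad_p[OF x]] by simp
  have "has_grad (\<lambda>x. exp (\<phi> x) * (- p x * \<rho> x * z i x))
    (\<lambda>j. exp (\<phi> x) * (- p x * \<rho> x * (if j = i then 1 else 0)
        + (- p x * (- 2 * (\<rho> x)\<^sup>2 * z j x) + - (- q x * \<rho> x * z j x) * \<rho> x) * z i x)
      + exp (\<phi> x) * (- p x * \<rho> x * z j x) * (- p x * \<rho> x * z i x)) x"
    by (intro has_grad_mult e np has_grad_nth has_grad_inverse_norm_sq x)
  moreover have "e * (- P * r * d + (- P * (- 2 * r\<^sup>2 * v) + - (- Q * r * v) * r) * u) + e * (- P * r * v) * (- P * r * u)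
     = e * ((P\<^sup>2 * r\<^sup>2 + Q * r\<^sup>2 + 2 * P * r\<^sup>2) * u * v - P * r * d)" for e P Q r d u v :: real
    by (simp add: algebra_simps power2_eq_square)
  ultimately have "has_grad (\<lambda>x. exp (\<phi> x) * (- p x * \<rho> x * z i x))
    (\<lambda>j. exp (\<phi> x) * (((p x)\<^sup>2 * (\<rho> x)\<^sup>2 + q x * (\<rho> x)\<^sup>2 + 2 * p x * (\<rho> x)\<^sup>2) * z i x * z j x
        - p x * \<rho> x * (if j = i then 1 else 0))) x"
    by (rule has_grad_cong)
  then show "has_grad (\<lambda>x. exp (\<phi> x) * (- p x * \<rho> x * z i x))
    (\<lambda>j. exp (\<phi> x) * (((p x)\<^sup>2 * (\<rho> x)\<^sup>2 + q x * (\<rho> x)\<^sup>2 + 2 * p x * (\<rho> x)\<^sup>2) * z i x * z j x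
        - (if j = i then p x * \<rho> x else 0))) x"
    by (rule has_grad_cong) simp
next
  fix i j
  show "continuous_on (- {c}) (\<lambda>x. exp (\<phi> x) * (((p x)\<^sup>2 * (\<rho> x)\<^sup>2 + q x * (\<rho> x)\<^sup>2 + 2 * p x * (\<rho> x)\<^sup>2) * z i x * z j x
        - (if j = i then p x * \<rho> x else 0)))"
    by (cases "j = i") (auto intro!: continuous_intros cont_p cont_q cont_\<phi>)
qed (auto simp: mult_ac)

text \<open>Conjugation at a point: with \<open>y = e * w\<close>, the operator Laplacian plus
  \<open>lr\<close> plus \<open>J\<close> applied to \<open>w\<close>, times \<open>r2 * e\<close>,
  is \<open>r2\<close> times the symmetric part plus the multiplier plus \<open>q * y\<close>.
  \<open>LapY\<close> is the Laplacian of \<open>y\<close> in the shape in which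
  \<open>C2_on_scaleR\<close> delivers it.\<close>

lemma conjugated_laplacian:
  fixes w :: "real^'n \<Rightarrow> 'b::real_inner" and Dw :: "'n \<Rightarrow> real^'n \<Rightarrow> 'b"
    and D2w :: "'n \<Rightarrow> 'n \<Rightarrow> real^'n \<Rightarrow> 'b"
  assumes x: "x \<noteq> c" and J: "bounded_linear J"
  defines "e \<equiv> exp (\<phi> x)"
  defines "Y \<equiv> \<lambda>i. e *\<^sub>R Dw i x + (e * (- p x * \<rho> x * z i x)) *\<^sub>R w x"
  defines "LapY \<equiv> \<Sum>i\<in>UNIV. e *\<^sub>R D2w i i x + (e * (- p x * \<rho> x * z i x)) *\<^sub>R Dw i x
      + ((e * (- p x * \<rho> x * z i x)) *\<^sub>R Dw i x
        + (e * (((p x)\<^sup>2 * (\<rho> x)\<^sup>2 + q x * (\<rho> x)\<^sup>2 + 2 * p x * (\<rho> x)\<^sup>2) * z i x * z i x - p x * \<rho> x)) *\<^sub>R w x)"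
  shows "r2 x *\<^sub>R (LapY + (lr + (p x)\<^sup>2 * \<rho> x) *\<^sub>R (e *\<^sub>R w x))
      + ((2 * p x) *\<^sub>R (\<Sum>k\<in>UNIV. z k x *\<^sub>R Y k) + m x *\<^sub>R (e *\<^sub>R w x) + r2 x *\<^sub>R J (e *\<^sub>R w x))
      + q x *\<^sub>R (e *\<^sub>R w x)
    = (r2 x * e) *\<^sub>R ((\<Sum>i\<in>UNIV. D2w i i x) + lr *\<^sub>R w x + J (w x))"
proof -
  define L where "L = (\<Sum>i\<in>UNIV. D2w i i x)"
  define Ew where "Ew = (\<Sum>i\<in>UNIV. z i x *\<^sub>R Dw i x)"
  define R where "R = \<rho> x"
  have R: "R * r2 x = 1" "r2 x * R = 1"
    using x by (simp_all add: R_def)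
  have zz: "(\<Sum>i\<in>UNIV. z i x * z i x) = r2 x"
    using sum_z_sq[of x] by (simp add: power2_eq_square)
  have "LapY = (\<Sum>i\<in>UNIV. e *\<^sub>R D2w i i x + (- 2 * e * p x * R) *\<^sub>R (z i x *\<^sub>R Dw i x)
      + (e * ((p x)\<^sup>2 * R\<^sup>2 + q x * R\<^sup>2 + 2 * p x * R\<^sup>2)) *\<^sub>R ((z i x * z i x) *\<^sub>R w x) - (e * p x * R) *\<^sub>R w x)"
    unfolding LapY_def R_def[symmetric]
  proof (rule sum.cong[OF refl])
    fix i
    have *: "e *\<^sub>R A + (e * (- P * R * Z)) *\<^sub>R D + ((e * (- P * R * Z)) *\<^sub>R D + (e * (k * Z * Z - P * R)) *\<^sub>R W)
      = e *\<^sub>R A + (- 2 * e * P * R) *\<^sub>R (Z *\<^sub>R D) + (e * k) *\<^sub>R ((Z * Z) *\<^sub>R W) - (e * P * R) *\<^sub>R W"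
      for A D W :: 'b and P Z k
    proof -
      have "(- 2 * e * P * R) *\<^sub>R (Z *\<^sub>R D) = (e * (- P * R * Z)) *\<^sub>R D + (e * (- P * R * Z)) *\<^sub>R D"
        unfolding scaleR_left_distrib[symmetric] scaleR_scaleR
        by (rule arg_cong[where f = "\<lambda>t. t *\<^sub>R D"]) (simp add: algebra_simps)
      then show ?thesis
        by (simp add: algebra_simps)
    qed
    show "e *\<^sub>R D2w i i x + (e * (- p x * R * z i x)) *\<^sub>R Dw i x
      + ((e * (- p x * R * z i x)) *\<^sub>R Dw i x
        + (e * (((p x)\<^sup>2 * R\<^sup>2 + q x * R\<^sup>2 + 2 * p x * R\<^sup>2) * z i x * z i x - p x * R)) *\<^sub>R w x)
      = e *\<^sub>R D2w i i x + (- 2 * e * p x * R) *\<^sub>R (z i x *\<^sub>R Dw i x)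
      + (e * ((p x)\<^sup>2 * R\<^sup>2 + q x * R\<^sup>2 + 2 * p x * R\<^sup>2)) *\<^sub>R ((z i x * z i x) *\<^sub>R w x) - (e * p x * R) *\<^sub>R w x"
      by (rule *)
  qed
  also have "\<dots> = e *\<^sub>R L + (- 2 * e * p x * R) *\<^sub>R Ew
     + (e * ((p x)\<^sup>2 * R\<^sup>2 + q x * R\<^sup>2 + 2 * p x * R\<^sup>2)) *\<^sub>R (r2 x *\<^sub>R w x) - (real CARD('n) * (e * p x * R)) *\<^sub>R w x"
    unfolding sum.distrib sum_subtractf scaleR_sum_right[symmetric] scaleR_sum_left[symmetric] zz
    by (simp add: L_def Ew_def sum_constant_scaleR mult_ac)
  finally have L0: "LapY = e *\<^sub>R L + (- 2 * e * p x * R) *\<^sub>R Ew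
     + (e * ((p x)\<^sup>2 * R\<^sup>2 + q x * R\<^sup>2 + 2 * p x * R\<^sup>2)) *\<^sub>R (r2 x *\<^sub>R w x) - (real CARD('n) * (e * p x * R)) *\<^sub>R w x" .
  define Q where "Q = r2 x"
  have L1: "r2 x *\<^sub>R LapY = (r2 x * e) *\<^sub>R L + (- 2 * e * p x * (R * r2 x)) *\<^sub>R Ew
     + (e * ((p x)\<^sup>2 * (R * r2 x)\<^sup>2 + q x * (R * r2 x)\<^sup>2 + 2 * p x * (R * r2 x)\<^sup>2)) *\<^sub>R w x
     - (real CARD('n) * (e * p x * (R * r2 x))) *\<^sub>R w x"
    unfolding L0 Q_def[symmetric] by (simp add: algebra_simps power2_eq_square)
  have "(\<Sum>k\<in>UNIV. z k x *\<^sub>R Y k) = (\<Sum>k\<in>UNIV. e *\<^sub>R (z k x *\<^sub>R Dw k x) + (- e * p x * R) *\<^sub>R ((z k x * z k x) *\<^sub>R w x))"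
  proof -
    have "Z *\<^sub>R (e *\<^sub>R D + (e * (- P * R * Z)) *\<^sub>R W) = e *\<^sub>R (Z *\<^sub>R D) + (- e * P * R) *\<^sub>R ((Z * Z) *\<^sub>R W)"
      for D W :: 'b and P Z
      by (simp add: algebra_simps)
    then show ?thesis
      unfolding Y_def R_def[symmetric] by (intro sum.cong refl)
  qed
  also have "\<dots> = e *\<^sub>R Ew + (- e * p x * R) *\<^sub>R (r2 x *\<^sub>R w x)"
    unfolding sum.distrib scaleR_sum_right[symmetric] scaleR_sum_left[symmetric] zz by (simp add: Ew_def)
  finally have E1: "(\<Sum>k\<in>UNIV. z k x *\<^sub>R Y k) = e *\<^sub>R Ew + (- e * p x * (R * r2 x)) *\<^sub>R w x"
    by (simp add: mult_ac)
  have Je: "J (e *\<^sub>R w x) = e *\<^sub>R J (w x)"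
    using J by (simp add: bounded_linear.linear linear_scale)
  have V: "r2 x *\<^sub>R ((lr + (p x)\<^sup>2 * R) *\<^sub>R (e *\<^sub>R w x)) = (e * (lr * r2 x + (p x)\<^sup>2 * (R * r2 x))) *\<^sub>R w x"
    by (simp add: algebra_simps)
  have collect: "A1 *\<^sub>R L + A2 *\<^sub>R Ew + A3 *\<^sub>R W - A4 *\<^sub>R W + A5 *\<^sub>R W
      + (B1 *\<^sub>R (e *\<^sub>R Ew + B2 *\<^sub>R W) + B3 *\<^sub>R (e *\<^sub>R W) + B4 *\<^sub>R (e *\<^sub>R JW)) + B5 *\<^sub>R (e *\<^sub>R W)
    = A1 *\<^sub>R L + (A2 + B1 * e) *\<^sub>R Ew + (A3 - A4 + A5 + B1 * B2 + B3 * e + B5 * e) *\<^sub>R W + (B4 * e) *\<^sub>R JW"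
    for A1 A2 A3 A4 A5 B1 B2 B3 B4 B5 and W JW :: 'b
    by (simp add: algebra_simps)
  have c1: "- 2 * e * p x * (R * r2 x) + 2 * p x * e = 0"
    by (simp add: R)
  have c2: "e * ((p x)\<^sup>2 * (R * r2 x)\<^sup>2 + q x * (R * r2 x)\<^sup>2 + 2 * p x * (R * r2 x)\<^sup>2)
     - real CARD('n) * (e * p x * (R * r2 x)) + e * (lr * r2 x + (p x)\<^sup>2 * (R * r2 x))
     + 2 * p x * (- e * p x * (R * r2 x)) + ((real CARD('n) - 2) * p x - 2 * q x) * e + q x * e = r2 x * e * lr"
    unfolding R by (simp add: algebra_simps power2_eq_square)
  show ?thesis
    unfolding R_def[symmetric] scaleR_add_right[of "r2 x" LapY] L1 E1 V Je L_def[symmetric] m_def collect c1 c2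
    by (simp add: algebra_simps)
qed

text \<open>Square bound and coercivity are combined, and the gradient of \<open>y\<close> is
  converted back to that of \<open>w\<close>. The last bracket on the right is the integrand of the
  Carleman identity, so it vanishes upon integration.\<close>

lemma carleman_pointwise:
  fixes w :: "real^'n \<Rightarrow> 'b::real_inner" and Dw :: "'n \<Rightarrow> real^'n \<Rightarrow> 'b"
    and D2w :: "'n \<Rightarrow> 'n \<Rightarrow> real^'n \<Rightarrow> 'b"
  assumes x: "x \<noteq> c" and J: "bounded_linear J" "\<And>v. norm (J v) \<le> l * norm v"
    and pq: "p x > 0" "q x > 0"
    and l: "l \<ge> 0" "\<bar>lr\<bar> \<le> l" "16 * l * r2 x \<le> p x * q x" "8 * l * r2 x \<le> (p x)\<^sup>2"
    and q4: "4 * q x \<le> (p x)\<^sup>2"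
    and M: "4 * \<bar>m2 x * r2 x + real CARD('n) * m1 x\<bar> * r2 x \<le> (p x)\<^sup>2 * q x"
  defines "e \<equiv> exp (\<phi> x)"
  defines "y \<equiv> \<lambda>x. exp (\<phi> x) *\<^sub>R w x"
  defines "Y \<equiv> \<lambda>i x. exp (\<phi> x) *\<^sub>R Dw i x + (exp (\<phi> x) * (- p x * \<rho> x * z i x)) *\<^sub>R w x"
  defines "LapY \<equiv> \<Sum>i\<in>UNIV. e *\<^sub>R D2w i i x + (e * (- p x * \<rho> x * z i x)) *\<^sub>R Dw i x
      + ((e * (- p x * \<rho> x * z i x)) *\<^sub>R Dw i x
        + (e * (((p x)\<^sup>2 * (\<rho> x)\<^sup>2 + q x * (\<rho> x)\<^sup>2 + 2 * p x * (\<rho> x)\<^sup>2) * z i x * z i x - p x * \<rho> x)) *\<^sub>R w x)"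
  shows "exp (2 * \<phi> x) * (q x * (\<Sum>i\<in>UNIV. (norm (Dw i x))\<^sup>2) + (p x)\<^sup>2 * q x * \<rho> x * (norm (w x))\<^sup>2)
    \<le> 8 * (r2 x * exp (2 * \<phi> x) * (norm ((\<Sum>i\<in>UNIV. D2w i i x) + lr *\<^sub>R w x + J (w x)))\<^sup>2)
      - 8 * (2 * ((LapY + (lr + (p x)\<^sup>2 * \<rho> x) *\<^sub>R y x) \<bullet> multiplier J y Y x) - carleman_form lr J y Y x)"
proof -
  define F where "F = (\<Sum>i\<in>UNIV. D2w i i x) + lr *\<^sub>R w x + J (w x)"
  define a where "a = multiplier J y Y x"
  define S where "S = LapY + (lr + (p x)\<^sup>2 * \<rho> x) *\<^sub>R y x"
  define E where "E = (\<Sum>k\<in>UNIV. z k x *\<^sub>R Y k x)"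
  define N where "N = (\<Sum>k\<in>UNIV. Y k x \<bullet> Y k x)"
  define B where "B = norm (y x)"
  have \<rho>: "\<rho> x > 0" "\<rho> x * r2 x = 1"
    using x by simp_all
  have e2: "exp (2 * \<phi> x) = e\<^sup>2"
    by (simp add: e_def exp_double)
  have "r2 x *\<^sub>R S + a + q x *\<^sub>R y x = (r2 x * e) *\<^sub>R F"
    using conjugated_laplacian[OF x J(1), where w = w and Dw = Dw and ?D2w = D2w and lr = lr]
    unfolding S_def a_def F_def multiplier_def LapY_def e_def y_def Y_def by simp
  then have "2 * (S \<bullet> a) - \<rho> x * (q x)\<^sup>2 * B\<^sup>2 \<le> \<rho> x * (norm ((r2 x * e) *\<^sub>R F))\<^sup>2"
    using carleman_square_bound[of "\<rho> x" "r2 x" S a "q x" "y x"] \<rho> by (simp add: B_def)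
  also have "\<rho> x * (norm ((r2 x * e) *\<^sub>R F))\<^sup>2 = (\<rho> x * r2 x) * (r2 x * e\<^sup>2 * (norm F)\<^sup>2)"
    unfolding norm_scaleR power_mult_distrib power2_abs by (simp only: power2_eq_square mult_ac)
  finally have P1: "2 * (S \<bullet> a) - \<rho> x * (q x)\<^sup>2 * B\<^sup>2 \<le> r2 x * exp (2 * \<phi> x) * (norm F)\<^sup>2"
    using \<rho>(2) by (simp add: e2)
  have "E \<bullet> J (y x) \<le> norm E * norm (J (y x))"
    by (rule norm_cauchy_schwarz)
  also have "\<dots> \<le> norm E * (l * B)"
    unfolding B_def by (intro mult_left_mono J(2)) auto
  finally have EJ: "E \<bullet> J (y x) \<le> norm E * (l * B)" .
  have "2 * q x * N + (p x)\<^sup>2 * q x * \<rho> x / 2 * B\<^sup>2 \<le> 4 * q x * \<rho> x * (norm E)\<^sup>2 + 2 * q x * N - 4 * (E \<bullet> J (y x))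
     + (m2 x * r2 x + real CARD('n) * m1 x) * B\<^sup>2 - lr * (4 * p x + 2 * q x) * B\<^sup>2
     + 2 * (p x)\<^sup>2 * q x * \<rho> x * B\<^sup>2 - \<rho> x * (q x)\<^sup>2 * B\<^sup>2"
    by (rule carleman_form_coercive[OF pq \<rho> l q4 M EJ])
  also have "\<dots> = carleman_form lr J y Y x - \<rho> x * (q x)\<^sup>2 * B\<^sup>2"
    by (simp add: carleman_form_def Let_def E_def N_def B_def power2_norm_eq_inner)
  finally have P2: "2 * q x * N + (p x)\<^sup>2 * q x * \<rho> x / 2 * B\<^sup>2 \<le> carleman_form lr J y Y x - \<rho> x * (q x)\<^sup>2 * B\<^sup>2" .
  have B: "B\<^sup>2 = e\<^sup>2 * (norm (w x))\<^sup>2"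
    by (simp add: B_def y_def e_def power_mult_distrib)
  \<comment> \<open>\<open>e *\<^sub>R Dw i x\<close> differs from \<open>Y i x\<close> by
    \<open>p * \<rho> * z i * y\<close>. The parallelogram law bounds the square of the sum, and the
    \<open>z i\<close> have square sum \<open>1 / \<rho>\<close>.\<close>
  have P3: "e\<^sup>2 * (\<Sum>i\<in>UNIV. (norm (Dw i x))\<^sup>2) \<le> 2 * N + 2 * ((p x)\<^sup>2 * \<rho> x * B\<^sup>2)"
  proof -
    have "e\<^sup>2 * (norm (Dw i x))\<^sup>2 \<le> 2 * (Y i x \<bullet> Y i x) + 2 * ((p x)\<^sup>2 * (\<rho> x)\<^sup>2 * B\<^sup>2) * (z i x)\<^sup>2" for i
    proof -
      let ?b = "(p x * \<rho> x * z i x) *\<^sub>R y x"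
      have "e *\<^sub>R Dw i x = Y i x + ?b"
        by (simp add: Y_def y_def e_def)
      then have "e\<^sup>2 * (norm (Dw i x))\<^sup>2 = (norm (Y i x + ?b))\<^sup>2"
        by (metis norm_scaleR power_mult_distrib power2_abs)
      also have "\<dots> \<le> (norm (Y i x + ?b))\<^sup>2 + (norm (Y i x - ?b))\<^sup>2"
        by simp
      also have "\<dots> = 2 * (Y i x \<bullet> Y i x) + 2 * (?b \<bullet> ?b)"
        unfolding power2_norm_eq_inner by (simp add: inner_add_left inner_add_right inner_diff_left inner_diff_right inner_commute)
      also have "?b \<bullet> ?b = (p x)\<^sup>2 * (\<rho> x)\<^sup>2 * B\<^sup>2 * (z i x)\<^sup>2"
        by (simp only: inner_scaleR_left inner_scaleR_right) (simp only: B_def dot_square_norm power2_eq_square mult_ac)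
      finally show ?thesis
        by (simp add: mult_ac)
    qed
    then have "(\<Sum>i\<in>UNIV. e\<^sup>2 * (norm (Dw i x))\<^sup>2) \<le>
        (\<Sum>i\<in>UNIV. 2 * (Y i x \<bullet> Y i x) + 2 * ((p x)\<^sup>2 * (\<rho> x)\<^sup>2 * B\<^sup>2) * (z i x)\<^sup>2)"
      by (intro sum_mono)
    also have "\<dots> = 2 * N + 2 * ((p x)\<^sup>2 * (\<rho> x)\<^sup>2 * B\<^sup>2) * r2 x"
      unfolding sum.distrib sum_distrib_left[symmetric] sum_z_sq N_def by simp
    also have "\<dots> = 2 * N + 2 * ((p x)\<^sup>2 * \<rho> x * B\<^sup>2) * (\<rho> x * r2 x)"
      by (simp add: power2_eq_square)
    finally show ?thesis
      by (simp add: sum_distrib_left[symmetric] \<rho>(2) x)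
  qed
  have N: "N \<ge> 0"
    by (auto simp: N_def intro: sum_nonneg)
  have "exp (2 * \<phi> x) * (q x * (\<Sum>i\<in>UNIV. (norm (Dw i x))\<^sup>2) + (p x)\<^sup>2 * q x * \<rho> x * (norm (w x))\<^sup>2)
    = q x * (e\<^sup>2 * (\<Sum>i\<in>UNIV. (norm (Dw i x))\<^sup>2)) + (p x)\<^sup>2 * q x * \<rho> x * B\<^sup>2"
    unfolding e2 B by (simp add: algebra_simps)
  also have "\<dots> \<le> q x * (2 * N + 2 * ((p x)\<^sup>2 * \<rho> x * B\<^sup>2)) + (p x)\<^sup>2 * q x * \<rho> x * B\<^sup>2"
    using P3 pq by (intro add_right_mono mult_left_mono) auto
  \<comment> \<open>With \<open>T\<close> for the zeroth order gain this reads
    \<open>2 * q * N + 3 * T \<le> 16 * q * N + 4 * T\<close>; this is the origin of the factor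
    8.\<close>
  also have "\<dots> \<le> 8 * (2 * q x * N + (p x)\<^sup>2 * q x * \<rho> x / 2 * B\<^sup>2)"
  proof -
    define T where "T = (p x)\<^sup>2 * q x * \<rho> x * B\<^sup>2"
    have h0: "0 \<le> q x * N" "0 \<le> T"
      using N pq by (simp_all add: T_def)
    have h: "q x * (2 * N + 2 * ((p x)\<^sup>2 * \<rho> x * B\<^sup>2)) = 2 * (q x * N) + 2 * T"
      "(p x)\<^sup>2 * q x * \<rho> x / 2 * B\<^sup>2 = T / 2" "2 * q x * N = 2 * (q x * N)"
      by (simp_all add: T_def algebra_simps)
    show ?thesis
      unfolding T_def[symmetric] h using h0 by argo
  qed
  also have "\<dots> \<le> 8 * (r2 x * exp (2 * \<phi> x) * (norm F)\<^sup>2) - 8 * (2 * (S \<bullet> a) - carleman_form lr J y Y x)"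
  proof -
    have "8 * u \<le> 8 * b - 8 * (2 * s - f)" if "2 * s - t \<le> b" "u \<le> f - t" for u s t b f :: real
      using that by argo
    then show ?thesis
      using P1 P2 by blast
  qed
  finally show ?thesis
    by (simp add: F_def S_def a_def)
qed

lemma carleman_inequality:
  fixes w :: "real^'n \<Rightarrow> complex" and lam :: complex
  assumes K: "compact K" "c \<notin> K"
    and w: "C2_on (- {c}) w Dw D2w"
    and supp: "\<And>x. x \<in> - {c} - K \<Longrightarrow> w x = 0"
    and pq: "\<And>x. x \<in> K \<Longrightarrow> p x > 0" "\<And>x. x \<in> K \<Longrightarrow> q x > 0"
    and l: "\<And>x. x \<in> K \<Longrightarrow> 16 * cmod lam * r2 x \<le> p x * q x"
       "\<And>x. x \<in> K \<Longrightarrow> 8 * cmod lam * r2 x \<le> (p x)\<^sup>2"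
    and q4: "\<And>x. x \<in> K \<Longrightarrow> 4 * q x \<le> (p x)\<^sup>2"
    and M: "\<And>x. x \<in> K \<Longrightarrow> 4 * \<bar>m2 x * r2 x + real CARD('n) * m1 x\<bar> * r2 x \<le> (p x)\<^sup>2 * q x"
  shows "(LINT x:K|lborel. exp (2 * \<phi> x) *
      (q x * (\<Sum>i\<in>UNIV. (norm (Dw i x))\<^sup>2) + (p x)\<^sup>2 * q x * \<rho> x * (norm (w x))\<^sup>2))
    \<le> 8 * (LINT x:K|lborel. r2 x * exp (2 * \<phi> x) * (norm ((\<Sum>i\<in>UNIV. D2w i i x) + lam * w x))\<^sup>2)"
proof -
  \<comment> \<open>Multiplication by \<open>\<i> * Im lam\<close> is orthogonal to the identity for
    the real inner product of complex numbers, and \<open>Re lam\<close> becomes \<open>lr\<close>;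
    so real and non-real \<lambda> are treated alike.\<close>
  define J where "J v = (\<i> * complex_of_real (Im lam)) * v" for v
  define lr where "lr = Re lam"
  have J: "bounded_linear J" "\<And>v. v \<bullet> J v = 0" "\<And>v. norm (J v) \<le> cmod lam * norm v"
  proof -
    show "bounded_linear J"
      unfolding J_def[abs_def] by (rule bounded_linear_mult_right)
    show "v \<bullet> J v = 0" for v
      by (simp add: J_def inner_complex_def)
    show "norm (J v) \<le> cmod lam * norm v" for v
      by (simp add: J_def norm_mult mult_right_mono abs_Im_le_cmod)
  qed
  have lam: "lr *\<^sub>R v + J v = lam * v" for v
    by (simp add: lr_def J_def complex_eq_iff)
  define y where "y x = exp (\<phi> x) *\<^sub>R w x" for x
  define Y where "Y i x = exp (\<phi> x) *\<^sub>R Dw i x + (exp (\<phi> x) * (- p x * \<rho> x * z i x)) *\<^sub>R w x" for i x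
  define Y2 where "Y2 i j x = exp (\<phi> x) *\<^sub>R D2w i j x + (exp (\<phi> x) * (- p x * \<rho> x * z j x)) *\<^sub>R Dw i x
      + ((exp (\<phi> x) * (- p x * \<rho> x * z i x)) *\<^sub>R Dw j x
        + (exp (\<phi> x) * (((p x)\<^sup>2 * (\<rho> x)\<^sup>2 + q x * (\<rho> x)\<^sup>2 + 2 * p x * (\<rho> x)\<^sup>2) * z i x * z j x
            - (if j = i then p x * \<rho> x else 0))) *\<^sub>R w x)" for i j x
  have y: "C2_on (- {c}) y Y Y2"
    unfolding y_def[abs_def] Y_def[abs_def] Y2_def[abs_def]
    by (rule C2_on_scaleR[OF C2_on_exp_weight w])
  define I1 where "I1 x = 2 * (((\<Sum>i\<in>UNIV. Y2 i i x) + (lr + (p x)\<^sup>2 * \<rho> x) *\<^sub>R y x) \<bullet> multiplier J y Y x)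
      - carleman_form lr J y Y x" for x
  define A where "A x = exp (2 * \<phi> x) *
      (q x * (\<Sum>i\<in>UNIV. (norm (Dw i x))\<^sup>2) + (p x)\<^sup>2 * q x * \<rho> x * (norm (w x))\<^sup>2)" for x
  define B where "B x = r2 x * exp (2 * \<phi> x) * (norm ((\<Sum>i\<in>UNIV. D2w i i x) + lam * w x))\<^sup>2" for x
  have I1: "(LINT x:K|lborel. I1 x) = 0"
    unfolding I1_def using supp by (intro carleman_identity[OF J(1,2) K y]) (auto simp: y_def)
  have AB: "A x \<le> 8 * B x - 8 * I1 x" if "x \<in> K" for x
  proof -
    have "x \<noteq> c"
      using that K by auto
    from carleman_pointwise[where Dw = Dw and w = w and ?D2w = D2w and lr = lr, OF this J(1,3)
        pq[OF that] _ _ l[OF that] q4[OF that] M[OF that]]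
    show ?thesis
      by (simp add: A_def B_def I1_def Y2_def Y_def[abs_def] y_def[abs_def] lr_def abs_Re_le_cmod
          lam[unfolded lr_def] add.assoc)
  qed
  note cw = C2_on_continuous[OF w] and cy = C2_on_continuous[OF y]
  have cJ: "continuous_on U (\<lambda>x. J (f x))" if "continuous_on U f" for U and f :: "real^'n \<Rightarrow> complex"
    using bounded_linear.continuous_on[OF J(1) that] .
  have c\<rho>: "continuous_on (- {c}) \<rho>"
    by (intro continuous_intros) auto
  have int: "set_integrable lborel K f" if "continuous_on (- {c}) f" for f :: "real^'n \<Rightarrow> real"
    unfolding set_integrable_def using K(2)
    by (intro borel_integrable_compact K continuous_on_subset[OF that]) auto
  have cA: "continuous_on (- {c}) A"
    unfolding A_def[abs_def]
    by (intro continuous_intros cw cont_p cont_q cont_\<phi>) auto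
  have cB: "continuous_on (- {c}) B"
    unfolding B_def[abs_def]
    by (intro continuous_intros cw cont_p cont_q cont_\<phi>)
  have cI: "continuous_on (- {c}) I1"
    unfolding I1_def[abs_def] carleman_form_def[abs_def] multiplier_def[abs_def] Let_def
    by (intro continuous_on_add continuous_on_diff continuous_on_mult continuous_on_scaleR continuous_on_inner
        continuous_on_sum continuous_on_power continuous_on_norm continuous_on_component continuous_on_id
        continuous_on_const cy cont_p cont_q cont_m cont_m1 cont_m2 cJ c\<rho>)
  have "(LINT x:K|lborel. A x) \<le> (LINT x:K|lborel. 8 * B x - 8 * I1 x)"
    using AB by (intro set_integral_mono int cA cB cI continuous_intros) auto
  also have "\<dots> = 8 * (LINT x:K|lborel. B x) - 8 * (LINT x:K|lborel. I1 x)"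
    using int[OF cB] int[OF cI] by (subst set_integral_diff) auto
  finally show ?thesis
    by (simp add: I1 A_def B_def)
qed

end

section \<open>The weight\<close>

text \<open>The reciprocal bracket of a real number, which is also the derivative of arsinh.\<close>

definition bracket_inv :: "real \<Rightarrow> real" where
  "bracket_inv s = 1 / sqrt (1 + s\<^sup>2)"

lemma bracket_inv_pos: "bracket_inv s > 0"
  by (simp add: bracket_inv_def add_pos_nonneg)

lemma bracket_inv_le_1: "bracket_inv s \<le> 1"
  unfolding bracket_inv_def by (rule divide_le_eq_1_pos[THEN iffD2]) (simp_all add: add_pos_nonneg)

lemma bracket_inv_sq: "(bracket_inv s)\<^sup>2 * (1 + s\<^sup>2) = 1"
proof -
  have "1 + s\<^sup>2 \<noteq> 0"
    using sum_power2_gt_zero_iff[of 1 s] by simp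
  then show ?thesis
    by (simp add: bracket_inv_def power_one_over real_sqrt_pow2)
qed

lemma bracket_inv_ge:
  assumes "\<bar>s\<bar> \<le> b"
  shows "bracket_inv s \<ge> 1 / (1 + b)"
proof -
  have "sqrt (1 + s\<^sup>2) \<le> sqrt ((1 + \<bar>s\<bar>)\<^sup>2)"
    by (intro real_sqrt_le_mono) (simp add: power2_sum)
  also have "\<dots> = 1 + \<bar>s\<bar>"
    by simp
  finally have "sqrt (1 + s\<^sup>2) \<le> 1 + b"
    using assms by simp
  moreover have "0 < sqrt (1 + s\<^sup>2)"
    by (simp add: add_pos_nonneg)
  ultimately show ?thesis
    unfolding bracket_inv_def by (intro divide_left_mono mult_pos_pos) linarith+
qed

lemma DERIV_bracket_inv:
  "(bracket_inv has_real_derivative - s * bracket_inv s ^ 3) (at s within A)"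
proof -
  have pos: "1 + s\<^sup>2 > 0"
    by (simp add: add_pos_nonneg)
  then have "sqrt (1 + s\<^sup>2) ^ 3 = sqrt (1 + s\<^sup>2) * (1 + s\<^sup>2)"
    by (simp add: power3_eq_cube)
  moreover have "(bracket_inv has_real_derivative - (inverse (sqrt (1 + s\<^sup>2)) * (2 * s) / 2) / (sqrt (1 + s\<^sup>2))\<^sup>2) (at s within A)"
    unfolding bracket_inv_def[abs_def] using pos
    by (auto intro!: derivative_eq_intros simp: power2_eq_square)
  ultimately show ?thesis
    using pos by (simp add: bracket_inv_def power_one_over field_simps)
qed

text \<open>The chain is \<open>|arsinh s| \<le> ln (9 * R) \<le> ln (R * R)\<close>, which is why
  \<open>R \<ge> 9\<close> appears throughout. The coefficient 3 of \<open>ln R\<close> in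
  \<open>wp\<close> exceeds the 2 obtained here by one, and this keeps \<open>wp\<close> at least
  \<kappa> ln R.\<close>

lemma abs_arsinh_le:
  assumes "\<bar>s\<bar> \<le> 4 * R" "R \<ge> 9"
  shows "\<bar>arsinh s\<bar> \<le> 2 * ln (R::real)"
proof -
  have "\<bar>arsinh s\<bar> = arsinh \<bar>s\<bar>"
    using arsinh_real_neg_iff[of s] by (cases "s \<ge> 0") (auto simp: abs_if not_less)
  also have "\<dots> \<le> arsinh (4 * R)"
    using assms arsinh_less_iff_real[of "4 * R" "\<bar>s\<bar>"] by (simp add: not_less[symmetric])
  also have "\<dots> \<le> ln (9 * R)"
  proof -
    have "sqrt ((4 * R)\<^sup>2 + 1) \<le> sqrt ((4 * R + 1)\<^sup>2)"
      using assms by (intro real_sqrt_le_mono) (simp add: power2_sum)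
    then have "4 * R + sqrt ((4 * R)\<^sup>2 + 1) \<le> 9 * R"
      using assms by simp
    moreover have "0 < 4 * R + sqrt ((4 * R)\<^sup>2 + 1)"
      using assms by (simp add: add_pos_nonneg)
    ultimately show ?thesis
      unfolding arsinh_real_def by (subst ln_le_cancel_iff) auto
  qed
  also have "\<dots> \<le> ln (R * R)"
    using assms by (subst ln_le_cancel_iff) auto
  also have "\<dots> = 2 * ln R"
    using assms by (simp add: ln_mult)
  finally show ?thesis .
qed

text \<open>For the centre \<open>x\<^sub>0\<close> with \<open>|x\<^sub>0| = R\<close> and \<open>r = |x - x\<^sub>0|\<close> one has \<open>|x| \<ge> |r - R|\<close>. The weight is chosen such that
  its convexity \<open>wq\<close> is concentrated near \<open>r = R\<close> like \<open>1/\<langle>r - R\<rangle>\<close>, where the potentials need not be small,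
  at the price of only a factor \<open>ln R\<close> in \<open>wp\<close>.\<close>

definition wp :: "real \<Rightarrow> real \<Rightarrow> real \<Rightarrow> real" where
  "wp \<kappa> R r = \<kappa> * (3 * ln R - arsinh (r - R))"

definition wq :: "real \<Rightarrow> real \<Rightarrow> real \<Rightarrow> real" where
  "wq \<kappa> R r = \<kappa> * (r * bracket_inv (r - R))"

text \<open>A radial function with profile \<open>g\<close> has gradient \<open>g' / r\<close> times
  the position. This is that factor for \<open>(n - 2) * wp - 2 * wq\<close>, and \<open>wm2\<close>
  is the corresponding factor for \<open>wm1\<close>.\<close>

definition wm1 :: "real \<Rightarrow> real \<Rightarrow> real \<Rightarrow> real \<Rightarrow> real" where
  "wm1 n \<kappa> R r = - \<kappa> * (n * (bracket_inv (r - R) / r) - 2 * ((r - R) * bracket_inv (r - R) ^ 3))"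

definition wm2 :: "real \<Rightarrow> real \<Rightarrow> real \<Rightarrow> real \<Rightarrow> real" where
  "wm2 n \<kappa> R r = - \<kappa> * (n * (- ((r - R) * bracket_inv (r - R) ^ 3) / r - bracket_inv (r - R) / r\<^sup>2)
     - 2 * (bracket_inv (r - R) ^ 3 - 3 * (r - R)\<^sup>2 * bracket_inv (r - R) ^ 5)) / r"

lemma DERIV_bracket_inv_shift:
  "((\<lambda>r. bracket_inv (r - R)) has_real_derivative - (r - R) * bracket_inv (r - R) ^ 3) (at r)"
proof -
  have "((\<lambda>r. bracket_inv (r - R)) has_real_derivative (- (r - R) * bracket_inv (r - R) ^ 3) * 1) (at r)"
    by (rule DERIV_chain2[where f = bracket_inv and g = "\<lambda>r. r - R", OF DERIV_bracket_inv])
      (auto intro!: derivative_eq_intros)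
  then show ?thesis
    by simp
qed

lemma DERIV_wp:
  assumes "r > 0"
  shows "(wp \<kappa> R has_real_derivative - wq \<kappa> R r / r) (at r)"
proof -
  have "((\<lambda>r. arsinh (r - R)) has_real_derivative 1 / sqrt ((r - R)\<^sup>2 + 1) * 1) (at r)"
    by (rule DERIV_chain2[where f = arsinh and g = "\<lambda>r. r - R", OF arsinh_real_has_field_derivative])
      (auto intro!: derivative_eq_intros)
  then have "(wp \<kappa> R has_real_derivative \<kappa> * (0 - bracket_inv (r - R))) (at r)"
    unfolding wp_def[abs_def]
    by (intro DERIV_cmult DERIV_diff DERIV_const) (simp add: bracket_inv_def add.commute)
  then show ?thesis
    using assms by (simp add: wq_def)
qed

lemma DERIV_wm:
  assumes "r > 0"
  shows "((\<lambda>r. (n - 2) * wp \<kappa> R r - 2 * wq \<kappa> R r) has_real_derivative wm1 n \<kappa> R r * r) (at r)"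
proof -
  have "((\<lambda>r. (n - 2) * wp \<kappa> R r - 2 * wq \<kappa> R r) has_real_derivative
    (n - 2) * (- wq \<kappa> R r / r) - 2 * (\<kappa> * (1 * bracket_inv (r - R) + (- (r - R) * bracket_inv (r - R) ^ 3) * r))) (at r)"
    using assms unfolding wq_def[abs_def]
    by (intro DERIV_diff DERIV_cmult DERIV_wp[unfolded wq_def] DERIV_mult DERIV_bracket_inv_shift DERIV_ident)
  moreover have "(n - 2) * (- wq \<kappa> R r / r) - 2 * (\<kappa> * (1 * bracket_inv (r - R) + (- (r - R) * bracket_inv (r - R) ^ 3) * r))
     = wm1 n \<kappa> R r * r"
    using assms by (simp add: wq_def wm1_def field_simps)
  ultimately show ?thesis
    by simp
qed

lemma DERIV_wm1:
  assumes "r > 0"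
  shows "(wm1 n \<kappa> R has_real_derivative wm2 n \<kappa> R r * r) (at r)"
proof -
  have k3: "((\<lambda>r. bracket_inv (r - R) ^ 3) has_real_derivative
      - 3 * (r - R) * bracket_inv (r - R) ^ 5) (at r)"
    by (rule derivative_eq_intros DERIV_bracket_inv_shift refl)+ (simp add: power_def algebra_simps)
  have id: "((\<lambda>r. r - R) has_real_derivative 1) (at r)"
    by (auto intro!: derivative_eq_intros)
  have "(wm1 n \<kappa> R has_real_derivative
     - \<kappa> * (n * (((- (r - R) * bracket_inv (r - R) ^ 3) * r - bracket_inv (r - R) * 1) / (r * r))
       - 2 * (1 * bracket_inv (r - R) ^ 3 + (- 3 * (r - R) * bracket_inv (r - R) ^ 5) * (r - R)))) (at r)"
    unfolding wm1_def[abs_def] using assms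
    by (intro DERIV_diff DERIV_cmult DERIV_divide DERIV_mult DERIV_bracket_inv_shift DERIV_ident k3 id) auto
  moreover have "- \<kappa> * (n * (((- (r - R) * bracket_inv (r - R) ^ 3) * r - bracket_inv (r - R) * 1) / (r * r))
       - 2 * (1 * bracket_inv (r - R) ^ 3 + (- 3 * (r - R) * bracket_inv (r - R) ^ 5) * (r - R)))
     = wm2 n \<kappa> R r * r"
    using assms by (simp add: wm2_def field_simps power2_eq_square)
  ultimately show ?thesis
    by simp
qed

text \<open>The exponent enters only through its derivative and its differences, so any
  antiderivative on the half line serves and no closed formula is required.\<close>

lemma weight_potential_exists:
  "\<exists>\<phi>. \<forall>r>0. (\<phi> has_real_derivative - wp \<kappa> R r / r) (at r)"
proof -
  have "\<exists>\<phi>. \<forall>r. ereal 0 < r \<longrightarrow> r < \<infinity> \<longrightarrow> (\<phi> has_vector_derivative - wp \<kappa> R r / r) (at r)"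
  proof (rule einterval_antiderivative)
    fix r :: real
    assume "ereal 0 < r"
    then have "r > 0"
      by simp
    then show "isCont (\<lambda>r. - wp \<kappa> R r / r) r"
      by (intro continuous_intros DERIV_isCont[OF DERIV_wp]) auto
  qed auto
  then show ?thesis
    by (auto simp: has_real_derivative_iff_has_vector_derivative)
qed

lemma radial_weight_wp:
  fixes c :: "real^'n"
  assumes \<phi>: "\<And>r. r > 0 \<Longrightarrow> (\<phi> has_real_derivative - wp \<kappa> R r / r) (at r)"
  shows "radial_weight c (\<lambda>x. \<phi> (norm (x - c))) (\<lambda>x. wp \<kappa> R (norm (x - c))) (\<lambda>x. wq \<kappa> R (norm (x - c)))
    (\<lambda>x. wm1 (real CARD('n)) \<kappa> R (norm (x - c))) (\<lambda>x. wm2 (real CARD('n)) \<kappa> R (norm (x - c)))"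
proof
  fix x :: "real^'n"
  assume x: "x \<noteq> c"
  then have r: "norm (x - c) > 0"
    by simp
  have *: "a / r / r * v = a * (1 / r\<^sup>2) * v" for a r v :: real
    by (simp add: power2_eq_square)
  show "has_grad (\<lambda>x. \<phi> (norm (x - c))) (\<lambda>i. - wp \<kappa> R (norm (x - c)) * (1 / (norm (x - c))\<^sup>2) * (x $ i - c $ i)) x"
    using has_grad_radial[OF x \<phi>[OF r]] unfolding * .
  show "has_grad (\<lambda>x. wp \<kappa> R (norm (x - c))) (\<lambda>i. - wq \<kappa> R (norm (x - c)) * (1 / (norm (x - c))\<^sup>2) * (x $ i - c $ i)) x"
    using has_grad_radial[OF x DERIV_wp[OF r]] unfolding * .
  show "has_grad (\<lambda>x. (real CARD('n) - 2) * wp \<kappa> R (norm (x - c)) - 2 * wq \<kappa> R (norm (x - c)))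
      (\<lambda>i. wm1 (real CARD('n)) \<kappa> R (norm (x - c)) * (x $ i - c $ i)) x"
    using has_grad_radial[OF x DERIV_wm[OF r]] x by simp
  show "has_grad (\<lambda>x. wm1 (real CARD('n)) \<kappa> R (norm (x - c)))
      (\<lambda>i. wm2 (real CARD('n)) \<kappa> R (norm (x - c)) * (x $ i - c $ i)) x"
    using has_grad_radial[OF x DERIV_wm1[OF r]] x by simp
next
  have k: "continuous_on A (\<lambda>x::real^'n. bracket_inv (norm (x - c) - R))" for A
    unfolding bracket_inv_def
    by (intro continuous_intros) (metis add_pos_nonneg less_irrefl real_sqrt_gt_zero zero_le_power2 zero_less_one)
  show "continuous_on (- {c}) (\<lambda>x. wq \<kappa> R (norm (x - c)))"
    unfolding wq_def by (intro continuous_intros k)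
  show "continuous_on (- {c}) (\<lambda>x. wm2 (real CARD('n)) \<kappa> R (norm (x - c)))"
    unfolding wm2_def by (intro continuous_intros k) auto
qed

text \<open>In the following bounds \<open>\<kappa>\<close> is \<open>R\<^sup>\<beta> ln R\<close> with \<open>\<beta> \<ge> 1\<close>; all constants are absorbed into powers
  of \<open>L = ln R\<close>.\<close>

lemma wp_bounds:
  assumes "R \<ge> 9" "0 < r" "r \<le> 4 * R" "\<kappa> > 0"
  shows "\<kappa> * ln R \<le> wp \<kappa> R r" "wp \<kappa> R r \<le> \<kappa> * (5 * ln R)"
proof -
  have "\<bar>arsinh (r - R)\<bar> \<le> 2 * ln R"
    using assms by (intro abs_arsinh_le) auto
  then show "\<kappa> * ln R \<le> wp \<kappa> R r" "wp \<kappa> R r \<le> \<kappa> * (5 * ln R)"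
    unfolding wp_def using assms by (auto intro!: mult_left_mono)
qed

lemma bracket_inv_shift_ge:
  assumes "R \<ge> 9" "0 < r" "r \<le> 4 * R"
  shows "bracket_inv (r - R) \<ge> 1 / (5 * R)"
proof -
  have "1 / (5 * R) \<le> 1 / (1 + 4 * R)"
    using assms by (intro divide_left_mono) auto
  also have "\<dots> \<le> bracket_inv (r - R)"
    using assms by (intro bracket_inv_ge) auto
  finally show ?thesis .
qed

text \<open>The conditions of the Carleman inequality, with \<open>k\<close> for
  \<open>bracket_inv (r - R)\<close>: here \<open>wq = \<kappa> * (r * k)\<close>,
  \<open>wp \<ge> \<kappa> * ln R\<close>, \<open>\<kappa> \<ge> R * ln R\<close> and
  \<open>k \<ge> 1 / (5 * R)\<close>. Each condition has a power of \<open>ln R\<close> to spare,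
  which absorbs \<open>l\<close> and the dimension.\<close>

lemma weight_conditions:
  assumes R: "R \<ge> 9" and r: "0 < r" "r \<le> 4 * R" and \<kappa>: "\<kappa> \<ge> R * ln R"
    and L: "ln R \<ge> 320 * l + 48 * n + 4 * n\<^sup>2 + 256" and l: "l \<ge> 0" and n: "n \<ge> 1"
  shows "wp \<kappa> R r > 0" "wq \<kappa> R r > 0"
    "16 * l * r\<^sup>2 \<le> wp \<kappa> R r * wq \<kappa> R r" "8 * l * r\<^sup>2 \<le> (wp \<kappa> R r)\<^sup>2"
    "4 * wq \<kappa> R r \<le> (wp \<kappa> R r)\<^sup>2"
    "4 * \<bar>wm2 n \<kappa> R r * r\<^sup>2 + n * wm1 n \<kappa> R r\<bar> * r\<^sup>2 \<le> (wp \<kappa> R r)\<^sup>2 * wq \<kappa> R r"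
proof -
  define L where "L = ln R"
  define k where "k = bracket_inv (r - R)"
  define s where "s = r - R"
  define p where "p = wp \<kappa> R r"
  have n2: "n\<^sup>2 \<ge> 0"
    by simp
  have L1: "L \<ge> 256" "L \<ge> 320 * l" "L \<ge> 48 * n + 4 * n\<^sup>2 + 256"
    using L l n n2 unfolding L_def by linarith+
  have "0 < R * L"
    using R L1 by simp
  then have pos: "0 < R * L" "0 < \<kappa>"
    using \<kappa> by (auto simp: L_def)
  have k: "0 < k" "k \<le> 1" "1 / (5 * R) \<le> k" "k\<^sup>2 * (1 + s\<^sup>2) = 1"
    using bracket_inv_pos bracket_inv_le_1 bracket_inv_shift_ge[OF R r] bracket_inv_sq
    by (auto simp: k_def s_def)
  have q: "wq \<kappa> R r = \<kappa> * (r * k)"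
    by (simp add: wq_def k_def)
  have "\<kappa> * L \<le> p"
    using wp_bounds(1)[OF R r pos(2)] by (simp add: p_def L_def)
  moreover have "R * L * L \<le> \<kappa> * L"
    using \<kappa> L1 by (intro mult_right_mono) (auto simp: L_def)
  ultimately have p0: "R * L * L \<le> p" "\<kappa> * L \<le> p"
    by auto
  have LL: "L * L \<ge> L" "L * L \<ge> 1" "L * L \<ge> 16"
    using mult_right_mono[of 1 L L] mult_mono[of 1 L 1 L] mult_mono[of 4 L 4 L] L1 by auto
  have "R * 1 \<le> R * (L * L)"
    using R LL by (intro mult_left_mono) auto
  also have "\<dots> \<le> p"
    using p0 by (simp add: mult_ac)
  finally have p1: "0 < p" "R \<le> p"
    using R by auto
  show "wp \<kappa> R r > 0"
    using p1 by (simp add: p_def)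
  show "wq \<kappa> R r > 0"
    unfolding q using pos r k by simp
  have R2: "R\<^sup>2 * L \<le> p\<^sup>2"
  proof -
    have "R\<^sup>2 * L \<le> (R * L * L)\<^sup>2"
    proof -
      have "L * 1 \<le> L * (L * (L * L))"
        using LL L1 mult_mono[of 1 "L" 1 "L * L"] by (intro mult_left_mono) auto
      then have "R\<^sup>2 * L \<le> R\<^sup>2 * (L * (L * (L * L)))"
        by (intro mult_left_mono) auto
      then show ?thesis
        by (simp add: power2_eq_square mult_ac)
    qed
    also have "\<dots> \<le> p\<^sup>2"
      using p0 R L1 by (intro power_mono) auto
    finally show ?thesis .
  qed
  have r2: "r\<^sup>2 \<le> 4 * R * r" "r\<^sup>2 \<le> 16 * R\<^sup>2"
    using r mult_mono[of r "4 * R" r "4 * R"] by (auto simp: power2_eq_square)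
  show "16 * l * r\<^sup>2 \<le> wp \<kappa> R r * wq \<kappa> R r"
  proof -
    have "16 * l * r\<^sup>2 \<le> 16 * l * (4 * R * r)"
      using l r2 by (intro mult_left_mono) auto
    \<comment> \<open>The 5 pays for \<open>k \<ge> 1 / (5 * R)\<close>; hence the coefficient 320 =
      5 * 64 in the bound for \<open>ln R\<close>.\<close>
    also have "\<dots> = (320 * l) * (R * r) / 5"
      by simp
    also have "\<dots> \<le> (L * 1) * (R * r) / 5"
      using L1 R r by (intro divide_right_mono mult_right_mono) auto
    also have "\<dots> \<le> (L * (L * L)) * (R * r) / 5"
      using L1 R r LL by (intro divide_right_mono mult_right_mono mult_left_mono) auto
    also have "\<dots> = (R * L * L) * ((R * L) * (r * (1 / (5 * R))))"
      using R by (simp add: field_simps)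
    also have "\<dots> \<le> p * (\<kappa> * (r * k))"
      using p0 p1 \<kappa> pos k r R L1 by (intro mult_mono) (auto simp: L_def)
    finally show ?thesis
      by (simp add: q p_def)
  qed
  show "8 * l * r\<^sup>2 \<le> (wp \<kappa> R r)\<^sup>2"
  proof -
    have "8 * l * r\<^sup>2 \<le> 8 * l * (16 * R\<^sup>2)"
      using l r2 by (intro mult_left_mono) auto
    also have "\<dots> = R\<^sup>2 * (128 * l)"
      by simp
    also have "\<dots> \<le> R\<^sup>2 * L"
      using L1 l by (intro mult_left_mono) auto
    finally show ?thesis
      using R2 by (simp add: p_def)
  qed
  show "4 * wq \<kappa> R r \<le> (wp \<kappa> R r)\<^sup>2"
  proof -
    have "4 * (\<kappa> * (r * k)) \<le> 4 * (\<kappa> * ((4 * R) * 1))"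
      using pos r k R by (intro mult_left_mono mult_mono) auto
    also have "\<dots> = \<kappa> * (R * 16)"
      by simp
    also have "\<dots> \<le> \<kappa> * (R * (L * L))"
      using pos R L1 LL by (intro mult_left_mono) auto
    also have "\<dots> \<le> (\<kappa> * L) * (R * L * L)"
      using pos L1 LL R mult_right_mono[of 1 L "\<kappa> * (R * (L * L))"] by (simp add: mult_ac)
    also have "\<dots> \<le> p * p"
      using p0 p1 pos L1 R by (intro mult_mono) auto
    finally show ?thesis
      by (simp add: q p_def power2_eq_square)
  qed
  show "4 * \<bar>wm2 n \<kappa> R r * r\<^sup>2 + n * wm1 n \<kappa> R r\<bar> * r\<^sup>2 \<le> (wp \<kappa> R r)\<^sup>2 * wq \<kappa> R r"
  proof -
    \<comment> \<open>The Laplacian of the radial function \<open>m\<close>. The three summands are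
      bounded by \<open>k\<close> times a constant, \<open>k / r\<close> times a constant, and
      \<open>r * k\<close> times a constant.\<close>
    have M: "wm2 n \<kappa> R r * r\<^sup>2 + n * wm1 n \<kappa> R r =
      - \<kappa> * (- 3 * n * (s * k ^ 3) + n * (n - 1) * (k / r) + 2 * r * (- (k ^ 3) + 3 * s\<^sup>2 * k ^ 5))"
      unfolding wm1_def wm2_def unfolding k_def[symmetric] unfolding s_def[symmetric] using r
      by (simp add: field_simps power2_eq_square)
    have sk: "\<bar>s\<bar> * k \<le> 1" "s\<^sup>2 * k\<^sup>2 \<le> 1" "k\<^sup>2 \<le> 1"
    proof -
      show *: "s\<^sup>2 * k\<^sup>2 \<le> 1" "k\<^sup>2 \<le> 1"
      proof -
        have "k\<^sup>2 + s\<^sup>2 * k\<^sup>2 = 1" "0 \<le> k\<^sup>2" "0 \<le> s\<^sup>2 * k\<^sup>2"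
          using k(4) by (simp_all add: algebra_simps)
        then show "s\<^sup>2 * k\<^sup>2 \<le> 1" "k\<^sup>2 \<le> 1"
          by linarith+
      qed
      then have "(\<bar>s\<bar> * k)\<^sup>2 \<le> 1\<^sup>2"
        by (simp add: power_mult_distrib)
      then show "\<bar>s\<bar> * k \<le> 1"
        by (rule power2_le_imp_le) simp
    qed
    have b1: "\<bar>s * k ^ 3\<bar> \<le> k"
    proof -
      have "\<bar>s * k ^ 3\<bar> = k * ((\<bar>s\<bar> * k) * k)"
        using k by (simp add: abs_mult power3_eq_cube mult_ac)
      also have "\<dots> \<le> k * 1"
        using sk k mult_mono[of "\<bar>s\<bar> * k" 1 k 1] by (intro mult_left_mono) auto
      finally show ?thesis by simp
    qed
    have b2: "\<bar>- (k ^ 3) + 3 * s\<^sup>2 * k ^ 5\<bar> \<le> 2 * k"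
    proof -
      have "- (k ^ 3) + 3 * s\<^sup>2 * k ^ 5 = k * (k\<^sup>2 * (3 * (s\<^sup>2 * k\<^sup>2) - 1))"
        by (simp add: algebra_simps power2_eq_square power_def)
      moreover have "\<bar>k\<^sup>2 * (3 * (s\<^sup>2 * k\<^sup>2) - 1)\<bar> \<le> 1 * 2"
      proof -
        have "0 \<le> s\<^sup>2 * k\<^sup>2"
          by simp
        then have "\<bar>3 * (s\<^sup>2 * k\<^sup>2) - 1\<bar> \<le> 2"
          using sk(2) by argo
        then show ?thesis
          unfolding abs_mult using sk(3) by (intro mult_mono) auto
      qed
      ultimately show ?thesis
        using k by (simp add: abs_mult)
    qed
    have nk: "0 \<le> n * (n - 1) * (k / r)" "n * (n - 1) * (k / r) \<le> n\<^sup>2 * (k / r)"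
    proof -
      show "0 \<le> n * (n - 1) * (k / r)"
        using n k r by (intro mult_nonneg_nonneg) auto
      have "n * (n - 1) \<le> n\<^sup>2"
        using n by (simp add: power2_eq_square)
      then show "n * (n - 1) * (k / r) \<le> n\<^sup>2 * (k / r)"
        using k r by (intro mult_right_mono) auto
    qed
    have "\<bar>- 3 * n * (s * k ^ 3) + n * (n - 1) * (k / r) + 2 * r * (- (k ^ 3) + 3 * s\<^sup>2 * k ^ 5)\<bar>
      \<le> 3 * n * \<bar>s * k ^ 3\<bar> + n\<^sup>2 * (k / r) + 2 * r * \<bar>- (k ^ 3) + 3 * s\<^sup>2 * k ^ 5\<bar>"
    proof -
      have "\<bar>- 3 * n * (s * k ^ 3)\<bar> = 3 * n * \<bar>s * k ^ 3\<bar>"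
        using n by (simp add: abs_mult)
      moreover have "\<bar>2 * r * (- (k ^ 3) + 3 * s\<^sup>2 * k ^ 5)\<bar> = 2 * r * \<bar>- (k ^ 3) + 3 * s\<^sup>2 * k ^ 5\<bar>"
        using r unfolding abs_mult by simp
      moreover have "\<bar>a + b + d\<bar> \<le> A + B + D"
        if "\<bar>a\<bar> = A" "\<bar>d\<bar> = D" "0 \<le> b" "b \<le> B" for a b d A B D :: real
        using that by argo
      ultimately show ?thesis
        using nk by blast
    qed
    also have "\<dots> \<le> 3 * n * k + n\<^sup>2 * (k / r) + 2 * r * (2 * k)"
      using b1 b2 n r by (intro add_mono mult_left_mono) auto
    also have "\<dots> = (k / r) * (3 * n * r + n\<^sup>2 + 4 * r\<^sup>2)"
      using r by (simp add: field_simps power2_eq_square)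
    also have "\<dots> \<le> (k / r) * (R\<^sup>2 * (12 * n + n\<^sup>2 + 64))"
    proof (intro mult_left_mono)
      have "R * 1 \<le> R * R"
        using R by (intro mult_left_mono) auto
      then have RR: "R \<le> R\<^sup>2" "1 \<le> R\<^sup>2"
        using R mult_mono[of 1 R 1 R] by (auto simp: power2_eq_square)
      have "3 * n * r \<le> 3 * n * (4 * R\<^sup>2)"
        using r n RR by (intro mult_left_mono) auto
      moreover have "n\<^sup>2 * 1 \<le> n\<^sup>2 * R\<^sup>2"
        using RR by (intro mult_left_mono) auto
      ultimately show "3 * n * r + n\<^sup>2 + 4 * r\<^sup>2 \<le> R\<^sup>2 * (12 * n + n\<^sup>2 + 64)"
        using r2 by (simp add: algebra_simps)
    qed (use k r in auto)
    finally have M1: "\<bar>- 3 * n * (s * k ^ 3) + n * (n - 1) * (k / r) + 2 * r * (- (k ^ 3) + 3 * s\<^sup>2 * k ^ 5)\<bar>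
      \<le> (k / r) * (R\<^sup>2 * (12 * n + n\<^sup>2 + 64))" .
    have M2: "\<bar>wm2 n \<kappa> R r * r\<^sup>2 + n * wm1 n \<kappa> R r\<bar> \<le> \<kappa> * ((k / r) * (R\<^sup>2 * (12 * n + n\<^sup>2 + 64)))"
      unfolding M abs_mult[of "- \<kappa>"] abs_minus_cancel abs_of_pos[OF pos(2)]
      by (rule mult_left_mono[OF M1]) (use pos in simp)
    have "4 * \<bar>wm2 n \<kappa> R r * r\<^sup>2 + n * wm1 n \<kappa> R r\<bar> * r\<^sup>2
      \<le> 4 * (\<kappa> * ((k / r) * (R\<^sup>2 * (12 * n + n\<^sup>2 + 64)))) * r\<^sup>2"
      using M2 by (intro mult_right_mono mult_left_mono) auto
    \<comment> \<open>Four times \<open>12 * n + n^2 + 64\<close> is the dimensional part of the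
      assumed lower bound for \<open>ln R\<close>.\<close>
    also have "\<dots> = (R\<^sup>2 * (48 * n + 4 * n\<^sup>2 + 256)) * (\<kappa> * (r * k))"
      using r by (simp add: field_simps power2_eq_square)
    also have "\<dots> \<le> (R\<^sup>2 * L) * (\<kappa> * (r * k))"
      using L1 pos r k by (intro mult_right_mono mult_left_mono) auto
    also have "\<dots> \<le> p\<^sup>2 * (\<kappa> * (r * k))"
      using R2 pos r k by (intro mult_right_mono) auto
    finally show ?thesis
      by (simp add: q p_def)
  qed
qed

section \<open>A flat function and smooth functions built from it\<close>

text \<open>The negative powers are carried along because differentiating
  \<open>exp (- 1 / s)\<close> creates them: the family in \<open>j\<close> is closed under
  differentiation up to linear combinations, and each member vanishes continuously at 0.\<close>

definition flat_exp :: "nat \<Rightarrow> real \<Rightarrow> real" where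
  "flat_exp j s = (if s > 0 then exp (- 1 / s) / s ^ j else 0)"

lemma flat_exp_nonneg: "flat_exp j s \<ge> 0"
  by (simp add: flat_exp_def)

lemma isCont_flat_exp_0: "isCont (flat_exp j) 0"
proof -
  have "((\<lambda>s. inverse s ^ j / exp (inverse s)) \<longlongrightarrow> 0) (at_right (0::real))"
    by (rule filterlim_compose[OF tendsto_power_div_exp_0 filterlim_inverse_at_top_right])
  then have "(flat_exp j \<longlongrightarrow> 0) (at_right 0)"
    by (rule Lim_transform_eventually)
      (auto simp: eventually_at_filter flat_exp_def exp_minus field_simps)
  moreover have "(flat_exp j \<longlongrightarrow> 0) (at_left 0)"
    by (rule Lim_transform_eventually[OF tendsto_const])
      (auto simp: eventually_at_filter flat_exp_def)
  ultimately show ?thesis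
    by (simp add: isCont_def filterlim_at_split flat_exp_def)
qed

lemma DERIV_flat_exp:
  "(flat_exp j has_real_derivative flat_exp (j + 2) s - real j * flat_exp (j + 1) s) (at s)"
proof -
  consider "s > 0" | "s < 0" | "s = 0"
    by linarith
  then show ?thesis
  proof cases
    case 1
    have "((\<lambda>s. exp (- 1 / s) / s ^ j) has_real_derivative flat_exp (j + 2) s - real j * flat_exp (j + 1) s) (at s)"
    proof -
      have "((\<lambda>s. exp (- 1 / s) / s ^ j) has_real_derivative
         (exp (- 1 / s) * (1 / s\<^sup>2) * s ^ j - exp (- 1 / s) * (real j * s ^ (j - 1))) / (s ^ j * s ^ j)) (at s)"
        using 1 by (auto intro!: derivative_eq_intros simp: power2_eq_square)
      moreover have "(exp (- 1 / s) * (1 / s\<^sup>2) * s ^ j - exp (- 1 / s) * (real j * s ^ (j - 1))) / (s ^ j * s ^ j)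
          = flat_exp (j + 2) s - real j * flat_exp (j + 1) s"
        using 1 by (cases j) (auto simp: flat_exp_def field_simps power2_eq_square)
      ultimately show ?thesis
        by simp
    qed
    then show ?thesis
      by (rule has_field_derivative_transform_within_open[where S = "{0<..}"])
        (use 1 in \<open>auto simp: flat_exp_def\<close>)
  next
    case 2
    have "((\<lambda>s. 0) has_real_derivative flat_exp (j + 2) s - real j * flat_exp (j + 1) s) (at s)"
      using 2 by (simp add: flat_exp_def)
    then show ?thesis
      by (rule has_field_derivative_transform_within_open[where S = "{..<0}"])
        (use 2 in \<open>auto simp: flat_exp_def\<close>)
  next
    case 3
    \<comment> \<open>At 0 the difference quotient of member \<open>j\<close> is member
      \<open>j + 1\<close>, so continuity of the latter gives the derivative.\<close>
    have "(flat_exp (j + 1) \<longlongrightarrow> 0) (at 0)"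
      using isCont_flat_exp_0[of "j + 1"] unfolding isCont_def by (simp add: flat_exp_def[of _ 0])
    moreover have "flat_exp (j + 1) h = (flat_exp j (0 + h) - flat_exp j 0) / h" if "h \<noteq> 0" for h
      using that by (simp add: flat_exp_def)
    ultimately have "((\<lambda>h. (flat_exp j (0 + h) - flat_exp j 0) / h) \<longlongrightarrow> 0) (at 0)"
      by (subst LIM_equal[of 0 _ "flat_exp (j + 1)"]) auto
    moreover have "flat_exp (j + 2) s - real j * flat_exp (j + 1) s = 0"
      using 3 by (simp add: flat_exp_def)
    ultimately show ?thesis
      unfolding DERIV_def using 3 by simp
  qed
qed

lemma C_k_add:
  "C_k k f \<Longrightarrow> C_k k g \<Longrightarrow> C_k k (\<lambda>x. f x + g x)"
proof (induction k arbitrary: f g)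
  case 0
  then show ?case
    by (simp add: continuous_on_add)
next
  case (Suc k)
  then have d: "f differentiable (at x)" "g differentiable (at x)" for x
    by simp_all
  have "frechet_derivative (\<lambda>x. f x + g x) (at x) v
      = frechet_derivative f (at x) v + frechet_derivative g (at x) v" for x v
    using has_derivative_add[OF d[THEN frechet_derivative_works[THEN iffD1]]]
    by (metis frechet_derivative_at)
  then show ?case
    using Suc d by (simp add: differentiable_add)
qed

text \<open>Polynomials are the coefficients that repeated differentiation of the mollifier
  produces; closure under directional derivatives feeds the induction on the order of
  smoothness.\<close>

lemma real_polynomial_function_derivative:
  assumes "real_polynomial_function (g :: 'a::real_normed_vector \<Rightarrow> real)"
  shows "\<exists>g'. (\<forall>y. (g has_derivative (\<lambda>v. g' v y)) (at y)) \<and> (\<forall>v. real_polynomial_function (g' v))"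
  using assms
proof (induction rule: real_polynomial_function.induct)
  case (linear f)
  then show ?case
    by (intro exI[of _ "\<lambda>v y. f v"])
      (auto intro: bounded_linear_imp_has_derivative real_polynomial_function.intros(2))
next
  case (const c)
  show ?case
    by (intro exI[of _ "\<lambda>v y. 0"]) (auto intro: real_polynomial_function.intros(2))
next
  case (add f g)
  then obtain f' g' where "\<forall>y. (f has_derivative (\<lambda>v. f' v y)) (at y)" "\<forall>v. real_polynomial_function (f' v)"
    "\<forall>y. (g has_derivative (\<lambda>v. g' v y)) (at y)" "\<forall>v. real_polynomial_function (g' v)"
    by metis
  then show ?case
    by (intro exI[of _ "\<lambda>v y. f' v y + g' v y"])
      (auto intro: has_derivative_add real_polynomial_function.intros(3))
next
  case (mult f g)
  then obtain f' g' where "\<forall>y. (f has_derivative (\<lambda>v. f' v y)) (at y)" "\<forall>v. real_polynomial_function (f' v)"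
    "\<forall>y. (g has_derivative (\<lambda>v. g' v y)) (at y)" "\<forall>v. real_polynomial_function (g' v)"
    by metis
  then show ?case
    using mult by (intro exI[of _ "\<lambda>v y. f y * g' v y + f' v y * g y"])
      (auto intro!: has_derivative_mult real_polynomial_function.intros(3) real_polynomial_function.intros(4))
qed

text \<open>Products of a \<open>flat_exp j (b - |x - y|^2)\<close> with a polynomial are stable
  under directional derivatives up to sums. Keeping \<open>j\<close> and the polynomial arbitrary in
  the induction therefore yields every order of smoothness.\<close>

lemma C_k_flat_exp:
  fixes x :: "'a::real_inner"
  assumes "real_polynomial_function g"
  shows "C_k k (\<lambda>y. complex_of_real (flat_exp j (b - (norm (x - y))\<^sup>2) * g y))"
  using assms
proof (induction k arbitrary: j g)
  case 0
  have "isCont (flat_exp j) s" for s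
    using DERIV_flat_exp DERIV_isCont by blast
  then have "continuous_on UNIV (flat_exp j)"
    by (simp add: continuous_at_imp_continuous_on)
  moreover have "continuous_on UNIV g"
    using differentiable_imp_continuous_on[OF differentiable_on_real_polynomial_function[OF 0]] .
  ultimately show ?case
    by (auto intro!: continuous_intros intro: continuous_on_compose2[of UNIV "flat_exp j"])
next
  case (Suc k)
  obtain g' where g': "\<And>y. (g has_derivative (\<lambda>v. g' v y)) (at y)" "\<And>v. real_polynomial_function (g' v)"
    using real_polynomial_function_derivative[OF Suc.prems] by metis
  define F where "F y = complex_of_real (flat_exp j (b - (norm (x - y))\<^sup>2) * g y)" for y
  \<comment> \<open>The three summands are the two parts of the derivative of
    \<open>flat_exp j\<close> and the derivative of the polynomial, each again of the form covered
    by the induction hypothesis.\<close>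
  define D where "D v y = complex_of_real (flat_exp (j + 2) (b - (norm (x - y))\<^sup>2) * (2 * (v \<bullet> (x - y)) * g y))
     + (complex_of_real (flat_exp (j + 1) (b - (norm (x - y))\<^sup>2) * (- real j * (2 * (v \<bullet> (x - y))) * g y))
     + complex_of_real (flat_exp j (b - (norm (x - y))\<^sup>2) * g' v y))" for v y
  have der: "(F has_derivative (\<lambda>v. D v y)) (at y)" for y
  proof -
    have "((\<lambda>y. b - (x - y) \<bullet> (x - y)) has_derivative (\<lambda>v. 2 * (v \<bullet> (x - y)))) (at y)"
      by (auto intro!: derivative_eq_intros simp: inner_commute)
    then have "((\<lambda>y. b - (norm (x - y))\<^sup>2) has_derivative (\<lambda>v. 2 * (v \<bullet> (x - y)))) (at y)"
      by (simp add: dot_square_norm)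
    then have "((\<lambda>y. flat_exp j (b - (norm (x - y))\<^sup>2)) has_derivative
      (\<lambda>v. (flat_exp (j + 2) (b - (norm (x - y))\<^sup>2) - real j * flat_exp (j + 1) (b - (norm (x - y))\<^sup>2))
         * (2 * (v \<bullet> (x - y))))) (at y)"
      using has_derivative_compose[OF _ DERIV_flat_exp[unfolded has_field_derivative_def]] by blast
    from has_derivative_of_real[OF has_derivative_mult[OF this g'(1)]]
    show ?thesis
      unfolding F_def[abs_def]
      by (rule has_derivative_eq_rhs) (simp add: D_def fun_eq_iff algebra_simps)
  qed
  have lin: "real_polynomial_function (\<lambda>y. v \<bullet> (x - y))" for v
    unfolding inner_diff_right
    by (intro real_polynomial_function_diff real_polynomial_function.intros(2) real_polynomial_function.intros(1)
        bounded_linear_inner_right)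
  have "C_k k (D v)" for v
    unfolding D_def[abs_def]
    by (intro C_k_add Suc.IH real_polynomial_function.intros(4) real_polynomial_function.intros(2) lin Suc.prems g'(2))
  moreover have "frechet_derivative F (at y) v = D v y" for y v
    using frechet_derivative_at[OF der] by metis
  moreover have "F differentiable (at y)" for y
    using der unfolding differentiable_def by blast
  ultimately have "C_k (Suc k) F"
    by simp
  then show ?case
    by (simp add: F_def[abs_def])
qed

section \<open>Mollification and local square integrability\<close>

lemma uniformly_continuous_compact_support:
  fixes g :: "'a::euclidean_space \<Rightarrow> 'b::real_normed_vector"
  assumes "continuous_on UNIV g" "\<And>x. norm x > b \<Longrightarrow> g x = 0" "e > 0"
  shows "\<exists>d>0. d \<le> 1 \<and> (\<forall>x y. dist x y < d \<longrightarrow> norm (g x - g y) < e)"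
proof -
  have "uniformly_continuous_on (cball 0 (b + 2)) g"
    using assms(1) continuous_on_subset by (intro compact_uniformly_continuous) auto
  then obtain d where d: "d > 0"
    "\<And>x y. x \<in> cball 0 (b + 2) \<Longrightarrow> y \<in> cball 0 (b + 2) \<Longrightarrow> dist x y < d \<Longrightarrow> dist (g x) (g y) < e"
    using assms(3) unfolding uniformly_continuous_on_def by (metis dist_commute)
  have "norm (g x - g y) < e" if "dist x y < min d 1" for x y
  proof (cases "norm x \<le> b + 1 \<and> norm y \<le> b + 1")
    case True
    then show ?thesis
      using d(2)[of x y] that by (simp add: dist_norm)
  next
    case False
    moreover have "norm x \<le> norm y + dist x y" "norm y \<le> norm x + dist x y"
      using norm_triangle_sub[of x y] norm_triangle_sub[of y x] by (auto simp: dist_norm norm_minus_commute)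
    ultimately have "norm x > b" "norm y > b"
      using that by auto
    then show ?thesis
      using assms by simp
  qed
  then show ?thesis
    using d(1) by (intro exI[of _ "min d 1"]) auto
qed

text \<open>The counterpart of \<open>L2_loc\<close> for Borel functions and \<open>lborel\<close>,
  where product measurability and translation are available. Weak solutions enter it through Borel
  representatives.\<close>

definition loc_sq :: "('a::euclidean_space \<Rightarrow> 'b::euclidean_space) \<Rightarrow> bool" where
  "loc_sq f \<longleftrightarrow> f \<in> borel_measurable borel \<and>
     (\<forall>K. compact K \<longrightarrow> set_integrable lborel K (\<lambda>x. (norm (f x))\<^sup>2))"

lemma loc_sq_loc_integrable:
  assumes "loc_sq f" "compact K"
  shows "set_integrable lborel K (\<lambda>x. norm (f x))"
proof -
  have "set_integrable lborel K (\<lambda>x. 1 + (norm (f x))\<^sup>2)"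
    using assms borel_integrable_compact[OF assms(2), of "\<lambda>x. 1::real"]
    by (intro set_integral_add) (auto simp: loc_sq_def set_integrable_def)
  moreover have "norm v \<le> 1 + (norm v)\<^sup>2" for v :: 'b
  proof -
    have "0 \<le> (norm v - 1)\<^sup>2"
      by simp
    then have "2 * norm v \<le> 1 + (norm v)\<^sup>2"
      by (simp add: power2_diff)
    then show ?thesis
      using norm_ge_zero[of v] by linarith
  qed
  ultimately show ?thesis
    unfolding set_integrable_def
  proof (elim Bochner_Integration.integrable_bound)
    show "(\<lambda>x. indicator K x *\<^sub>R norm (f x)) \<in> borel_measurable lborel"
      using assms by (intro borel_measurable_scaleR borel_measurable_indicator borel_measurable_norm)
        (auto simp: loc_sq_def compact_imp_closed)
  qed (auto simp: indicator_def)
qed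

lemma integrable_continuous_times:
  fixes g :: "'a::euclidean_space \<Rightarrow> real" and f :: "'a \<Rightarrow> 'b::euclidean_space"
  assumes f: "f \<in> borel_measurable borel" "set_integrable lborel K (\<lambda>x. norm (f x))"
    and g: "continuous_on UNIV g" and K: "compact K" "\<And>x. x \<notin> K \<Longrightarrow> g x = 0"
  shows "integrable lborel (\<lambda>x. g x *\<^sub>R f x)"
proof -
  obtain C where C: "\<And>x. x \<in> K \<Longrightarrow> norm (g x) \<le> C"
  proof -
    have "bounded (g ` K)"
      by (intro compact_imp_bounded compact_continuous_image K continuous_on_subset[OF g]) auto
    then show ?thesis
      using that by (auto simp: bounded_iff)
  qed
  have "integrable lborel (\<lambda>x. C * (indicator K x *\<^sub>R norm (f x)))"
    using f(2) unfolding set_integrable_def by (intro integrable_mult_right)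
  then show ?thesis
  proof (rule Bochner_Integration.integrable_bound)
    show "(\<lambda>x. g x *\<^sub>R f x) \<in> borel_measurable lborel"
      using f g by (simp add: borel_measurable_continuous_onI borel_measurable_scaleR)
    have "norm (g x *\<^sub>R f x) \<le> norm (C * (indicator K x *\<^sub>R norm (f x)))" for x
    proof (cases "x \<in> K")
      case True
      then have "0 \<le> C"
        using C[of x] norm_ge_zero order_trans by blast
      then show ?thesis
        using True C[of x] by (simp add: abs_mult mult_right_mono)
    qed (use K in simp)
    then show "AE x in lborel. norm (g x *\<^sub>R f x) \<le> norm (C * (indicator K x *\<^sub>R norm (f x)))"
      by simp
  qed
qed

lemma integrable_kernel_times:
  fixes g :: "'a::euclidean_space \<Rightarrow> real" and f :: "'a \<Rightarrow> 'b::euclidean_space"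
  assumes f: "loc_sq f" and g: "continuous_on UNIV g" and K: "compact K" "\<And>x. x \<notin> K \<Longrightarrow> g x = 0"
  shows "integrable lborel (\<lambda>x. g x *\<^sub>R f x)"
  by (rule integrable_continuous_times[OF _ loc_sq_loc_integrable[OF f K(1)] g K])
    (use f in \<open>simp add: loc_sq_def\<close>)

definition conv :: "('a::euclidean_space \<Rightarrow> 'b::euclidean_space) \<Rightarrow> ('a \<Rightarrow> real) \<Rightarrow> 'a \<Rightarrow> 'b" where
  "conv f k x = (LINT y|lborel. k (x - y) *\<^sub>R f y)"

lemma shifted_support:
  fixes k :: "'a::real_normed_vector \<Rightarrow> 'b::zero"
  assumes "\<And>x. norm x > b \<Longrightarrow> k x = 0"
  shows "y \<notin> cball x b \<Longrightarrow> k (x - y) = 0"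
  using assms by (simp add: dist_norm)

lemma conv_integrable:
  assumes "loc_sq f" "continuous_on UNIV k" "\<And>x. norm x > b \<Longrightarrow> k x = 0"
  shows "integrable lborel (\<lambda>y. k (x - y) *\<^sub>R f y)"
  by (rule integrable_kernel_times[OF assms(1) _ compact_cball[of x b]])
    (use shifted_support[of b k, OF assms(3)] in \<open>auto intro!: continuous_on_compose2[OF assms(2)] continuous_intros\<close>)

lemma norm_integral_kernel_le:
  fixes f :: "'a::euclidean_space \<Rightarrow> 'b::euclidean_space"
  assumes f: "loc_sq f" and D: "\<And>y. \<bar>D y\<bar> \<le> e * indicator (cball x b) y" "D \<in> borel_measurable borel"
  shows "norm (LINT y|lborel. D y *\<^sub>R f y) \<le> e * (LINT y:cball x b|lborel. norm (f y))"
proof -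
  have I: "integrable lborel (\<lambda>y. e * (indicator (cball x b) y *\<^sub>R norm (f y)))"
    using loc_sq_loc_integrable[OF f compact_cball] unfolding set_integrable_def by (intro integrable_mult_right)
  have *: "norm (D y *\<^sub>R f y) \<le> e * (indicator (cball x b) y *\<^sub>R norm (f y))" for y
    using mult_right_mono[OF D(1)[of y], of "norm (f y)"] by (simp add: mult_ac)
  have "integrable lborel (\<lambda>y. D y *\<^sub>R f y)"
  proof (rule Bochner_Integration.integrable_bound[OF I])
    show "(\<lambda>y. D y *\<^sub>R f y) \<in> borel_measurable lborel"
      using f D by (simp add: loc_sq_def borel_measurable_scaleR)
    show "AE y in lborel. norm (D y *\<^sub>R f y) \<le> norm (e * (indicator (cball x b) y *\<^sub>R norm (f y)))"
      by (intro AE_I2 order_trans[OF *]) (simp only: real_norm_def abs_ge_self)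
  qed
  then have "norm (LINT y|lborel. D y *\<^sub>R f y) \<le> (LINT y|lborel. e * (indicator (cball x b) y *\<^sub>R norm (f y)))"
    using * I by (intro order_trans[OF integral_norm_bound] integral_mono integrable_norm) auto
  then show ?thesis
    by (simp add: set_lebesgue_integral_def)
qed

text \<open>A compactly supported continuous kernel is uniformly continuous, and for nearby points
  the difference of kernels lives in a fixed ball, on which \<open>f\<close> is integrable.\<close>

lemma continuous_on_conv:
  fixes f :: "'a::euclidean_space \<Rightarrow> 'b::euclidean_space"
  assumes f: "loc_sq f" and k: "continuous_on UNIV k" "\<And>x. norm x > b \<Longrightarrow> k x = 0"
  shows "continuous_on UNIV (conv f k)"
  unfolding continuous_on_iff
proof (intro ballI allI impI)
  fix x :: 'a and e :: real
  assume "e > 0"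
  define A where "A = (LINT y:cball x (b + 1)|lborel. norm (f y))"
  have A: "A \<ge> 0"
    unfolding A_def set_lebesgue_integral_def by (rule Bochner_Integration.integral_nonneg) simp
  \<comment> \<open>Dividing by \<open>A + 1\<close> instead of \<open>A\<close> covers the case
    \<open>A = 0\<close>.\<close>
  obtain d where d: "d > 0" "d \<le> 1" "\<And>x y. dist x y < d \<Longrightarrow> norm (k x - k y) < e / (A + 1)"
    using uniformly_continuous_compact_support[OF k, where b = b and e = "e / (A + 1)"] A \<open>e > 0\<close> by auto
  have "dist (conv f k x') (conv f k x) < e" if "dist x' x < d" for x'
  proof -
    have meas: "(\<lambda>y. k (x - y)) \<in> borel_measurable borel" for x
      by (intro borel_measurable_continuous_onI continuous_on_compose2[OF k(1)] continuous_intros) auto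
    have eq: "conv f k x' - conv f k x = (LINT y|lborel. (k (x' - y) - k (x - y)) *\<^sub>R f y)"
      unfolding conv_def scaleR_diff_left
      by (rule Bochner_Integration.integral_diff[OF conv_integrable[OF f k, where x = x']
            conv_integrable[OF f k, where x = x], symmetric])
    have bd: "\<bar>k (x' - y) - k (x - y)\<bar> \<le> e / (A + 1) * indicator (cball x (b + 1)) y" for y
    proof (cases "y \<in> cball x (b + 1)")
      case True
      have "dist (x' - y) (x - y) < d"
        using that by (simp add: dist_norm)
      then show ?thesis
        using d(3) True by (simp add: less_imp_le)
    next
      case False
      then have "norm (x - y) > b + 1"
        by (simp add: dist_norm)
      moreover have "norm (x - y) \<le> norm (x' - y) + dist x' x"
        using norm_triangle_ineq[of "x' - y" "x - x'"] by (simp add: dist_norm norm_minus_commute)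
      ultimately have "norm (x - y) > b" "norm (x' - y) > b"
        using that d by auto
      then show ?thesis
        using k(2) False by simp
    qed
    have "norm (LINT y|lborel. (k (x' - y) - k (x - y)) *\<^sub>R f y)
        \<le> e / (A + 1) * (LINT y:cball x (b + 1)|lborel. norm (f y))"
      by (rule norm_integral_kernel_le[OF f bd]) (intro borel_measurable_diff meas)
    then have "norm (conv f k x' - conv f k x) \<le> e / (A + 1) * A"
      by (simp only: eq A_def[symmetric])
    also have "\<dots> < e"
      using A \<open>e > 0\<close> by (simp add: field_simps)
    finally show ?thesis
      by (simp add: dist_norm)
  qed
  then show "\<exists>d>0. \<forall>x'\<in>UNIV. dist x' x < d \<longrightarrow> dist (conv f k x') (conv f k x) < e"
    using d(1) by blast
qed

lemma has_grad_linearization: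
  fixes k :: "real^'n \<Rightarrow> real"
  assumes g: "\<And>x. has_grad k (\<lambda>i. Dk i x) x"
    and B: "\<And>y i. dist x y < d \<Longrightarrow> \<bar>Dk i y - Dk i x\<bar> \<le> B" and h: "norm h < d"
  shows "\<bar>k (x + h) - k x - (\<Sum>i\<in>UNIV. h $ i * Dk i x)\<bar> \<le> norm h * (real CARD('n) * B)"
proof -
  have d: "d > 0"
    using h norm_ge_zero[of h] by linarith
  have "norm (k (x + h) - k x - (\<Sum>i\<in>UNIV. ((x + h) - x) $ i *\<^sub>R Dk i x)) \<le> norm ((x + h) - x) * (real CARD('n) * B)"
  proof (rule differentiable_bound_linearization[where S = "ball x d" and f' = "\<lambda>x h. \<Sum>i\<in>UNIV. h $ i *\<^sub>R Dk i x"])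
    show "x + t *\<^sub>R (x + h - x) \<in> ball x d" if "t \<in> {0..1}" for t
    proof -
      have "\<bar>t\<bar> * norm h \<le> 1 * norm h"
        using that by (intro mult_right_mono) auto
      then show ?thesis
        using h by (simp add: dist_norm)
    qed
    show "(k has_derivative (\<lambda>h. \<Sum>i\<in>UNIV. h $ i *\<^sub>R Dk i y)) (at y within ball x d)" for y
      using g[of y] by (simp add: has_grad_def has_derivative_at_withinI)
    show "onorm ((\<lambda>h. \<Sum>i\<in>UNIV. h $ i *\<^sub>R Dk i y) - (\<lambda>h. \<Sum>i\<in>UNIV. h $ i *\<^sub>R Dk i x)) \<le> real CARD('n) * B"
      if "y \<in> ball x d" for y
    proof (rule onorm_le)
      fix v :: "real^'n"
      have "norm (((\<lambda>h. \<Sum>i\<in>UNIV. h $ i *\<^sub>R Dk i y) - (\<lambda>h. \<Sum>i\<in>UNIV. h $ i *\<^sub>R Dk i x)) v)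
          = \<bar>\<Sum>i\<in>UNIV. v $ i * (Dk i y - Dk i x)\<bar>"
        by (simp add: sum_subtractf right_diff_distrib)
      also have "\<dots> \<le> (\<Sum>i\<in>UNIV. \<bar>v $ i * (Dk i y - Dk i x)\<bar>)"
        by (rule sum_abs)
      also have "\<dots> \<le> (\<Sum>i\<in>(UNIV::'n set). norm v * B)"
        unfolding abs_mult using that B by (intro sum_mono mult_mono component_le_norm_cart) auto
      also have "\<dots> = real CARD('n) * B * norm v"
        by simp
      finally show "norm (((\<lambda>h. \<Sum>i\<in>UNIV. h $ i *\<^sub>R Dk i y) - (\<lambda>h. \<Sum>i\<in>UNIV. h $ i *\<^sub>R Dk i x)) v)
        \<le> real CARD('n) * B * norm v" .
    qed
    show "x \<in> ball x d"
      using d by simp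
  qed
  then show ?thesis
    by simp
qed

text \<open>The first order Taylor error of the kernel is bounded by \<open>|h| * n * B\<close>
  uniformly in the integration variable and supported in a fixed ball where \<open>f\<close> is
  integrable, so the derivative may be taken under the integral.\<close>

lemma has_grad_conv:
  fixes k :: "real^'n \<Rightarrow> real" and f :: "real^'n \<Rightarrow> 'b::euclidean_space"
  assumes f: "loc_sq f" and g: "\<And>x. has_grad k (\<lambda>i. Dk i x) x" and cont: "\<And>i. continuous_on UNIV (Dk i)"
    and supp: "\<And>x. norm x > b \<Longrightarrow> k x = 0"
  shows "has_grad (conv f k) (\<lambda>i. conv f (Dk i) x) x"
proof -
  have ck: "continuous_on UNIV k"
    by (rule has_grad_continuous_on[OF g])
  have supp': "Dk i x = 0" if "norm x > b" for x i
  proof -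
    have "has_grad k (\<lambda>i. 0) x"
      by (rule has_grad_transform[OF has_grad_const, of "- cball 0 b" x 0])
        (use that supp in \<open>auto simp: open_Compl\<close>)
    then show ?thesis
      using has_grad_unique[OF g] by (metis (full_types))
  qed
  have meas: "(\<lambda>y. k (x - y)) \<in> borel_measurable borel" "(\<lambda>y. Dk i (x - y)) \<in> borel_measurable borel" for x i
    by (intro borel_measurable_continuous_onI continuous_on_compose2[OF ck] continuous_on_compose2[OF cont]
        continuous_intros; auto)+
  have lin: "bounded_linear (\<lambda>h :: real^'n. \<Sum>i\<in>UNIV. h $ i *\<^sub>R conv f (Dk i) x)"
    by (intro bounded_linear_sum bounded_linear_scaleR_left[THEN bounded_linear_compose] bounded_linear_vec_nth)
  define n where "n = real CARD('n)"
  have n: "n > 0"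
    by (simp add: n_def)
  have "\<exists>d>0. \<forall>y. norm (y - x) < d \<longrightarrow>
      norm (conv f k y - conv f k x - (\<Sum>i\<in>UNIV. (y - x) $ i *\<^sub>R conv f (Dk i) x)) \<le> e * norm (y - x)"
    if "e > 0" for e
  proof -
    define A where "A = (LINT y:cball x (b + 1)|lborel. norm (f y))"
    have A: "A \<ge> 0"
      unfolding A_def set_lebesgue_integral_def by (rule Bochner_Integration.integral_nonneg) simp
    \<comment> \<open>Chosen such that \<open>n * B * A \<le> e\<close>, including the case
      \<open>A = 0\<close>.\<close>
    define B where "B = e / (n * (A + 1))"
    have B: "B > 0"
      using A n that by (simp add: B_def)
    have "\<forall>i. \<exists>d>0. d \<le> 1 \<and> (\<forall>x y. dist x y < d \<longrightarrow> norm (Dk i x - Dk i y) < B)"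
      using uniformly_continuous_compact_support[OF cont supp' B] by blast
    then obtain d where d: "\<And>i. d i > 0" "\<And>i. d i \<le> 1" "\<And>i x y. dist x y < d i \<Longrightarrow> norm (Dk i x - Dk i y) < B"
      by metis
    define \<delta> where "\<delta> = Min (range d)"
    have \<delta>: "\<delta> > 0" "\<delta> \<le> d i" for i
      using d(1) by (auto simp: \<delta>_def)
    have \<delta>1: "\<delta> \<le> 1"
      using \<delta>(2) d(2) order_trans by blast
    have "norm (conv f k y - conv f k x - (\<Sum>i\<in>UNIV. (y - x) $ i *\<^sub>R conv f (Dk i) x)) \<le> e * norm (y - x)"
      if y: "norm (y - x) < \<delta>" for y
    proof -
      define h where "h = y - x"
      define D where "D t = k (x - t + h) - k (x - t) - (\<Sum>i\<in>UNIV. h $ i * Dk i (x - t))" for t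
      have yx: "y - t = x - t + h" for t
        by (simp add: h_def)
      note ia = conv_integrable[OF f ck supp, where x = y] and ib = conv_integrable[OF f ck supp, where x = x]
      have ic: "integrable lborel (\<lambda>t. \<Sum>i\<in>UNIV. h $ i *\<^sub>R (Dk i (x - t) *\<^sub>R f t))"
        by (intro Bochner_Integration.integrable_sum integrable_scaleR_right conv_integrable[OF f cont supp'])
      have "(LINT t|lborel. (\<Sum>i\<in>UNIV. h $ i *\<^sub>R (Dk i (x - t) *\<^sub>R f t)))
          = (\<Sum>i\<in>UNIV. LINT t|lborel. h $ i *\<^sub>R (Dk i (x - t) *\<^sub>R f t))"
        by (intro Bochner_Integration.integral_sum integrable_scaleR_right conv_integrable[OF f cont supp'])
      then have sum: "(LINT t|lborel. (\<Sum>i\<in>UNIV. h $ i *\<^sub>R (Dk i (x - t) *\<^sub>R f t)))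
          = (\<Sum>i\<in>UNIV. h $ i *\<^sub>R conv f (Dk i) x)"
        by (simp only: integral_scaleR_right conv_def)
      have "conv f k y - conv f k x = (LINT t|lborel. k (y - t) *\<^sub>R f t - k (x - t) *\<^sub>R f t)"
        unfolding conv_def by (rule Bochner_Integration.integral_diff[OF ia ib, symmetric])
      then have "conv f k y - conv f k x - (\<Sum>i\<in>UNIV. h $ i *\<^sub>R conv f (Dk i) x)
        = (LINT t|lborel. k (y - t) *\<^sub>R f t - k (x - t) *\<^sub>R f t)
          - (LINT t|lborel. (\<Sum>i\<in>UNIV. h $ i *\<^sub>R (Dk i (x - t) *\<^sub>R f t)))"
        by (simp only: sum)
      also have "\<dots> = (LINT t|lborel. k (y - t) *\<^sub>R f t - k (x - t) *\<^sub>R f t - (\<Sum>i\<in>UNIV. h $ i *\<^sub>R (Dk i (x - t) *\<^sub>R f t)))"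
        by (rule Bochner_Integration.integral_diff[OF Bochner_Integration.integrable_diff[OF ia ib] ic, symmetric])
      also have "\<dots> = (LINT t|lborel. D t *\<^sub>R f t)"
        unfolding D_def yx by (simp add: scaleR_diff_left scaleR_sum_left)
      finally have eq: "conv f k y - conv f k x - (\<Sum>i\<in>UNIV. h $ i *\<^sub>R conv f (Dk i) x) = (LINT t|lborel. D t *\<^sub>R f t)" .
      have "\<bar>D t\<bar> \<le> norm h * (n * B) * indicator (cball x (b + 1)) t" for t
      proof (cases "t \<in> cball x (b + 1)")
        case True
        have "\<bar>D t\<bar> \<le> norm h * (real CARD('n) * B)"
          unfolding D_def
        proof (rule has_grad_linearization[OF g, where d = \<delta>])
          show "\<bar>Dk i y - Dk i (x - t)\<bar> \<le> B" if "dist (x - t) y < \<delta>" for y i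
            using d(3)[of y "x - t" i] that \<delta>(2)[of i] by (simp add: dist_commute less_imp_le)
          show "norm h < \<delta>"
            using y by (simp add: h_def)
        qed
        then show ?thesis
          using True by (simp add: n_def)
      next
        case False
        then have *: "norm (x - t) > b + 1"
          by (simp add: dist_norm)
        moreover have "norm (x - t) \<le> norm (x - t + h) + norm h"
          using norm_triangle_ineq4[of "x - t + h" h] by simp
        moreover have "norm h < 1"
          using y \<delta>1 by (simp add: h_def)
        ultimately have "norm (x - t) > b" "norm (x - t + h) > b"
          by linarith+
        then show ?thesis
          using False supp supp' by (simp add: D_def)
      qed
      moreover have "D \<in> borel_measurable borel"
        unfolding D_def yx[symmetric] using meas by measurable
      ultimately have "norm (LINT t|lborel. D t *\<^sub>R f t) \<le> norm h * (n * B) * A"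
        unfolding A_def by (rule norm_integral_kernel_le[OF f])
      also have "\<dots> = norm h * (e * (A / (A + 1)))"
      proof -
        have nB: "n * B = e / (A + 1)"
          using n by (simp add: B_def)
        show ?thesis
          unfolding nB by simp
      qed
      also have "\<dots> \<le> norm h * (e * 1)"
        using \<open>e > 0\<close> A by (intro mult_left_mono) auto
      finally show ?thesis
        unfolding eq[symmetric] by (simp add: h_def mult.commute)
    qed
    then show ?thesis
      using \<delta>(1) by blast
  qed
  then show ?thesis
    unfolding has_grad_def has_derivative_within_alt using lin by simp
qed

section \<open>Convergence in L2 and the passage to limits\<close>

text \<open>Measurability and square integrability are part of the notion: the Bochner integral of a
  non-integrable function is 0, and the last clause alone could hold for that reason.\<close>

definition L2_conv :: "'a measure \<Rightarrow> (nat \<Rightarrow> 'a \<Rightarrow> 'b::euclidean_space) \<Rightarrow> ('a \<Rightarrow> 'b) \<Rightarrow> bool" where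
  "L2_conv M f g \<longleftrightarrow> (\<forall>k. f k \<in> borel_measurable M) \<and> g \<in> borel_measurable M \<and>
     (\<forall>k. integrable M (\<lambda>x. (norm (f k x))\<^sup>2)) \<and> integrable M (\<lambda>x. (norm (g x))\<^sup>2) \<and>
     (\<lambda>k. LINT x|M. (norm (f k x - g x))\<^sup>2) \<longlonglongrightarrow> 0"

lemma norm_add_sq_le: "(norm (a + b))\<^sup>2 \<le> 2 * (norm a)\<^sup>2 + 2 * (norm (b :: 'b::real_inner))\<^sup>2"
proof -
  have "(norm (a + b))\<^sup>2 + (norm (a - b))\<^sup>2 = 2 * (norm a)\<^sup>2 + 2 * (norm b)\<^sup>2"
    unfolding power2_norm_eq_inner
    by (simp add: inner_add_left inner_add_right inner_diff_left inner_diff_right inner_commute)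
  then show ?thesis
    using zero_le_power2[of "norm (a - b)"] by linarith
qed

lemma norm_diff_sq_le: "(norm (a - b))\<^sup>2 \<le> 2 * (norm a)\<^sup>2 + 2 * (norm (b :: 'b::real_inner))\<^sup>2"
  using norm_add_sq_le[of a "- b"] by simp

lemma integrable_norm_add_sq:
  fixes f g :: "'a \<Rightarrow> 'b::euclidean_space"
  assumes "f \<in> borel_measurable M" "g \<in> borel_measurable M"
    "integrable M (\<lambda>x. (norm (f x))\<^sup>2)" "integrable M (\<lambda>x. (norm (g x))\<^sup>2)"
  shows "integrable M (\<lambda>x. (norm (f x + g x))\<^sup>2)" "integrable M (\<lambda>x. (norm (f x - g x))\<^sup>2)"
proof -
  have I: "integrable M (\<lambda>x. 2 * (norm (f x))\<^sup>2 + 2 * (norm (g x))\<^sup>2)"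
    using assms by (intro Bochner_Integration.integrable_add integrable_mult_right)
  show "integrable M (\<lambda>x. (norm (f x + g x))\<^sup>2)" "integrable M (\<lambda>x. (norm (f x - g x))\<^sup>2)"
    by (rule Bochner_Integration.integrable_bound[OF I];
        use assms norm_add_sq_le norm_diff_sq_le in \<open>auto intro!: AE_I2\<close>)+
qed

lemma L2_convD:
  assumes "L2_conv M f g"
  shows "f k \<in> borel_measurable M" "g \<in> borel_measurable M"
    "integrable M (\<lambda>x. (norm (f k x))\<^sup>2)" "integrable M (\<lambda>x. (norm (g x))\<^sup>2)"
    "integrable M (\<lambda>x. (norm (f k x - g x))\<^sup>2)"
    "(\<lambda>k. LINT x|M. (norm (f k x - g x))\<^sup>2) \<longlonglongrightarrow> 0"
  using assms by (auto simp: L2_conv_def intro: integrable_norm_add_sq)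

lemma L2_conv_add:
  assumes f: "L2_conv M f f'" and g: "L2_conv M g g'"
  shows "L2_conv M (\<lambda>k x. f k x + g k x) (\<lambda>x. f' x + g' x)"
proof -
  have lim: "(\<lambda>k. LINT x|M. (norm ((f k x + g k x) - (f' x + g' x)))\<^sup>2) \<longlonglongrightarrow> 0"
  proof (rule tendsto_sandwich[OF _ _ tendsto_const])
    have "(\<lambda>k. 2 * (LINT x|M. (norm (f k x - f' x))\<^sup>2) + 2 * (LINT x|M. (norm (g k x - g' x))\<^sup>2))
        \<longlonglongrightarrow> 2 * 0 + 2 * 0"
      by (intro tendsto_intros L2_convD(6)[OF f] L2_convD(6)[OF g])
    then show "(\<lambda>k. 2 * (LINT x|M. (norm (f k x - f' x))\<^sup>2) + 2 * (LINT x|M. (norm (g k x - g' x))\<^sup>2)) \<longlonglongrightarrow> 0"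
      by simp
    have "(LINT x|M. (norm ((f k x + g k x) - (f' x + g' x)))\<^sup>2)
        \<le> (LINT x|M. 2 * (norm (f k x - f' x))\<^sup>2 + 2 * (norm (g k x - g' x))\<^sup>2)" for k
    proof (rule integral_mono')
      show "integrable M (\<lambda>x. 2 * (norm (f k x - f' x))\<^sup>2 + 2 * (norm (g k x - g' x))\<^sup>2)"
        by (intro Bochner_Integration.integrable_add integrable_mult_right L2_convD(5)[OF f] L2_convD(5)[OF g])
      show "(norm ((f k x + g k x) - (f' x + g' x)))\<^sup>2 \<le> 2 * (norm (f k x - f' x))\<^sup>2 + 2 * (norm (g k x - g' x))\<^sup>2" for x
        using norm_add_sq_le[of "f k x - f' x" "g k x - g' x"] by (simp add: algebra_simps)
    qed auto
    then show "\<forall>\<^sub>F k in sequentially. (LINT x|M. (norm ((f k x + g k x) - (f' x + g' x)))\<^sup>2)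
        \<le> 2 * (LINT x|M. (norm (f k x - f' x))\<^sup>2) + 2 * (LINT x|M. (norm (g k x - g' x))\<^sup>2)"
      by (simp add: L2_convD(5)[OF f] L2_convD(5)[OF g])
  qed (auto intro!: Bochner_Integration.integral_nonneg)
  then show ?thesis
    using L2_convD(1-4)[OF f] L2_convD(1-4)[OF g]
    by (auto simp: L2_conv_def intro!: integrable_norm_add_sq)
qed

lemma L2_conv_sum:
  assumes "\<And>i. i \<in> I \<Longrightarrow> L2_conv M (f i) (f' i)"
  shows "L2_conv M (\<lambda>k x. \<Sum>i\<in>I. f i k x) (\<lambda>x. \<Sum>i\<in>I. f' i x)"
  using assms
proof (induction I rule: infinite_finite_induct)
  case (insert i I)
  then show ?case
    by (simp add: L2_conv_add)
qed (auto simp: L2_conv_def)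

text \<open>Common form of multiplication by bounded functions and by complex constants; linearity
  enters through differences, as convergence is a statement about differences.\<close>

lemma L2_conv_bounded_op:
  fixes T :: "'a \<Rightarrow> 'b::euclidean_space \<Rightarrow> 'c::euclidean_space"
  assumes f: "L2_conv M f f'" and lin: "\<And>x v w. T x v - T x w = T x (v - w)"
    and C: "\<And>x v. x \<in> space M \<Longrightarrow> norm (T x v) \<le> C * norm v"
    and meas: "\<And>h. h \<in> borel_measurable M \<Longrightarrow> (\<lambda>x. T x (h x)) \<in> borel_measurable M"
  shows "L2_conv M (\<lambda>k x. T x (f k x)) (\<lambda>x. T x (f' x))"
proof -
  have C2: "(norm (T x v))\<^sup>2 \<le> C\<^sup>2 * (norm v)\<^sup>2" if "x \<in> space M" for x v
    using power_mono[OF C[OF that], of v 2] by (simp add: power_mult_distrib)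
  have int: "integrable M (\<lambda>x. (norm (T x (h x)))\<^sup>2)"
    if "h \<in> borel_measurable M" "integrable M (\<lambda>x. (norm (h x))\<^sup>2)" for h
    by (rule Bochner_Integration.integrable_bound[OF integrable_mult_right[OF that(2), of "C\<^sup>2"]])
      (use C2 meas[OF that(1)] in \<open>auto intro!: AE_I2\<close>)
  have "(\<lambda>k. LINT x|M. (norm (T x (f k x) - T x (f' x)))\<^sup>2) \<longlonglongrightarrow> 0"
  proof (rule tendsto_sandwich[OF _ _ tendsto_const])
    show "(\<lambda>k. C\<^sup>2 * (LINT x|M. (norm (f k x - f' x))\<^sup>2)) \<longlonglongrightarrow> 0"
      using tendsto_mult_left[OF L2_convD(6)[OF f], of "C\<^sup>2"] by simp
    have "(LINT x|M. (norm (T x (f k x) - T x (f' x)))\<^sup>2) \<le> (LINT x|M. C\<^sup>2 * (norm (f k x - f' x))\<^sup>2)" for k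
      using C2 by (intro integral_mono' integrable_mult_right L2_convD(5)[OF f]) (auto simp: lin)
    then show "\<forall>\<^sub>F k in sequentially. (LINT x|M. (norm (T x (f k x) - T x (f' x)))\<^sup>2)
        \<le> C\<^sup>2 * (LINT x|M. (norm (f k x - f' x))\<^sup>2)"
      by simp
  qed (auto intro!: Bochner_Integration.integral_nonneg)
  then show ?thesis
    using L2_convD(1-4)[OF f] by (auto simp: L2_conv_def intro!: int meas)
qed

lemma L2_conv_scaleR:
  assumes "L2_conv M f f'" "g \<in> borel_measurable M" "\<And>x. x \<in> space M \<Longrightarrow> \<bar>g x\<bar> \<le> C"
  shows "L2_conv M (\<lambda>k x. g x *\<^sub>R f k x) (\<lambda>x. g x *\<^sub>R f' x)"
  by (rule L2_conv_bounded_op[OF assms(1), where C = C])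
    (use assms in \<open>auto simp: scaleR_diff_right intro!: mult_right_mono\<close>)

lemma L2_conv_cmult:
  fixes f :: "nat \<Rightarrow> 'a \<Rightarrow> complex"
  assumes "L2_conv M f f'"
  shows "L2_conv M (\<lambda>k x. c * f k x) (\<lambda>x. c * f' x)"
  by (rule L2_conv_bounded_op[OF assms, where C = "norm c"])
    (auto simp: norm_mult right_diff_distrib)

text \<open>Young's inequality with a parameter that tends to zero along with the error takes the
  place of the Cauchy-Schwarz inequality for integrals.\<close>

lemma L2_conv_norm:
  assumes "L2_conv M f g"
  shows "(\<lambda>k. LINT x|M. (norm (f k x))\<^sup>2) \<longlonglongrightarrow> (LINT x|M. (norm (g x))\<^sup>2)"
proof -
  note f = L2_convD[OF assms]
  define A where "A = (LINT x|M. (norm (g x))\<^sup>2)"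
  define N where "N k = (LINT x|M. (norm (f k x - g x))\<^sup>2)" for k
  \<comment> \<open>The Young parameter. The summand \<open>1 / real (Suc k)\<close> keeps it
    positive when the error \<open>N k\<close> vanishes, and \<open>d k \<ge> sqrt (N k)\<close>
    keeps \<open>N k / d k\<close> small.\<close>
  define d where "d k = sqrt (N k) + 1 / real (Suc k)" for k
  have N0: "N k \<ge> 0" for k
    by (simp add: N_def Bochner_Integration.integral_nonneg)
  have d: "d k > 0" "N k / d k \<le> sqrt (N k)" for k
  proof -
    show dk: "d k > 0"
      using N0[of k] by (simp add: d_def add_nonneg_pos)
    have "N k = sqrt (N k) * sqrt (N k)"
      using N0[of k] by simp
    also have "\<dots> \<le> sqrt (N k) * d k"
      using N0[of k] by (intro mult_left_mono) (auto simp: d_def)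
    finally show "N k / d k \<le> sqrt (N k)"
      using dk by (simp add: field_simps)
  qed
  have pt: "\<bar>(norm a)\<^sup>2 - (norm b)\<^sup>2\<bar> \<le> (norm (a - b))\<^sup>2 + e * (norm b)\<^sup>2 + (norm (a - b))\<^sup>2 / e"
    if "e > 0" for a b :: 'b and e
  proof -
    have "(norm a)\<^sup>2 - (norm b)\<^sup>2 = (norm (a - b))\<^sup>2 + 2 * (b \<bullet> (a - b))"
      unfolding power2_norm_eq_inner by (simp add: inner_diff_left inner_diff_right inner_commute)
    moreover have "\<bar>2 * (b \<bullet> (a - b))\<bar> \<le> 2 * (norm b * norm (a - b))"
      using Cauchy_Schwarz_ineq2[of b "a - b"] by simp
    moreover have "2 * (norm b * norm (a - b)) \<le> e * (norm b)\<^sup>2 + (norm (a - b))\<^sup>2 / e"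
    proof -
      have "0 \<le> (e * norm b - norm (a - b))\<^sup>2 / e"
        using that by simp
      then show ?thesis
        using that by (simp add: power2_eq_square field_simps)
    qed
    ultimately show ?thesis
      using zero_le_power2[of "norm (a - b)"] by linarith
  qed
  have bound: "\<bar>(LINT x|M. (norm (f k x))\<^sup>2) - A\<bar> \<le> N k + d k * A + sqrt (N k)" for k
  proof -
    have "(LINT x|M. (norm (f k x))\<^sup>2) - A = (LINT x|M. (norm (f k x))\<^sup>2 - (norm (g x))\<^sup>2)"
      unfolding A_def using f by simp
    also have "\<bar>\<dots>\<bar> \<le> (LINT x|M. \<bar>(norm (f k x))\<^sup>2 - (norm (g x))\<^sup>2\<bar>)"
      by (rule integral_abs_bound)
    also have "\<dots> \<le> (LINT x|M. (norm (f k x - g x))\<^sup>2 + d k * (norm (g x))\<^sup>2 + (norm (f k x - g x))\<^sup>2 / d k)"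
      using f pt[OF d(1)] by (intro integral_mono) auto
    also have "\<dots> = N k + d k * A + N k / d k"
      using f by (simp add: N_def A_def)
    also have "\<dots> \<le> N k + d k * A + sqrt (N k)"
      using d(2) by simp
    finally show ?thesis .
  qed
  have N: "N \<longlonglongrightarrow> 0"
    using f(6) by (simp add: N_def[abs_def])
  have inv: "(\<lambda>k. 1 / real (Suc k)) \<longlonglongrightarrow> 0"
    using LIMSEQ_inverse_real_of_nat by (simp add: inverse_eq_divide)
  have "(\<lambda>k. N k + d k * A + sqrt (N k)) \<longlonglongrightarrow> 0 + (sqrt 0 + 0) * A + sqrt 0"
    unfolding d_def by (intro tendsto_intros N inv)
  then have lim: "(\<lambda>k. N k + d k * A + sqrt (N k)) \<longlonglongrightarrow> 0"
    by simp
  have "(\<lambda>k. \<bar>(LINT x|M. (norm (f k x))\<^sup>2) - A\<bar>) \<longlonglongrightarrow> 0"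
  proof (rule tendsto_sandwich[OF _ _ tendsto_const lim])
    show "\<forall>\<^sub>F k in sequentially. \<bar>(LINT x|M. (norm (f k x))\<^sup>2) - A\<bar> \<le> N k + d k * A + sqrt (N k)"
      using bound by (rule always_eventually[OF allI])
  qed simp
  then have "(\<lambda>k. (LINT x|M. (norm (f k x))\<^sup>2) - A) \<longlonglongrightarrow> 0"
    by (simp only: tendsto_rabs_zero_iff)
  then show ?thesis
    unfolding A_def by (rule LIM_zero_cancel)
qed

lemma L2_conv_weighted_norm:
  assumes f: "L2_conv M f g" and w: "w \<in> borel_measurable M" "\<And>x. x \<in> space M \<Longrightarrow> 0 \<le> w x"
    "\<And>x. x \<in> space M \<Longrightarrow> w x \<le> C"
  shows "(\<lambda>k. LINT x|M. w x * (norm (f k x))\<^sup>2) \<longlonglongrightarrow> (LINT x|M. w x * (norm (g x))\<^sup>2)"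
    and "integrable M (\<lambda>x. w x * (norm (g x))\<^sup>2)"
    and "integrable M (\<lambda>x. w x * (norm (f k x))\<^sup>2)"
proof -
  have *: "L2_conv M (\<lambda>k x. sqrt (w x) *\<^sub>R f k x) (\<lambda>x. sqrt (w x) *\<^sub>R g x)"
    by (rule L2_conv_scaleR[OF f, where C = "sqrt C"]) (use w in auto)
  have **: "(norm (sqrt (w x) *\<^sub>R v))\<^sup>2 = w x * (norm v)\<^sup>2" if "x \<in> space M" for x and v :: 'b
    using w(2)[OF that] by (simp add: power_mult_distrib)
  have e: "(LINT x|M. (norm (sqrt (w x) *\<^sub>R h x))\<^sup>2) = (LINT x|M. w x * (norm (h x))\<^sup>2)"
    and i: "integrable M (\<lambda>x. (norm (sqrt (w x) *\<^sub>R h x))\<^sup>2) \<longleftrightarrow> integrable M (\<lambda>x. w x * (norm (h x))\<^sup>2)"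
    for h :: "'a \<Rightarrow> 'b"
    by (rule Bochner_Integration.integral_cong[OF refl **] Bochner_Integration.integrable_cong[OF refl **]; assumption)+
  show "(\<lambda>k. LINT x|M. w x * (norm (f k x))\<^sup>2) \<longlonglongrightarrow> (LINT x|M. w x * (norm (g x))\<^sup>2)"
    using L2_conv_norm[OF *] by (simp only: e)
  show "integrable M (\<lambda>x. w x * (norm (g x))\<^sup>2)"
    using L2_convD(4)[OF *] by (simp only: i)
  show "integrable M (\<lambda>x. w x * (norm (f k x))\<^sup>2)"
    using L2_convD(3)[OF *] by (simp only: i)
qed

lemma inner_polarization: "a \<bullet> b = ((norm (a + b))\<^sup>2 - (norm a)\<^sup>2 - (norm b)\<^sup>2) / 2"
  unfolding power2_norm_eq_inner by (simp add: inner_add_left inner_add_right inner_commute)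

text \<open>Polarisation reduces the pairing to three squared norms. The weight is put into one of
  the factors, so it may change sign.\<close>

lemma L2_conv_inner:
  assumes f: "L2_conv M f f'" and g: "L2_conv M g g'"
    and w: "w \<in> borel_measurable M" "\<And>x. x \<in> space M \<Longrightarrow> \<bar>w x\<bar> \<le> C"
  shows "(\<lambda>k. LINT x|M. w x * (f k x \<bullet> g k x)) \<longlonglongrightarrow> (LINT x|M. w x * (f' x \<bullet> g' x))"
    and "integrable M (\<lambda>x. w x * (f' x \<bullet> g' x))"
    and "integrable M (\<lambda>x. w x * (f k x \<bullet> g k x))"
proof -
  have wf: "L2_conv M (\<lambda>k x. w x *\<^sub>R f k x) (\<lambda>x. w x *\<^sub>R f' x)"
    by (rule L2_conv_scaleR[OF f w])
  note s = L2_conv_add[OF wf g]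
  have *: "w x * (a \<bullet> b) = ((norm (w x *\<^sub>R a + b))\<^sup>2 - (norm (w x *\<^sub>R a))\<^sup>2 - (norm b)\<^sup>2) / 2" for x and a b :: 'b
    using inner_polarization[of "w x *\<^sub>R a" b] by simp
  show "integrable M (\<lambda>x. w x * (f' x \<bullet> g' x))"
    unfolding * using L2_convD(4)[OF s] L2_convD(4)[OF wf] L2_convD(4)[OF g] by auto
  show "integrable M (\<lambda>x. w x * (f k x \<bullet> g k x))"
    unfolding * using L2_convD(3)[OF s, of k] L2_convD(3)[OF wf, of k] L2_convD(3)[OF g, of k] by auto
  have "(\<lambda>k. ((LINT x|M. (norm (w x *\<^sub>R f k x + g k x))\<^sup>2) - (LINT x|M. (norm (w x *\<^sub>R f k x))\<^sup>2) - (LINT x|M. (norm (g k x))\<^sup>2)) / 2)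
    \<longlonglongrightarrow> ((LINT x|M. (norm (w x *\<^sub>R f' x + g' x))\<^sup>2) - (LINT x|M. (norm (w x *\<^sub>R f' x))\<^sup>2) - (LINT x|M. (norm (g' x))\<^sup>2)) / 2"
    by (intro tendsto_intros L2_conv_norm s wf g) auto
  then show "(\<lambda>k. LINT x|M. w x * (f k x \<bullet> g k x)) \<longlonglongrightarrow> (LINT x|M. w x * (f' x \<bullet> g' x))"
    unfolding * using L2_convD(3,4)[OF s] L2_convD(3,4)[OF wf] L2_convD(3,4)[OF g]
    by (simp del: norm_scaleR)
qed

lemma loc_sq_continuous:
  fixes f :: "'a::euclidean_space \<Rightarrow> 'b::euclidean_space"
  assumes "continuous_on UNIV f"
  shows "loc_sq f"
  unfolding loc_sq_def
proof (intro conjI allI impI)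
  show "f \<in> borel_measurable borel"
    using assms by (rule borel_measurable_continuous_onI)
  fix K :: "'a set"
  assume "compact K"
  then show "set_integrable lborel K (\<lambda>x. (norm (f x))\<^sup>2)"
    unfolding set_integrable_def using assms continuous_on_subset
    by (intro borel_integrable_compact continuous_intros) blast+
qed

lemma loc_sq_diff:
  fixes f g :: "'a::euclidean_space \<Rightarrow> 'b::euclidean_space"
  assumes "loc_sq f" "loc_sq g"
  shows "loc_sq (\<lambda>x. f x - g x)"
proof -
  have "set_integrable lborel K (\<lambda>x. (norm (f x - g x))\<^sup>2)" if K: "compact K" for K
  proof -
    have *: "set_integrable lborel K h \<longleftrightarrow> integrable (restrict_space lborel K) h" for h :: "'a \<Rightarrow> real"
      unfolding set_integrable_def
      by (subst integrable_restrict_space) (use K in \<open>auto simp: compact_imp_closed\<close>)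
    have "set_integrable lborel K (\<lambda>x. (norm (f x))\<^sup>2)" "set_integrable lborel K (\<lambda>x. (norm (g x))\<^sup>2)"
      using assms K by (auto simp: loc_sq_def)
    then show ?thesis
      using assms unfolding * 
      by (intro integrable_norm_add_sq) (auto simp: loc_sq_def intro: measurable_restrict_space1)
  qed
  then show ?thesis
    using assms by (auto simp: loc_sq_def)
qed

section \<open>Mollifiers and convergence of mollifications\<close>

text \<open>A mollifier of radius \<open>e\<close>. Evenness allows \<open>k (x - y)\<close> to be
  read as a probability density in either variable.\<close>

definition kernel :: "real \<Rightarrow> ('a::euclidean_space \<Rightarrow> real) \<Rightarrow> bool" where
  "kernel e k \<longleftrightarrow> continuous_on UNIV k \<and> (\<forall>x. 0 \<le> k x) \<and> (\<forall>x. k (- x) = k x) \<and>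
     (\<forall>x. norm x > e \<longrightarrow> k x = 0) \<and> (LINT x|lborel. k x) = 1"

lemma kernelD:
  assumes "kernel e k"
  shows "continuous_on UNIV k" "0 \<le> k x" "k (x - y) = k (y - x)" "norm x > e \<Longrightarrow> k x = 0"
    "k \<in> borel_measurable borel" "integrable lborel k" "(LINT x|lborel. k x) = 1"
    "integrable lborel (\<lambda>y. k (x - y))" "(LINT y|lborel. k (x - y)) = 1"
    "(LINT y|lborel. k (y - x)) = 1"
proof -
  show c: "continuous_on UNIV k" "0 \<le> k x" "norm x > e \<Longrightarrow> k x = 0" "(LINT x|lborel. k x) = 1"
    using assms by (auto simp: kernel_def)
  show sym: "k (x - y) = k (y - x)" for x y
    using assms unfolding kernel_def by (metis minus_diff_eq)
  show m: "k \<in> borel_measurable borel"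
    using c(1) by (rule borel_measurable_continuous_onI)
  \<comment> \<open>A non-integrable function has Bochner integral 0, so total mass 1 forces
    integrability.\<close>
  show "integrable lborel k"
    using c(4) not_integrable_integral_eq by fastforce
  show 1: "(LINT y|lborel. k (y - x)) = 1" for x
    using lborel_integral_shift[OF m, of "- x"] c(4) by simp
  show 2: "(LINT y|lborel. k (x - y)) = 1"
    using 1[of x] by (simp add: sym[of x])
  show "integrable lborel (\<lambda>y. k (x - y))"
    using 2 not_integrable_integral_eq by fastforce
qed

text \<open>Jensen's inequality for the density \<open>k (x - y)\<close>, obtained from the
  nonnegative variance of \<open>norm (f y)\<close> about its mean \<open>a\<close>.\<close>

lemma conv_sq_le:
  assumes f: "loc_sq f" and k: "kernel e k"
  shows "integrable lborel (\<lambda>y. k (x - y) * (norm (f y))\<^sup>2)"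
    "(norm (conv f k x))\<^sup>2 \<le> (LINT y|lborel. k (x - y) * (norm (f y))\<^sup>2)"
proof -
  note k' = kernelD[OF k]
  have kc: "continuous_on UNIV (\<lambda>y. k (x - y))"
    by (intro continuous_on_compose2[OF k'(1)] continuous_intros) auto
  have supp: "y \<notin> cball x e \<Longrightarrow> k (x - y) = 0" for y
    using k'(4) by (rule shifted_support)
  have fm: "f \<in> borel_measurable borel"
    using f by (simp add: loc_sq_def)
  show i2: "integrable lborel (\<lambda>y. k (x - y) * (norm (f y))\<^sup>2)"
    using integrable_continuous_times[of "\<lambda>y. (norm (f y))\<^sup>2" "cball x e" "\<lambda>y. k (x - y)", OF _ _ kc compact_cball supp]
      f fm by (simp add: loc_sq_def)
  have i1: "integrable lborel (\<lambda>y. k (x - y) * norm (f y))"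
    using integrable_continuous_times[of "\<lambda>y. norm (f y)" "cball x e" "\<lambda>y. k (x - y)", OF _ _ kc compact_cball supp]
      loc_sq_loc_integrable[OF f] fm by simp
  define a where "a = (LINT y|lborel. k (x - y) * norm (f y))"
  have "0 \<le> (LINT y|lborel. k (x - y) * (norm (f y) - a)\<^sup>2)"
    using k'(2) by (intro Bochner_Integration.integral_nonneg) simp
  also have "\<dots> = (LINT y|lborel. k (x - y) * (norm (f y))\<^sup>2 - 2 * a * (k (x - y) * norm (f y)) + a\<^sup>2 * k (x - y))"
    by (rule Bochner_Integration.integral_cong) (auto simp: power2_diff algebra_simps)
  also have "\<dots> = (LINT y|lborel. k (x - y) * (norm (f y))\<^sup>2) - 2 * a * a + a\<^sup>2 * 1"
    using i1 i2 k'(8,9) by (simp add: a_def)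
  finally have "a\<^sup>2 \<le> (LINT y|lborel. k (x - y) * (norm (f y))\<^sup>2)"
    by (simp add: power2_eq_square)
  moreover have "norm (conv f k x) \<le> a"
  proof -
    have "norm (conv f k x) \<le> (LINT y|lborel. norm (k (x - y) *\<^sub>R f y))"
      unfolding conv_def by (rule integral_norm_bound)
    then show ?thesis
      using k'(2) by (simp add: a_def)
  qed
  ultimately show "(norm (conv f k x))\<^sup>2 \<le> (LINT y|lborel. k (x - y) * (norm (f y))\<^sup>2)"
    using power_mono[of "norm (conv f k x)" a 2] by simp
qed

text \<open>Jensen's inequality at each point, then Tonelli and total mass 1 in the other variable.
  The ball grows by 1 because the radius of the mollifier is at most 1.\<close>

lemma conv_L2_bound:
  fixes f :: "'a::euclidean_space \<Rightarrow> 'b::euclidean_space"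
  assumes f: "loc_sq f" and k: "kernel e k" "e \<le> 1" and S: "compact S" "S \<subseteq> cball 0 b"
  shows "(LINT x:S|lborel. (norm (conv f k x))\<^sup>2) \<le> (LINT y:cball 0 (b + 1)|lborel. (norm (f y))\<^sup>2)"
proof -
  note k' = kernelD[OF k(1)]
  have fm [measurable]: "f \<in> borel_measurable borel"
    using f by (simp add: loc_sq_def)
  note [measurable] = k'(5)
  have cc: "continuous_on UNIV (conv f k)"
    by (rule continuous_on_conv[OF f k'(1,4)])
  have Sm [measurable]: "S \<in> sets borel"
    using S(1) by (simp add: compact_imp_closed)
  have I1: "set_integrable lborel S (\<lambda>x. (norm (conv f k x))\<^sup>2)"
    using loc_sq_continuous[OF cc] S(1) by (simp add: loc_sq_def)
  have I2: "set_integrable lborel (cball 0 (b + 1)) (\<lambda>y. (norm (f y))\<^sup>2)"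
    using f by (simp add: loc_sq_def)
  have "ennreal (LINT x:S|lborel. (norm (conv f k x))\<^sup>2) = (\<integral>\<^sup>+x. ennreal (indicator S x * (norm (conv f k x))\<^sup>2) \<partial>lborel)"
    using I1 unfolding set_lebesgue_integral_def set_integrable_def
    by (subst nn_integral_eq_integral) (auto intro!: AE_I2)
  also have "\<dots> \<le> (\<integral>\<^sup>+x. (\<integral>\<^sup>+y. ennreal (indicator S x * (k (x - y) * (norm (f y))\<^sup>2)) \<partial>lborel) \<partial>lborel)"
  proof (rule nn_integral_mono)
    fix x
    have "(\<integral>\<^sup>+y. ennreal (indicator S x * (k (x - y) * (norm (f y))\<^sup>2)) \<partial>lborel)
        = ennreal (indicator S x * (LINT y|lborel. k (x - y) * (norm (f y))\<^sup>2))"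
      using conv_sq_le(1)[OF f k(1)] k'(2)
      by (subst nn_integral_eq_integral) (auto intro!: AE_I2)
    then show "ennreal (indicator S x * (norm (conv f k x))\<^sup>2)
        \<le> (\<integral>\<^sup>+y. ennreal (indicator S x * (k (x - y) * (norm (f y))\<^sup>2)) \<partial>lborel)"
      using conv_sq_le(2)[OF f k(1), of x] by (auto intro!: ennreal_leI mult_left_mono)
  qed
  also have "\<dots> = (\<integral>\<^sup>+y. (\<integral>\<^sup>+x. ennreal (indicator S x * (k (x - y) * (norm (f y))\<^sup>2)) \<partial>lborel) \<partial>lborel)"
    by (rule lborel_pair.Fubini'[symmetric]) measurable
  also have "\<dots> \<le> (\<integral>\<^sup>+y. ennreal (indicator (cball 0 (b + 1)) y * (norm (f y))\<^sup>2) \<partial>lborel)"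
  proof (rule nn_integral_mono)
    fix y
    have "(\<integral>\<^sup>+x. ennreal (indicator S x * (k (x - y) * (norm (f y))\<^sup>2)) \<partial>lborel)
       \<le> (\<integral>\<^sup>+x. ennreal (indicator (cball 0 (b + 1)) y * (norm (f y))\<^sup>2 * k (y - x)) \<partial>lborel)"
    proof (intro nn_integral_mono ennreal_leI)
      fix x
      show "indicator S x * (k (x - y) * (norm (f y))\<^sup>2) \<le> indicator (cball 0 (b + 1)) y * (norm (f y))\<^sup>2 * k (y - x)"
      proof (cases "x \<in> S \<and> norm (x - y) \<le> e")
        case True
        then have "norm x \<le> b" "norm (x - y) \<le> 1"
          using S(2) k(2) by auto
        then have "norm y \<le> b + 1"
          using norm_triangle_sub[of y x] by (simp add: norm_minus_commute)
        then show ?thesis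
          using True k'(3)[of x y] by (simp add: mult_ac)
      next
        case False
        then have *: "indicator S x * (k (x - y) * (norm (f y))\<^sup>2) = 0"
          using k'(4)[of "x - y"] by (auto simp: indicator_def)
        show ?thesis
          unfolding * using k'(2)[of "y - x"] by simp
      qed
    qed
    also have "\<dots> = ennreal (indicator (cball 0 (b + 1)) y * (norm (f y))\<^sup>2)"
      using k'(8)[of y] k'(9)[of y] k'(2) by (subst nn_integral_eq_integral) (auto intro!: AE_I2)
    finally show "(\<integral>\<^sup>+x. ennreal (indicator S x * (k (x - y) * (norm (f y))\<^sup>2)) \<partial>lborel)
        \<le> ennreal (indicator (cball 0 (b + 1)) y * (norm (f y))\<^sup>2)" .
  qed
  also have "\<dots> = ennreal (LINT y:cball 0 (b + 1)|lborel. (norm (f y))\<^sup>2)"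
    using I2 unfolding set_lebesgue_integral_def set_integrable_def
    by (subst nn_integral_eq_integral) (auto intro!: AE_I2)
  finally show ?thesis
    by (subst (asm) ennreal_le_iff) (auto simp: set_lebesgue_integral_def intro!: Bochner_Integration.integral_nonneg)
qed

text \<open>Dominated convergence is applied twice: to truncations of \<open>f\<close>, and to an
  almost everywhere approximation of \<open>f\<close> by continuous functions to which the same
  truncation is applied, so that a constant dominates.\<close>

lemma continuous_dense_L2:
  fixes f :: "'a::euclidean_space \<Rightarrow> 'b::euclidean_space"
  assumes f: "loc_sq f" and S: "compact S" and "\<delta> > 0"
  shows "\<exists>g. continuous_on UNIV g \<and> (LINT x:S|lborel. (norm (f x - g x))\<^sup>2) < \<delta>"
proof -
  have fm [measurable]: "f \<in> borel_measurable borel" and fi: "set_integrable lborel S (\<lambda>x. (norm (f x))\<^sup>2)"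
    using f S by (auto simp: loc_sq_def)
  have Sm [measurable]: "S \<in> sets borel"
    using S by (simp add: compact_imp_closed)
  \<comment> \<open>The radial retraction onto the ball of radius \<open>m\<close>; the maximum in
    the denominator makes it continuous and equal to the identity on that ball.\<close>
  define T where "T m v = (m / max m (norm v)) *\<^sub>R v" for m :: real and v :: 'b
  have T1: "norm (T m v) \<le> m" "norm (v - T m v) \<le> norm v" if "m > 0" for m v
  proof -
    have "m * norm v \<le> m * max m (norm v)"
      using that by (intro mult_left_mono) auto
    then show "norm (T m v) \<le> m"
      using that by (simp add: T_def divide_le_eq)
    have "v - T m v = (1 - m / max m (norm v)) *\<^sub>R v"
      by (simp add: T_def scaleR_diff_left)
    moreover have "0 \<le> 1 - m / max m (norm v)" "1 - m / max m (norm v) \<le> 1"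
      using that by auto
    ultimately show "norm (v - T m v) \<le> norm v"
      by (simp add: mult_left_le_one_le)
  qed
  have T2: "T m v = v" if "m > 0" "norm v \<le> m" for m v
    using that by (simp add: T_def max_absorb1)
  have Tc: "continuous_on UNIV (T m)" if "m > 0" for m
    unfolding T_def using that by (intro continuous_intros) (auto simp: max_def)
  have Tm [measurable]: "T m \<in> borel_measurable borel" if "m > 0" for m
    using Tc[OF that] by (rule borel_measurable_continuous_onI)
  have lim1: "(\<lambda>j. LINT x|lborel. indicator S x * (norm (f x - T (real (Suc j)) (f x)))\<^sup>2) \<longlonglongrightarrow> (LINT x|(lborel :: 'a measure). 0 :: real)"
  proof (rule integral_dominated_convergence)
    show "integrable lborel (\<lambda>x. indicator S x * (norm (f x))\<^sup>2)"
      using fi by (simp add: set_integrable_def)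
    show "(\<lambda>x. indicator S x * (norm (f x - T (real (Suc j)) (f x)))\<^sup>2) \<in> borel_measurable lborel" for j
      using measurable_compose[OF fm Tm[of "real (Suc j)"]] by simp
    have "(\<lambda>j. indicator S x * (norm (f x - T (real (Suc j)) (f x)))\<^sup>2) \<longlonglongrightarrow> 0" for x
    proof (rule tendsto_eventually)
      obtain m :: nat where "norm (f x) \<le> real m"
        using real_arch_simple by blast
      then have "T (real (Suc j)) (f x) = f x" if "j \<ge> m" for j
        using that by (intro T2) auto
      then show "\<forall>\<^sub>F j in sequentially. indicator S x * (norm (f x - T (real (Suc j)) (f x)))\<^sup>2 = (0::real)"
        by (auto intro!: eventually_sequentiallyI[of m])
    qed
    then show "AE x in lborel. (\<lambda>j. indicator S x * (norm (f x - T (real (Suc j)) (f x)))\<^sup>2) \<longlonglongrightarrow> 0"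
      by simp
    show "AE x in lborel. norm (indicator S x * (norm (f x - T (real (Suc j)) (f x)))\<^sup>2) \<le> indicator S x * (norm (f x))\<^sup>2" for j
      using T1(2)[of "real (Suc j)"] by (auto intro!: AE_I2 mult_left_mono power_mono)
  qed auto
  then have "\<forall>\<^sub>F j in sequentially. (LINT x|lborel. indicator S x * (norm (f x - T (real (Suc j)) (f x)))\<^sup>2) < \<delta> / 4"
    using \<open>\<delta> > 0\<close> by (intro order_tendstoD(2)) auto
  then obtain j where j: "(LINT x|lborel. indicator S x * (norm (f x - T (real (Suc j)) (f x)))\<^sup>2) < \<delta> / 4"
    by (auto simp: eventually_sequentially)
  define m where "m = real (Suc j)"
  have m: "m > 0"
    by (simp add: m_def)
  have "f \<in> borel_measurable lebesgue"
    using fm by (simp add: measurable_completion)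
  \<comment> \<open>Measurability in this sense means being an almost everywhere limit of continuous
    functions, the source of the approximants \<open>g\<close>.\<close>
  then have "f measurable_on UNIV"
    by (intro lebesgue_measurable_imp_measurable_on) auto
  then obtain N g where N: "negligible N" and g: "\<And>i. continuous_on UNIV (g i)"
      and lim: "\<And>x. x \<notin> N \<Longrightarrow> (\<lambda>i. g i x) \<longlonglongrightarrow> f x"
    unfolding measurable_on_def by auto
  have aeN: "AE x in lborel. x \<notin> N"
  proof -
    have "AE x in lebesgue. x \<notin> N"
      using N by (simp add: AE_not_in negligible_iff_null_sets)
    then show ?thesis
      by (simp add: AE_completion_iff)
  qed
  have gm [measurable]: "g i \<in> borel_measurable borel" for i
    using g by (rule borel_measurable_continuous_onI)
  have lim2: "(\<lambda>i. LINT x|lborel. indicator S x * (norm (T m (f x) - T m (g i x)))\<^sup>2) \<longlonglongrightarrow> (LINT x|(lborel :: 'a measure). 0 :: real)"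
  proof (rule integral_dominated_convergence)
    show "integrable lborel (\<lambda>x. indicator S x * (2 * m)\<^sup>2)"
      using borel_integrable_compact[OF S, of "\<lambda>x. (2 * m)\<^sup>2"] by simp
    show "(\<lambda>x. indicator S x * (norm (T m (f x) - T m (g i x)))\<^sup>2) \<in> borel_measurable lborel" for i
      using measurable_compose[OF fm Tm[OF m]] measurable_compose[OF gm Tm[OF m]] by simp
    show "AE x in lborel. (\<lambda>i. indicator S x * (norm (T m (f x) - T m (g i x)))\<^sup>2) \<longlonglongrightarrow> 0"
      using aeN
    proof eventually_elim
      case (elim x)
      have "(\<lambda>i. T m (g i x)) \<longlonglongrightarrow> T m (f x)"
        using Tc[OF m] lim[OF elim] by (rule continuous_on_tendsto_compose) auto
      then have "(\<lambda>i. indicator S x * (norm (T m (f x) - T m (g i x)))\<^sup>2) \<longlonglongrightarrow> indicator S x * (norm (T m (f x) - T m (f x)))\<^sup>2"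
        by (intro tendsto_intros)
      then show ?case
        by simp
    qed
    show "AE x in lborel. norm (indicator S x * (norm (T m (f x) - T m (g i x)))\<^sup>2) \<le> indicator S x * (2 * m)\<^sup>2" for i
    proof (intro AE_I2)
      fix x
      have "norm (T m (f x) - T m (g i x)) \<le> 2 * m"
        using norm_triangle_ineq4[of "T m (f x)" "T m (g i x)"] T1(1)[OF m, of "f x"] T1(1)[OF m, of "g i x"] by linarith
      then have "(norm (T m (f x) - T m (g i x)))\<^sup>2 \<le> (2 * m)\<^sup>2"
        by (intro power_mono) auto
      then show "norm (indicator S x * (norm (T m (f x) - T m (g i x)))\<^sup>2) \<le> indicator S x * (2 * m)\<^sup>2"
        by (auto simp: indicator_def)
    qed
  qed auto
  then have "\<forall>\<^sub>F i in sequentially. (LINT x|lborel. indicator S x * (norm (T m (f x) - T m (g i x)))\<^sup>2) < \<delta> / 4"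
    using \<open>\<delta> > 0\<close> by (intro order_tendstoD(2)) auto
  then obtain i where i: "(LINT x|lborel. indicator S x * (norm (T m (f x) - T m (g i x)))\<^sup>2) < \<delta> / 4"
    by (auto simp: eventually_sequentially)
  have c: "continuous_on UNIV (\<lambda>x. T m (g i x))"
    by (rule continuous_on_compose2[OF Tc[OF m] g]) auto
  have Tfm: "(\<lambda>x. T m (f x)) \<in> borel_measurable borel"
    using measurable_compose[OF fm Tm[OF m]] .
  have int: "integrable lborel (\<lambda>x. indicator S x * (norm (f x - T m (f x)))\<^sup>2)"
    using fi unfolding set_integrable_def
    by (rule Bochner_Integration.integrable_bound)
      (use Tfm T1(2)[OF m] in \<open>auto intro!: AE_I2 mult_left_mono power_mono\<close>)
  have int2: "integrable lborel (\<lambda>x. indicator S x * (norm (T m (f x) - T m (g i x)))\<^sup>2)"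
  proof -
    have "set_integrable lborel S (\<lambda>x. (norm (T m (f x) - T m (g i x)))\<^sup>2)"
    proof -
      have "loc_sq (\<lambda>x. T m (f x))"
        unfolding loc_sq_def
      proof (intro conjI Tfm allI impI)
        fix K :: "'a set"
        assume K: "compact K"
        have "set_integrable lborel K (\<lambda>x. (m)\<^sup>2)"
          unfolding set_integrable_def using borel_integrable_compact[OF K, of "\<lambda>x. m\<^sup>2"] by simp
        then show "set_integrable lborel K (\<lambda>x. (norm (T m (f x)))\<^sup>2)"
          unfolding set_integrable_def
          by (rule Bochner_Integration.integrable_bound)
            (use Tfm K T1(1)[OF m] in \<open>auto intro!: AE_I2 mult_left_mono power_mono simp: compact_imp_closed\<close>)
      qed
      from loc_sq_diff[OF this loc_sq_continuous[OF c]] show ?thesis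
        using S by (simp add: loc_sq_def)
    qed
    then show ?thesis
      by (simp add: set_integrable_def)
  qed
  have "(LINT x:S|lborel. (norm (f x - T m (g i x)))\<^sup>2)
      \<le> (LINT x|lborel. 2 * (indicator S x * (norm (f x - T m (f x)))\<^sup>2) + 2 * (indicator S x * (norm (T m (f x) - T m (g i x)))\<^sup>2))"
    unfolding set_lebesgue_integral_def
  proof (rule integral_mono')
    fix x
    show "indicator S x *\<^sub>R (norm (f x - T m (g i x)))\<^sup>2
      \<le> 2 * (indicator S x * (norm (f x - T m (f x)))\<^sup>2) + 2 * (indicator S x * (norm (T m (f x) - T m (g i x)))\<^sup>2)"
      using norm_add_sq_le[of "f x - T m (f x)" "T m (f x) - T m (g i x)"] by (auto simp: indicator_def)
  qed (use int int2 in auto)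
  also have "\<dots> < \<delta>"
    using int int2 i j \<open>\<delta> > 0\<close> by (simp add: m_def)
  finally show ?thesis
    using c by blast
qed

text \<open>For a continuous \<open>g\<close> close to \<open>f\<close> the error splits into
  \<open>conv (f - g)\<close>, \<open>conv g - g\<close> and \<open>g - f\<close>. The first is
  small uniformly in the kernel by the L2 bound, the second by uniform continuity, the third by
  density.\<close>

lemma mollification_L2:
  fixes f :: "'a::euclidean_space \<Rightarrow> 'b::euclidean_space"
  assumes f: "loc_sq f" and k: "\<And>j. kernel (e j) (k j)" and e: "\<And>j. e j \<le> 1" "e \<longlonglongrightarrow> 0" and S: "compact S"
  shows "L2_conv (restrict_space lborel S) (\<lambda>j. conv f (k j)) f"
proof -
  have Sm [measurable]: "S \<in> sets borel"
    using S by (simp add: compact_imp_closed)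
  have restr: "integrable (restrict_space lborel S) h \<longleftrightarrow> set_integrable lborel S h"
    "(LINT x|restrict_space lborel S. h x) = (LINT x:S|lborel. h x)" for h :: "'a \<Rightarrow> real"
    by (auto simp: integrable_restrict_space integral_restrict_space set_integrable_def set_lebesgue_integral_def)
  have kc: "loc_sq (conv f (k j))" for j
    using continuous_on_conv[OF f kernelD(1,4)[OF k]] by (rule loc_sq_continuous)
  obtain b where b: "b > 0" "S \<subseteq> cball 0 b"
    using bounded_subset_ballD[OF compact_imp_bounded[OF S], of 0] ball_subset_cball by blast
  define V where "V = measure lborel S"
  have "(\<lambda>j. LINT x:S|lborel. (norm (conv f (k j) x - f x))\<^sup>2) \<longlonglongrightarrow> 0"
  proof (rule order_tendstoI)
    fix \<delta> :: real
    assume "\<delta> > 0"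
    then obtain g where g: "continuous_on UNIV g"
        and fg: "(LINT x:cball 0 (b + 1)|lborel. (norm (f x - g x))\<^sup>2) < \<delta> / 12"
      using continuous_dense_L2[OF f compact_cball, of "\<delta> / 12" 0 "b + 1"] by auto
    have gl: "loc_sq g"
      using g by (rule loc_sq_continuous)
    define \<eta> where "\<eta> = sqrt (\<delta> / (16 * (V + 1)))"
    have V0: "V \<ge> 0"
      by (simp add: V_def)
    have \<eta>: "\<eta> > 0" "\<eta>\<^sup>2 = \<delta> / (16 * (V + 1))"
      using \<open>\<delta> > 0\<close> V0 by (auto simp: \<eta>_def)
    have "uniformly_continuous_on (cball 0 (b + 1)) g"
      using g continuous_on_subset by (intro compact_uniformly_continuous) auto
    then obtain d where d: "d > 0" "\<And>x y. x \<in> cball 0 (b + 1) \<Longrightarrow> y \<in> cball 0 (b + 1) \<Longrightarrow> dist y x < d \<Longrightarrow> dist (g y) (g x) < \<eta>"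
      unfolding uniformly_continuous_on_def using \<eta>(1) by metis
    have "\<forall>\<^sub>F j in sequentially. e j < d"
      using order_tendstoD(2)[OF e(2) d(1)] .
    then show "\<forall>\<^sub>F j in sequentially. (LINT x:S|lborel. (norm (conv f (k j) x - f x))\<^sup>2) < \<delta>"
    proof eventually_elim
      case (elim j)
      note kj = kernelD[OF k[of j]]
      have unif: "norm (conv g (k j) x - g x) \<le> \<eta>" if "x \<in> S" for x
      proof -
        have ig: "integrable lborel (\<lambda>y. k j (x - y) *\<^sub>R g y)"
          by (rule conv_integrable[OF gl kj(1,4)])
        have ic: "integrable lborel (\<lambda>y. k j (x - y) *\<^sub>R g x)"
          using kj(8) by simp
        have "conv g (k j) x - g x = (LINT y|lborel. k j (x - y) *\<^sub>R g y) - (LINT y|lborel. k j (x - y) *\<^sub>R g x)"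
          using kj(8,9) by (simp add: conv_def)
        also have "\<dots> = (LINT y|lborel. k j (x - y) *\<^sub>R g y - k j (x - y) *\<^sub>R g x)"
          by (rule Bochner_Integration.integral_diff[OF ig ic, symmetric])
        finally have "norm (conv g (k j) x - g x) \<le> (LINT y|lborel. norm (k j (x - y) *\<^sub>R g y - k j (x - y) *\<^sub>R g x))"
          by (simp only: integral_norm_bound)
        also have "\<dots> \<le> (LINT y|lborel. k j (x - y) * \<eta>)"
        proof (rule integral_mono)
          show "integrable lborel (\<lambda>y. norm (k j (x - y) *\<^sub>R g y - k j (x - y) *\<^sub>R g x))"
            using ig ic by (intro integrable_norm Bochner_Integration.integrable_diff)
          show "integrable lborel (\<lambda>y. k j (x - y) * \<eta>)"
            using kj(8) by simp
          fix y
          have "norm (k j (x - y) *\<^sub>R g y - k j (x - y) *\<^sub>R g x) = k j (x - y) * norm (g y - g x)"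
            using kj(2) by (simp add: scaleR_diff_right[symmetric])
          also have "\<dots> \<le> k j (x - y) * \<eta>"
          proof (cases "norm (x - y) > e j")
            case False
            then have "dist y x < d" "norm (x - y) \<le> 1"
              using elim e(1)[of j] by (auto simp: dist_norm norm_minus_commute)
            moreover have "norm x \<le> b"
              using \<open>x \<in> S\<close> b by auto
            ultimately have "norm (g y - g x) \<le> \<eta>"
              using d(2)[of x y] norm_triangle_sub[of y x] by (auto simp: dist_norm norm_minus_commute less_imp_le)
            then show ?thesis
              using kj(2) by (intro mult_left_mono)
          qed (use kj(4) in simp)
          finally show "norm (k j (x - y) *\<^sub>R g y - k j (x - y) *\<^sub>R g x) \<le> k j (x - y) * \<eta>" .
        qed
        also have "\<dots> = \<eta>"
          using kj(9) by simp
        finally show ?thesis .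
      qed
      have lin: "conv (\<lambda>y. f y - g y) (k j) x = conv f (k j) x - conv g (k j) x" for x
        unfolding conv_def scaleR_diff_right
        by (rule Bochner_Integration.integral_diff[OF conv_integrable[OF f kj(1,4), where x = x]
              conv_integrable[OF gl kj(1,4), where x = x]])
      have fgl: "loc_sq (\<lambda>y. f y - g y)"
        by (rule loc_sq_diff[OF f gl])
      have cl: "loc_sq (conv (\<lambda>y. f y - g y) (k j))"
        using continuous_on_conv[OF fgl kj(1,4)] by (rule loc_sq_continuous)
      have i1: "set_integrable lborel S (\<lambda>x. (norm (conv (\<lambda>y. f y - g y) (k j) x))\<^sup>2)"
        and i2: "set_integrable lborel S (\<lambda>x. (norm (f x - g x))\<^sup>2)"
        and i2': "set_integrable lborel (cball 0 (b + 1)) (\<lambda>x. (norm (f x - g x))\<^sup>2)"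
        using cl fgl S by (auto simp: loc_sq_def)
      have i3: "set_integrable lborel S (\<lambda>x. \<eta>\<^sup>2)"
        unfolding set_integrable_def using borel_integrable_compact[OF S, of "\<lambda>x. \<eta>\<^sup>2"] by simp
      have "(LINT x:S|lborel. (norm (conv f (k j) x - f x))\<^sup>2)
        \<le> (LINT x:S|lborel. 2 * (norm (conv (\<lambda>y. f y - g y) (k j) x))\<^sup>2 + (4 * \<eta>\<^sup>2 + 4 * (norm (f x - g x))\<^sup>2))"
      proof (rule set_integral_mono)
        show "set_integrable lborel S (\<lambda>x. (norm (conv f (k j) x - f x))\<^sup>2)"
          using loc_sq_diff[OF kc f] S by (simp add: loc_sq_def)
        show "set_integrable lborel S (\<lambda>x. 2 * (norm (conv (\<lambda>y. f y - g y) (k j) x))\<^sup>2 + (4 * \<eta>\<^sup>2 + 4 * (norm (f x - g x))\<^sup>2))"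
          using i1 i2 i3 by (intro set_integral_add) auto
        fix x
        assume "x \<in> S"
        have "(norm (conv f (k j) x - f x))\<^sup>2 = (norm (conv (\<lambda>y. f y - g y) (k j) x + ((conv g (k j) x - g x) + (g x - f x))))\<^sup>2"
          by (simp add: lin)
        also have "\<dots> \<le> 2 * (norm (conv (\<lambda>y. f y - g y) (k j) x))\<^sup>2 + 2 * (norm ((conv g (k j) x - g x) + (g x - f x)))\<^sup>2"
          by (rule norm_add_sq_le)
        also have "(norm ((conv g (k j) x - g x) + (g x - f x)))\<^sup>2 \<le> 2 * (norm (conv g (k j) x - g x))\<^sup>2 + 2 * (norm (g x - f x))\<^sup>2"
          by (rule norm_add_sq_le)
        also have "(norm (conv g (k j) x - g x))\<^sup>2 \<le> \<eta>\<^sup>2"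
          using unif[OF \<open>x \<in> S\<close>] by (intro power_mono) auto
        finally show "(norm (conv f (k j) x - f x))\<^sup>2
          \<le> 2 * (norm (conv (\<lambda>y. f y - g y) (k j) x))\<^sup>2 + (4 * \<eta>\<^sup>2 + 4 * (norm (f x - g x))\<^sup>2)"
          by (simp add: norm_minus_commute)
      qed
      also have "\<dots> = 2 * (LINT x:S|lborel. (norm (conv (\<lambda>y. f y - g y) (k j) x))\<^sup>2)
          + (4 * (LINT x:S|lborel. \<eta>\<^sup>2) + 4 * (LINT x:S|lborel. (norm (f x - g x))\<^sup>2))"
      proof -
        have j: "set_integrable lborel S (\<lambda>x. 2 * (norm (conv (\<lambda>y. f y - g y) (k j) x))\<^sup>2)"
          "set_integrable lborel S (\<lambda>x. 4 * \<eta>\<^sup>2)" "set_integrable lborel S (\<lambda>x. 4 * (norm (f x - g x))\<^sup>2)"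
          using i1 i2 i3 by (auto intro: set_integrable_mult_right)
        show ?thesis
          by (simp only: set_integral_add(2)[OF j(1) set_integral_add(1)[OF j(2,3)]] set_integral_add(2)[OF j(2,3)]
              set_integral_mult_right)
      qed
      \<comment> \<open>In total \<open>2/12 + 4/12 + 4/16\<close>, that is, three quarters of
        \<delta>; the choice of \<eta> makes \<open>V * \<eta>^2\<close> at most
        \<delta>/16.\<close>
      also have "\<dots> \<le> 2 * (\<delta> / 12) + (4 * (V * \<eta>\<^sup>2) + 4 * (\<delta> / 12))"
      proof -
        have "(LINT x:S|lborel. (norm (conv (\<lambda>y. f y - g y) (k j) x))\<^sup>2) \<le> \<delta> / 12"
          using conv_L2_bound[OF fgl k[of j] e(1) S b(2)] fg by simp
        moreover have "(LINT x:S|lborel. (norm (f x - g x))\<^sup>2) \<le> \<delta> / 12"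
        proof -
          have "(LINT x:S|lborel. (norm (f x - g x))\<^sup>2) \<le> (LINT x:cball 0 (b + 1)|lborel. (norm (f x - g x))\<^sup>2)"
            using i2 i2' b(2) unfolding set_lebesgue_integral_def set_integrable_def
            by (intro integral_mono) (auto simp: indicator_def)
          then show ?thesis
            using fg by simp
        qed
        moreover have "(LINT x:S|lborel. \<eta>\<^sup>2) = V * \<eta>\<^sup>2"
          unfolding set_lebesgue_integral_def V_def
          using S by (simp add: emeasure_compact_finite)
        ultimately show ?thesis
          by simp
      qed
      also have "\<dots> < \<delta>"
      proof -
        have "V * \<eta>\<^sup>2 \<le> \<delta> / 16"
          unfolding \<eta>(2) using V0 \<open>\<delta> > 0\<close> by (simp add: field_simps)
        then show ?thesis
          using \<open>\<delta> > 0\<close> by simp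
      qed
      finally show ?case .
    qed
  next
    fix \<delta> :: real
    assume "\<delta> < 0"
    moreover have "0 \<le> (LINT x:S|lborel. (norm (conv f (k j) x - f x))\<^sup>2)" for j
      unfolding set_lebesgue_integral_def by (rule Bochner_Integration.integral_nonneg) simp
    ultimately show "\<forall>\<^sub>F j in sequentially. \<delta> < (LINT x:S|lborel. (norm (conv f (k j) x - f x))\<^sup>2)"
      using less_le_trans by (intro always_eventually allI) blast
  qed
  then show ?thesis
    using f kc S unfolding L2_conv_def restr loc_sq_def
    by (auto intro: measurable_restrict_space1)
qed

section \<open>Weak solutions as limits of smooth functions\<close>

text \<open>If the integral were zero, the closed set of zeros of \<open>f\<close> would have full
  measure and hence be the whole space.\<close>

lemma integral_pos_continuous:
  fixes f :: "'a::euclidean_space \<Rightarrow> real"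
  assumes "continuous_on UNIV f" "\<And>x. 0 \<le> f x" "integrable lborel f" "f a > 0"
  shows "(LINT x|lborel. f x) > 0"
proof -
  have "(LINT x|lborel. f x) \<noteq> 0"
  proof
    assume "(LINT x|lborel. f x) = 0"
    then have "AE x in lborel. f x = 0"
      using assms by (subst (asm) integral_nonneg_eq_0_iff_AE) auto
    then have "AE x in lebesgue. x \<in> {x. f x = 0}"
      by (simp add: AE_completion)
    moreover have "closed {x. f x = 0}"
      using assms(1) by (intro closed_Collect_eq continuous_on_const) auto
    ultimately have "a \<in> {x. f x = 0}"
      using mem_closed_if_AE_lebesgue by blast
    then show False
      using assms(4) by simp
  qed
  moreover have "(LINT x|lborel. f x) \<ge> 0"
    using assms(2) by (intro Bochner_Integration.integral_nonneg) auto
  ultimately show ?thesis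
    by simp
qed

lemma continuous_on_flat_exp: "continuous_on UNIV (flat_exp j)"
  using DERIV_isCont[OF DERIV_flat_exp] by (simp add: continuous_at_imp_continuous_on)

lemma has_grad_flat_exp:
  fixes c :: "real^'n"
  shows "has_grad (\<lambda>x. flat_exp j (b - (norm (x - c))\<^sup>2))
    (\<lambda>i. (flat_exp (j + 2) (b - (norm (x - c))\<^sup>2) - real j * flat_exp (j + 1) (b - (norm (x - c))\<^sup>2))
       * (- 2 * (x $ i - c $ i))) x"
proof -
  have "has_grad (\<lambda>x. b - (norm (x - c))\<^sup>2) (\<lambda>i. 0 - 2 * (x $ i - c $ i)) x"
    by (intro has_grad_diff has_grad_const has_grad_norm_sq)
  then show ?thesis
    using has_grad_field[OF DERIV_flat_exp, of "\<lambda>x. b - (norm (x - c))\<^sup>2"] by simp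
qed

text \<open>The kernel is a normalised \<open>flat_exp 0 (e^2 - |x|^2)\<close>. It is needed with
  explicit second derivatives, for differentiating convolutions, and as a test function in
  \<open>y\<close>, for insertion into the weak equation.\<close>

lemma mollifier_exists:
  assumes "e > 0"
  obtains k :: "real^'n \<Rightarrow> real" and Dk D2k where
    "kernel e k" "C2_on UNIV k Dk D2k"
    "\<And>x. test_function (\<lambda>y. complex_of_real (k (x - y)))"
proof -
  define g where "g j x = flat_exp j (e\<^sup>2 - (norm (x :: real^'n))\<^sup>2)" for j x
  have gc: "continuous_on UNIV (g j)" for j
    unfolding g_def by (intro continuous_on_compose2[OF continuous_on_flat_exp] continuous_intros) auto
  have supp: "g j x = 0" if "norm x > e" for j x
    using power_strict_mono[OF that, of 2] assms by (simp add: g_def flat_exp_def)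
  have gi: "integrable lborel (g j)" for j
    by (rule integrable_compact_support[OF gc compact_cball[of 0 e]]) (use supp in auto)
  define c where "c = (LINT x|lborel. g 0 x)"
  have c: "c > 0"
    unfolding c_def using assms
    by (intro integral_pos_continuous[where a = 0] gc gi) (auto simp: g_def flat_exp_nonneg flat_exp_def)
  define k where "k x = 1 / c * g 0 x" for x
  define Dk where "Dk i x = 1 / c * (- 2 * x $ i * g 2 x)" for i x
  define D2k where "D2k i j x = 1 / c * (- 2 * x $ i * ((g 4 x - 2 * g 3 x) * (- 2 * x $ j)) + (if j = i then - 2 else 0) * g 2 x)"
    for i j x
  have gg: "has_grad (g j) (\<lambda>i. (g (j + 2) x - real j * g (j + 1) x) * (- 2 * x $ i)) x" for j x
    using has_grad_flat_exp[of j "e\<^sup>2" 0 x] by (simp add: g_def[abs_def])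
  have gn: "has_grad (\<lambda>x. x $ i) (\<lambda>j. if j = i then 1 else 0) x" for i and x :: "real^'n"
    using has_grad_nth[of i 0 x] by simp
  have "kernel e k"
    unfolding kernel_def
  proof (intro conjI allI impI)
    show "continuous_on UNIV k"
      unfolding k_def by (intro continuous_intros gc)
    show "0 \<le> k x" "k (- x) = k x" for x
      using c by (auto simp: k_def g_def flat_exp_nonneg)
    show "norm x > e \<Longrightarrow> k x = 0" for x
      by (simp add: k_def supp)
    show "(LINT x|lborel. k x) = 1"
      using c by (simp add: k_def c_def)
  qed
  moreover have "C2_on UNIV k Dk D2k"
    unfolding C2_on_def
  proof (intro conjI ballI allI)
    fix x i j
    have "has_grad k (\<lambda>i. 1 / c * ((g 2 x - 0 * g 1 x) * (- 2 * x $ i)) + 0 * g 0 x) x"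
      unfolding k_def[abs_def] using gg[of 0 x] by (intro has_grad_mult has_grad_const) (simp add: numeral_2_eq_2)
    then show "has_grad k (\<lambda>i. Dk i x) x"
      by (rule has_grad_cong) (simp add: Dk_def)
    have g2: "has_grad (g 2) (\<lambda>i. (g 4 x - 2 * g 3 x) * (- 2 * x $ i)) x"
      using gg[of 2 x] by (simp add: numeral_eq_Suc)
    have "has_grad (Dk i) (\<lambda>j. 1 / c * ((- 2 * x $ i) * ((g 4 x - 2 * g 3 x) * (- 2 * x $ j))
        + (- 2 * (if j = i then 1 else 0) + 0 * x $ i) * g 2 x) + 0 * (- 2 * x $ i * g 2 x)) x"
      unfolding Dk_def[abs_def] by (intro has_grad_mult has_grad_const gn g2)
    then show "has_grad (Dk i) (\<lambda>j. D2k i j x) x"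
      by (rule has_grad_cong) (simp add: D2k_def)
    show "D2k i j x = D2k j i x"
      by (simp add: D2k_def)
  next
    fix i j
    show "continuous_on UNIV (D2k i j)"
      unfolding D2k_def[abs_def] by (intro continuous_intros gc) 
  qed
  moreover have "test_function (\<lambda>y. complex_of_real (k (x - y)))" for x
    unfolding test_function_def
  proof (intro conjI allI)
    fix m
    show "C_k m (\<lambda>y. complex_of_real (k (x - y)))"
      using C_k_flat_exp[OF real_polynomial_function.intros(2)[of "1 / c"], of m 0 "e\<^sup>2" x]
      by (simp add: k_def g_def mult.commute)
    have "{y. complex_of_real (k (x - y)) \<noteq> 0} \<subseteq> cball x e"
      using supp by (auto simp: k_def dist_norm not_less[symmetric])
    then have "closure {y. complex_of_real (k (x - y)) \<noteq> 0} \<subseteq> cball x e"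
      by (rule closure_minimal) simp
    then show "compact (closure {y. complex_of_real (k (x - y)) \<noteq> 0})"
      using compact_Int_closed[OF compact_cball[of x e] closed_closure, of "{y. complex_of_real (k (x - y)) \<noteq> 0}"]
      by (simp add: Int_absorb1)
  qed
  ultimately show ?thesis
    using that by blast
qed

text \<open>Encodes that \<open>v\<close> is locally in the domain of the Laplacian, with gradient \<open>G\<close> and Laplacian \<open>F\<close>.\<close>

definition H2_approx :: "(real^'n \<Rightarrow> complex) \<Rightarrow> ('n \<Rightarrow> real^'n \<Rightarrow> complex) \<Rightarrow> (real^'n \<Rightarrow> complex) \<Rightarrow> bool" where
  "H2_approx v G F \<longleftrightarrow> (\<exists>U DU D2U. (\<forall>k. C2_on UNIV (U k) (DU k) (D2U k)) \<and>
     (\<forall>S. compact S \<longrightarrow> L2_conv (restrict_space lborel S) U v \<and>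
        (\<forall>i. L2_conv (restrict_space lborel S) (\<lambda>k. DU k i) (G i)) \<and>
        L2_conv (restrict_space lborel S) (\<lambda>k x. \<Sum>i\<in>UNIV. D2U k i i x) F))"

text \<open>Derivatives of \<open>conv v k\<close> fall on the kernel, which is a test function in
  the integration variable. Then \<open>weak1\<close> turns the gradient into
  \<open>conv (G i) k\<close> and \<open>weak2\<close> turns the Laplacian into
  \<open>conv F k\<close>, and all of these converge locally in L2.\<close>

lemma H2_approx_of_weak:
  fixes v F :: "real^'n \<Rightarrow> complex" and G :: "'n \<Rightarrow> real^'n \<Rightarrow> complex"
  assumes v: "loc_sq v" and G: "\<And>i. loc_sq (G i)" and F: "loc_sq F"
    and weak1: "\<And>\<kappa> D\<kappa> K i. test_function (\<lambda>y. complex_of_real (\<kappa> y)) \<Longrightarrow> (\<And>y. has_grad \<kappa> (\<lambda>i. D\<kappa> i y) y) \<Longrightarrow>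
        (\<And>i. continuous_on UNIV (D\<kappa> i)) \<Longrightarrow> compact K \<Longrightarrow> (\<And>y i. y \<notin> K \<Longrightarrow> \<kappa> y = 0 \<and> D\<kappa> i y = 0) \<Longrightarrow>
        (LINT y|lborel. D\<kappa> i y *\<^sub>R v y) = - (LINT y|lborel. \<kappa> y *\<^sub>R G i y)"
    and weak2: "\<And>\<kappa> D\<kappa> K. test_function (\<lambda>y. complex_of_real (\<kappa> y)) \<Longrightarrow> (\<And>y. has_grad \<kappa> (\<lambda>i. D\<kappa> i y) y) \<Longrightarrow>
        (\<And>i. continuous_on UNIV (D\<kappa> i)) \<Longrightarrow> compact K \<Longrightarrow> (\<And>y i. y \<notin> K \<Longrightarrow> \<kappa> y = 0 \<and> D\<kappa> i y = 0) \<Longrightarrow>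
        (LINT y|lborel. (\<Sum>i\<in>UNIV. D\<kappa> i y *\<^sub>R G i y)) = - (LINT y|lborel. \<kappa> y *\<^sub>R F y)"
  shows "H2_approx v G F"
proof -
  define e where "e j = 1 / real (Suc j)" for j
  have e: "e j > 0" "e j \<le> 1" for j
    by (auto simp: e_def)
  have e0: "e \<longlonglongrightarrow> 0"
    using LIMSEQ_inverse_real_of_nat by (simp add: e_def[abs_def] inverse_eq_divide)
  have "\<forall>j. \<exists>k Dk D2k. kernel (e j) (k :: real^'n \<Rightarrow> real) \<and> C2_on UNIV k Dk D2k \<and>
      (\<forall>x. test_function (\<lambda>y. complex_of_real (k (x - y))))"
    by (intro allI, rule mollifier_exists[OF e(1)]) blast
  then obtain k Dk D2k where k: "\<And>j. kernel (e j) (k j :: real^'n \<Rightarrow> real)"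
    and C2: "\<And>j. C2_on UNIV (k j) (Dk j) (D2k j)"
    and test: "\<And>j x. test_function (\<lambda>y. complex_of_real (k j (x - y)))"
    by metis
  note kc = C2_on_continuous[OF C2]
  have z: "k j x = 0" "Dk j i x = 0" "D2k j i l x = 0" if "norm x > e j" for j i l x
    using C2_on_zero[OF C2 open_UNIV compact_cball[of 0 "e j"], where x = x] kernelD(4)[OF k] that by auto
  \<comment> \<open>The gradient of \<open>k j (x - y)\<close> in \<open>y\<close>, whence the minus
    sign.\<close>
  define D where "D j x i y = - Dk j i (x - y)" for j x i y
  have kD: "has_grad (\<lambda>y. k j (x - y)) (\<lambda>i. D j x i y) y" for j x y
  proof -
    have a: "((\<lambda>y. x - y) has_derivative (\<lambda>h. - h)) (at y)"
      by (auto intro!: derivative_eq_intros)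
    have b: "(k j has_derivative (\<lambda>h. \<Sum>i\<in>UNIV. h $ i *\<^sub>R Dk j i (x - y))) (at (x - y))"
      using C2_onD(1)[OF C2, of "x - y" j] by (simp add: has_grad_def)
    have "((\<lambda>y. k j (x - y)) has_derivative (\<lambda>h. \<Sum>i\<in>UNIV. (- h) $ i *\<^sub>R Dk j i (x - y))) (at y)"
      by (rule has_derivative_compose[OF a b])
    then show ?thesis
      by (simp add: has_grad_def D_def sum_negf)
  qed
  have Dc: "continuous_on UNIV (D j x i)" for j x i
    unfolding D_def[abs_def] by (intro continuous_intros continuous_on_compose2[OF kc(2)]) auto
  have supp: "k j (x - y) = 0 \<and> D j x i y = 0" if "y \<notin> cball x (e j)" for j x i y
    using z(1,2)[of j "x - y"] that by (simp add: D_def dist_norm)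
  define U where "U j = conv v (k j)" for j
  define DU where "DU j i = conv v (Dk j i)" for j i
  define D2U where "D2U j i l = conv v (D2k j i l)" for j i l
  have U: "C2_on UNIV (U j) (DU j) (D2U j)" for j
    unfolding C2_on_def
  proof (intro conjI ballI allI)
    fix x i l
    show "has_grad (U j) (\<lambda>i. DU j i x) x"
      unfolding U_def DU_def
      by (rule has_grad_conv[OF v _ kc(2) z(1)]) (use C2_onD(1)[OF C2] in auto)
    show "has_grad (DU j i) (\<lambda>l. D2U j i l x) x"
      unfolding DU_def D2U_def
      by (rule has_grad_conv[OF v _ kc(3) z(2)]) (use C2_onD(2)[OF C2] in auto)
    show "D2U j i l x = D2U j l i x"
      unfolding D2U_def conv_def using C2_onD(3)[OF C2] by simp
  next
    fix i l
    show "continuous_on UNIV (D2U j i l)"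
      unfolding D2U_def by (rule continuous_on_conv[OF v kc(3) z(3)])
  qed
  have DU: "DU j i = conv (G i) (k j)" for j i
  proof
    fix x
    have "(LINT y|lborel. D j x i y *\<^sub>R v y) = - (LINT y|lborel. k j (x - y) *\<^sub>R G i y)"
      by (rule weak1[OF test kD Dc compact_cball supp])
    then show "DU j i x = conv (G i) (k j) x"
      by (simp add: DU_def conv_def D_def)
  qed
  \<comment> \<open>Differentiating the gradient in its form \<open>conv (G i) (k j)\<close> leaves
    a single derivative on the kernel, as \<open>weak2\<close> requires; uniqueness of gradients
    identifies the result with the second derivative.\<close>
  have D2U: "D2U j i l x = conv (G i) (Dk j l) x" for j i l x
  proof -
    have "has_grad (DU j i) (\<lambda>l. conv (G i) (Dk j l) x) x"
      unfolding DU by (rule has_grad_conv[OF G _ kc(2) z(1)]) (use C2_onD(1)[OF C2] in auto)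
    from has_grad_unique[OF this C2_onD(2)[OF U UNIV_I]] show ?thesis
      by metis
  qed
  have Lap: "(\<Sum>i\<in>UNIV. D2U j i i x) = conv F (k j) x" for j x
  proof -
    have "(LINT y|lborel. (\<Sum>i\<in>UNIV. D j x i y *\<^sub>R G i y)) = (\<Sum>i\<in>UNIV. (LINT y|lborel. D j x i y *\<^sub>R G i y))"
      by (intro Bochner_Integration.integral_sum integrable_kernel_times[OF G Dc compact_cball[of x "e j"]])
        (use supp in auto)
    also have "\<dots> = - (\<Sum>i\<in>UNIV. conv (G i) (Dk j i) x)"
      by (simp add: D_def conv_def sum_negf)
    finally have "(\<Sum>i\<in>UNIV. conv (G i) (Dk j i) x) = - (LINT y|lborel. (\<Sum>i\<in>UNIV. D j x i y *\<^sub>R G i y))"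
      by simp
    also have "\<dots> = (LINT y|lborel. k j (x - y) *\<^sub>R F y)"
      using weak2[OF test kD Dc compact_cball supp] by simp
    finally show ?thesis
      by (simp add: D2U conv_def)
  qed
  show ?thesis
    unfolding H2_approx_def
  proof (intro exI conjI allI impI)
    show "C2_on UNIV (U j) (DU j) (D2U j)" for j
      by (rule U)
    fix S :: "(real^'n) set"
    assume S: "compact S"
    show "L2_conv (restrict_space lborel S) U v"
      unfolding U_def[abs_def] by (rule mollification_L2[OF v k e(2) e0 S])
    show "L2_conv (restrict_space lborel S) (\<lambda>j. DU j i) (G i)" for i
      unfolding DU by (rule mollification_L2[OF G k e(2) e0 S])
    show "L2_conv (restrict_space lborel S) (\<lambda>j x. \<Sum>i\<in>UNIV. D2U j i i x) F"
      unfolding Lap using mollification_L2[OF F k e(2) e0 S] by simp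
  qed
qed

section \<open>Borel representatives of weak solutions\<close>

lemma lebesgue_ex_borel_complex:
  fixes f :: "'a::euclidean_space \<Rightarrow> complex"
  assumes "f \<in> borel_measurable lebesgue"
  obtains g where "g \<in> borel_measurable borel" "AE x in lborel. f x = g x"
proof -
  have "(\<lambda>x. Re (f x)) \<in> borel_measurable lebesgue" "(\<lambda>x. Im (f x)) \<in> borel_measurable lebesgue"
    using assms by measurable
  then obtain r s where rs: "r \<in> borel_measurable lborel" "AE x in lborel. Re (f x) = r x"
      "s \<in> borel_measurable lborel" "AE x in lborel. Im (f x) = s x"
    using completion_ex_borel_measurable_real by metis
  have "AE x in lborel. f x = complex_of_real (r x) + \<i> * complex_of_real (s x)"
    using rs(2,4) by eventually_elim (simp add: complex_eq_iff)
  moreover have "(\<lambda>x. complex_of_real (r x) + \<i> * complex_of_real (s x)) \<in> borel_measurable borel"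
    using rs(1,3) by measurable
  ultimately show ?thesis
    using that by blast
qed

lemma partial_deriv_of_real:
  assumes "has_grad \<kappa> (\<lambda>i. D i) y"
  shows "partial_deriv i (\<lambda>y. complex_of_real (\<kappa> y)) y = complex_of_real (D i)"
proof -
  have "((\<lambda>y. complex_of_real (\<kappa> y)) has_derivative (\<lambda>h. complex_of_real (\<Sum>i\<in>UNIV. h $ i *\<^sub>R D i))) (at y)"
    using assms unfolding has_grad_def by (rule has_derivative_of_real)
  from frechet_derivative_at[OF this] have
    "partial_deriv i (\<lambda>y. complex_of_real (\<kappa> y)) y = complex_of_real (\<Sum>j\<in>UNIV. axis i 1 $ j *\<^sub>R D j)"
    unfolding partial_deriv_def by metis
  then show ?thesis
    by (simp add: axis_def if_distrib if_distribR cong: if_cong)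
qed

lemma loc_sqI_lebesgue:
  fixes f :: "'a::euclidean_space \<Rightarrow> 'b::euclidean_space"
  assumes f: "f \<in> borel_measurable borel"
    and le: "AE x in lborel. (norm (f x))\<^sup>2 \<le> h x"
    and h: "\<And>K. compact K \<Longrightarrow> set_integrable lebesgue K h"
  shows "loc_sq f"
  unfolding loc_sq_def
proof (intro conjI allI impI f)
  fix K :: "'a set"
  assume K: "compact K"
  have m: "(\<lambda>x. indicator K x *\<^sub>R (norm (f x))\<^sup>2) \<in> borel_measurable lborel"
    using f K by (intro borel_measurable_scaleR borel_measurable_indicator) (auto simp: compact_imp_closed)
  have "integrable lebesgue (\<lambda>x. indicator K x *\<^sub>R (norm (f x))\<^sup>2)"
  proof (rule Bochner_Integration.integrable_bound)
    show "integrable lebesgue (\<lambda>x. indicator K x *\<^sub>R h x)"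
      using h[OF K] by (simp add: set_integrable_def)
    show "(\<lambda>x. indicator K x *\<^sub>R (norm (f x))\<^sup>2) \<in> borel_measurable lebesgue"
      using m by (rule measurable_completion)
    have "AE x in lebesgue. (norm (f x))\<^sup>2 \<le> h x"
      using le by (rule AE_completion)
    then show "AE x in lebesgue. norm (indicator K x *\<^sub>R (norm (f x))\<^sup>2) \<le> norm (indicator K x *\<^sub>R h x)"
      by eventually_elim (auto simp: indicator_def)
  qed
  then show "set_integrable lborel K (\<lambda>x. (norm (f x))\<^sup>2)"
    unfolding set_integrable_def using m by (simp add: integrable_completion)
qed

lemma lebesgue_integral_eq_borel:
  fixes f g :: "'a::euclidean_space \<Rightarrow> complex"
  assumes "f \<in> borel_measurable lebesgue" "g \<in> borel_measurable borel" "AE x in lborel. f x = g x"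
  shows "(LINT x|lebesgue. f x) = (LINT x|lborel. g x)"
proof -
  have "(LINT x|lebesgue. f x) = (LINT x|lebesgue. g x)"
    using assms by (intro integral_cong_AE AE_completion) (auto intro: measurable_completion)
  then show ?thesis
    using assms(2) by (simp add: integral_completion)
qed

text \<open>The pairing has no conjugation, but the triangle inequality passes to absolute values
  before the Cauchy-Schwarz inequality is applied.\<close>

lemma norm_bilinear_le:
  fixes W G :: "complex^'n"
  shows "cmod (\<Sum>i\<in>UNIV. W $ i * G $ i) \<le> norm W * norm G"
proof -
  have "cmod (\<Sum>i\<in>UNIV. W $ i * G $ i) \<le> (\<Sum>i\<in>UNIV. \<bar>cmod (W $ i)\<bar> * \<bar>cmod (G $ i)\<bar>)"
    by (rule order_trans[OF norm_sum]) (simp add: norm_mult)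
  also have "\<dots> \<le> L2_set (\<lambda>i. cmod (W $ i)) UNIV * L2_set (\<lambda>i. cmod (G $ i)) UNIV"
    by (rule L2_set_mult_ineq)
  finally show ?thesis
    by (simp add: norm_vec_def)
qed

text \<open>The equation identifies the weak Laplacian as drift plus potential term minus
  \<open>lam * u\<close>. The decaying bounds \<open>a\<close> and \<open>b\<close> are kept in the
  conclusion for the absorption argument; the constants \<open>A1\<close> and \<open>A2\<close>
  provide local square integrability.\<close>

lemma weak_solution_H2_approx:
  fixes V u v :: "real^'n \<Rightarrow> complex" and W :: "real^'n \<Rightarrow> complex^'n"
  assumes Vm: "V \<in> borel_measurable lebesgue" and Wm: "W \<in> borel_measurable lebesgue"
    and Vb: "\<And>x. norm (V x) \<le> a x" "\<And>x. a x \<le> A1" and Wb: "\<And>x. norm (W x) \<le> b x" "\<And>x. b x \<le> A2"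
    and sol: "weak_solution V W lam u"
    and vc: "continuous_on UNIV v" and uv: "AE x in lebesgue. u x = v x"
  obtains G F where "H2_approx v G F"
    "AE x in lborel. cmod (F x + lam * v x) \<le> b x * sqrt (\<Sum>i\<in>UNIV. (cmod (G i x))\<^sup>2) + a x * cmod (v x)"
proof -
  obtain G0 where um: "u \<in> borel_measurable lebesgue"
    and uL: "\<And>K. compact K \<Longrightarrow> set_integrable lebesgue K (\<lambda>x. (norm (u x))\<^sup>2)"
    and G0m: "G0 \<in> borel_measurable lebesgue"
    and G0L: "\<And>K. compact K \<Longrightarrow> set_integrable lebesgue K (\<lambda>x. (norm (G0 x))\<^sup>2)"
    and grad: "weak_gradient u G0"
    and eq: "\<And>\<phi>. test_function \<phi> \<Longrightarrow>
         (LINT x|lebesgue. (\<Sum>i\<in>UNIV. G0 x $ i * partial_deriv i \<phi> x)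
            + (\<Sum>i\<in>UNIV. W x $ i * G0 x $ i) * \<phi> x + V x * u x * \<phi> x)
         = (LINT x|lebesgue. lam * u x * \<phi> x)"
    using sol unfolding weak_solution_def L2_loc_def by blast
  have comp: "(\<lambda>x. h x $ i) \<in> borel_measurable lebesgue"
    if "h \<in> borel_measurable lebesgue" for h :: "real^'n \<Rightarrow> complex^'n" and i
  proof -
    have "(\<lambda>v :: complex^'n. v $ i) \<in> borel_measurable borel"
      by (intro borel_measurable_continuous_onI continuous_intros)
    then show ?thesis
      using measurable_compose[OF that] by blast
  qed
  have "\<forall>i. \<exists>g. g \<in> borel_measurable borel \<and> (AE x in lborel. G0 x $ i = g x)"
    using lebesgue_ex_borel_complex[OF comp[OF G0m]] by blast
  then obtain G where Gm: "\<And>i. G i \<in> borel_measurable borel" and GG: "\<And>i. AE x in lborel. G0 x $ i = G i x"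
    by metis
  have GGall: "AE x in lborel. \<forall>i. G0 x $ i = G i x"
    using GG by (simp add: AE_all_countable)
  have uv': "AE x in lborel. u x = v x"
    using uv by (simp add: AE_completion_iff)
  define F0 where "F0 x = (\<Sum>i\<in>UNIV. W x $ i * G0 x $ i) + V x * u x - lam * u x" for x
  have F0m: "F0 \<in> borel_measurable lebesgue"
    unfolding F0_def using comp[OF G0m] comp[OF Wm] um Vm by measurable
  obtain F where Fm: "F \<in> borel_measurable borel" and FF: "AE x in lborel. F0 x = F x"
    using lebesgue_ex_borel_complex[OF F0m] .
  have vm: "v \<in> borel_measurable borel"
    using vc by (rule borel_measurable_continuous_onI)
  have Gl: "loc_sq (G i)" for i
  proof (rule loc_sqI_lebesgue[OF Gm _ G0L])
    show "AE x in lborel. (norm (G i x))\<^sup>2 \<le> (norm (G0 x))\<^sup>2"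
      using GG[of i]
    proof eventually_elim
      case (elim x)
      then show ?case
        using power_mono[OF Finite_Cartesian_Product.norm_nth_le[of "G0 x" i], of 2] by simp
    qed
  qed
  have F0b: "cmod (F0 x + lam * u x) \<le> b x * norm (G0 x) + a x * cmod (u x)" for x
  proof -
    have "cmod (F0 x + lam * u x) \<le> cmod (\<Sum>i\<in>UNIV. W x $ i * G0 x $ i) + cmod (V x * u x)"
      unfolding F0_def by (simp add: norm_triangle_ineq)
    also have "\<dots> \<le> norm (W x) * norm (G0 x) + norm (V x) * cmod (u x)"
      by (intro add_mono norm_bilinear_le) (simp add: norm_mult)
    also have "\<dots> \<le> b x * norm (G0 x) + a x * cmod (u x)"
      using Vb(1) Wb(1) by (intro add_mono mult_right_mono) auto
    finally show ?thesis .
  qed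
  have Fl: "loc_sq F"
  proof (rule loc_sqI_lebesgue[OF Fm])
    show "AE x in lborel. (norm (F x))\<^sup>2 \<le> 2 * A2\<^sup>2 * (norm (G0 x))\<^sup>2 + 2 * (A1 + cmod lam)\<^sup>2 * (cmod (u x))\<^sup>2"
      using FF
    proof eventually_elim
      case (elim x)
      have "cmod (F0 x) \<le> cmod (F0 x + lam * u x) + cmod (lam * u x)"
        using norm_triangle_ineq4[of "F0 x + lam * u x" "lam * u x"] by simp
      also have "\<dots> \<le> b x * norm (G0 x) + a x * cmod (u x) + cmod lam * cmod (u x)"
        using F0b[of x] by (simp add: norm_mult)
      also have "\<dots> \<le> A2 * norm (G0 x) + A1 * cmod (u x) + cmod lam * cmod (u x)"
        using Vb(2) Wb(2) by (intro add_mono mult_right_mono) auto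
      finally have "cmod (F0 x) \<le> A2 * norm (G0 x) + (A1 + cmod lam) * cmod (u x)"
        by (simp add: algebra_simps)
      then have "(cmod (F0 x))\<^sup>2 \<le> (A2 * norm (G0 x) + (A1 + cmod lam) * cmod (u x))\<^sup>2"
        by (intro power_mono) auto
      also have "\<dots> \<le> 2 * (A2 * norm (G0 x))\<^sup>2 + 2 * ((A1 + cmod lam) * cmod (u x))\<^sup>2"
        using norm_add_sq_le[of "A2 * norm (G0 x)" "(A1 + cmod lam) * cmod (u x)"] by simp
      finally show ?case
        using elim by (simp add: power_mult_distrib)
    qed
    fix K :: "(real^'n) set"
    assume K: "compact K"
    show "set_integrable lebesgue K (\<lambda>x. 2 * A2\<^sup>2 * (norm (G0 x))\<^sup>2 + 2 * (A1 + cmod lam)\<^sup>2 * (cmod (u x))\<^sup>2)"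
      using G0L[OF K] uL[OF K] by (intro set_integral_add set_integrable_mult_right) auto
  qed
  have vl: "loc_sq v"
    using vc by (rule loc_sq_continuous)
  have "H2_approx v G F"
  proof (rule H2_approx_of_weak[OF vl Gl Fl])
    fix \<kappa> :: "real^'n \<Rightarrow> real" and D\<kappa> K i
    assume test: "test_function (\<lambda>y. complex_of_real (\<kappa> y))" and g: "\<And>y. has_grad \<kappa> (\<lambda>i. D\<kappa> i y) y"
      and c: "\<And>i. continuous_on UNIV (D\<kappa> i)" and K: "compact K" "\<And>y i. y \<notin> K \<Longrightarrow> \<kappa> y = 0 \<and> D\<kappa> i y = 0"
    have \<kappa>c: "continuous_on UNIV \<kappa>"
      by (rule has_grad_continuous_on[OF g])
    have \<kappa>m: "\<kappa> \<in> borel_measurable borel" "D\<kappa> i \<in> borel_measurable borel" for i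
      using \<kappa>c c by (auto intro: borel_measurable_continuous_onI)
    have \<kappa>m': "\<kappa> \<in> borel_measurable lebesgue" "D\<kappa> i \<in> borel_measurable lebesgue" for i
      using \<kappa>m by (auto intro!: measurable_completion)
    have pd: "partial_deriv i (\<lambda>y. complex_of_real (\<kappa> y)) y = complex_of_real (D\<kappa> i y)" for i y
      by (rule partial_deriv_of_real[OF g])
    show "(LINT y|lborel. D\<kappa> i y *\<^sub>R v y) = - (LINT y|lborel. \<kappa> y *\<^sub>R G i y)"
    proof -
      have "(LINT y|lborel. D\<kappa> i y *\<^sub>R v y) = (LINT y|lebesgue. u y * partial_deriv i (\<lambda>y. complex_of_real (\<kappa> y)) y)"
        unfolding pd
      proof (rule lebesgue_integral_eq_borel[symmetric])
        show "(\<lambda>y. u y * complex_of_real (D\<kappa> i y)) \<in> borel_measurable lebesgue"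
          using um \<kappa>m' by measurable
        show "(\<lambda>y. D\<kappa> i y *\<^sub>R v y) \<in> borel_measurable borel"
          using vm \<kappa>m by (intro borel_measurable_scaleR)
        show "AE y in lborel. u y * complex_of_real (D\<kappa> i y) = D\<kappa> i y *\<^sub>R v y"
          using uv' by eventually_elim (simp add: scaleR_conv_of_real)
      qed
      also have "\<dots> = - (LINT y|lebesgue. G0 y $ i * complex_of_real (\<kappa> y))"
        using grad test unfolding weak_gradient_def by blast
      also have "(LINT y|lebesgue. G0 y $ i * complex_of_real (\<kappa> y)) = (LINT y|lborel. \<kappa> y *\<^sub>R G i y)"
      proof (rule lebesgue_integral_eq_borel)
        show "(\<lambda>y. G0 y $ i * complex_of_real (\<kappa> y)) \<in> borel_measurable lebesgue"
          using comp[OF G0m] \<kappa>m' by measurable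
        show "(\<lambda>y. \<kappa> y *\<^sub>R G i y) \<in> borel_measurable borel"
          using Gm \<kappa>m by (intro borel_measurable_scaleR)
        show "AE y in lborel. G0 y $ i * complex_of_real (\<kappa> y) = \<kappa> y *\<^sub>R G i y"
          using GG[of i] by eventually_elim (simp add: scaleR_conv_of_real)
      qed
      finally show ?thesis .
    qed
    show "(LINT y|lborel. (\<Sum>i\<in>UNIV. D\<kappa> i y *\<^sub>R G i y)) = - (LINT y|lborel. \<kappa> y *\<^sub>R F y)"
    proof -
      have i1: "integrable lborel (\<lambda>y. \<Sum>i\<in>UNIV. D\<kappa> i y *\<^sub>R G i y)"
        by (intro Bochner_Integration.integrable_sum integrable_kernel_times[OF Gl c K(1)]) (use K(2) in auto)
      have i2: "integrable lborel (\<lambda>y. \<kappa> y *\<^sub>R F y)"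
        by (intro integrable_kernel_times[OF Fl \<kappa>c K(1)]) (use K(2) in auto)
      have i3: "integrable lborel (\<lambda>y. \<kappa> y *\<^sub>R (lam * v y))"
        by (intro integrable_kernel_times[OF loc_sq_continuous \<kappa>c K(1)] continuous_intros vc) (use K(2) in auto)
      \<comment> \<open>Drift and potential term together equal \<open>F + lam * v\<close> almost
        everywhere. The weak equation equates this integral with that of
        \<open>\<kappa> * lam * v\<close>, which then cancels and leaves the weak identity for
        \<open>F\<close>.\<close>
      have "(LINT y|lborel. (\<Sum>i\<in>UNIV. D\<kappa> i y *\<^sub>R G i y) + \<kappa> y *\<^sub>R F y + \<kappa> y *\<^sub>R (lam * v y))
        = (LINT x|lebesgue. (\<Sum>i\<in>UNIV. G0 x $ i * partial_deriv i (\<lambda>y. complex_of_real (\<kappa> y)) x)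
            + (\<Sum>i\<in>UNIV. W x $ i * G0 x $ i) * complex_of_real (\<kappa> x) + V x * u x * complex_of_real (\<kappa> x))"
        unfolding pd
      proof (rule lebesgue_integral_eq_borel[symmetric])
        show "(\<lambda>x. (\<Sum>i\<in>UNIV. G0 x $ i * complex_of_real (D\<kappa> i x))
            + (\<Sum>i\<in>UNIV. W x $ i * G0 x $ i) * complex_of_real (\<kappa> x) + V x * u x * complex_of_real (\<kappa> x)) \<in> borel_measurable lebesgue"
          using um Vm comp[OF G0m] comp[OF Wm] \<kappa>m' by measurable
        show "(\<lambda>y. (\<Sum>i\<in>UNIV. D\<kappa> i y *\<^sub>R G i y) + \<kappa> y *\<^sub>R F y + \<kappa> y *\<^sub>R (lam * v y)) \<in> borel_measurable borel"
          using vm Gm Fm \<kappa>m by (intro borel_measurable_add borel_measurable_sum borel_measurable_scaleR borel_measurable_times) auto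
        show "AE x in lborel. (\<Sum>i\<in>UNIV. G0 x $ i * complex_of_real (D\<kappa> i x))
            + (\<Sum>i\<in>UNIV. W x $ i * G0 x $ i) * complex_of_real (\<kappa> x) + V x * u x * complex_of_real (\<kappa> x)
            = (\<Sum>i\<in>UNIV. D\<kappa> i x *\<^sub>R G i x) + \<kappa> x *\<^sub>R F x + \<kappa> x *\<^sub>R (lam * v x)"
          using GGall uv' FF
        proof eventually_elim
          case (elim x)
          have "(\<Sum>i\<in>UNIV. G0 x $ i * complex_of_real (D\<kappa> i x)) = (\<Sum>i\<in>UNIV. D\<kappa> i x *\<^sub>R G i x)"
            using elim(1) by (simp add: scaleR_conv_of_real mult.commute)
          moreover have "(\<Sum>i\<in>UNIV. W x $ i * G0 x $ i) + V x * u x = F x + lam * v x"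
            using elim(2,3) by (simp add: F0_def algebra_simps)
          then have "(\<Sum>i\<in>UNIV. W x $ i * G0 x $ i) * complex_of_real (\<kappa> x) + V x * u x * complex_of_real (\<kappa> x)
              = \<kappa> x *\<^sub>R F x + \<kappa> x *\<^sub>R (lam * v x)"
            by (metis distrib_right mult.commute scaleR_add_right scaleR_conv_of_real)
          ultimately show ?case
            by (simp add: add.assoc)
        qed
      qed
      also have "\<dots> = (LINT x|lebesgue. lam * u x * complex_of_real (\<kappa> x))"
        by (rule eq[OF test])
      also have "\<dots> = (LINT y|lborel. \<kappa> y *\<^sub>R (lam * v y))"
      proof (rule lebesgue_integral_eq_borel)
        show "(\<lambda>x. lam * u x * complex_of_real (\<kappa> x)) \<in> borel_measurable lebesgue"
          using um \<kappa>m' by measurable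
        show "(\<lambda>y. \<kappa> y *\<^sub>R (lam * v y)) \<in> borel_measurable borel"
          using vm \<kappa>m by (intro borel_measurable_scaleR borel_measurable_times) auto
        show "AE x in lborel. lam * u x * complex_of_real (\<kappa> x) = \<kappa> x *\<^sub>R (lam * v x)"
          using uv' by eventually_elim (simp add: scaleR_conv_of_real)
      qed
      finally have "(LINT y|lborel. (\<Sum>i\<in>UNIV. D\<kappa> i y *\<^sub>R G i y)) + (LINT y|lborel. \<kappa> y *\<^sub>R F y)
          + (LINT y|lborel. \<kappa> y *\<^sub>R (lam * v y)) = (LINT y|lborel. \<kappa> y *\<^sub>R (lam * v y))"
        using i1 i2 i3 by (simp only: Bochner_Integration.integral_add Bochner_Integration.integrable_add)
      then show ?thesis
        by (simp add: eq_neg_iff_add_eq_0)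
    qed
  qed
  moreover have "AE x in lborel. cmod (F x + lam * v x) \<le> b x * sqrt (\<Sum>i\<in>UNIV. (cmod (G i x))\<^sup>2) + a x * cmod (v x)"
    using GGall uv' FF
  proof eventually_elim
    case (elim x)
    have "norm (G0 x) = sqrt (\<Sum>i\<in>UNIV. (cmod (G i x))\<^sup>2)"
      using elim(1) by (simp add: norm_vec_def L2_set_def)
    then show ?case
      using F0b[of x] elim by simp
  qed
  ultimately show ?thesis
    using that by blast
qed

section \<open>Cutoff functions and the Caccioppoli inequality\<close>

lemma continuous_bounded_on_compact:
  fixes f :: "'a::metric_space \<Rightarrow> real"
  assumes "continuous_on S f" "compact S"
  obtains C where "\<And>x. x \<in> S \<Longrightarrow> \<bar>f x\<bar> \<le> C"
  using compact_imp_bounded[OF compact_continuous_image[OF assms]] that by (auto simp: bounded_iff)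

lemma H2_approxE:
  fixes v F :: "real^'n \<Rightarrow> complex"
  assumes "H2_approx v G F"
  obtains U DU D2U where "\<And>k. C2_on UNIV (U k) (DU k) (D2U k)"
    "\<And>S. compact S \<Longrightarrow> L2_conv (restrict_space lborel S) U v"
    "\<And>S i. compact S \<Longrightarrow> L2_conv (restrict_space lborel S) (\<lambda>k. DU k i) (G i)"
    "\<And>S. compact S \<Longrightarrow> L2_conv (restrict_space lborel S) (\<lambda>k x. \<Sum>i\<in>UNIV. D2U k i i x) F"
  using assms[unfolded H2_approx_def]
proof (elim exE conjE)
  fix U DU D2U
  assume 1: "\<forall>k. C2_on UNIV (U k) (DU k) (D2U k)"
    and 2: "\<forall>S. compact S \<longrightarrow> L2_conv (restrict_space lborel S) U v \<and>
        (\<forall>i. L2_conv (restrict_space lborel S) (\<lambda>k. DU k i) (G i)) \<and>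
        L2_conv (restrict_space lborel S) (\<lambda>k x. \<Sum>i\<in>UNIV. D2U k i i x) F"
  show thesis
    by (rule that[of U DU D2U]) (simp_all add: 1 2)
qed

lemma H2_approx_integrable:
  fixes v F :: "real^'n \<Rightarrow> complex"
  assumes "H2_approx v G F" "compact S" "continuous_on S w"
  shows "set_integrable lborel S (\<lambda>x. w x * (norm (v x))\<^sup>2)"
    "set_integrable lborel S (\<lambda>x. w x * (\<Sum>i\<in>UNIV. (norm (G i x))\<^sup>2))"
    "set_integrable lborel S (\<lambda>x. w x * (v x \<bullet> F x))"
proof -
  obtain U DU D2U where "\<And>k. C2_on UNIV (U k) (DU k) (D2U k)"
    and U0: "\<And>S. compact S \<Longrightarrow> L2_conv (restrict_space lborel S) U v"
    "\<And>S i. compact S \<Longrightarrow> L2_conv (restrict_space lborel S) (\<lambda>k. DU k i) (G i)"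
    "\<And>S. compact S \<Longrightarrow> L2_conv (restrict_space lborel S) (\<lambda>k x. \<Sum>i\<in>UNIV. D2U k i i x) F"
    by (rule H2_approxE[OF assms(1)], rule that)
  note U = U0[OF assms(2)]
  have Sm: "S \<in> sets borel"
    using assms(2) by (simp add: compact_imp_closed)
  obtain C where C: "\<And>x. x \<in> S \<Longrightarrow> \<bar>w x\<bar> \<le> C"
    by (rule continuous_bounded_on_compact[OF assms(3,2)], rule that)
  have wm: "w \<in> borel_measurable (restrict_space lborel S)"
    using borel_measurable_continuous_on_restrict[OF assms(3)]
    by (simp add: measurable_def space_restrict_space sets_restrict_space)
  have C': "x \<in> space (restrict_space lborel S) \<Longrightarrow> \<bar>w x\<bar> \<le> C" for x
    using C by (simp add: space_restrict_space)
  have restr: "integrable (restrict_space lborel S) h \<longleftrightarrow> set_integrable lborel S h" for h :: "real^'n \<Rightarrow> real"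
    using Sm by (simp add: integrable_restrict_space set_integrable_def)
  show "set_integrable lborel S (\<lambda>x. w x * (norm (v x))\<^sup>2)"
    "set_integrable lborel S (\<lambda>x. w x * (v x \<bullet> F x))"
    using L2_conv_inner(2)[OF U(1) U(1) wm C'] L2_conv_inner(2)[OF U(1) U(3) wm C']
    by (simp_all add: restr dot_square_norm)
  show "set_integrable lborel S (\<lambda>x. w x * (\<Sum>i\<in>UNIV. (norm (G i x))\<^sup>2))"
    unfolding restr[symmetric] sum_distrib_left dot_square_norm[symmetric]
    by (intro Bochner_Integration.integrable_sum) (rule L2_conv_inner(2)[OF U(2) U(2) wm C'])
qed

text \<open>Green's identity holds for the approximants, and each of its terms is a weighted pairing
  of sequences that converge in L2 on \<open>K\<close>.\<close>

lemma H2_approx_by_parts: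
  fixes v F :: "real^'n \<Rightarrow> complex"
  assumes H: "H2_approx v G F" and K: "compact K"
    and \<psi>: "C2_on UNIV \<psi> D\<psi> D2\<psi>" and supp: "\<And>x. x \<notin> K \<Longrightarrow> \<psi> x = 0"
  shows "(LINT x:K|lborel. (\<Sum>i\<in>UNIV. D2\<psi> i i x) * (norm (v x))\<^sup>2)
     = (LINT x:K|lborel. 2 * \<psi> x * (\<Sum>i\<in>UNIV. (norm (G i x))\<^sup>2)) + (LINT x:K|lborel. 2 * \<psi> x * (v x \<bullet> F x))"
proof -
  obtain U DU D2U where C2: "\<And>k. C2_on UNIV (U k) (DU k) (D2U k)"
    and U0: "\<And>S. compact S \<Longrightarrow> L2_conv (restrict_space lborel S) U v"
    "\<And>S i. compact S \<Longrightarrow> L2_conv (restrict_space lborel S) (\<lambda>k. DU k i) (G i)"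
    "\<And>S. compact S \<Longrightarrow> L2_conv (restrict_space lborel S) (\<lambda>k x. \<Sum>i\<in>UNIV. D2U k i i x) F"
    by (rule H2_approxE[OF H], rule that)
  note U = U0[OF K]
  define M where "M = restrict_space lborel K"
  have Km: "K \<in> sets borel"
    using K by (simp add: compact_imp_closed)
  note \<psi>c = C2_on_continuous[OF \<psi>]
  have bm: "w \<in> borel_measurable M" "\<exists>C. \<forall>x\<in>space M. \<bar>w x\<bar> \<le> C" if "continuous_on UNIV w" for w :: "real^'n \<Rightarrow> real"
  proof -
    show "w \<in> borel_measurable M"
      unfolding M_def using borel_measurable_continuous_onI[OF that] by (intro measurable_restrict_space1) simp
    show "\<exists>C. \<forall>x\<in>space M. \<bar>w x\<bar> \<le> C"
      using continuous_bounded_on_compact[OF continuous_on_subset[OF that subset_UNIV] K]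
      by (metis M_def space_restrict_space Int_iff)
  qed
  have restr: "(LINT x:K|lborel. h x) = (LINT x|M. h x)" for h :: "real^'n \<Rightarrow> real"
    using Km by (simp add: M_def integral_restrict_space set_lebesgue_integral_def)
  define L where "L x = (\<Sum>i\<in>UNIV. D2\<psi> i i x)" for x
  have Lc: "continuous_on UNIV L"
    unfolding L_def[abs_def] by (intro continuous_intros \<psi>c)
  have Pc: "continuous_on UNIV (\<lambda>x. 2 * \<psi> x)"
    by (intro continuous_intros \<psi>c)
  obtain CL CP where CL: "\<And>x. x \<in> space M \<Longrightarrow> \<bar>L x\<bar> \<le> CL" and CP: "\<And>x. x \<in> space M \<Longrightarrow> \<bar>2 * \<psi> x\<bar> \<le> CP"
    using bm(2)[OF Lc] bm(2)[OF Pc] by blast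
  note U' = U[folded M_def]
  note t1 = L2_conv_inner[OF U'(1) U'(1) bm(1)[OF Lc] CL]
  have t2: "(\<lambda>k. LINT x|M. 2 * \<psi> x * (DU k i x \<bullet> DU k i x)) \<longlonglongrightarrow> (LINT x|M. 2 * \<psi> x * (G i x \<bullet> G i x))"
    "integrable M (\<lambda>x. 2 * \<psi> x * (G i x \<bullet> G i x))" "integrable M (\<lambda>x. 2 * \<psi> x * (DU k i x \<bullet> DU k i x))" for i k
    by (rule L2_conv_inner[OF U'(2)[of i] U'(2)[of i] bm(1)[OF Pc] CP]; assumption)+
  note t3 = L2_conv_inner[OF U'(1) U'(3) bm(1)[OF Pc] CP]
  have eq: "(LINT x|M. L x * (U k x \<bullet> U k x)) = (\<Sum>i\<in>UNIV. LINT x|M. 2 * \<psi> x * (DU k i x \<bullet> DU k i x))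
      + (LINT x|M. 2 * \<psi> x * (U k x \<bullet> (\<Sum>i\<in>UNIV. D2U k i i x)))" for k
  proof -
    have "0 = (LINT x|M. (\<Sum>i\<in>UNIV. (norm (U k x))\<^sup>2 * D2\<psi> i i x
      - 2 * \<psi> x * ((norm (DU k i x))\<^sup>2 + U k x \<bullet> D2U k i i x)))"
      using integral_laplacian_by_parts[OF open_UNIV K subset_UNIV C2[of k] \<psi>] supp by (simp add: restr)
    also have "\<dots> = (LINT x|M. L x * (U k x \<bullet> U k x) - ((\<Sum>i\<in>UNIV. 2 * \<psi> x * (DU k i x \<bullet> DU k i x))
        + 2 * \<psi> x * (U k x \<bullet> (\<Sum>i\<in>UNIV. D2U k i i x))))"
    proof (rule Bochner_Integration.integral_cong[OF refl])
      fix x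
      show "(\<Sum>i\<in>UNIV. (norm (U k x))\<^sup>2 * D2\<psi> i i x - 2 * \<psi> x * ((norm (DU k i x))\<^sup>2 + U k x \<bullet> D2U k i i x))
        = L x * (U k x \<bullet> U k x) - ((\<Sum>i\<in>UNIV. 2 * \<psi> x * (DU k i x \<bullet> DU k i x)) + 2 * \<psi> x * (U k x \<bullet> (\<Sum>i\<in>UNIV. D2U k i i x)))"
        unfolding L_def dot_square_norm sum_subtractf distrib_left sum.distrib inner_sum_right sum_distrib_left sum_distrib_right
        by (simp add: mult.commute)
    qed
    also have "\<dots> = (LINT x|M. L x * (U k x \<bullet> U k x)) - ((\<Sum>i\<in>UNIV. LINT x|M. 2 * \<psi> x * (DU k i x \<bullet> DU k i x))
        + (LINT x|M. 2 * \<psi> x * (U k x \<bullet> (\<Sum>i\<in>UNIV. D2U k i i x))))"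
      using t1(3)[where k = k] t2(3)[where k = k] t3(3)[where k = k]
      by (simp only: Bochner_Integration.integral_diff Bochner_Integration.integral_add Bochner_Integration.integral_sum
          Bochner_Integration.integrable_add Bochner_Integration.integrable_sum)
    finally show ?thesis
      by simp
  qed
  have "(\<lambda>k. LINT x|M. L x * (U k x \<bullet> U k x)) \<longlonglongrightarrow> (\<Sum>i\<in>UNIV. LINT x|M. 2 * \<psi> x * (G i x \<bullet> G i x))
      + (LINT x|M. 2 * \<psi> x * (v x \<bullet> F x))"
    unfolding eq by (intro tendsto_add tendsto_sum t2(1) t3(1))
  from LIMSEQ_unique[OF t1(1) this]
  have "(LINT x|M. L x * (v x \<bullet> v x)) = (\<Sum>i\<in>UNIV. LINT x|M. 2 * \<psi> x * (G i x \<bullet> G i x)) + (LINT x|M. 2 * \<psi> x * (v x \<bullet> F x))" .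
  moreover have "(\<Sum>i\<in>UNIV. LINT x|M. 2 * \<psi> x * (G i x \<bullet> G i x)) = (LINT x|M. 2 * \<psi> x * (\<Sum>i\<in>UNIV. (norm (G i x))\<^sup>2))"
    unfolding sum_distrib_left dot_square_norm[symmetric]
    by (rule Bochner_Integration.integral_sum[symmetric]) (rule t2(2))
  ultimately show ?thesis
    unfolding restr L_def[symmetric] dot_square_norm by simp
qed

text \<open>\<open>|v|^2\<close> is a weak subsolution of the Laplacian plus \<Gamma>, with one copy
  of the squared gradient retained on the left. Dropping that copy gives the hypothesis of the mean
  value argument; keeping it gives the Caccioppoli inequality.\<close>

lemma H2_approx_subsolution:
  fixes v F :: "real^'n \<Rightarrow> complex"
  assumes H: "H2_approx v G F" and K: "compact K"
    and \<psi>: "C2_on UNIV \<psi> D\<psi> D2\<psi>" "\<And>x. 0 \<le> \<psi> x" and supp: "\<And>x. x \<notin> K \<Longrightarrow> \<psi> x = 0"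
    and F: "AE x in lborel. cmod (F x + lam * v x) \<le> A2 * sqrt (\<Sum>i\<in>UNIV. (cmod (G i x))\<^sup>2) + A1 * cmod (v x)"
  shows "(LINT x:K|lborel. \<psi> x * (\<Sum>i\<in>UNIV. (norm (G i x))\<^sup>2))
    \<le> (LINT x:K|lborel. ((\<Sum>i\<in>UNIV. D2\<psi> i i x) + (A2\<^sup>2 + 2 * (A1 + cmod lam)) * \<psi> x) * (norm (v x))\<^sup>2)"
proof -
  define \<Gamma> where "\<Gamma> = A2\<^sup>2 + 2 * (A1 + cmod lam)"
  note \<psi>c = C2_on_continuous[OF \<psi>(1)]
  have cont: "continuous_on K (\<lambda>x. \<Sum>i\<in>UNIV. D2\<psi> i i x)" "continuous_on K \<psi>"
    by (rule continuous_on_subset[OF _ subset_UNIV], intro continuous_intros \<psi>c)+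
  have cont2: "continuous_on K (\<lambda>x. (\<Sum>i\<in>UNIV. D2\<psi> i i x) + \<Gamma> * \<psi> x)" "continuous_on K (\<lambda>x. \<Gamma> * \<psi> x)" "continuous_on K (\<lambda>x. 2 * \<psi> x)"
    by (intro continuous_intros cont)+
  note int = H2_approx_integrable[OF H K]
  have "(LINT x:K|lborel. 2 * \<psi> x * (v x \<bullet> F x)) \<ge>
      (LINT x:K|lborel. - (\<psi> x * (\<Sum>i\<in>UNIV. (norm (G i x))\<^sup>2)) - \<Gamma> * \<psi> x * (norm (v x))\<^sup>2)"
  proof (rule set_integral_mono_AE)
    show "set_integrable lborel K (\<lambda>x. - (\<psi> x * (\<Sum>i\<in>UNIV. (norm (G i x))\<^sup>2)) - \<Gamma> * \<psi> x * (norm (v x))\<^sup>2)"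
      using int(2)[OF cont(2)] int(1)[OF cont2(2)] unfolding set_integrable_def
      by (simp add: right_diff_distrib)
    show "set_integrable lborel K (\<lambda>x. 2 * \<psi> x * (v x \<bullet> F x))"
      by (rule int(3)[OF cont2(3)])
    show "AE x\<in>K in lborel. - (\<psi> x * (\<Sum>i\<in>UNIV. (norm (G i x))\<^sup>2)) - \<Gamma> * \<psi> x * (norm (v x))\<^sup>2 \<le> 2 * \<psi> x * (v x \<bullet> F x)"
      using F
    proof (eventually_elim, intro impI)
      fix x
      assume Fx: "cmod (F x + lam * v x) \<le> A2 * sqrt (\<Sum>i\<in>UNIV. (cmod (G i x))\<^sup>2) + A1 * cmod (v x)"
      define g where "g = sqrt (\<Sum>i\<in>UNIV. (cmod (G i x))\<^sup>2)"
      have g2: "g\<^sup>2 = (\<Sum>i\<in>UNIV. (cmod (G i x))\<^sup>2)"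
        unfolding g_def by (rule real_sqrt_pow2) (auto intro: sum_nonneg)
      have "cmod (F x) \<le> cmod (F x + lam * v x) + cmod (lam * v x)"
        using norm_triangle_ineq4[of "F x + lam * v x" "lam * v x"] by simp
      also have "\<dots> \<le> A2 * g + A1 * cmod (v x) + cmod lam * cmod (v x)"
        using Fx by (simp add: g_def norm_mult)
      finally have "cmod (v x) * cmod (F x) \<le> cmod (v x) * (A2 * g + A1 * cmod (v x) + cmod lam * cmod (v x))"
        by (intro mult_left_mono) auto
      moreover have "- (v x \<bullet> F x) \<le> cmod (v x) * cmod (F x)"
        using Cauchy_Schwarz_ineq2[of "v x" "F x"] by linarith
      \<comment> \<open>Green's identity supplies two copies of \<open>g^2\<close>; one of them pays
        for the drift, at the price of \<open>A2^2\<close> in \<Gamma>.\<close>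
      moreover have "2 * (A2 * g * cmod (v x)) \<le> g\<^sup>2 + A2\<^sup>2 * (cmod (v x))\<^sup>2"
        using sum_squares_bound[of g "A2 * cmod (v x)"] by (simp add: power_mult_distrib mult_ac)
      ultimately have "- (g\<^sup>2) - \<Gamma> * (cmod (v x))\<^sup>2 \<le> 2 * (v x \<bullet> F x)"
        by (simp add: \<Gamma>_def algebra_simps power2_eq_square)
      then have "\<psi> x * (- (g\<^sup>2) - \<Gamma> * (cmod (v x))\<^sup>2) \<le> \<psi> x * (2 * (v x \<bullet> F x))"
        using \<psi>(2) by (intro mult_left_mono)
      then show "- (\<psi> x * (\<Sum>i\<in>UNIV. (norm (G i x))\<^sup>2)) - \<Gamma> * \<psi> x * (norm (v x))\<^sup>2 \<le> 2 * \<psi> x * (v x \<bullet> F x)"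
        unfolding g2[symmetric] by (simp add: algebra_simps)
    qed
  qed
  also have "(LINT x:K|lborel. - (\<psi> x * (\<Sum>i\<in>UNIV. (norm (G i x))\<^sup>2)) - \<Gamma> * \<psi> x * (norm (v x))\<^sup>2)
    = - (LINT x:K|lborel. \<psi> x * (\<Sum>i\<in>UNIV. (norm (G i x))\<^sup>2)) - (LINT x:K|lborel. \<Gamma> * \<psi> x * (norm (v x))\<^sup>2)"
    using int(2)[OF cont(2)] int(1)[OF cont2(2)] unfolding set_integrable_def set_lebesgue_integral_def
    by (simp add: right_diff_distrib)
  finally have "- (LINT x:K|lborel. \<psi> x * (\<Sum>i\<in>UNIV. (norm (G i x))\<^sup>2)) - (LINT x:K|lborel. \<Gamma> * \<psi> x * (norm (v x))\<^sup>2)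
      \<le> (LINT x:K|lborel. 2 * \<psi> x * (v x \<bullet> F x))" .
  moreover have "(LINT x:K|lborel. 2 * \<psi> x * (\<Sum>i\<in>UNIV. (norm (G i x))\<^sup>2)) = 2 * (LINT x:K|lborel. \<psi> x * (\<Sum>i\<in>UNIV. (norm (G i x))\<^sup>2))"
    by (simp add: mult.assoc)
  moreover have "(LINT x:K|lborel. ((\<Sum>i\<in>UNIV. D2\<psi> i i x) + \<Gamma> * \<psi> x) * (norm (v x))\<^sup>2)
    = (LINT x:K|lborel. (\<Sum>i\<in>UNIV. D2\<psi> i i x) * (norm (v x))\<^sup>2) + (LINT x:K|lborel. \<Gamma> * \<psi> x * (norm (v x))\<^sup>2)"
    unfolding distrib_right by (rule set_integral_add(2)[OF int(1)[OF cont(1)] int(1)[OF cont2(2)]])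
  ultimately show ?thesis
    using H2_approx_by_parts[OF H K \<psi>(1) supp] unfolding \<Gamma>_def[symmetric] by linarith
qed

section \<open>Cutoff functions of class C2\<close>

lemma DERIV_pos_part_power:
  "((\<lambda>s. (max 0 s) ^ Suc (Suc m)) has_real_derivative real (Suc (Suc m)) * (max 0 s) ^ Suc m) (at s)"
proof -
  consider "s > 0" | "s < 0" | "s = 0"
    by linarith
  then show ?thesis
  proof cases
    case 1
    have "((\<lambda>s. s ^ Suc (Suc m)) has_real_derivative real (Suc (Suc m)) * (max 0 s) ^ Suc m) (at s)"
      using 1 DERIV_pow[of "Suc (Suc m)" s UNIV] by simp
    then show ?thesis
      by (rule has_field_derivative_transform_within_open[where S = "{0<..}"]) (use 1 in auto)
  next
    case 2
    have "((\<lambda>s. 0) has_real_derivative real (Suc (Suc m)) * (max 0 s) ^ Suc m) (at s)"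
      using 2 by simp
    then show ?thesis
      by (rule has_field_derivative_transform_within_open[where S = "{..<0}"]) (use 2 in auto)
  next
    case 3
    have "isCont (\<lambda>h::real. (max 0 h) ^ Suc m) 0"
      by (intro continuous_intros)
    then have "((\<lambda>h::real. (max 0 h) ^ Suc m) \<longlongrightarrow> 0) (at 0)"
      by (simp add: isCont_def)
    then have "((\<lambda>h::real. ((max 0 (0 + h)) ^ Suc (Suc m) - (max 0 0) ^ Suc (Suc m)) / h) \<longlongrightarrow> 0) (at 0)"
      by (subst LIM_equal[of 0 _ "\<lambda>h. (max 0 h) ^ Suc m"]) (auto simp: max_def)
    then show ?thesis
      using 3 by (simp add: DERIV_def)
  qed
qed

definition pos_pow :: "nat \<Rightarrow> real \<Rightarrow> real" where
  "pos_pow m s = (max 0 s) ^ m"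

lemma pos_pow_nonneg: "0 \<le> pos_pow m s"
  by (simp add: pos_pow_def)

lemma pos_pow_le_1: "s \<le> 1 \<Longrightarrow> pos_pow m s \<le> 1"
  by (simp add: pos_pow_def power_le_one)

lemma pos_pow_eq_0: "s \<le> 0 \<Longrightarrow> m > 0 \<Longrightarrow> pos_pow m s = 0"
  by (simp add: pos_pow_def max_def)

lemma continuous_on_pos_pow: "continuous_on A (pos_pow m)"
  unfolding pos_pow_def[abs_def] by (intro continuous_intros)

lemma DERIV_pos_pow:
  "(pos_pow 4 has_real_derivative 4 * pos_pow 3 s) (at s)"
  "(pos_pow 3 has_real_derivative 3 * pos_pow 2 s) (at s)"
  "(pos_pow 2 has_real_derivative 2 * pos_pow 1 s) (at s)"
  using DERIV_pos_part_power[of 2 s] DERIV_pos_part_power[of 1 s] DERIV_pos_part_power[of 0 s]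
  by (simp_all add: pos_pow_def[abs_def] numeral_eq_Suc)

text \<open>The cube of the positive part is twice continuously differentiable, so this composition
  rises from 0 to 1 on the unit interval as a C2 function whose derivatives have numerical
  bounds.\<close>

definition step :: "real \<Rightarrow> real" where "step s = 1 - pos_pow 3 (1 - pos_pow 3 s)"
definition step1 :: "real \<Rightarrow> real" where "step1 s = 9 * pos_pow 2 (1 - pos_pow 3 s) * pos_pow 2 s"
definition step2 :: "real \<Rightarrow> real" where
  "step2 s = 18 * pos_pow 2 (1 - pos_pow 3 s) * pos_pow 1 s - 54 * pos_pow 1 (1 - pos_pow 3 s) * (pos_pow 2 s)\<^sup>2"

lemma DERIV_step: "(step has_real_derivative step1 s) (at s)"
proof -
  have 1: "((\<lambda>s. 1 - pos_pow 3 s) has_real_derivative 0 - 3 * pos_pow 2 s) (at s)"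
    by (intro DERIV_diff DERIV_const DERIV_pos_pow)
  have "((\<lambda>s. pos_pow 3 (1 - pos_pow 3 s)) has_real_derivative 3 * pos_pow 2 (1 - pos_pow 3 s) * (0 - 3 * pos_pow 2 s)) (at s)"
    by (rule DERIV_chain2[where f = "pos_pow 3", OF DERIV_pos_pow(2) 1])
  then have "(step has_real_derivative 0 - 3 * pos_pow 2 (1 - pos_pow 3 s) * (0 - 3 * pos_pow 2 s)) (at s)"
    unfolding step_def[abs_def] by (intro DERIV_diff DERIV_const)
  then show ?thesis
    by (simp add: step1_def mult.assoc)
qed

lemma DERIV_step1: "(step1 has_real_derivative step2 s) (at s)"
proof -
  have 1: "((\<lambda>s. 1 - pos_pow 3 s) has_real_derivative 0 - 3 * pos_pow 2 s) (at s)"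
    by (intro DERIV_diff DERIV_const DERIV_pos_pow)
  have 2: "((\<lambda>s. 9 * pos_pow 2 (1 - pos_pow 3 s)) has_real_derivative 9 * (2 * pos_pow 1 (1 - pos_pow 3 s) * (0 - 3 * pos_pow 2 s))) (at s)"
    by (rule DERIV_cmult[OF DERIV_chain2[where f = "pos_pow 2", OF DERIV_pos_pow(3) 1]])
  have "(step1 has_real_derivative 9 * (2 * pos_pow 1 (1 - pos_pow 3 s) * (0 - 3 * pos_pow 2 s)) * pos_pow 2 s
      + (2 * pos_pow 1 s) * (9 * pos_pow 2 (1 - pos_pow 3 s))) (at s)"
    unfolding step1_def[abs_def] by (rule DERIV_mult[OF 2 DERIV_pos_pow(3)])
  then show ?thesis
    by (rule DERIV_cong) (simp add: step2_def power2_eq_square)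
qed

lemma step_values:
  "s \<le> 0 \<Longrightarrow> step s = 0" "s \<ge> 1 \<Longrightarrow> step s = 1" "0 \<le> step s" "step s \<le> 1"
  "s \<ge> 1 \<or> s \<le> 0 \<Longrightarrow> step1 s = 0" "s \<ge> 1 \<or> s \<le> 0 \<Longrightarrow> step2 s = 0" "\<bar>step1 s\<bar> \<le> 9" "\<bar>step2 s\<bar> \<le> 72"
proof -
  have p1: "pos_pow m s \<ge> 1" if "s \<ge> 1" for m s
    using that by (simp add: pos_pow_def max_def one_le_power)
  have b: "1 - pos_pow 3 s \<le> 1"
    using pos_pow_nonneg[of 3 s] by simp
  show "s \<le> 0 \<Longrightarrow> step s = 0"
    by (simp add: step_def pos_pow_eq_0) (simp add: pos_pow_def)
  show "s \<ge> 1 \<Longrightarrow> step s = 1"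
    using p1[of s 3] by (simp add: step_def pos_pow_eq_0)
  show "0 \<le> step s" "step s \<le> 1"
    using pos_pow_le_1[OF b, of 3] pos_pow_nonneg[of 3] by (simp_all add: step_def)
  show s1: "s \<ge> 1 \<or> s \<le> 0 \<Longrightarrow> step1 s = 0"
    using p1[of s 3] by (auto simp: step1_def pos_pow_eq_0)
  show s2: "s \<ge> 1 \<or> s \<le> 0 \<Longrightarrow> step2 s = 0"
    using p1[of s 3] by (auto simp: step2_def pos_pow_eq_0)
  show "\<bar>step1 s\<bar> \<le> 9"
  proof (cases "s \<ge> 1 \<or> s \<le> 0")
    case False
    then have "pos_pow 2 (1 - pos_pow 3 s) * pos_pow 2 s \<le> 1 * 1"
      by (intro mult_mono pos_pow_le_1 b) (auto simp: pos_pow_nonneg)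
    moreover have "0 \<le> pos_pow 2 (1 - pos_pow 3 s) * pos_pow 2 s"
      by (simp add: pos_pow_nonneg)
    ultimately show ?thesis
      by (simp add: step1_def)
  qed (use s1 in simp)
  show "\<bar>step2 s\<bar> \<le> 72"
  proof (cases "s \<ge> 1 \<or> s \<le> 0")
    case False
    have "pos_pow 2 (1 - pos_pow 3 s) * pos_pow 1 s \<le> 1 * 1"
      using False by (intro mult_mono pos_pow_le_1 b) (auto simp: pos_pow_nonneg)
    moreover have "0 \<le> pos_pow 2 (1 - pos_pow 3 s) * pos_pow 1 s" "0 \<le> pos_pow 1 (1 - pos_pow 3 s) * (pos_pow 2 s)\<^sup>2"
      by (simp_all add: pos_pow_nonneg)
    moreover have "pos_pow 1 (1 - pos_pow 3 s) * (pos_pow 2 s)\<^sup>2 \<le> 1 * 1"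
      using False by (intro mult_mono power_le_one pos_pow_le_1 b) (auto simp: pos_pow_nonneg)
    ultimately show ?thesis
      unfolding step2_def mult.assoc by linarith
  qed (use s2 in simp)
qed

text \<open>The transition takes place in the squared distance, which is smooth at \<open>c\<close>.
  With \<open>d = b^2 - a^2\<close> the last two assumptions say \<open>b / d \<le> 3\<close> and
  \<open>1 / d \<le> 6\<close>, so the bounds on the derivatives do not depend on the radii.\<close>

lemma bump_exists:
  fixes c :: "real^'n"
  assumes ab: "0 < a" "a < b" "b \<le> 3 * (b\<^sup>2 - a\<^sup>2)" "1 \<le> 6 * (b\<^sup>2 - a\<^sup>2)"
  obtains \<theta> D\<theta> D2\<theta> where "C2_on UNIV \<theta> D\<theta> D2\<theta>" "\<And>x. 0 \<le> \<theta> x" "\<And>x. \<theta> x \<le> 1"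
    "\<And>x. norm (x - c) \<le> a \<Longrightarrow> \<theta> x = 1" "\<And>x. norm (x - c) \<ge> b \<Longrightarrow> \<theta> x = 0"
    "\<And>i x. norm (x - c) \<le> a \<or> norm (x - c) \<ge> b \<Longrightarrow> D\<theta> i x = 0 \<and> D2\<theta> i i x = 0"
    "\<And>i x. \<bar>D\<theta> i x\<bar> \<le> 54" "\<And>x. \<bar>\<Sum>i\<in>UNIV. D2\<theta> i i x\<bar> \<le> 2592 + 108 * real CARD('n)"
proof -
  define d where "d = b\<^sup>2 - a\<^sup>2"
  have d: "d > 0" "b / d \<le> 3" "1 / d \<le> 6"
    using ab power_strict_mono[of a b 2] by (auto simp: d_def field_simps)
  define \<tau> where "\<tau> x = ((norm (x - c))\<^sup>2 - a\<^sup>2) / d" for x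
  define \<theta> where "\<theta> x = 1 - step (\<tau> x)" for x
  define D\<theta> where "D\<theta> i x = - (step1 (\<tau> x) * (2 / d * (x $ i - c $ i)))" for i x
  define D2\<theta> where "D2\<theta> i j x = - (step1 (\<tau> x) * (2 / d * (if j = i then 1 else 0))
      + step2 (\<tau> x) * (2 / d * (x $ j - c $ j)) * (2 / d * (x $ i - c $ i)))" for i j x
  have g\<tau>: "has_grad \<tau> (\<lambda>i. 2 / d * (x $ i - c $ i)) x" for x
  proof -
    have "has_grad (\<lambda>x. 1 / d * ((norm (x - c))\<^sup>2 - a\<^sup>2)) (\<lambda>i. 1 / d * (2 * (x $ i - c $ i) - 0) + 0 * ((norm (x - c))\<^sup>2 - a\<^sup>2)) x"
      by (intro has_grad_mult has_grad_diff has_grad_const has_grad_norm_sq)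
    then show ?thesis
      unfolding \<tau>_def[abs_def] by (simp add: has_grad_def)
  qed
  have cp: "continuous_on UNIV (\<lambda>s. pos_pow m (1 - pos_pow 3 s))" for m
    by (rule continuous_on_compose2[OF continuous_on_pos_pow[of UNIV]])
      (auto intro!: continuous_intros continuous_on_pos_pow)
  have cs1: "continuous_on UNIV step1"
    unfolding step1_def[abs_def] by (intro continuous_on_mult continuous_on_const cp continuous_on_pos_pow)
  have cs2: "continuous_on UNIV step2"
    unfolding step2_def[abs_def]
    by (intro continuous_on_diff continuous_on_power continuous_on_mult continuous_on_const cp continuous_on_pos_pow)
  have c\<tau>: "continuous_on UNIV \<tau>"
    unfolding \<tau>_def[abs_def] using d by (intro continuous_intros) auto
  have \<tau>1: "\<tau> x \<ge> 1" if "norm (x - c) \<ge> b" for x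
    using power_mono[OF that, of 2] ab d(1) by (simp add: \<tau>_def d_def le_divide_eq)
  have \<tau>0: "\<tau> x \<le> 0" if "norm (x - c) \<le> a" for x
    using power_mono[OF that norm_ge_zero, of 2] d(1) by (simp add: \<tau>_def divide_le_0_iff)
  have sup: "step1 (\<tau> x) = 0" "step2 (\<tau> x) = 0" if "norm (x - c) \<le> a \<or> norm (x - c) \<ge> b" for x
    using step_values(5,6)[of "\<tau> x"] that \<tau>0[of x] \<tau>1[of x] by blast+
  have "C2_on UNIV \<theta> D\<theta> D2\<theta>"
    unfolding C2_on_def
  proof (intro conjI ballI allI)
    fix x i j
    have "has_grad \<theta> (\<lambda>i. 0 - step1 (\<tau> x) * (2 / d * (x $ i - c $ i))) x"
      unfolding \<theta>_def[abs_def]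
      by (intro has_grad_diff has_grad_const has_grad_field[where g = step, OF DERIV_step g\<tau>])
    then show "has_grad \<theta> (\<lambda>i. D\<theta> i x) x"
      by (simp add: D\<theta>_def)
    have "has_grad (\<lambda>x. 0 - step1 (\<tau> x) * (2 / d * (x $ i - c $ i)))
      (\<lambda>j. 0 - (step1 (\<tau> x) * (2 / d * (if j = i then 1 else 0) + 0 * (x $ i - c $ i))
        + step2 (\<tau> x) * (2 / d * (x $ j - c $ j)) * (2 / d * (x $ i - c $ i)))) x"
      by (intro has_grad_diff has_grad_mult has_grad_const has_grad_nth has_grad_field[where g = step1, OF DERIV_step1 g\<tau>])
    then show "has_grad (D\<theta> i) (\<lambda>j. D2\<theta> i j x) x"
      by (simp add: D\<theta>_def[abs_def] D2\<theta>_def)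
    show "D2\<theta> i j x = D2\<theta> j i x"
      by (simp add: D2\<theta>_def)
  next
    fix i j
    show "continuous_on UNIV (D2\<theta> i j)"
      unfolding D2\<theta>_def[abs_def]
      by (intro continuous_intros continuous_on_compose2[OF cs1 c\<tau>] continuous_on_compose2[OF cs2 c\<tau>]) auto
  qed
  moreover have "0 \<le> \<theta> x" "\<theta> x \<le> 1" for x
    using step_values(3,4) by (simp_all add: \<theta>_def)
  moreover have "\<theta> x = 1" if "norm (x - c) \<le> a" for x
    using \<tau>0[OF that] by (simp add: \<theta>_def step_values)
  moreover have "\<theta> x = 0" if "norm (x - c) \<ge> b" for x
    using \<tau>1[OF that] by (simp add: \<theta>_def step_values)
  moreover have "D\<theta> i x = 0 \<and> D2\<theta> i i x = 0" if "norm (x - c) \<le> a \<or> norm (x - c) \<ge> b" for i x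
    using sup[OF that] by (simp add: D\<theta>_def D2\<theta>_def)
  \<comment> \<open>Here 54 = 9 * 6, from \<open>|step1| \<le> 9\<close> and
    \<open>2 * b / d \<le> 6\<close>. In the bound for the Laplacian, 2592 = 72 * 6^2 and 108 = 9 *
    12.\<close>
  moreover have "\<bar>D\<theta> i x\<bar> \<le> 54" for i x
  proof (cases "norm (x - c) > b")
    case False
    have "\<bar>x $ i - c $ i\<bar> \<le> b"
      using component_le_norm_cart[of "x - c" i] False by simp
    then have "2 / d * \<bar>x $ i - c $ i\<bar> \<le> 2 / d * b"
      using d by (intro mult_left_mono) auto
    also have "\<dots> \<le> 6"
      using d(2) by simp
    finally have "\<bar>step1 (\<tau> x)\<bar> * (2 / d * \<bar>x $ i - c $ i\<bar>) \<le> 9 * 6"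
      using d step_values(7) by (intro mult_mono) auto
    moreover have "\<bar>2 / d\<bar> = 2 / d"
      using d by simp
    ultimately show ?thesis
      unfolding D\<theta>_def abs_minus_cancel abs_mult by simp
  qed (use sup[of x] in \<open>simp add: D\<theta>_def\<close>)
  moreover have "\<bar>\<Sum>i\<in>UNIV. D2\<theta> i i x\<bar> \<le> 2592 + 108 * real CARD('n)" for x
  proof (cases "norm (x - c) > b")
    case False
    have "(\<Sum>i\<in>UNIV. D2\<theta> i i x) = - (real CARD('n) * (step1 (\<tau> x) * (2 / d)) + step2 (\<tau> x) * (2 / d)\<^sup>2 * (norm (x - c))\<^sup>2)"
    proof -
      have "- (A * (e * 1) + B * (e * z) * (e * z)) = - (A * e) + (- (B * e\<^sup>2)) * z\<^sup>2" for A B e z :: real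
        by (simp add: power2_eq_square)
      then have "D2\<theta> i i x = - (step1 (\<tau> x) * (2 / d)) + (- (step2 (\<tau> x) * (2 / d)\<^sup>2)) * ((x - c) $ i)\<^sup>2" for i
        by (simp only: D2\<theta>_def if_True simp_thms vector_minus_component)
      then show ?thesis
        unfolding norm_cart_sq by (simp only: sum.distrib sum_distrib_left[symmetric]) simp
    qed
    also have "\<bar>\<dots>\<bar> \<le> \<bar>real CARD('n) * (step1 (\<tau> x) * (2 / d))\<bar> + \<bar>step2 (\<tau> x) * (2 / d)\<^sup>2 * (norm (x - c))\<^sup>2\<bar>"
      unfolding abs_minus_cancel by (rule abs_triangle_ineq)
    also have "\<dots> \<le> real CARD('n) * (9 * 12) + 72 * 36"
    proof (rule add_mono)
      show "\<bar>real CARD('n) * (step1 (\<tau> x) * (2 / d))\<bar> \<le> real CARD('n) * (9 * 12)"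
        unfolding abs_mult using d step_values(7) by (intro mult_mono) auto
      have "(2 / d * norm (x - c))\<^sup>2 \<le> 6\<^sup>2"
      proof (rule power_mono)
        have "2 / d * norm (x - c) \<le> 2 / d * b"
          using False d by (intro mult_left_mono) auto
        then show "2 / d * norm (x - c) \<le> 6"
          using d(2) by simp
      qed (use d in simp)
      then have "\<bar>step2 (\<tau> x)\<bar> * (2 / d * norm (x - c))\<^sup>2 \<le> 72 * 6\<^sup>2"
        using step_values(8) by (intro mult_mono) auto
      then show "\<bar>step2 (\<tau> x) * (2 / d)\<^sup>2 * (norm (x - c))\<^sup>2\<bar> \<le> 72 * 36"
        by (simp add: abs_mult power_mult_distrib power_divide mult_ac)
    qed
    finally show ?thesis
      by simp
  qed (use sup[of x] in \<open>simp add: D2\<theta>_def\<close>)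
  ultimately show ?thesis
    using that by blast
qed

text \<open>The subsolution inequality tested with a cutoff between the two balls; the constant is
  the bound for the Laplacian of the cutoff plus \<Gamma>.\<close>

lemma caccioppoli:
  fixes v F :: "real^'n \<Rightarrow> complex"
  assumes H: "H2_approx v G F" and ab: "0 < a" "a < b" "b \<le> 3 * (b\<^sup>2 - a\<^sup>2)" "1 \<le> 6 * (b\<^sup>2 - a\<^sup>2)"
    and F: "AE x in lborel. cmod (F x + lam * v x) \<le> A2 * sqrt (\<Sum>i\<in>UNIV. (cmod (G i x))\<^sup>2) + A1 * cmod (v x)"
    and A: "0 \<le> A1"
  shows "(LINT x:cball c a|lborel. (\<Sum>i\<in>UNIV. (norm (G i x))\<^sup>2))
    \<le> (2592 + 108 * real CARD('n) + A2\<^sup>2 + 2 * (A1 + cmod lam)) * (LINT x:cball c b|lborel. (norm (v x))\<^sup>2)"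
proof -
  define \<Gamma> where "\<Gamma> = A2\<^sup>2 + 2 * (A1 + cmod lam)"
  have \<Gamma>: "\<Gamma> \<ge> 0"
    using A by (simp add: \<Gamma>_def)
  obtain \<theta> D\<theta> D2\<theta> where \<theta>: "C2_on UNIV \<theta> D\<theta> D2\<theta>" "\<And>x. 0 \<le> \<theta> x" "\<And>x. \<theta> x \<le> 1"
    "\<And>x. norm (x - c) \<le> a \<Longrightarrow> \<theta> x = 1" "\<And>x. norm (x - c) \<ge> b \<Longrightarrow> \<theta> x = 0"
    "\<And>i x. norm (x - c) \<le> a \<or> norm (x - c) \<ge> b \<Longrightarrow> D\<theta> i x = 0 \<and> D2\<theta> i i x = 0"
    "\<And>i x. \<bar>D\<theta> i x\<bar> \<le> 54" "\<And>x. \<bar>\<Sum>i\<in>UNIV. D2\<theta> i i x\<bar> \<le> 2592 + 108 * real CARD('n)"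
    by (rule bump_exists[OF ab, of c], rule that)
  note c\<theta> = continuous_on_subset[OF C2_on_continuous(1)[OF \<theta>(1)] subset_UNIV]
    continuous_on_subset[OF C2_on_continuous(3)[OF \<theta>(1)] subset_UNIV]
  note int = H2_approx_integrable[OF H compact_cball]
  have "(LINT x:cball c a|lborel. (\<Sum>i\<in>UNIV. (norm (G i x))\<^sup>2)) \<le> (LINT x:cball c b|lborel. \<theta> x * (\<Sum>i\<in>UNIV. (norm (G i x))\<^sup>2))"
    unfolding set_lebesgue_integral_def
  proof (rule integral_mono)
    show "integrable lborel (\<lambda>x. indicator (cball c a) x *\<^sub>R (\<Sum>i\<in>UNIV. (norm (G i x))\<^sup>2))"
      using int(2)[of c a "\<lambda>x. 1"] by (simp add: set_integrable_def)
    show "integrable lborel (\<lambda>x. indicator (cball c b) x *\<^sub>R (\<theta> x * (\<Sum>i\<in>UNIV. (norm (G i x))\<^sup>2)))"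
      using int(2)[OF c\<theta>(1)] by (simp add: set_integrable_def)
    fix x
    have "0 \<le> (\<Sum>i\<in>UNIV. (norm (G i x))\<^sup>2)"
      by (auto intro: sum_nonneg)
    then show "indicator (cball c a) x *\<^sub>R (\<Sum>i\<in>UNIV. (norm (G i x))\<^sup>2)
      \<le> indicator (cball c b) x *\<^sub>R (\<theta> x * (\<Sum>i\<in>UNIV. (norm (G i x))\<^sup>2))"
      using \<theta>(4)[of x] \<theta>(2)[of x] ab by (auto simp: indicator_def dist_norm norm_minus_commute)
  qed
  also have "\<dots> \<le> (LINT x:cball c b|lborel. ((\<Sum>i\<in>UNIV. D2\<theta> i i x) + \<Gamma> * \<theta> x) * (norm (v x))\<^sup>2)"
    unfolding \<Gamma>_def
    by (rule H2_approx_subsolution[OF H compact_cball \<theta>(1,2) _ F])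
      (use \<theta>(5) in \<open>auto simp: dist_norm norm_minus_commute\<close>)
  also have "\<dots> \<le> (LINT x:cball c b|lborel. (2592 + 108 * real CARD('n) + \<Gamma>) * (norm (v x))\<^sup>2)"
  proof (rule set_integral_mono)
    show "set_integrable lborel (cball c b) (\<lambda>x. ((\<Sum>i\<in>UNIV. D2\<theta> i i x) + \<Gamma> * \<theta> x) * (norm (v x))\<^sup>2)"
      by (intro int(1) continuous_intros c\<theta>)
    show "set_integrable lborel (cball c b) (\<lambda>x. (2592 + 108 * real CARD('n) + \<Gamma>) * (norm (v x))\<^sup>2)"
      by (intro int(1) continuous_intros)
    fix x
    have "(\<Sum>i\<in>UNIV. D2\<theta> i i x) \<le> 2592 + 108 * real CARD('n)"
      using \<theta>(8)[of x] by linarith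
    moreover have "\<Gamma> * \<theta> x \<le> \<Gamma> * 1"
      using \<Gamma> \<theta>(3) by (intro mult_left_mono)
    ultimately show "((\<Sum>i\<in>UNIV. D2\<theta> i i x) + \<Gamma> * \<theta> x) * (norm (v x))\<^sup>2
      \<le> (2592 + 108 * real CARD('n) + \<Gamma>) * (norm (v x))\<^sup>2"
      by (intro mult_right_mono) auto
  qed
  finally show ?thesis
    by (simp add: \<Gamma>_def add.assoc)
qed

section \<open>Mass near the origin\<close>

lemma integral_cbox_eq_set_integral:
  fixes h :: "'a::euclidean_space \<Rightarrow> real"
  assumes "continuous_on UNIV h" "compact K" "\<And>x. x \<notin> K \<Longrightarrow> h x = 0" "K \<subseteq> cbox a b"
  shows "integral (cbox a b) h = (LINT x:K|lborel. h x)"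
proof -
  have "integral (cbox a b) h = integral UNIV h"
    by (subst integral_restrict_UNIV[symmetric]) (use assms in \<open>force intro!: integral_cong\<close>)
  also have "\<dots> = (LINT x|lborel. h x)"
    by (rule integral_lborel[OF integrable_compact_support[OF assms(1-3)]])
  also have "\<dots> = (LINT x:K|lborel. h x)"
    unfolding set_lebesgue_integral_def
    by (rule Bochner_Integration.integral_cong) (use assms(3) in \<open>auto simp: indicator_def\<close>)
  finally show ?thesis .
qed

definition profile :: "real \<Rightarrow> real^'n \<Rightarrow> real" where
  "profile t x = 1 - (norm x)\<^sup>2 / t\<^sup>2"

text \<open>The kernel \<open>avg_kernel t\<close> is a rescaled average over the ball of radius \<open>t\<close>. Its \<open>t\<close>-derivative is
  \<open>t\<close> to the power \<open>-n-1\<close> times the Laplacian of the nonnegative function \<open>avg_potential t\<close>, which is what makes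
  averages of subharmonic functions monotone in \<open>t\<close>.\<close>

definition avg_kernel :: "real \<Rightarrow> real^'n \<Rightarrow> real" where
  "avg_kernel t x = pos_pow 3 (profile t x) / t ^ CARD('n)"

text \<open>The factor \<open>t^2 / 8\<close> normalises the gradient to
  \<open>- pos_pow 3 (profile t x)\<close> times \<open>x\<close>, the profile of
  \<open>avg_kernel\<close>.\<close>

definition avg_potential :: "real \<Rightarrow> real^'n \<Rightarrow> real" where
  "avg_potential t x = t\<^sup>2 / 8 * pos_pow 4 (profile t x)"

definition avg_laplacian :: "real \<Rightarrow> real^'n \<Rightarrow> real" where
  "avg_laplacian t x = 6 * (norm x)\<^sup>2 / t\<^sup>2 * pos_pow 2 (profile t x) - real CARD('n) * pos_pow 3 (profile t x)"

lemma profile_le: "profile t x \<le> 1"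
  by (simp add: profile_def)

lemma profile_nonpos:
  assumes "norm x \<ge> t" "t > 0"
  shows "profile t x \<le> 0"
  using power_mono[OF assms(1), of 2] assms(2) by (simp add: profile_def le_divide_eq)

lemma C2_on_avg_potential:
  assumes t: "t > 0"
  obtains D D2 where "C2_on UNIV (avg_potential t :: real^'n \<Rightarrow> real) D D2"
    "\<And>x. (\<Sum>i\<in>UNIV. D2 i i x) = avg_laplacian t x"
proof -
  let ?p = "profile t :: real^'n \<Rightarrow> real"
  define D where "D i x = - (x $ i * pos_pow 3 (?p x))" for i :: 'n and x
  define D2 where "D2 i j x = - (x $ i * (3 * pos_pow 2 (?p x) * (- 2 / t\<^sup>2 * x $ j)) + (if j = i then 1 else 0) * pos_pow 3 (?p x))"
    for i j :: 'n and x
  have gp: "has_grad ?p (\<lambda>i. - 2 / t\<^sup>2 * x $ i) x" for x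
  proof -
    have "has_grad (\<lambda>x :: real^'n. 1 - 1 / t\<^sup>2 * (norm (x - 0))\<^sup>2) (\<lambda>i. 0 - (1 / t\<^sup>2 * (2 * (x $ i - 0 $ i)) + 0 * (norm (x - 0))\<^sup>2)) x"
      by (intro has_grad_diff has_grad_mult has_grad_const has_grad_norm_sq)
    then show ?thesis
      unfolding profile_def[abs_def] by (simp add: has_grad_def)
  qed
  have gn: "has_grad (\<lambda>x. x $ i) (\<lambda>j. if j = i then 1 else 0) x" for i and x :: "real^'n"
    using has_grad_nth[of i 0 x] by simp
  have cp: "continuous_on UNIV (\<lambda>x. pos_pow m (?p x))" for m
    by (rule continuous_on_compose2[OF continuous_on_pos_pow[of UNIV]])
      (use has_grad_continuous_on[of UNIV ?p, OF gp] in auto)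
  have "C2_on UNIV (avg_potential t) D D2"
    unfolding C2_on_def
  proof (intro conjI ballI allI)
    fix x :: "real^'n" and i j :: 'n
    have "has_grad (avg_potential t) (\<lambda>i. t\<^sup>2 / 8 * (4 * pos_pow 3 (?p x) * (- 2 / t\<^sup>2 * x $ i)) + 0 * pos_pow 4 (?p x)) x"
      unfolding avg_potential_def[abs_def]
      by (intro has_grad_mult has_grad_const has_grad_field[where g = "pos_pow 4", OF DERIV_pos_pow(1) gp])
    then show "has_grad (avg_potential t) (\<lambda>i. D i x) x"
      by (rule has_grad_cong) (use t in \<open>simp add: D_def\<close>)
    have "has_grad (\<lambda>x. 0 - x $ i * pos_pow 3 (?p x)) (\<lambda>j. 0 - (x $ i * (3 * pos_pow 2 (?p x) * (- 2 / t\<^sup>2 * x $ j))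
        + (if j = i then 1 else 0) * pos_pow 3 (?p x))) x"
      by (intro has_grad_diff has_grad_mult has_grad_const gn has_grad_field[where g = "pos_pow 3", OF DERIV_pos_pow(2) gp])
    then show "has_grad (D i) (\<lambda>j. D2 i j x) x"
      by (simp add: D_def[abs_def] D2_def)
    show "D2 i j x = D2 j i x"
      by (simp add: D2_def)
  next
    fix i j :: 'n
    show "continuous_on UNIV (D2 i j)"
      unfolding D2_def[abs_def] by (intro continuous_on_minus continuous_on_add continuous_on_mult continuous_on_const
          continuous_on_component continuous_on_id cp)
  qed
  moreover have "(\<Sum>i\<in>UNIV. D2 i i x) = avg_laplacian t x" for x
  proof -
    have "D2 i i x = 6 / t\<^sup>2 * pos_pow 2 (?p x) * (x $ i)\<^sup>2 - pos_pow 3 (?p x)" for i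
      by (simp add: D2_def power2_eq_square)
    then have "(\<Sum>i\<in>UNIV. D2 i i x) = 6 / t\<^sup>2 * pos_pow 2 (?p x) * (norm x)\<^sup>2 - (\<Sum>i\<in>(UNIV :: 'n set). pos_pow 3 (?p x))"
      unfolding norm_cart_sq by (simp only: sum_subtractf sum_distrib_left[symmetric])
    then show ?thesis
      by (simp add: avg_laplacian_def mult_ac)
  qed
  ultimately show ?thesis
    using that by blast
qed

lemma DERIV_avg_kernel:
  fixes x :: "real^'n"
  assumes t: "t > 0"
  shows "((\<lambda>t. avg_kernel t x) has_real_derivative avg_laplacian t x / t ^ Suc CARD('n)) (at t)"
proof -
  have 1: "((\<lambda>t. profile t x) has_real_derivative 2 * (norm x)\<^sup>2 / t ^ 3) (at t)"
    unfolding profile_def using t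
    by (auto intro!: derivative_eq_intros simp: power2_eq_square power3_eq_cube field_simps)
  have 2: "((\<lambda>t. pos_pow 3 (profile t x)) has_real_derivative 3 * pos_pow 2 (profile t x) * (2 * (norm x)\<^sup>2 / t ^ 3)) (at t)"
    by (rule DERIV_chain2[where f = "pos_pow 3", OF DERIV_pos_pow(2) 1])
  have 3: "((\<lambda>t. t ^ CARD('n)) has_real_derivative real CARD('n) * t ^ (CARD('n) - 1)) (at t)"
    using DERIV_pow[of "CARD('n)" t UNIV] by simp
  have "((\<lambda>t. avg_kernel t x) has_real_derivative
     (3 * pos_pow 2 (profile t x) * (2 * (norm x)\<^sup>2 / t ^ 3) * t ^ CARD('n)
        - pos_pow 3 (profile t x) * (real CARD('n) * t ^ (CARD('n) - 1))) / (t ^ CARD('n) * t ^ CARD('n))) (at t)"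
    unfolding avg_kernel_def using t by (intro DERIV_divide 2 3) auto
  moreover have "(3 * a * (2 * s / t ^ 3) * t ^ k - b * (real k * t ^ (k - 1))) / (t ^ k * t ^ k)
      = (6 * s / t\<^sup>2 * a - real k * b) / t ^ Suc k" if k0: "k > 0" for a b s and k :: nat
  proof -
    obtain l where k: "k = Suc l"
      using k0 gr0_conv_Suc by auto
    define T where "T = t ^ l"
    have T: "T \<noteq> 0" "t ^ k = t * T" "t ^ (k - 1) = T" "t ^ Suc k = t * (t * T)"
      using t by (simp_all add: T_def k)
    have e: "3 * a * (2 * s / t ^ 3) * t = 6 * s / t\<^sup>2 * a"
      using t by (simp add: power2_eq_square power3_eq_cube)
    have "3 * a * (2 * s / t ^ 3) * (t * T) - b * (real k * T) = (3 * a * (2 * s / t ^ 3) * t) * T - (real k * b) * T"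
      by (simp only: mult_ac)
    also have "\<dots> = T * (6 * s / t\<^sup>2 * a - real k * b)"
      unfolding e by (simp only: right_diff_distrib mult_ac)
    finally have "3 * a * (2 * s / t ^ 3) * (t * T) - b * (real k * T) = T * (6 * s / t\<^sup>2 * a - real k * b)" .
    moreover have "(t * T) * (t * T) = T * (t * (t * T))"
      by (simp only: mult_ac)
    ultimately show ?thesis
      unfolding T(2-4) using T(1) by (simp only: nonzero_mult_divide_mult_cancel_left[OF T(1)])
  qed
  ultimately show ?thesis
    unfolding avg_laplacian_def by (simp only: zero_less_card_finite)
qed

lemma continuous_on_profile: "continuous_on ({0<..} \<times> UNIV) (\<lambda>(t, x :: real^'n). profile t x)"
  unfolding profile_def split_beta by (intro continuous_intros) auto

text \<open>For \<open>t < 1\<close> the kernel is supported in the unit ball, so the integral can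
  be differentiated over a fixed box.\<close>

lemma DERIV_average:
  fixes f :: "real^'n \<Rightarrow> real"
  assumes f: "continuous_on UNIV f" and t: "0 < t" "t < 1"
  shows "((\<lambda>t. LINT x:cball 0 1|lborel. f x * avg_kernel t x) has_real_derivative
     (LINT x:cball 0 1|lborel. f x * avg_laplacian t x) / t ^ Suc CARD('n)) (at t)"
proof -
  obtain a where ab: "cball 0 1 \<subseteq> cbox (- a) (a :: real^'n)"
    using bounded_subset_cbox_symmetric[OF bounded_cball[of "0::real^'n" 1]] by metis
  have cpp: "continuous_on ({0<..} \<times> UNIV) (\<lambda>(t, x :: real^'n). pos_pow m (profile t x))" for m
    using continuous_on_compose2[OF continuous_on_pos_pow[of UNIV] continuous_on_profile] by (simp add: split_beta)
  have cl: "continuous_on ({0<..} \<times> UNIV) (\<lambda>z. f (snd z) * (avg_laplacian (fst z) (snd z) / fst z ^ Suc CARD('n)))"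
    unfolding avg_laplacian_def
    by (intro continuous_intros continuous_on_compose2[OF f] cpp[unfolded split_beta]) auto
  have slice: "continuous_on UNIV (\<lambda>x :: real^'n. (s, x))" for s :: real
    by (intro continuous_intros)
  have ck: "continuous_on UNIV (\<lambda>x. f x * avg_kernel s x)" if "s > 0" for s
    unfolding avg_kernel_def divide_inverse
    by (intro continuous_on_mult f continuous_on_const
        continuous_on_compose2[OF cpp[unfolded split_beta] slice[of s], simplified]) (use that in auto)
  have cL: "continuous_on UNIV (\<lambda>x. f x * (avg_laplacian s x / s ^ Suc CARD('n)))" if "s > 0" for s
  proof -
    have "continuous_on UNIV (\<lambda>x. f (snd (s, x)) * (avg_laplacian (fst (s, x)) (snd (s, x)) / fst (s, x) ^ Suc CARD('n)))"
      by (rule continuous_on_compose2[OF cl slice]) (use that in auto)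
    then show ?thesis
      by simp
  qed
  have zero: "avg_kernel s x = 0" "avg_laplacian s x = 0" if "x \<notin> cball 0 1" "0 < s" "s \<le> 1" for s and x :: "real^'n"
    using profile_nonpos[of s x] that by (auto simp: avg_kernel_def avg_laplacian_def pos_pow_eq_0)
  have "((\<lambda>t. integral (cbox (- a) a) (\<lambda>x. f x * avg_kernel t x)) has_real_derivative
     integral (cbox (- a) a) (\<lambda>x. f x * (avg_laplacian t x / t ^ Suc CARD('n)))) (at t within {0<..})"
  proof (rule leibniz_rule_field_derivative)
    show "((\<lambda>t. f x * avg_kernel t x) has_real_derivative f x * (avg_laplacian s x / s ^ Suc CARD('n))) (at s within {0<..})"
      if "s \<in> {0<..}" for s and x :: "real^'n"
      using DERIV_cmult[OF has_field_derivative_at_within[OF DERIV_avg_kernel[of s x]]] that by simp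
    show "(\<lambda>x. f x * avg_kernel s x) integrable_on cbox (- a) a" if "s \<in> {0<..}" for s
      using ck[of s] that by (intro integrable_continuous) (auto intro: continuous_on_subset)
    show "continuous_on ({0<..} \<times> cbox (- a) a) (\<lambda>(t, x). f x * (avg_laplacian t x / t ^ Suc CARD('n)))"
      unfolding split_beta by (rule continuous_on_subset[OF cl]) auto
  qed (use t in auto)
  then have "((\<lambda>t. integral (cbox (- a) a) (\<lambda>x. f x * avg_kernel t x)) has_real_derivative
     integral (cbox (- a) a) (\<lambda>x. f x * (avg_laplacian t x / t ^ Suc CARD('n)))) (at t)"
    using t by (subst (asm) at_within_open) auto
  then have "((\<lambda>t. LINT x:cball 0 1|lborel. f x * avg_kernel t x) has_real_derivative
     integral (cbox (- a) a) (\<lambda>x. f x * (avg_laplacian t x / t ^ Suc CARD('n)))) (at t)"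
  proof (rule has_field_derivative_transform_within_open[where S = "{0<..<1}"])
    show "integral (cbox (- a) a) (\<lambda>x. f x * avg_kernel s x) = (LINT x:cball 0 1|lborel. f x * avg_kernel s x)"
      if "s \<in> {0<..<1}" for s
      by (rule integral_cbox_eq_set_integral[OF ck _ _ ab]) (use that zero in auto)
  qed (use t in auto)
  moreover have "integral (cbox (- a) a) (\<lambda>x. f x * (avg_laplacian t x / t ^ Suc CARD('n)))
      = (LINT x:cball 0 1|lborel. f x * (avg_laplacian t x / t ^ Suc CARD('n)))"
    by (rule integral_cbox_eq_set_integral[OF cL _ _ ab]) (use t zero in auto)
  ultimately show ?thesis
    using t by simp
qed

text \<open>For \<open>f = 1\<close> the derivative in \<open>t\<close> is a multiple of the
  integral of the Laplacian of a compactly supported function, hence zero. This replaces a change of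
  variables.\<close>

lemma average_of_one_constant:
  "\<exists>c>0. \<forall>t\<in>{0<..<1}. (LINT x:cball 0 1|lborel. avg_kernel t (x :: real^'n)) = c"
proof -
  define A where "A t = (LINT x:cball 0 1|lborel. avg_kernel t (x :: real^'n))" for t
  have "(A has_real_derivative 0) (at t within {0<..<1})" if t: "t \<in> {0<..<1}" for t
  proof -
    have t0: "t > 0"
      using t by simp
    obtain D D2 where C2: "C2_on UNIV (avg_potential t :: real^'n \<Rightarrow> real) D D2"
      and L: "\<And>x. (\<Sum>i\<in>UNIV. D2 i i x) = avg_laplacian t x"
      by (rule C2_on_avg_potential[OF t0], rule that)
    have one: "C2_on UNIV (\<lambda>x :: real^'n. 1 :: real) (\<lambda>i x. 0) (\<lambda>i j x. 0)"
      by (auto simp: C2_on_def has_grad_const)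
    have "(LINT x:cball 0 1|lborel. (\<Sum>i\<in>UNIV. (norm (1 :: real))\<^sup>2 * D2 i i x
        - 2 * avg_potential t x * ((norm (0 :: real))\<^sup>2 + 1 \<bullet> (0 :: real)))) = 0"
    proof (rule integral_laplacian_by_parts[OF open_UNIV compact_cball subset_UNIV one C2])
      show "avg_potential t x = 0" if "x \<in> UNIV - cball 0 1" for x :: "real^'n"
        using profile_nonpos[of t x] t that by (auto simp: avg_potential_def pos_pow_eq_0)
    qed
    then have "(LINT x:cball 0 1|lborel. 1 * avg_laplacian t (x :: real^'n)) = 0"
      by (simp add: L)
    then show ?thesis
      using has_field_derivative_at_within[OF DERIV_average[of "\<lambda>x :: real^'n. 1" t]] t by (simp add: A_def[abs_def])
  qed
  then obtain c where c: "\<And>t. t \<in> {0<..<1} \<Longrightarrow> A t = c"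
    using has_field_derivative_zero_constant[of "{0<..<1::real}" A] by (auto simp: convex_real_interval)
  have "c > 0"
  proof -
    have ck: "continuous_on UNIV (avg_kernel (1/2) :: real^'n \<Rightarrow> real)"
      unfolding avg_kernel_def[abs_def] profile_def[abs_def]
      by (intro continuous_on_divide continuous_on_compose2[OF continuous_on_pos_pow[of UNIV]] continuous_intros) auto
    have z: "avg_kernel (1/2) x = 0" if "x \<notin> cball 0 1" for x :: "real^'n"
      using profile_nonpos[of "1/2" x] that by (auto simp: avg_kernel_def pos_pow_eq_0)
    have "0 < (LINT x|lborel. avg_kernel (1/2) (x :: real^'n))"
      by (rule integral_pos_continuous[OF ck _ integrable_compact_support[OF ck compact_cball[of 0 1] z], where a = 0])
        (auto simp: avg_kernel_def pos_pow_nonneg profile_def pos_pow_def)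
    also have "\<dots> = A (1/2)"
      unfolding A_def set_lebesgue_integral_def
      by (rule Bochner_Integration.integral_cong) (use z in \<open>auto simp: indicator_def\<close>)
    finally show ?thesis
      using c[of "1/2"] by simp
  qed
  then show ?thesis
    using c by (auto simp: A_def)
qed

text \<open>The average \<open>A t\<close> of \<open>f\<close> plus \<open>B * t^2 / 2\<close> is
  nondecreasing. For small \<open>t\<close>, depending on \<open>f\<close>, it is at least
  \<open>c1 / 2\<close> by continuity at 0; monotonicity carries this to a radius \<delta> that
  depends on \<Gamma>, \<open>C0\<close> and the dimension only.\<close>

lemma lower_bound_near_origin:
  fixes \<Gamma> C0 :: real
  assumes \<Gamma>: "\<Gamma> \<ge> 0" and C0: "C0 > 0"
  shows "\<exists>c>0. \<forall>f :: real^'n \<Rightarrow> real. continuous_on UNIV f \<longrightarrow> (\<forall>x. 0 \<le> f x \<and> f x \<le> C0) \<longrightarrow> f 0 \<ge> 1 \<longrightarrow>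
     (\<forall>\<psi> D D2. C2_on UNIV \<psi> D D2 \<longrightarrow> (\<forall>x. 0 \<le> \<psi> x) \<longrightarrow> (\<forall>x. x \<notin> cball 0 1 \<longrightarrow> \<psi> x = 0) \<longrightarrow>
        0 \<le> (LINT x:cball 0 1|lborel. ((\<Sum>i\<in>UNIV. D2 i i x) + \<Gamma> * \<psi> x) * f x)) \<longrightarrow>
     c \<le> (LINT x:cball 0 1|lborel. f x)"
proof -
  obtain c1 where c1: "c1 > 0" "\<And>t. t \<in> {0<..<1} \<Longrightarrow> (LINT x:cball 0 1|lborel. avg_kernel t (x :: real^'n)) = c1"
    using average_of_one_constant by blast
  define n where "n = CARD('n)"
  define \<omega> where "\<omega> = unit_ball_vol (real n)"
  \<comment> \<open>\<open>B * t\<close> bounds the loss from \<Gamma> in the derivative of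
    \<open>A\<close>: ball volume \<open>\<omega> * t^n\<close> times the maximum
    \<open>t^2 / 8\<close> of the potential times \<open>\<Gamma> * C0\<close>, divided by
    \<open>t^(n + 1)\<close>.\<close>
  define B where "B = \<Gamma> * C0 * \<omega> / 8"
  have B: "B \<ge> 0"
    using \<Gamma> C0 by (simp add: B_def \<omega>_def)
  \<comment> \<open>Small enough that the correction \<open>B * \<delta>^2 / 2\<close> uses at most
    half of the initial value \<open>c1 / 2\<close>.\<close>
  define \<delta> where "\<delta> = min (1/2) (sqrt (c1 / (2 * (B + 1))))"
  have \<delta>: "0 < \<delta>" "\<delta> < 1" "B * \<delta>\<^sup>2 / 2 \<le> c1 / 4"
  proof -
    have p: "0 < c1 / (2 * (B + 1))"
      using c1 B by simp
    then show "0 < \<delta>" "\<delta> < 1"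
      by (auto simp: \<delta>_def min_less_iff_disj)
    then have "\<delta>\<^sup>2 \<le> (sqrt (c1 / (2 * (B + 1))))\<^sup>2"
      by (intro power_mono) (auto simp: \<delta>_def)
    then have "\<delta>\<^sup>2 \<le> c1 / (2 * (B + 1))"
      using p by simp
    then have "(B + 1) * \<delta>\<^sup>2 \<le> c1 / 2"
      using B by (simp add: field_simps)
    moreover have "B * \<delta>\<^sup>2 \<le> (B + 1) * \<delta>\<^sup>2"
      by (intro mult_right_mono) auto
    ultimately show "B * \<delta>\<^sup>2 / 2 \<le> c1 / 4"
      by simp
  qed
  have "\<delta> ^ n * (c1 / 4) \<le> (LINT x:cball 0 1|lborel. f x)"
    if f: "continuous_on UNIV f" "\<And>x. 0 \<le> f x" "\<And>x. f x \<le> C0" "f 0 \<ge> 1"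
    and sub: "\<And>\<psi> D D2. C2_on UNIV \<psi> D D2 \<Longrightarrow> (\<And>x. 0 \<le> \<psi> x) \<Longrightarrow> (\<And>x. x \<notin> cball 0 1 \<Longrightarrow> \<psi> x = 0) \<Longrightarrow>
        0 \<le> (LINT x:cball 0 1|lborel. ((\<Sum>i\<in>UNIV. D2 i i x) + \<Gamma> * \<psi> x) * f x)" for f :: "real^'n \<Rightarrow> real"
  proof -
    define A where "A t = (LINT x:cball 0 1|lborel. f x * avg_kernel t x)" for t
    have int: "set_integrable lborel (cball 0 1) h" if "continuous_on UNIV h" for h :: "real^'n \<Rightarrow> real"
      unfolding set_integrable_def
      by (intro borel_integrable_compact continuous_on_subset[OF that]) auto
    have cprof: "continuous_on UNIV (\<lambda>x. pos_pow m (profile t (x :: real^'n)))" for m t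
      unfolding profile_def divide_inverse
      by (intro continuous_on_compose2[OF continuous_on_pos_pow[of UNIV]] continuous_intros) auto
    have ck: "continuous_on UNIV (avg_kernel t :: real^'n \<Rightarrow> real)" for t
      unfolding avg_kernel_def[abs_def] divide_inverse by (intro continuous_intros cprof)
    have cpot: "continuous_on UNIV (avg_potential t :: real^'n \<Rightarrow> real)" for t
      unfolding avg_potential_def[abs_def] by (intro continuous_intros cprof)
    have cl: "continuous_on UNIV (avg_laplacian t :: real^'n \<Rightarrow> real)" for t
      unfolding avg_laplacian_def[abs_def] divide_inverse by (intro continuous_intros cprof)
    have kz: "avg_kernel t x = 0" "avg_potential t x = 0" if "norm x \<ge> t" "t > 0" for t and x :: "real^'n"
      using profile_nonpos[OF that] by (auto simp: avg_kernel_def avg_potential_def pos_pow_eq_0)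
    have k0: "0 \<le> avg_kernel t x" "0 \<le> avg_potential t x" if "t > 0" for t and x :: "real^'n"
      using that by (auto simp: avg_kernel_def avg_potential_def pos_pow_nonneg)
    have dA: "(LINT x:cball 0 1|lborel. f x * avg_laplacian t x) / t ^ Suc n \<ge> - B * t" if t: "0 < t" "t < 1" for t
    proof -
      obtain D D2 where C2: "C2_on UNIV (avg_potential t :: real^'n \<Rightarrow> real) D D2"
        and L: "\<And>x. (\<Sum>i\<in>UNIV. D2 i i x) = avg_laplacian t x"
        by (rule C2_on_avg_potential[OF t(1)], rule that)
      have "0 \<le> (LINT x:cball 0 1|lborel. ((\<Sum>i\<in>UNIV. D2 i i x) + \<Gamma> * avg_potential t x) * f x)"
        by (rule sub[OF C2]) (use k0 kz t in auto)
      also have "\<dots> = (LINT x:cball 0 1|lborel. f x * avg_laplacian t x + \<Gamma> * (avg_potential t x * f x))"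
        by (rule set_lebesgue_integral_cong) (auto simp: L algebra_simps)
      also have "\<dots> = (LINT x:cball 0 1|lborel. f x * avg_laplacian t x) + \<Gamma> * (LINT x:cball 0 1|lborel. avg_potential t x * f x)"
        using int[OF continuous_on_mult[OF f(1) cl]] int[OF continuous_on_mult[OF cpot f(1)]]
        by (subst set_integral_add) auto
      finally have 1: "- (\<Gamma> * (LINT x:cball 0 1|lborel. avg_potential t x * f x)) \<le> (LINT x:cball 0 1|lborel. f x * avg_laplacian t x)"
        by simp
      have fin: "emeasure lborel (cball 0 t :: (real^'n) set) < \<infinity>"
        using emeasure_compact_finite[OF compact_cball] by simp
      have "(LINT x:cball 0 1|lborel. avg_potential t x * f x) \<le> (LINT x|lborel. indicator (cball 0 t :: (real^'n) set) x * (t\<^sup>2 / 8 * C0))"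
        unfolding set_lebesgue_integral_def
      proof (rule integral_mono)
        show "integrable lborel (\<lambda>x. indicator (cball 0 1) x *\<^sub>R (avg_potential t x * f x))"
          using int[OF continuous_on_mult[OF cpot f(1)]] by (simp add: set_integrable_def)
        show "integrable lborel (\<lambda>x. indicator (cball 0 t :: (real^'n) set) x * (t\<^sup>2 / 8 * C0))"
          using fin by simp
        fix x
        show "indicator (cball 0 1) x *\<^sub>R (avg_potential t x * f x) \<le> indicator (cball 0 t) x * (t\<^sup>2 / 8 * C0)"
        proof (cases "norm x \<le> t")
          case True
          have "avg_potential t x \<le> t\<^sup>2 / 8 * 1"
            unfolding avg_potential_def by (intro mult_left_mono pos_pow_le_1 profile_le) auto
          then have "avg_potential t x * f x \<le> t\<^sup>2 / 8 * C0"
            using f(2,3) k0(2)[OF t(1)] by (intro mult_mono) auto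
          then show ?thesis
            using True t by simp
        next
          case False
          then show ?thesis
            using kz(2)[of t x] t by simp
        qed
      qed
      also have "\<dots> = \<omega> * t ^ n * (t\<^sup>2 / 8 * C0)"
        using t fin by (simp add: content_cball \<omega>_def n_def)
      finally have "\<Gamma> * (LINT x:cball 0 1|lborel. avg_potential t x * f x) \<le> \<Gamma> * (\<omega> * t ^ n * (t\<^sup>2 / 8 * C0))"
        using \<Gamma> by (intro mult_left_mono)
      also have "\<dots> = B * t * t ^ Suc n"
        by (simp add: B_def power2_eq_square)
      finally have "- B * t * t ^ Suc n \<le> (LINT x:cball 0 1|lborel. f x * avg_laplacian t x)"
        using 1 by simp
      then show ?thesis
        using t by (simp add: le_divide_eq)
    qed
    have mono: "A s + B * s\<^sup>2 / 2 \<le> A \<delta> + B * \<delta>\<^sup>2 / 2" if s: "0 < s" "s \<le> \<delta>" for s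
    proof (rule DERIV_nonneg_imp_nondecreasing[OF s(2)])
      fix t
      assume t: "s \<le> t" "t \<le> \<delta>"
      then have t': "0 < t" "t < 1"
        using s \<delta> by auto
      have "((\<lambda>t. A t + B * t\<^sup>2 / 2) has_real_derivative
          (LINT x:cball 0 1|lborel. f x * avg_laplacian t x) / t ^ Suc n + B * t) (at t)"
        unfolding A_def n_def
        by (intro DERIV_add DERIV_average f(1) t') (auto intro!: derivative_eq_intros)
      then show "\<exists>y. ((\<lambda>t. A t + B * t\<^sup>2 / 2) has_real_derivative y) (at t) \<and> 0 \<le> y"
        using dA[OF t'] by (intro exI conjI) auto
    qed
    \<comment> \<open>\<open>s\<close> depends on \<open>f\<close>, but the final bound is read off
      at \<delta>.\<close>
    obtain s where s: "0 < s" "s \<le> \<delta>" "\<And>x. norm x \<le> s \<Longrightarrow> f x \<ge> 1/2"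
    proof -
      have "isCont f 0"
        using f(1) by (simp add: continuous_on_eq_continuous_at)
      then obtain d where d: "d > 0" "\<And>x. norm x < d \<Longrightarrow> \<bar>f x - f 0\<bar> < 1/2"
        unfolding continuous_at_eps_delta by (metis dist_norm diff_zero real_norm_def half_gt_zero_iff zero_less_one)
      have "f x \<ge> 1/2" if "norm x \<le> min \<delta> (d / 2)" for x
      proof -
        have "norm x < d"
          using that d(1) by auto
        then show ?thesis
          using d(2)[of x] f(4) by linarith
      qed
      then show ?thesis
        using that[of "min \<delta> (d / 2)"] \<delta> d by auto
    qed
    have "c1 / 2 \<le> A s"
    proof -
      have "(LINT x:cball 0 1|lborel. 1 / 2 * avg_kernel s (x :: real^'n)) \<le> A s"
        unfolding A_def
      proof (rule set_integral_mono)
        show "set_integrable lborel (cball 0 1) (\<lambda>x :: real^'n. 1 / 2 * avg_kernel s x)"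
          by (intro int continuous_intros ck)
        show "set_integrable lborel (cball 0 1) (\<lambda>x. f x * avg_kernel s x)"
          by (intro int continuous_on_mult f(1) ck)
        fix x :: "real^'n"
        show "1 / 2 * avg_kernel s x \<le> f x * avg_kernel s x"
        proof (cases "norm x \<le> s")
          case True
          then show ?thesis
            using s(3) k0(1)[OF s(1)] by (intro mult_right_mono) auto
        qed (use kz(1)[of s x] s in simp)
      qed
      then show ?thesis
        using c1(2)[of s] s \<delta> by simp
    qed
    then have "c1 / 4 \<le> A \<delta>"
      using mono[OF s(1,2)] \<delta>(3) mult_nonneg_nonneg[OF B, of "s\<^sup>2"] by simp
    also have "A \<delta> \<le> (LINT x:cball 0 1|lborel. f x / \<delta> ^ n)"
      unfolding A_def
    proof (rule set_integral_mono)
      show "set_integrable lborel (cball 0 1) (\<lambda>x. f x * avg_kernel \<delta> x)"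
        by (intro int continuous_on_mult f(1) ck)
      show "set_integrable lborel (cball 0 1) (\<lambda>x. f x / \<delta> ^ n)"
        using \<delta> by (intro int continuous_intros f(1)) auto
      fix x :: "real^'n"
      have "avg_kernel \<delta> x \<le> 1 / \<delta> ^ n"
        unfolding avg_kernel_def n_def using \<delta> by (intro divide_right_mono pos_pow_le_1 profile_le) auto
      then show "f x * avg_kernel \<delta> x \<le> f x / \<delta> ^ n"
        using mult_left_mono[OF _ f(2), of _ _ x] by fastforce
    qed
    also have "\<dots> = (LINT x:cball 0 1|lborel. f x) / \<delta> ^ n"
      by simp
    finally show ?thesis
      using \<delta> by (simp add: le_divide_eq mult.commute)
  qed
  moreover have "\<delta> ^ n * (c1 / 4) > 0"
    using \<delta> c1 by simp
  ultimately show ?thesis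
    by blast
qed

section \<open>Carleman estimate on the annulus\<close>

context radial_weight
begin

text \<open>The inequality for the C2 functions \<theta> times \<open>U k\<close> passes to the
  limit, since all weights are bounded on the compact set \<open>K\<close>. The right side shows the
  equation times \<theta> plus the commutator of the Laplacian with \<theta>.\<close>

lemma carleman_H2:
  fixes v F :: "real^'n \<Rightarrow> complex" and lam :: complex
  assumes H: "H2_approx v G F" and K: "compact K" "c \<notin> K"
    and \<theta>: "C2_on UNIV \<theta> D\<theta> D2\<theta>" and supp: "\<And>x. x \<notin> K \<Longrightarrow> \<theta> x = 0"
    and pq: "\<And>x. x \<in> K \<Longrightarrow> p x > 0" "\<And>x. x \<in> K \<Longrightarrow> q x > 0"
    and l: "\<And>x. x \<in> K \<Longrightarrow> 16 * cmod lam * r2 x \<le> p x * q x"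
       "\<And>x. x \<in> K \<Longrightarrow> 8 * cmod lam * r2 x \<le> (p x)\<^sup>2"
    and q4: "\<And>x. x \<in> K \<Longrightarrow> 4 * q x \<le> (p x)\<^sup>2"
    and M: "\<And>x. x \<in> K \<Longrightarrow> 4 * \<bar>m2 x * r2 x + real CARD('n) * m1 x\<bar> * r2 x \<le> (p x)\<^sup>2 * q x"
  defines "lhs \<equiv> \<lambda>x. exp (2 * \<phi> x) * (q x * (\<Sum>i\<in>UNIV. (norm (\<theta> x *\<^sub>R G i x + D\<theta> i x *\<^sub>R v x))\<^sup>2)
      + (p x)\<^sup>2 * q x * \<rho> x * (norm (\<theta> x *\<^sub>R v x))\<^sup>2)"
    and "rhs \<equiv> \<lambda>x. r2 x * exp (2 * \<phi> x) * (norm (\<theta> x *\<^sub>R (F x + lam * v x)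
      + (\<Sum>i\<in>UNIV. (2 * D\<theta> i x) *\<^sub>R G i x) + (\<Sum>i\<in>UNIV. D2\<theta> i i x) *\<^sub>R v x))\<^sup>2"
  shows "set_integrable lborel K lhs" "set_integrable lborel K rhs"
    "(LINT x:K|lborel. lhs x) \<le> 8 * (LINT x:K|lborel. rhs x)"
proof -
  obtain U DU D2U where C2: "\<And>k. C2_on UNIV (U k) (DU k) (D2U k)"
    and U0: "\<And>S. compact S \<Longrightarrow> L2_conv (restrict_space lborel S) U v"
    "\<And>S i. compact S \<Longrightarrow> L2_conv (restrict_space lborel S) (\<lambda>k. DU k i) (G i)"
    "\<And>S. compact S \<Longrightarrow> L2_conv (restrict_space lborel S) (\<lambda>k x. \<Sum>i\<in>UNIV. D2U k i i x) F"
    by (rule H2_approxE[OF H], rule that)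
  define Ms where "Ms = restrict_space (lborel :: (real^'n) measure) K"
  note U = U0[OF K(1), folded Ms_def]
  have Km: "K \<in> sets borel"
    using K by (simp add: compact_imp_closed)
  have restr: "(LINT x:K|lborel. h x) = (LINT x|Ms. h x)" "set_integrable lborel K h \<longleftrightarrow> integrable Ms h"
    for h :: "real^'n \<Rightarrow> real"
    using Km by (simp_all add: Ms_def integral_restrict_space set_lebesgue_integral_def integrable_restrict_space set_integrable_def)
  have sp: "space Ms = K"
    using Km by (simp add: Ms_def space_restrict_space)
  have bm: "w \<in> borel_measurable Ms" if "continuous_on K w" for w :: "real^'n \<Rightarrow> real"
    using borel_measurable_continuous_on_restrict[OF that]
    by (simp add: Ms_def measurable_def space_restrict_space sets_restrict_space)
  have bd: "\<exists>C. \<forall>x\<in>space Ms. \<bar>w x\<bar> \<le> C" if "continuous_on K w" for w :: "real^'n \<Rightarrow> real"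
    using continuous_bounded_on_compact[OF that K(1)] unfolding sp by metis
  have mult: "L2_conv Ms (\<lambda>k x. w x *\<^sub>R f k x) (\<lambda>x. w x *\<^sub>R g x)"
    if f: "L2_conv Ms f g" and w: "continuous_on K w" for w :: "real^'n \<Rightarrow> real" and f and g :: "real^'n \<Rightarrow> complex"
  proof -
    obtain C where "\<forall>x\<in>space Ms. \<bar>w x\<bar> \<le> C"
      using bd[OF w] by blast
    then show ?thesis
      using L2_conv_scaleR[OF f bm[OF w], of C] by blast
  qed
  have wnorm: "(\<lambda>k. LINT x|Ms. w x * (norm (f k x))\<^sup>2) \<longlonglongrightarrow> (LINT x|Ms. w x * (norm (g x))\<^sup>2)"
    "integrable Ms (\<lambda>x. w x * (norm (g x))\<^sup>2)" "integrable Ms (\<lambda>x. w x * (norm (f k x))\<^sup>2)"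
    if f: "L2_conv Ms f g" and w: "continuous_on K w" "\<And>x. x \<in> K \<Longrightarrow> 0 \<le> w x"
    for w :: "real^'n \<Rightarrow> real" and f and g :: "real^'n \<Rightarrow> complex" and k
  proof -
    obtain C where C: "\<forall>x\<in>space Ms. \<bar>w x\<bar> \<le> C"
      using bd[OF w(1)] by blast
    have C': "w x \<le> C" "0 \<le> w x" if "x \<in> space Ms" for x
      using C that w(2) abs_le_D1 sp by auto
    show "(\<lambda>k. LINT x|Ms. w x * (norm (f k x))\<^sup>2) \<longlonglongrightarrow> (LINT x|Ms. w x * (norm (g x))\<^sup>2)"
      "integrable Ms (\<lambda>x. w x * (norm (g x))\<^sup>2)" "integrable Ms (\<lambda>x. w x * (norm (f k x))\<^sup>2)"
      by (rule L2_conv_weighted_norm[OF f bm[OF w(1)] C'(2) C'(1)]; assumption)+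
  qed
  have KU: "K \<subseteq> - {c}"
    using K(2) by auto
  have cw: "continuous_on K \<theta>" "continuous_on K (D\<theta> i)" "continuous_on K (D2\<theta> i j)"
    "continuous_on K p" "continuous_on K q" "continuous_on K \<phi>" for i j
    using C2_on_continuous[OF C2_on_subset[OF \<theta> subset_UNIV, of K]] continuous_on_subset[OF cont_p KU]
      continuous_on_subset[OF cont_q KU] continuous_on_subset[OF cont_\<phi> KU] by auto
  have crho: "continuous_on K \<rho>"
    using K(2) by (intro continuous_intros) auto
  define Wk where "Wk k x = \<theta> x *\<^sub>R U k x" for k x
  define DWk where "DWk k i x = \<theta> x *\<^sub>R DU k i x + D\<theta> i x *\<^sub>R U k x" for k i x
  define D2Wk where "D2Wk k i j x = \<theta> x *\<^sub>R D2U k i j x + D\<theta> j x *\<^sub>R DU k i x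
      + (D\<theta> i x *\<^sub>R DU k j x + D2\<theta> i j x *\<^sub>R U k x)" for k i j x
  have C2W: "C2_on (- {c}) (Wk k) (DWk k) (D2Wk k)" for k
    unfolding Wk_def[abs_def] DWk_def[abs_def] D2Wk_def[abs_def]
    by (rule C2_on_subset[OF C2_on_scaleR[OF \<theta> C2] subset_UNIV])
  define W1 where "W1 x = exp (2 * \<phi> x) * q x" for x
  define W2 where "W2 x = exp (2 * \<phi> x) * ((p x)\<^sup>2 * q x * \<rho> x)" for x
  define W3 where "W3 x = r2 x * exp (2 * \<phi> x)" for x
  have W: "continuous_on K W1" "continuous_on K W2" "continuous_on K W3"
    unfolding W1_def[abs_def] W2_def[abs_def] W3_def[abs_def]
    by (intro continuous_intros cw crho)+
  have W0: "0 \<le> W1 x" "0 \<le> W2 x" "0 \<le> W3 x" if "x \<in> K" for x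
    using pq[OF that] by (simp_all add: W1_def W2_def W3_def)
  have c0: "L2_conv Ms Wk (\<lambda>x. \<theta> x *\<^sub>R v x)"
    unfolding Wk_def[abs_def] by (rule mult[OF U(1) cw(1)])
  have c1: "L2_conv Ms (\<lambda>k. DWk k i) (\<lambda>x. \<theta> x *\<^sub>R G i x + D\<theta> i x *\<^sub>R v x)" for i
    unfolding DWk_def[abs_def] by (intro L2_conv_add mult U cw)
  \<comment> \<open>The Laplacian of the product sorted by derivatives of \<theta>, so that second
    derivatives of \<open>U k\<close> occur only in its Laplacian, the one combination that
    converges.\<close>
  define LWk where "LWk k x = \<theta> x *\<^sub>R ((\<Sum>i\<in>UNIV. D2U k i i x) + lam * U k x)
      + (\<Sum>i\<in>UNIV. (2 * D\<theta> i x) *\<^sub>R DU k i x) + (\<Sum>i\<in>UNIV. D2\<theta> i i x) *\<^sub>R U k x" for k x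
  have LW: "(\<Sum>i\<in>UNIV. D2Wk k i i x) + lam * Wk k x = LWk k x" for k x
  proof -
    have "(\<Sum>i\<in>UNIV. D2Wk k i i x) = (\<Sum>i\<in>UNIV. \<theta> x *\<^sub>R D2U k i i x + (2 * D\<theta> i x) *\<^sub>R DU k i x + D2\<theta> i i x *\<^sub>R U k x)"
    proof (rule sum.cong[OF refl])
      fix i
      have "(2 * D\<theta> i x) *\<^sub>R DU k i x = D\<theta> i x *\<^sub>R DU k i x + D\<theta> i x *\<^sub>R DU k i x"
        by (simp only: mult_2 scaleR_left_distrib)
      then show "D2Wk k i i x = \<theta> x *\<^sub>R D2U k i i x + (2 * D\<theta> i x) *\<^sub>R DU k i x + D2\<theta> i i x *\<^sub>R U k x"
        by (simp only: D2Wk_def add.assoc)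
    qed
    then show ?thesis
      by (simp only: LWk_def Wk_def sum.distrib scaleR_sum_right[symmetric] scaleR_sum_left[symmetric])
        (simp add: algebra_simps)
  qed
  have c2: "L2_conv Ms LWk (\<lambda>x. \<theta> x *\<^sub>R (F x + lam * v x)
      + (\<Sum>i\<in>UNIV. (2 * D\<theta> i x) *\<^sub>R G i x) + (\<Sum>i\<in>UNIV. D2\<theta> i i x) *\<^sub>R v x)"
    unfolding LWk_def[abs_def]
    by (intro L2_conv_add L2_conv_sum L2_conv_cmult mult U cw continuous_intros)
  define R1 where "R1 k = (\<Sum>i\<in>UNIV. LINT x|Ms. W1 x * (norm (DWk k i x))\<^sup>2) + (LINT x|Ms. W2 x * (norm (Wk k x))\<^sup>2)" for k
  define R2 where "R2 k = (LINT x|Ms. W3 x * (norm (LWk k x))\<^sup>2)" for k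
  have ineq: "R1 k \<le> 8 * R2 k" for k
  proof -
    have "(LINT x:K|lborel. exp (2 * \<phi> x) *
      (q x * (\<Sum>i\<in>UNIV. (norm (DWk k i x))\<^sup>2) + (p x)\<^sup>2 * q x * \<rho> x * (norm (Wk k x))\<^sup>2))
      \<le> 8 * (LINT x:K|lborel. r2 x * exp (2 * \<phi> x) * (norm ((\<Sum>i\<in>UNIV. D2Wk k i i x) + lam * Wk k x))\<^sup>2)"
      by (rule carleman_inequality[OF K C2W _ pq l q4 M]) (simp_all add: Wk_def supp)
    also have "\<dots> = 8 * R2 k"
      by (simp add: restr(1) R2_def W3_def LW)
    finally have "(LINT x|Ms. exp (2 * \<phi> x) *
      (q x * (\<Sum>i\<in>UNIV. (norm (DWk k i x))\<^sup>2) + (p x)\<^sup>2 * q x * \<rho> x * (norm (Wk k x))\<^sup>2)) \<le> 8 * R2 k"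
      by (simp only: restr(1))
    moreover have "(LINT x|Ms. exp (2 * \<phi> x) *
      (q x * (\<Sum>i\<in>UNIV. (norm (DWk k i x))\<^sup>2) + (p x)\<^sup>2 * q x * \<rho> x * (norm (Wk k x))\<^sup>2))
      = (LINT x|Ms. (\<Sum>i\<in>UNIV. W1 x * (norm (DWk k i x))\<^sup>2) + W2 x * (norm (Wk k x))\<^sup>2)"
      by (rule Bochner_Integration.integral_cong[OF refl])
        (simp only: W1_def W2_def distrib_left sum_distrib_left mult.assoc)
    moreover have "\<dots> = R1 k"
      unfolding R1_def using wnorm(3)[OF c1 W(1) W0(1)] wnorm(3)[OF c0 W(2) W0(2)]
      by (simp only: Bochner_Integration.integral_add Bochner_Integration.integral_sum Bochner_Integration.integrable_sum)
    ultimately show ?thesis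
      by simp
  qed
  have lhs: "lhs x = (\<Sum>i\<in>UNIV. W1 x * (norm (\<theta> x *\<^sub>R G i x + D\<theta> i x *\<^sub>R v x))\<^sup>2) + W2 x * (norm (\<theta> x *\<^sub>R v x))\<^sup>2" for x
    by (simp only: lhs_def W1_def W2_def distrib_left sum_distrib_left mult.assoc)
  have lim1: "R1 \<longlonglongrightarrow> (\<Sum>i\<in>UNIV. LINT x|Ms. W1 x * (norm (\<theta> x *\<^sub>R G i x + D\<theta> i x *\<^sub>R v x))\<^sup>2)
      + (LINT x|Ms. W2 x * (norm (\<theta> x *\<^sub>R v x))\<^sup>2)"
    unfolding R1_def[abs_def] by (intro tendsto_add tendsto_sum wnorm(1) c0 c1 W W0)
  have lim2: "(\<lambda>k. 8 * R2 k) \<longlonglongrightarrow> 8 * (LINT x|Ms. rhs x)"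
    unfolding R2_def[abs_def] rhs_def W3_def[symmetric] by (intro tendsto_mult_left wnorm(1) c2 W W0)
  show "set_integrable lborel K lhs"
    unfolding restr(2) lhs using wnorm(2)[OF c1 W(1) W0(1)] wnorm(2)[OF c0 W(2) W0(2)]
    by (intro Bochner_Integration.integrable_add Bochner_Integration.integrable_sum)
  show "set_integrable lborel K rhs"
    unfolding restr(2) rhs_def W3_def[symmetric] by (rule wnorm(2)[OF c2 W(3) W0(3)])
  have "(LINT x:K|lborel. lhs x) = (\<Sum>i\<in>UNIV. LINT x|Ms. W1 x * (norm (\<theta> x *\<^sub>R G i x + D\<theta> i x *\<^sub>R v x))\<^sup>2)
      + (LINT x|Ms. W2 x * (norm (\<theta> x *\<^sub>R v x))\<^sup>2)"
    unfolding restr(1) lhs using wnorm(2)[OF c1 W(1) W0(1)] wnorm(2)[OF c0 W(2) W0(2)]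
    by (simp only: Bochner_Integration.integral_add Bochner_Integration.integral_sum Bochner_Integration.integrable_sum)
  also have "\<dots> \<le> 8 * (LINT x|Ms. rhs x)"
    by (rule LIMSEQ_le[OF lim1 lim2]) (use ineq in auto)
  finally show "(LINT x:K|lborel. lhs x) \<le> 8 * (LINT x:K|lborel. rhs x)"
    by (simp only: restr(1))
qed

end

text \<open>The difference of a bump at radius \<open>2 * R\<close> to \<open>3 * R\<close> and one
  at radius 1/4 to 1/2. The inner radii do not grow with \<open>R\<close>, which keeps the inner
  error inside the unit ball around \<open>c\<close>.\<close>

lemma annular_cutoff_exists:
  fixes c :: "real^'n"
  assumes R: "R \<ge> 1"
  obtains \<theta> D\<theta> D2\<theta> where "C2_on UNIV \<theta> D\<theta> D2\<theta>" "\<And>x. \<bar>\<theta> x\<bar> \<le> 1"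
    "\<And>x. norm (x - c) \<le> 1/4 \<or> norm (x - c) \<ge> 3 * R \<Longrightarrow> \<theta> x = 0"
    "\<And>i x. 1/2 \<le> norm (x - c) \<Longrightarrow> norm (x - c) \<le> 2 * R \<Longrightarrow> \<theta> x = 1 \<and> D\<theta> i x = 0 \<and> D2\<theta> i i x = 0"
    "\<And>i x. \<bar>D\<theta> i x\<bar> \<le> 108" "\<And>x. \<bar>\<Sum>i\<in>UNIV. D2\<theta> i i x\<bar> \<le> 5184 + 216 * real CARD('n)"
proof -
  have R2: "R\<^sup>2 \<ge> R"
    using R by (simp add: power2_eq_square mult_le_cancel_left1)
  then have ab: "0 < 2 * R" "2 * R < 3 * R" "3 * R \<le> 3 * ((3 * R)\<^sup>2 - (2 * R)\<^sup>2)" "1 \<le> 6 * ((3 * R)\<^sup>2 - (2 * R)\<^sup>2)"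
    using R by (auto simp: power_mult_distrib)
  obtain f Df D2f where f: "C2_on UNIV f Df D2f" "\<And>x. 0 \<le> f x" "\<And>x. f x \<le> 1"
    "\<And>x. norm (x - c) \<le> 2 * R \<Longrightarrow> f x = 1" "\<And>x. norm (x - c) \<ge> 3 * R \<Longrightarrow> f x = 0"
    "\<And>i x. norm (x - c) \<le> 2 * R \<or> norm (x - c) \<ge> 3 * R \<Longrightarrow> Df i x = 0 \<and> D2f i i x = 0"
    "\<And>i x. \<bar>Df i x\<bar> \<le> 54" "\<And>x. \<bar>\<Sum>i\<in>UNIV. D2f i i x\<bar> \<le> 2592 + 108 * real CARD('n)"
    by (rule bump_exists[OF ab, of c], rule that)
  have ab': "0 < (1/4::real)" "1/4 < (1/2::real)" "1/2 \<le> 3 * ((1/2)\<^sup>2 - (1/4 :: real)\<^sup>2)" "1 \<le> 6 * ((1/2)\<^sup>2 - (1/4 :: real)\<^sup>2)"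
    by (simp_all add: power2_eq_square)
  obtain h Dh D2h where h: "C2_on UNIV h Dh D2h" "\<And>x. 0 \<le> h x" "\<And>x. h x \<le> 1"
    "\<And>x. norm (x - c) \<le> 1/4 \<Longrightarrow> h x = 1" "\<And>x. norm (x - c) \<ge> 1/2 \<Longrightarrow> h x = 0"
    "\<And>i x. norm (x - c) \<le> 1/4 \<or> norm (x - c) \<ge> 1/2 \<Longrightarrow> Dh i x = 0 \<and> D2h i i x = 0"
    "\<And>i x. \<bar>Dh i x\<bar> \<le> 54" "\<And>x. \<bar>\<Sum>i\<in>UNIV. D2h i i x\<bar> \<le> 2592 + 108 * real CARD('n)"
    by (rule bump_exists[OF ab', of c], rule that)
  show thesis
  proof (rule that[of "\<lambda>x. f x - h x" "\<lambda>i x. Df i x - Dh i x" "\<lambda>i j x. D2f i j x - D2h i j x"])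
    show "C2_on UNIV (\<lambda>x. f x - h x) (\<lambda>i x. Df i x - Dh i x) (\<lambda>i j x. D2f i j x - D2h i j x)"
      using f(1) h(1) unfolding C2_on_def by (auto intro!: has_grad_diff continuous_intros)
    show "\<bar>f x - h x\<bar> \<le> 1" for x
      using f(2,3)[of x] h(2,3)[of x] by linarith
    show "norm (x - c) \<le> 1/4 \<or> norm (x - c) \<ge> 3 * R \<Longrightarrow> f x - h x = 0" for x
      using f(4,5)[of x] h(4,5)[of x] R by fastforce
    show "1/2 \<le> norm (x - c) \<Longrightarrow> norm (x - c) \<le> 2 * R \<Longrightarrow>
        f x - h x = 1 \<and> Df i x - Dh i x = 0 \<and> D2f i i x - D2h i i x = 0" for i x
      using f(4)[of x] f(6)[of x i] h(5)[of x] h(6)[of x i] by simp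
    show "\<bar>Df i x - Dh i x\<bar> \<le> 108" for i x
      using f(7)[of i x] h(7)[of i x] by linarith
    show "\<bar>\<Sum>i\<in>UNIV. D2f i i x - D2h i i x\<bar> \<le> 5184 + 216 * real CARD('n)" for x
      using f(8)[of x] h(8)[of x] by (simp add: sum_subtractf)
  qed
qed

section \<open>Growth of the weight and absorption of the potentials\<close>

text \<open>Since \<open>wp\<close> lies between \<kappa> ln R and 5 \<kappa> ln R, adding either
  bound times \<open>ln r\<close> to \<phi> gives a monotone function.\<close>

lemma weight_potential_diff:
  assumes \<phi>: "\<And>r. r > 0 \<Longrightarrow> (\<phi> has_real_derivative - wp \<kappa> R r / r) (at r)"
    and R: "R \<ge> 9" and st: "0 < s" "s \<le> t" "t \<le> 4 * R" and \<kappa>: "\<kappa> > 0"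
  shows "\<kappa> * ln R * (ln t - ln s) \<le> \<phi> s - \<phi> t" "\<phi> s - \<phi> t \<le> \<kappa> * (5 * ln R) * (ln t - ln s)"
proof -
  have d: "((\<lambda>r. \<phi> r + a * ln r) has_real_derivative (a - wp \<kappa> R r) / r) (at r)" if "r > 0" for r a
    using that by (auto intro!: derivative_eq_intros \<phi> simp: field_simps)
  have "\<phi> t + \<kappa> * ln R * ln t \<le> \<phi> s + \<kappa> * ln R * ln s"
  proof (rule DERIV_nonpos_imp_nonincreasing[OF st(2)])
    fix r assume "s \<le> r" "r \<le> t"
    then show "\<exists>y. ((\<lambda>r. \<phi> r + \<kappa> * ln R * ln r) has_real_derivative y) (at r) \<and> y \<le> 0"
      using d[of r "\<kappa> * ln R"] wp_bounds(1)[OF R, of r \<kappa>] st \<kappa> by (intro exI conjI) (auto simp: divide_le_0_iff)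
  qed
  then show "\<kappa> * ln R * (ln t - ln s) \<le> \<phi> s - \<phi> t"
    by (simp add: algebra_simps)
  have "\<phi> s + \<kappa> * (5 * ln R) * ln s \<le> \<phi> t + \<kappa> * (5 * ln R) * ln t"
  proof (rule DERIV_nonneg_imp_nondecreasing[OF st(2)])
    fix r assume "s \<le> r" "r \<le> t"
    then show "\<exists>y. ((\<lambda>r. \<phi> r + \<kappa> * (5 * ln R) * ln r) has_real_derivative y) (at r) \<and> 0 \<le> y"
      using d[of r "\<kappa> * (5 * ln R)"] wp_bounds(2)[OF R, of r \<kappa>] st \<kappa> by (intro exI conjI) (auto simp: zero_le_divide_iff)
  qed
  then show "\<phi> s - \<phi> t \<le> \<kappa> * (5 * ln R) * (ln t - ln s)"
    by (simp add: algebra_simps)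
qed

text \<open>In the application \<open>t\<close> is the bracket of \<open>x\<close> and
  \<open>k\<close> the reciprocal bracket of \<open>r - R\<close>. One factor \<open>1 / t\<close>
  is traded for \<open>k\<close>, and the remaining nonnegative power of \<open>t\<close> is bounded
  by the same power of \<open>5 * R\<close>.\<close>

lemma bracket_power_absorption:
  fixes t R k :: real
  assumes t: "1 \<le> t" "t \<le> 5 * R" "1 / t \<le> k" and R: "R \<ge> 1"
    and e: "0 \<le> e" "e \<le> m" and s: "- s \<le> e - 1"
  shows "t powr (- s) \<le> 5 powr m * R powr e * k"
proof -
  have k: "0 \<le> k"
    using t by (smt (verit) divide_nonneg_pos)
  have "t powr (- s) \<le> t powr (e - 1)"
    using s t by (intro powr_mono) auto
  also have "\<dots> = t powr e * (1 / t)"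
    using t by (simp add: powr_diff)
  also have "\<dots> \<le> (5 * R) powr e * k"
    using t e R by (intro mult_mono powr_mono2) auto
  also have "\<dots> = 5 powr e * R powr e * k"
    using R by (simp add: powr_mult)
  also have "\<dots> \<le> 5 powr m * R powr e * k"
    using e k by (intro mult_right_mono powr_mono) auto
  finally show ?thesis .
qed

text \<open>\<open>bracket_power_absorption\<close> is applied with exponent \<beta> - 1 for the
  drift, where \<open>2 - 2 * P \<le> \<beta>\<close> enters, and with 3\<beta> - 3 for the
  potential, where \<open>4 - 2 * N \<le> 3 * \<beta>\<close> enters. The bound \<beta> \<le> 2
  keeps these exponents below 1 and 3, hence the numerical factors 5 and 125.\<close>

lemma potential_absorption:
  assumes R: "R \<ge> 9" and r: "0 < r" "r \<le> 4 * R" and \<beta>: "1 \<le> \<beta>" "\<beta> \<le> 2"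
    and t: "1 \<le> t" "t \<le> 5 * R" "1 / t \<le> bracket_inv (r - R)"
    and P: "2 - 2 * P \<le> \<beta>" and N: "4 - 2 * N \<le> 3 * \<beta>"
    and L: "ln R \<ge> 1" "ln R \<ge> 640 * A2\<^sup>2" "ln R \<ge> 256000 * A1\<^sup>2"
    and \<kappa>: "\<kappa> = R powr \<beta> * ln R"
  shows "32 * (A2 * t powr (- P))\<^sup>2 * r\<^sup>2 \<le> wq \<kappa> R r"
    "32 * (A1 * t powr (- N))\<^sup>2 * r\<^sup>2 * r\<^sup>2 \<le> (wp \<kappa> R r)\<^sup>2 * wq \<kappa> R r"
proof -
  define k where "k = bracket_inv (r - R)"
  define l where "l = ln R"
  have k: "k > 0"
    by (simp add: k_def bracket_inv_pos)
  have sq: "(t powr (- s))\<^sup>2 = t powr (- (2 * s))" for s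
    using t by (simp add: power2_eq_square powr_add[symmetric])
  have "t powr (- (2 * P)) \<le> 5 powr 1 * R powr (\<beta> - 1) * k"
    using t R \<beta> P unfolding k_def by (intro bracket_power_absorption) auto
  then have "A2\<^sup>2 * (t powr (- (2 * P))) * (32 * r * r) \<le> A2\<^sup>2 * (5 powr 1 * R powr (\<beta> - 1) * k) * (32 * r * (4 * R))"
    using r R k by (intro mult_mono) auto
  \<comment> \<open>640 = 32 * 5 * 4, the 4 coming from \<open>r \<le> 4 * R\<close>; for the
    potential the same count gives 256000 = 32 * 125 * 64.\<close>
  also have "\<dots> = 640 * A2\<^sup>2 * ((R powr (\<beta> - 1) * R) * (r * k))"
    by (simp add: mult_ac)
  also have "\<dots> \<le> l * ((R powr (\<beta> - 1) * R) * (r * k))"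
    using L r k R unfolding l_def by (intro mult_right_mono) auto
  also have "\<dots> = wq \<kappa> R r"
    using R by (simp add: wq_def \<kappa> k_def l_def powr_diff mult_ac)
  finally show "32 * (A2 * t powr (- P))\<^sup>2 * r\<^sup>2 \<le> wq \<kappa> R r"
    by (simp add: power_mult_distrib sq power2_eq_square[of r] mult_ac)
  have l: "1 \<le> l ^ 4"
    using L by (simp add: l_def)
  have \<kappa>p: "\<kappa> > 0"
    using R L by (simp add: \<kappa>)
  have "\<kappa> * l \<le> wp \<kappa> R r"
    using wp_bounds(1)[OF R r \<kappa>p] by (simp add: l_def)
  then have "(\<kappa> * l)\<^sup>2 \<le> (wp \<kappa> R r)\<^sup>2"
    using \<kappa>p L by (intro power_mono) (auto simp: l_def)
  then have p: "(\<kappa> * l)\<^sup>2 * wq \<kappa> R r \<le> (wp \<kappa> R r)\<^sup>2 * wq \<kappa> R r"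
    using \<kappa>p r bracket_inv_pos[of "r - R"] by (intro mult_right_mono) (auto simp: wq_def)
  have "t powr (- (2 * N)) \<le> 5 powr 3 * R powr (3 * \<beta> - 3) * k"
    using t R \<beta> N unfolding k_def by (intro bracket_power_absorption) auto
  then have "A1\<^sup>2 * (t powr (- (2 * N))) * (32 * r * r ^ 3) \<le> A1\<^sup>2 * (5 powr 3 * R powr (3 * \<beta> - 3) * k) * (32 * r * (4 * R) ^ 3)"
    using r R k power_mono[of r "4 * R" 3] by (intro mult_mono) auto
  also have "\<dots> = 256000 * A1\<^sup>2 * ((R powr (3 * \<beta> - 3) * R ^ 3) * (r * k))"
    by (simp add: power_mult_distrib mult_ac)
  also have "\<dots> \<le> l * ((R powr (3 * \<beta> - 3) * R ^ 3) * (r * k))"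
    using L r k R unfolding l_def by (intro mult_right_mono) auto
  \<comment> \<open>The product of \<open>(\<kappa> * l)^2\<close> and \<open>wq\<close> contains
    five logarithms; one has absorbed \<open>A1\<close>, and the other four are filled in
    here.\<close>
  also have "\<dots> \<le> l * ((R powr (3 * \<beta> - 3) * R ^ 3) * (r * k)) * l ^ 4"
    using l L r k R mult_left_mono[OF l, of "l * ((R powr (3 * \<beta> - 3) * R ^ 3) * (r * k))"] by (simp add: l_def)
  also have "R powr (3 * \<beta> - 3) * R ^ 3 = (R powr \<beta>) ^ 3"
  proof -
    have "R powr 3 = R ^ 3"
      using R powr_realpow[of R 3] by simp
    moreover have "(R powr \<beta>) ^ 3 = R powr (3 * \<beta>)"
      using R by (simp add: power3_eq_cube powr_add[symmetric])
    ultimately show ?thesis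
      using R by (simp add: powr_diff)
  qed
  also have "l * ((R powr \<beta>) ^ 3 * (r * k)) * l ^ 4 = (\<kappa> * l)\<^sup>2 * wq \<kappa> R r"
    by (simp add: wq_def \<kappa> k_def l_def power_mult_distrib eval_nat_numeral mult_ac)
  also note p
  finally show "32 * (A1 * t powr (- N))\<^sup>2 * r\<^sup>2 * r\<^sup>2 \<le> (wp \<kappa> R r)\<^sup>2 * wq \<kappa> R r"
    by (simp add: power_mult_distrib sq power3_eq_cube[of r] power2_eq_square[of r] mult_ac)
qed

text \<open>Meant for the transition regions of the cutoff, where the equation and the commutator
  are bounded together by the H1 density of \<open>v\<close>. The bound on each \<open>D i\<close>
  is summed over the coordinates, hence 216 times the dimension.\<close>

lemma commutator_bound:
  fixes G :: "'n::finite \<Rightarrow> complex"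
  assumes F: "cmod F \<le> b * sqrt (\<Sum>i\<in>UNIV. (cmod (G i))\<^sup>2) + a * cmod v" and ab: "0 \<le> a" "a \<le> A1" "0 \<le> b" "b \<le> A2"
    and \<theta>: "\<bar>\<theta>\<bar> \<le> 1" "\<And>i. \<bar>D i\<bar> \<le> 108" "\<bar>d\<bar> \<le> C"
  shows "(cmod (\<theta> *\<^sub>R F + (\<Sum>i\<in>UNIV. (2 * D i) *\<^sub>R G i) + d *\<^sub>R v))\<^sup>2
    \<le> 2 * (A1 + A2 + 216 * real CARD('n) + C)\<^sup>2 * ((\<Sum>i\<in>UNIV. (cmod (G i))\<^sup>2) + (cmod v)\<^sup>2)"
proof -
  define g where "g = sqrt (\<Sum>i\<in>UNIV. (cmod (G i))\<^sup>2)"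
  define B where "B = A1 + A2 + 216 * real CARD('n) + C"
  have s0: "0 \<le> (\<Sum>i\<in>UNIV. (cmod (G i))\<^sup>2)"
    by (intro sum_nonneg) auto
  then have g: "0 \<le> g" "g\<^sup>2 = (\<Sum>i\<in>UNIV. (cmod (G i))\<^sup>2)"
    by (auto simp: g_def)
  have C: "0 \<le> C"
    using \<theta>(3) by linarith
  have Gi: "cmod (G i) \<le> g" for i
    unfolding g_def by (rule real_le_rsqrt) (intro member_le_sum, auto)
  have "cmod (\<Sum>i\<in>UNIV. (2 * D i) *\<^sub>R G i) \<le> 216 * real CARD('n) * g"
  proof -
    have "cmod ((2 * D i) *\<^sub>R G i) \<le> 216 * g" for i
    proof -
    have "\<bar>2 * D i\<bar> * cmod (G i) \<le> 216 * g"
      using \<theta>(2)[of i] Gi[of i] by (intro mult_mono) auto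
    then show ?thesis
      by simp
    qed
    then show ?thesis
      using sum_norm_le[of UNIV "\<lambda>i. (2 * D i) *\<^sub>R G i" "\<lambda>i. 216 * g"] by (simp add: mult_ac)
  qed
  moreover have "cmod (\<theta> *\<^sub>R F) \<le> 1 * (b * g + a * cmod v)"
    using \<theta>(1) F unfolding g_def[symmetric] norm_scaleR by (intro mult_mono) auto
  moreover have "cmod (d *\<^sub>R v) \<le> C * cmod v"
    using \<theta>(3) by (simp add: mult_right_mono)
  moreover have "b * g \<le> A2 * g" "a * cmod v \<le> A1 * cmod v"
    using ab g by (auto intro: mult_right_mono)
  moreover have "0 \<le> A1 * g" "0 \<le> A2 * cmod v" "0 \<le> 216 * real CARD('n) * cmod v" "0 \<le> C * g"
    using ab g C by auto
  moreover have "B * (g + cmod v) = A1 * g + A2 * g + 216 * real CARD('n) * g + C * g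
      + (A1 * cmod v + A2 * cmod v + 216 * real CARD('n) * cmod v + C * cmod v)"
    by (simp add: B_def algebra_simps)
  moreover have "cmod (\<theta> *\<^sub>R F + (\<Sum>i\<in>UNIV. (2 * D i) *\<^sub>R G i) + d *\<^sub>R v)
      \<le> cmod (\<theta> *\<^sub>R F) + cmod (\<Sum>i\<in>UNIV. (2 * D i) *\<^sub>R G i) + cmod (d *\<^sub>R v)"
    by (intro norm_triangle_mono order_refl)
  ultimately have "cmod (\<theta> *\<^sub>R F + (\<Sum>i\<in>UNIV. (2 * D i) *\<^sub>R G i) + d *\<^sub>R v) \<le> B * (g + cmod v)"
    by argo
  then have "(cmod (\<theta> *\<^sub>R F + (\<Sum>i\<in>UNIV. (2 * D i) *\<^sub>R G i) + d *\<^sub>R v))\<^sup>2 \<le> (B * (g + cmod v))\<^sup>2"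
    by (intro power_mono) auto
  also have "\<dots> \<le> B\<^sup>2 * (2 * g\<^sup>2 + 2 * (cmod v)\<^sup>2)"
    unfolding power_mult_distrib using norm_add_sq_le[of g "cmod v"] by (intro mult_left_mono) auto
  finally show ?thesis
    unfolding B_def g(2) by (simp add: algebra_simps)
qed

section \<open>The Carleman estimate with the potentials absorbed\<close>

context radial_weight
begin

text \<open>Where the cutoff is 1, sixteen times the right integrand is at most the left one, so
  half of the left side absorbs it. In the two transition regions it is an error weighted by the
  upper bounds \<open>s1\<close> and \<open>s2\<close> of the exponent. On \<open>B\<close> the left
  side is bounded below, with exponent at least \<open>s0\<close>.\<close>

lemma carleman_annulus:
  fixes v F :: "real^'n \<Rightarrow> complex" and lam :: complex
  assumes H: "H2_approx v G F"
    and F: "AE x in lborel. cmod (F x + lam * v x) \<le> b x * sqrt (\<Sum>i\<in>UNIV. (cmod (G i x))\<^sup>2) + a x * cmod (v x)"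
    and ab: "\<And>x. 0 \<le> a x" "\<And>x. a x \<le> A1" "\<And>x. 0 \<le> b x" "\<And>x. b x \<le> A2" and R: "R \<ge> 1"
    and weight: "\<And>x. 1/4 \<le> norm (x - c) \<Longrightarrow> norm (x - c) \<le> 3 * R \<Longrightarrow> p x > 0 \<and> q x > 0 \<and>
       16 * cmod lam * r2 x \<le> p x * q x \<and> 8 * cmod lam * r2 x \<le> (p x)\<^sup>2 \<and> 4 * q x \<le> (p x)\<^sup>2 \<and>
       4 * \<bar>m2 x * r2 x + real CARD('n) * m1 x\<bar> * r2 x \<le> (p x)\<^sup>2 * q x"
    and absorb: "\<And>x. 1/2 \<le> norm (x - c) \<Longrightarrow> norm (x - c) \<le> 2 * R \<Longrightarrow>
       32 * (b x)\<^sup>2 * r2 x \<le> q x \<and> 32 * (a x)\<^sup>2 * r2 x * r2 x \<le> (p x)\<^sup>2 * q x"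
    and s1: "\<And>x. 1/4 \<le> norm (x - c) \<Longrightarrow> norm (x - c) \<le> 1/2 \<Longrightarrow> \<phi> x \<le> s1"
    and s2: "\<And>x. 2 * R \<le> norm (x - c) \<Longrightarrow> norm (x - c) \<le> 3 * R \<Longrightarrow> \<phi> x \<le> s2"
    and B: "compact B" "\<And>x. x \<in> B \<Longrightarrow> 1/2 \<le> norm (x - c) \<and> norm (x - c) \<le> 2 * R \<and> s0 \<le> \<phi> x \<and> r2 x \<le> (p x)\<^sup>2 * q x"
  shows "exp (2 * s0) * (LINT x:B|lborel. (cmod (v x))\<^sup>2)
    \<le> 32 * (A1 + A2 + 5184 + 432 * real CARD('n))\<^sup>2 * (exp (2 * s1) * (LINT x:cball c (1/2)|lborel. (\<Sum>i\<in>UNIV. (cmod (G i x))\<^sup>2) + (cmod (v x))\<^sup>2)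
      + 9 * R\<^sup>2 * exp (2 * s2) * (LINT x:cball c (3 * R)|lborel. (\<Sum>i\<in>UNIV. (cmod (G i x))\<^sup>2) + (cmod (v x))\<^sup>2))"
proof -
  obtain \<theta> D\<theta> D2\<theta> where \<theta>: "C2_on UNIV \<theta> D\<theta> D2\<theta>" "\<And>x. \<bar>\<theta> x\<bar> \<le> 1"
    "\<And>x. norm (x - c) \<le> 1/4 \<or> norm (x - c) \<ge> 3 * R \<Longrightarrow> \<theta> x = 0"
    "\<And>i x. 1/2 \<le> norm (x - c) \<Longrightarrow> norm (x - c) \<le> 2 * R \<Longrightarrow> \<theta> x = 1 \<and> D\<theta> i x = 0 \<and> D2\<theta> i i x = 0"
    "\<And>i x. \<bar>D\<theta> i x\<bar> \<le> 108" "\<And>x. \<bar>\<Sum>i\<in>UNIV. D2\<theta> i i x\<bar> \<le> 5184 + 216 * real CARD('n)"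
    by (rule annular_cutoff_exists[OF R, of c], rule that)
  \<comment> \<open>The support of the cutoff; removing the ball of radius 1/4 keeps
    \<open>K\<close> away from the singularity of the weight.\<close>
  define K where "K = cball c (3 * R) - ball c (1/4)"
  have K: "compact K" "c \<notin> K" and Kin: "x \<in> K \<longleftrightarrow> 1/4 \<le> norm (x - c) \<and> norm (x - c) \<le> 3 * R" for x
    by (auto simp: K_def compact_diff dist_norm norm_minus_commute)
  define g2 where "g2 x = (\<Sum>i\<in>UNIV. (cmod (G i x))\<^sup>2)" for x
  define C where "C = (A1 + A2 + 5184 + 432 * real CARD('n))\<^sup>2"
  define lhs where "lhs = (\<lambda>x. exp (2 * \<phi> x) * (q x * (\<Sum>i\<in>UNIV. (norm (\<theta> x *\<^sub>R G i x + D\<theta> i x *\<^sub>R v x))\<^sup>2)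
      + (p x)\<^sup>2 * q x * \<rho> x * (norm (\<theta> x *\<^sub>R v x))\<^sup>2))"
  define rhs where "rhs = (\<lambda>x. r2 x * exp (2 * \<phi> x) * (norm (\<theta> x *\<^sub>R (F x + lam * v x)
      + (\<Sum>i\<in>UNIV. (2 * D\<theta> i x) *\<^sub>R G i x) + (\<Sum>i\<in>UNIV. D2\<theta> i i x) *\<^sub>R v x))\<^sup>2)"
  define err where "err = (\<lambda>x. exp (2 * s1) * (indicat_real (cball c (1/2)) x * (g2 x + (cmod (v x))\<^sup>2))
     + 9 * R\<^sup>2 * exp (2 * s2) * (indicat_real (cball c (3 * R)) x * (g2 x + (cmod (v x))\<^sup>2)))"
  have supp: "\<theta> x = 0" if "x \<notin> K" for x
    using \<theta>(3)[of x] that by (auto simp: Kin)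
  have "set_integrable lborel K lhs \<and> set_integrable lborel K rhs \<and> (LINT x:K|lborel. lhs x) \<le> 8 * (LINT x:K|lborel. rhs x)"
    unfolding lhs_def rhs_def
    by (intro conjI carleman_H2[where lam = lam, OF H K \<theta>(1) supp]) (use weight in \<open>simp_all add: Kin\<close>)
  then have carl: "set_integrable lborel K lhs" "set_integrable lborel K rhs"
    "(LINT x:K|lborel. lhs x) \<le> 8 * (LINT x:K|lborel. rhs x)"
    by auto
  have g2: "0 \<le> g2 x" for x
    unfolding g2_def by (intro sum_nonneg) auto
  have on_annulus: "lhs x = exp (2 * \<phi> x) * (q x * g2 x + (p x)\<^sup>2 * q x * \<rho> x * (cmod (v x))\<^sup>2)"
      "rhs x = r2 x * exp (2 * \<phi> x) * (cmod (F x + lam * v x))\<^sup>2"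
    if "1/2 \<le> norm (x - c)" "norm (x - c) \<le> 2 * R" for x
    using \<theta>(4)[OF that] by (simp_all add: lhs_def rhs_def g2_def)
  have lhs0: "0 \<le> lhs x" if "x \<in> K" for x
    unfolding lhs_def using weight[of x] that
    by (intro mult_nonneg_nonneg add_nonneg_nonneg sum_nonneg) (auto simp: Kin)
  have err0: "0 \<le> err x" for x
    unfolding err_def using g2[of x] by auto
  have int: "integrable lborel (\<lambda>x. indicat_real S x * (g2 x + (cmod (v x))\<^sup>2))" if "compact S" for S
    using set_integral_add(1)[OF H2_approx_integrable(2,1)[OF H that continuous_on_const[of S 1]]]
    by (simp add: set_integrable_def g2_def)
  have err_int: "integrable lborel err"
    unfolding err_def by (intro Bochner_Integration.integrable_add integrable_mult_right int) auto
  have key: "AE x\<in>K in lborel. 8 * rhs x \<le> lhs x / 2 + 16 * C * err x"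
    using F
  proof (eventually_elim, intro impI)
    fix x
    assume Fx: "cmod (F x + lam * v x) \<le> b x * sqrt (\<Sum>i\<in>UNIV. (cmod (G i x))\<^sup>2) + a x * cmod (v x)" and "x \<in> K"
    then have r: "1/4 \<le> norm (x - c)" "norm (x - c) \<le> 3 * R"
      by (auto simp: Kin)
    have r2: "r2 x > 0"
      using r by (intro zero_less_power) linarith
    show "8 * rhs x \<le> lhs x / 2 + 16 * C * err x"
    proof (cases "1/2 \<le> norm (x - c) \<and> norm (x - c) \<le> 2 * R")
      case True
      have "(cmod (F x + lam * v x))\<^sup>2 \<le> (b x * sqrt (g2 x) + a x * cmod (v x))\<^sup>2"
        using Fx unfolding g2_def by (intro power_mono) auto
      also have "\<dots> \<le> 2 * ((b x)\<^sup>2 * g2 x) + 2 * ((a x)\<^sup>2 * (cmod (v x))\<^sup>2)"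
        using norm_add_sq_le[of "b x * sqrt (g2 x)" "a x * cmod (v x)"] g2[of x] by (simp add: power_mult_distrib)
      finally have "16 * r2 x * (cmod (F x + lam * v x))\<^sup>2 \<le> 16 * r2 x * (2 * ((b x)\<^sup>2 * g2 x) + 2 * ((a x)\<^sup>2 * (cmod (v x))\<^sup>2))"
        using r2 by (intro mult_left_mono) auto
      also have "\<dots> = 32 * (b x)\<^sup>2 * r2 x * g2 x + 32 * (a x)\<^sup>2 * r2 x * r2 x * \<rho> x * (cmod (v x))\<^sup>2"
      proof -
        have "32 * (a x)\<^sup>2 * r2 x * r2 x * \<rho> x = 32 * (a x)\<^sup>2 * r2 x"
          using r2 by (simp only: mult.assoc) simp
        then show ?thesis
          by (simp add: distrib_left mult_ac)
      qed
      also have "\<dots> \<le> q x * g2 x + (p x)\<^sup>2 * q x * \<rho> x * (cmod (v x))\<^sup>2"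
        using absorb[of x] True g2[of x] by (intro add_mono mult_right_mono) auto
      finally have "exp (2 * \<phi> x) * (16 * r2 x * (cmod (F x + lam * v x))\<^sup>2)
          \<le> exp (2 * \<phi> x) * (q x * g2 x + (p x)\<^sup>2 * q x * \<rho> x * (cmod (v x))\<^sup>2)"
        by (intro mult_left_mono) auto
      then have "16 * rhs x \<le> lhs x"
        using True by (simp add: on_annulus mult_ac)
      moreover have "0 \<le> C * err x"
        using err0[of x] by (simp add: C_def)
      ultimately show ?thesis
        by linarith
    next
      case False
      have e: "r2 x * exp (2 * \<phi> x) * (g2 x + (cmod (v x))\<^sup>2) \<le> err x"
      proof (cases "norm (x - c) \<le> 1/2")
        case True
        have "r2 x * exp (2 * \<phi> x) \<le> 1 * exp (2 * s1)"
          using True r s1[of x] by (intro mult_mono power_le_one) auto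
        then have "r2 x * exp (2 * \<phi> x) * (g2 x + (cmod (v x))\<^sup>2) \<le> 1 * exp (2 * s1) * (g2 x + (cmod (v x))\<^sup>2)"
          using g2[of x] by (intro mult_right_mono) auto
        then show ?thesis
          using True g2[of x] by (auto simp: err_def dist_norm norm_minus_commute indicator_def intro: add_increasing2)
      next
        case f: False
        have "r2 x * exp (2 * \<phi> x) \<le> (3 * R)\<^sup>2 * exp (2 * s2)"
          using False f r s2[of x] by (intro mult_mono power_mono) auto
        then have "r2 x * exp (2 * \<phi> x) * (g2 x + (cmod (v x))\<^sup>2) \<le> (3 * R)\<^sup>2 * exp (2 * s2) * (g2 x + (cmod (v x))\<^sup>2)"
          using g2[of x] by (intro mult_right_mono) auto
        then show ?thesis
          using f r g2[of x] by (simp add: err_def dist_norm norm_minus_commute indicator_def power_mult_distrib)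
      qed
      have Ceq: "A1 + A2 + 216 * real CARD('n) + (5184 + 216 * real CARD('n)) = A1 + A2 + 5184 + 432 * real CARD('n)"
        by simp
      have "rhs x \<le> r2 x * exp (2 * \<phi> x) * (2 * C * (g2 x + (cmod (v x))\<^sup>2))"
        unfolding rhs_def C_def g2_def
        using commutator_bound[where D = "\<lambda>i. D\<theta> i x", OF Fx ab(1)[of x] ab(2)[of x] ab(3)[of x] ab(4)[of x]
            \<theta>(2)[of x] \<theta>(5)[of _ x] \<theta>(6)[of x]] r2
        unfolding Ceq by (intro mult_left_mono) auto
      also have "\<dots> = 2 * C * (r2 x * exp (2 * \<phi> x) * (g2 x + (cmod (v x))\<^sup>2))"
        by (simp add: mult_ac)
      also have "\<dots> \<le> 2 * C * err x"
        using e by (intro mult_left_mono) (auto simp: C_def)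
      finally show ?thesis
        using lhs0[OF \<open>x \<in> K\<close>] by linarith
    qed
  qed
  have Km: "K \<in> sets lborel"
    using K by (simp add: compact_imp_closed)
  have errK: "set_integrable lborel K err"
    unfolding set_integrable_def by (rule integrable_mult_indicator[OF Km err_int])
  have "8 * (LINT x:K|lborel. rhs x) = (LINT x:K|lborel. 8 * rhs x)"
    by simp
  also have "\<dots> \<le> (LINT x:K|lborel. 1/2 * lhs x + 16 * C * err x)"
    using key carl errK by (intro set_integral_mono_AE set_integral_add) (auto simp: set_integrable_mult_right)
  also have "\<dots> = (LINT x:K|lborel. 1/2 * lhs x) + (LINT x:K|lborel. 16 * C * err x)"
    using carl errK by (intro set_integral_add) (auto simp: set_integrable_mult_right)
  also have "\<dots> = 1/2 * (LINT x:K|lborel. lhs x) + 16 * C * (LINT x:K|lborel. err x)"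
    by simp
  \<comment> \<open>Half of the left side has been absorbed, which doubles the coefficient 16 of the
    error.\<close>
  finally have "(LINT x:K|lborel. lhs x) \<le> 32 * C * (LINT x:K|lborel. err x)"
    using carl(3) by linarith
  also have "\<dots> \<le> 32 * C * (LINT x|lborel. err x)"
    unfolding set_lebesgue_integral_def using err_int errK err0
    by (intro mult_left_mono integral_mono) (auto simp: C_def set_integrable_def indicator_def)
  also have "(LINT x|lborel. err x) = exp (2 * s1) * (LINT x:cball c (1/2)|lborel. g2 x + (cmod (v x))\<^sup>2)
      + 9 * R\<^sup>2 * exp (2 * s2) * (LINT x:cball c (3 * R)|lborel. g2 x + (cmod (v x))\<^sup>2)"
    unfolding err_def set_lebesgue_integral_def using int[of "cball c (1/2)"] int[of "cball c (3 * R)"]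
    by (subst Bochner_Integration.integral_add) auto
  finally have up: "(LINT x:K|lborel. lhs x) \<le> 32 * C * (exp (2 * s1) * (LINT x:cball c (1/2)|lborel. g2 x + (cmod (v x))\<^sup>2)
      + 9 * R\<^sup>2 * exp (2 * s2) * (LINT x:cball c (3 * R)|lborel. g2 x + (cmod (v x))\<^sup>2))" .
  have "exp (2 * s0) * (LINT x:B|lborel. (cmod (v x))\<^sup>2) = (LINT x:B|lborel. exp (2 * s0) * (cmod (v x))\<^sup>2)"
    by simp
  also have "\<dots> \<le> (LINT x:K|lborel. lhs x)"
    unfolding set_lebesgue_integral_def
  proof (rule integral_mono)
    show "integrable lborel (\<lambda>x. indicator B x *\<^sub>R (exp (2 * s0) * (cmod (v x))\<^sup>2))"
      using H2_approx_integrable(1)[OF H B(1) continuous_on_const[of B "exp (2 * s0)"]] by (simp add: set_integrable_def)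
    show "integrable lborel (\<lambda>x. indicator K x *\<^sub>R lhs x)"
      using carl(1) by (simp add: set_integrable_def)
    fix x
    show "indicator B x *\<^sub>R (exp (2 * s0) * (cmod (v x))\<^sup>2) \<le> indicator K x *\<^sub>R lhs x"
    proof (cases "x \<in> B")
      case True
      note Bx = B(2)[OF True]
      have xK: "x \<in> K"
        using Bx R by (auto simp: Kin)
      have r2: "r2 x > 0"
        using Bx by (intro zero_less_power) linarith
      \<comment> \<open>The assumption \<open>r2 x \<le> (p x)^2 * q x\<close> makes the zeroth
        order coefficient at least 1 on \<open>B\<close>.\<close>
      have "1 * (cmod (v x))\<^sup>2 \<le> (p x)\<^sup>2 * q x * \<rho> x * (cmod (v x))\<^sup>2"
        using Bx r2 by (intro mult_right_mono) (auto simp: field_simps)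
      moreover have "0 \<le> q x * g2 x"
        using weight[of x] xK g2[of x] by (auto simp: Kin)
      ultimately have "exp (2 * s0) * (cmod (v x))\<^sup>2 \<le> exp (2 * \<phi> x) * (q x * g2 x + (p x)\<^sup>2 * q x * \<rho> x * (cmod (v x))\<^sup>2)"
        using Bx by (intro mult_mono) auto
      then show ?thesis
        using True xK Bx by (simp add: on_annulus)
    next
      case False
      then show ?thesis
        using lhs0[of x] by (auto simp: indicator_def)
    qed
  qed
  also note up
  finally show ?thesis
    unfolding C_def g2_def .
qed

end

section \<open>Lower bound at distance R\<close>

text \<open>\<open>\<phi>0\<close>, \<open>\<phi>1\<close>, \<open>\<phi>2\<close> are the exponents
  at the inner error, at the origin and at the outer error. The gap \<kappa> ln R / 3 beats the
  polynomial growth \<open>R ^ k\<close> of the outer mass. The inner gap is of size \<kappa> times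
  the square of ln R, hence of R^\<beta> times its cube, and one more logarithm absorbs the
  constants: this is the fourth power.\<close>

lemma mass_from_exponents:
  fixes R \<kappa> \<beta> :: real and k :: nat
  assumes R: "R \<ge> 9" and \<kappa>: "\<kappa> = R powr \<beta> * ln R" and \<beta>: "\<beta> \<ge> 1" and pos: "c0 > 0" "D > 0"
    and main: "exp (2 * \<phi>1) * c0 \<le> D * (exp (2 * \<phi>0) * m + H * R ^ k * exp (2 * \<phi>2))"
    and far: "\<kappa> * ln R / 3 \<le> \<phi>1 - \<phi>2" and near: "\<phi>0 - \<phi>1 \<le> 10 * \<kappa> * (ln R)\<^sup>2"
    and L: "ln R \<ge> 2 * D * H / c0" "ln R \<ge> 2 * D / c0" "ln R \<ge> real k + 1" "ln R \<ge> 11"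
  shows "exp (- 2 * R powr \<beta> * ln R ^ 4) \<le> m"
proof -
  define l where "l = ln R"
  have Re: "R = exp l"
    using R by (simp add: l_def)
  have "R powr 1 \<le> R powr \<beta>"
    using R \<beta> by (intro powr_mono) auto
  then have "R * l \<le> \<kappa>"
    using R L by (auto simp: \<kappa> l_def intro!: mult_right_mono)
  moreover have "9 * l \<le> R * l"
    using R L by (intro mult_right_mono) (auto simp: l_def)
  ultimately have \<kappa>9: "9 * l \<le> \<kappa>"
    by simp
  have l: "l \<ge> 11"
    using L by (simp add: l_def)
  have le: "l \<le> exp l"
    using exp_ge_add_one_self[of l] by linarith
  \<comment> \<open>With the factor 2 the outer error is shown to take at most half of the main
    term.\<close>
  have "2 * D * H * R ^ k * exp (2 * \<phi>2) \<le> c0 * (l * R ^ k * exp (2 * \<phi>2))"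
  proof -
    have "2 * D * H \<le> c0 * l"
      using L(1) pos by (simp add: l_def field_simps)
    from mult_right_mono[OF this, of "R ^ k * exp (2 * \<phi>2)"] show ?thesis
      using R by (simp add: mult_ac)
  qed
  also have "l * R ^ k * exp (2 * \<phi>2) \<le> exp l * exp (real k * l) * exp (2 * \<phi>2)"
    using le by (intro mult_right_mono) (auto simp: Re exp_of_nat_mult)
  also have "\<dots> = exp ((real k + 1) * l + 2 * \<phi>2)"
    by (simp add: exp_add[symmetric] algebra_simps)
  also have "\<dots> \<le> exp (2 * \<phi>1)"
  proof -
    have "(real k + 1) * l \<le> l * l"
      using L l by (intro mult_right_mono) (auto simp: l_def)
    moreover have "9 * l * l \<le> \<kappa> * l"
      using \<kappa>9 l by (intro mult_right_mono) auto
    moreover have "0 \<le> l * l"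
      by simp
    ultimately have "(real k + 1) * l + 2 * \<phi>2 \<le> 2 * \<phi>1"
      using far unfolding l_def[symmetric] by argo
    then show ?thesis
      by simp
  qed
  finally have "2 * D * H * R ^ k * exp (2 * \<phi>2) \<le> c0 * exp (2 * \<phi>1)"
    using pos by simp
  then have "c0 * exp (2 * \<phi>1) \<le> 2 * D * exp (2 * \<phi>0) * m"
    using main by (simp add: algebra_simps)
  also have "\<dots> = 2 * D * m * exp (2 * (\<phi>0 - \<phi>1)) * exp (2 * \<phi>1)"
    by (simp add: exp_add[symmetric] algebra_simps)
  finally have m: "c0 \<le> 2 * D * m * exp (2 * (\<phi>0 - \<phi>1))"
    by simp
  then have "m \<ge> 0"
    using pos zero_less_mult_iff[of "2 * D * m" "exp (2 * (\<phi>0 - \<phi>1))"] zero_less_mult_iff[of "2 * D" m] by auto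
  have "1 \<le> exp l * (c0 / (2 * D))"
  proof -
    have "2 * D / c0 \<le> exp l"
      using L(2) le unfolding l_def by linarith
    then show ?thesis
      using pos by (simp add: field_simps)
  qed
  also have "\<dots> \<le> exp l * (m * exp (2 * (\<phi>0 - \<phi>1)))"
    using m pos by (intro mult_left_mono) (auto simp: field_simps)
  also have "\<dots> \<le> exp l * (m * exp (20 * \<kappa> * l\<^sup>2))"
    using near \<open>m \<ge> 0\<close> by (intro mult_left_mono) (auto simp: l_def)
  also have "\<dots> = m * exp (l + 20 * \<kappa> * l\<^sup>2)"
    by (simp add: exp_add)
  also have "\<dots> \<le> m * exp (2 * R powr \<beta> * l ^ 4)"
  proof -
    \<comment> \<open>With \<open>X = \<kappa> * l^2\<close> one has
      \<open>l + 20 * X \<le> 21 * X \<le> 22 * X \<le> 2 * l * X\<close>; this is the purpose of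
      \<open>l \<ge> 11\<close>.\<close>
    have "l * (\<kappa> * l\<^sup>2) \<ge> 11 * (\<kappa> * l\<^sup>2)"
      using l \<kappa>9 by (intro mult_right_mono) auto
    moreover have "1 * l \<le> \<kappa> * l\<^sup>2"
      using l \<kappa>9 mult_mono[of 1 l 1 l] by (intro mult_mono) (auto simp: power2_eq_square intro: order_trans)
    moreover have "2 * R powr \<beta> * l ^ 4 = 2 * (l * (\<kappa> * l\<^sup>2))"
      by (simp add: \<kappa> l_def eval_nat_numeral)
    ultimately have "l + 20 * \<kappa> * l\<^sup>2 \<le> 2 * R powr \<beta> * l ^ 4"
      using l by linarith
    then show ?thesis
      using \<open>m \<ge> 0\<close> by (intro mult_left_mono) auto
  qed
  finally show ?thesis
    by (simp add: l_def exp_minus field_simps)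
qed

text \<open>Adding the mass on the smaller ball raises the Caccioppoli constant by one, from 2592 to
  2593.\<close>

lemma caccioppoli_H1:
  fixes v F :: "real^'n \<Rightarrow> complex"
  assumes H: "H2_approx v G F" and ab: "0 < a" "a < b" "b \<le> 3 * (b\<^sup>2 - a\<^sup>2)" "1 \<le> 6 * (b\<^sup>2 - a\<^sup>2)"
    and F: "AE x in lborel. cmod (F x + lam * v x) \<le> A2 * sqrt (\<Sum>i\<in>UNIV. (cmod (G i x))\<^sup>2) + A1 * cmod (v x)"
    and A: "0 \<le> A1"
  shows "(LINT x:cball c a|lborel. (\<Sum>i\<in>UNIV. (norm (G i x))\<^sup>2) + (norm (v x))\<^sup>2)
    \<le> (2593 + 108 * real CARD('n) + A2\<^sup>2 + 2 * (A1 + cmod lam)) * (LINT x:cball c b|lborel. (norm (v x))\<^sup>2)"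
proof -
  note int = H2_approx_integrable(2,1)[OF H compact_cball continuous_on_const[of _ 1], simplified]
  have "(LINT x:cball c a|lborel. (norm (v x))\<^sup>2) \<le> (LINT x:cball c b|lborel. (norm (v x))\<^sup>2)"
    unfolding set_lebesgue_integral_def using int(2)[of c a] int(2)[of c b] ab
    by (intro integral_mono) (auto simp: set_integrable_def indicator_def)
  moreover have "(LINT x:cball c a|lborel. (\<Sum>i\<in>UNIV. (norm (G i x))\<^sup>2) + (norm (v x))\<^sup>2)
      = (LINT x:cball c a|lborel. (\<Sum>i\<in>UNIV. (norm (G i x))\<^sup>2)) + (LINT x:cball c a|lborel. (norm (v x))\<^sup>2)"
    by (rule set_integral_add(2)[OF int])
  ultimately show ?thesis
    using caccioppoli[OF H ab F A, of c] by (simp add: algebra_simps)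
qed

text \<open>From \<open>norm c = R\<close> the triangle inequality gives
  \<open>|norm (x - c) - R| \<le> norm x \<le> 4 * R\<close>. The left half turns decay in
  \<open>x\<close> into decay in the radial variable of the weight.\<close>

lemma japanese_bracket_bounds:
  fixes x c :: "'a::real_normed_vector"
  assumes "norm c = R" "R \<ge> 1" "norm (x - c) \<le> 3 * R"
  shows "1 \<le> japanese_bracket x" "japanese_bracket x \<le> 5 * R" "1 / japanese_bracket x \<le> bracket_inv (norm (x - c) - R)"
proof -
  show 1: "1 \<le> japanese_bracket x"
    by (simp add: japanese_bracket_def)
  have "norm x \<le> norm (x - c) + norm c"
    using norm_triangle_sub[of x c] by simp
  then have "norm x \<le> 4 * R"
    using assms by simp
  then have "1 + (norm x)\<^sup>2 \<le> 1 + (4 * R)\<^sup>2"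
    using power_mono[of "norm x" "4 * R" 2] by simp
  also have "\<dots> \<le> (5 * R)\<^sup>2"
    using one_le_power[OF assms(2), of 2] by (simp add: power_mult_distrib)
  finally show "japanese_bracket x \<le> 5 * R"
    unfolding japanese_bracket_def using assms by (intro real_le_lsqrt) auto
  have "\<bar>norm (x - c) - R\<bar> \<le> norm x"
    using norm_triangle_ineq3[of "x - c" "- c"] assms by simp
  then have "1 + (norm (x - c) - R)\<^sup>2 \<le> 1 + (norm x)\<^sup>2"
    using abs_le_square_iff[of "norm (x - c) - R" "norm x"] by simp
  moreover have "0 < 1 + (norm (x - c) - R)\<^sup>2"
    by (simp add: add_pos_nonneg)
  ultimately show "1 / japanese_bracket x \<le> bracket_inv (norm (x - c) - R)"
    unfolding japanese_bracket_def bracket_inv_def using 1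
    by (intro divide_left_mono mult_pos_pos) (auto simp: japanese_bracket_def)
qed

lemma japanese_bracket_powr_le_1: "s \<ge> 0 \<Longrightarrow> japanese_bracket x powr (- s) \<le> 1"
  using powr_mono[of "- s" 0 "japanese_bracket x"] by (auto simp: japanese_bracket_def split: if_splits)

text \<open>The exponent is compared at the radii \<open>R + 1\<close>, \<open>1/4\<close> and
  \<open>2 * R\<close>, for the mass at the origin and the two errors. The Caccioppoli inequality
  bounds the inner error by the mass in \<open>ball c 1\<close> and the outer one by a power of
  \<open>R\<close>. The threshold is chosen before \<open>v\<close>, \<open>N\<close>,
  \<open>P\<close> and \<beta>.\<close>

lemma unit_ball_mass_lower_bound:
  fixes lam :: complex
  assumes A: "0 \<le> A1" "0 \<le> A2" and C0: "C0 > 0"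
  shows "\<exists>Lmin. \<forall>(v :: real^'n \<Rightarrow> complex) G F N P \<beta> R c.
    H2_approx v G F \<longrightarrow>
    (AE x in lborel. cmod (F x + lam * v x) \<le> A2 * japanese_bracket x powr (- P) * sqrt (\<Sum>i\<in>UNIV. (cmod (G i x))\<^sup>2)
       + A1 * japanese_bracket x powr (- N) * cmod (v x)) \<longrightarrow>
    continuous_on UNIV v \<longrightarrow> (\<forall>x. cmod (v x) \<le> C0) \<longrightarrow> 1 \<le> cmod (v 0) \<longrightarrow>
    0 \<le> N \<longrightarrow> 0 \<le> P \<longrightarrow> 1 \<le> \<beta> \<longrightarrow> \<beta> \<le> 2 \<longrightarrow> 2 - 2 * P \<le> \<beta> \<longrightarrow> 4 - 2 * N \<le> 3 * \<beta> \<longrightarrow>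
    9 \<le> R \<longrightarrow> Lmin \<le> ln R \<longrightarrow> norm c = R \<longrightarrow>
    exp (- 2 * R powr \<beta> * ln R ^ 4) \<le> (LINT x:ball c 1|lborel. (cmod (v x))\<^sup>2)"
proof -
  define n where "n = real CARD('n)"
  define \<Gamma> where "\<Gamma> = A2\<^sup>2 + 2 * (A1 + cmod lam)"
  have \<Gamma>: "\<Gamma> \<ge> 0"
    using A by (simp add: \<Gamma>_def)
  obtain c0 where c0: "c0 > 0" and low: "\<And>f :: real^'n \<Rightarrow> real. continuous_on UNIV f \<Longrightarrow> \<forall>x. 0 \<le> f x \<and> f x \<le> C0\<^sup>2 \<Longrightarrow> f 0 \<ge> 1 \<Longrightarrow>
     (\<forall>\<psi> D D2. C2_on UNIV \<psi> D D2 \<longrightarrow> (\<forall>x. 0 \<le> \<psi> x) \<longrightarrow> (\<forall>x. x \<notin> cball 0 1 \<longrightarrow> \<psi> x = 0) \<longrightarrow>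
        0 \<le> (LINT x:cball 0 1|lborel. ((\<Sum>i\<in>UNIV. D2 i i x) + \<Gamma> * \<psi> x) * f x)) \<Longrightarrow>
     c0 \<le> (LINT x:cball 0 1|lborel. f x)"
  proof -
    have "C0\<^sup>2 > 0"
      using C0 by simp
    from lower_bound_near_origin[where 'n = 'n, OF \<Gamma> this] show thesis
      by (elim exE conjE) (rule that, assumption, blast)
  qed
  define Kc where "Kc = 2593 + 108 * n + A2\<^sup>2 + 2 * (A1 + cmod lam)"
  define D where "D = 32 * (A1 + A2 + 5184 + 432 * n)\<^sup>2 * Kc"
  define H where "H = 9 * C0\<^sup>2 * unit_ball_vol n * 4 ^ CARD('n)"
  have n: "n \<ge> 1"
    by (simp add: n_def)
  have "Kc > 0" "A1 + A2 + 5184 + 432 * n > 0"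
    using A n zero_le_power2[of A2] norm_ge_zero[of lam] by (auto simp: Kc_def intro!: add_pos_nonneg)
  then have pos: "Kc > 0" "D > 0"
    unfolding D_def by (auto intro!: mult_pos_pos)
  \<comment> \<open>In this order the entries serve the weight conditions, the drift, the potential,
    the outer error, the constant of the inner error, and the growth
    \<open>R ^ (CARD('n) + 2)\<close> of the outer error.\<close>
  define Lmin where "Lmin = Max {320 * cmod lam + 48 * n + 4 * n\<^sup>2 + 256, 640 * A2\<^sup>2, 256000 * A1\<^sup>2, 2 * D * H / c0, 2 * D / c0, n + 3}"
  show ?thesis
  proof (intro exI[of _ Lmin] allI impI)
    fix v F :: "real^'n \<Rightarrow> complex" and G :: "'n \<Rightarrow> real^'n \<Rightarrow> complex" and N P \<beta> R :: real and c :: "real^'n"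
    assume H2: "H2_approx v G F"
      and AE: "AE x in lborel. cmod (F x + lam * v x) \<le> A2 * japanese_bracket x powr (- P) * sqrt (\<Sum>i\<in>UNIV. (cmod (G i x))\<^sup>2)
       + A1 * japanese_bracket x powr (- N) * cmod (v x)"
      and v: "continuous_on UNIV v" "\<forall>x. cmod (v x) \<le> C0" "1 \<le> cmod (v 0)"
      and NP: "0 \<le> N" "0 \<le> P" and \<beta>: "1 \<le> \<beta>" "\<beta> \<le> 2" "2 - 2 * P \<le> \<beta>" "4 - 2 * N \<le> 3 * \<beta>"
      and R: "9 \<le> R" "Lmin \<le> ln R" "norm c = R"
    define L where "L = ln R"
    define \<kappa> where "\<kappa> = R powr \<beta> * ln R"
    have "Lmin \<le> L"
      using R by (simp add: L_def)
    then have L: "L \<ge> 320 * cmod lam + 48 * n + 4 * n\<^sup>2 + 256" "L \<ge> 640 * A2\<^sup>2" "L \<ge> 256000 * A1\<^sup>2"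
      "L \<ge> 2 * D * H / c0" "L \<ge> 2 * D / c0" "L \<ge> n + 3"
      unfolding Lmin_def by (auto simp: Max_le_iff)
    have L256: "L \<ge> 256"
      using L(1) n norm_ge_zero[of lam] zero_le_power2[of n] by linarith
    define a where "a x = A1 * japanese_bracket x powr (- N)" for x :: "real^'n"
    define b where "b x = A2 * japanese_bracket x powr (- P)" for x :: "real^'n"
    have ab: "0 \<le> a x" "a x \<le> A1" "0 \<le> b x" "b x \<le> A2" for x
      using A NP by (auto simp: a_def b_def intro!: mult_left_le japanese_bracket_powr_le_1)
    have AE1: "AE x in lborel. cmod (F x + lam * v x) \<le> b x * sqrt (\<Sum>i\<in>UNIV. (cmod (G i x))\<^sup>2) + a x * cmod (v x)"
      using AE by (simp add: a_def b_def)
    have AE2: "AE x in lborel. cmod (F x + lam * v x) \<le> A2 * sqrt (\<Sum>i\<in>UNIV. (cmod (G i x))\<^sup>2) + A1 * cmod (v x)"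
      using AE1
    proof eventually_elim
      case (elim x)
      have "b x * sqrt (\<Sum>i\<in>UNIV. (cmod (G i x))\<^sup>2) \<le> A2 * sqrt (\<Sum>i\<in>UNIV. (cmod (G i x))\<^sup>2)" "a x * cmod (v x) \<le> A1 * cmod (v x)"
        using ab[of x] by (auto intro!: mult_right_mono sum_nonneg)
      then show ?case
        using elim by linarith
    qed
    obtain \<phi> where \<phi>: "\<And>r. r > 0 \<Longrightarrow> (\<phi> has_real_derivative - wp \<kappa> R r / r) (at r)"
      using weight_potential_exists by blast
    have "R powr 1 \<le> R powr \<beta>"
      using R \<beta> by (intro powr_mono) auto
    then have \<kappa>: "R * ln R \<le> \<kappa>" "\<kappa> > 0"
      using R L256 by (auto simp: \<kappa>_def L_def intro!: mult_right_mono)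
    have anti: "\<phi> t \<le> \<phi> s" if "0 < s" "s \<le> t" "t \<le> 4 * R" for s t
    proof -
      have "0 \<le> \<kappa> * ln R * (ln t - ln s)"
        using that R \<kappa> L256 by (intro mult_nonneg_nonneg) (auto simp: L_def)
      also have "\<dots> \<le> \<phi> s - \<phi> t"
        by (rule weight_potential_diff(1)[OF \<phi> R(1) that \<kappa>(2)])
      finally show ?thesis
        by simp
    qed
    interpret radial_weight c "\<lambda>x. \<phi> (norm (x - c))" "\<lambda>x. wp \<kappa> R (norm (x - c))" "\<lambda>x. wq \<kappa> R (norm (x - c))"
        "\<lambda>x. wm1 (real CARD('n)) \<kappa> R (norm (x - c))" "\<lambda>x. wm2 (real CARD('n)) \<kappa> R (norm (x - c))"
      by (rule radial_weight_wp[OF \<phi>])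
    have origin: "R - 1 \<le> norm (x - c)" "norm (x - c) \<le> R + 1" if "x \<in> cball 0 1" for x
      using that R norm_triangle_ineq2[of c x] norm_triangle_ineq4[of x c] by (auto simp: norm_minus_commute)
    have "exp (2 * \<phi> (R + 1)) * (LINT x:cball 0 1|lborel. (cmod (v x))\<^sup>2)
      \<le> 32 * (A1 + A2 + 5184 + 432 * real CARD('n))\<^sup>2 * (exp (2 * \<phi> (1/4)) * (LINT x:cball c (1/2)|lborel. (\<Sum>i\<in>UNIV. (cmod (G i x))\<^sup>2) + (cmod (v x))\<^sup>2)
      + 9 * R\<^sup>2 * exp (2 * \<phi> (2 * R)) * (LINT x:cball c (3 * R)|lborel. (\<Sum>i\<in>UNIV. (cmod (G i x))\<^sup>2) + (cmod (v x))\<^sup>2))"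
    proof (rule carleman_annulus[OF H2 AE1 ab(1) ab(2) ab(3) ab(4)])
      show "1 \<le> R"
        using R by simp
      fix x :: "real^'n"
      let ?r = "norm (x - c)"
      show "wp \<kappa> R ?r > 0 \<and> wq \<kappa> R ?r > 0 \<and> 16 * cmod lam * ?r\<^sup>2 \<le> wp \<kappa> R ?r * wq \<kappa> R ?r \<and> 8 * cmod lam * ?r\<^sup>2 \<le> (wp \<kappa> R ?r)\<^sup>2 \<and>
          4 * wq \<kappa> R ?r \<le> (wp \<kappa> R ?r)\<^sup>2 \<and>
          4 * \<bar>wm2 (real CARD('n)) \<kappa> R ?r * ?r\<^sup>2 + real CARD('n) * wm1 (real CARD('n)) \<kappa> R ?r\<bar> * ?r\<^sup>2 \<le> (wp \<kappa> R ?r)\<^sup>2 * wq \<kappa> R ?r"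
        if "1/4 \<le> ?r" "?r \<le> 3 * R"
        by (intro conjI weight_conditions[where l = "cmod lam" and n = "real CARD('n)"]) (use that R \<kappa> L(1) n in \<open>auto simp: L_def n_def\<close>)
      show "32 * (b x)\<^sup>2 * ?r\<^sup>2 \<le> wq \<kappa> R ?r \<and> 32 * (a x)\<^sup>2 * ?r\<^sup>2 * ?r\<^sup>2 \<le> (wp \<kappa> R ?r)\<^sup>2 * wq \<kappa> R ?r"
        if "1/2 \<le> ?r" "?r \<le> 2 * R"
        unfolding a_def b_def
        by (intro conjI potential_absorption[OF R(1) _ _ \<beta>(1,2) _ _ _ \<beta>(3,4) _ _ _ \<kappa>_def] japanese_bracket_bounds[OF R(3)])
          (use that R L256 L(2,3) in \<open>auto simp: L_def\<close>)
      show "\<phi> ?r \<le> \<phi> (1/4)" if "1/4 \<le> ?r" "?r \<le> 1/2"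
        using anti[of "1/4" ?r] that R by auto
      show "\<phi> ?r \<le> \<phi> (2 * R)" if "2 * R \<le> ?r" "?r \<le> 3 * R"
        using anti[of "2 * R" ?r] that R by auto
    next
      show "compact (cball (0 :: real^'n) 1)"
        by simp
      fix x :: "real^'n"
      let ?r = "norm (x - c)"
      assume x: "x \<in> cball 0 1"
      note o = origin[OF x]
      have r: "0 < ?r" "?r \<le> 4 * R"
        using o R by linarith+
      have "?r * 1 \<le> (4 * R) * L"
        using r L256 R by (intro mult_mono) auto
      also have "\<dots> \<le> (R * L) * L"
        using R L256 by (simp add: mult_ac)
      also have "\<dots> \<le> \<kappa> * L"
        using \<kappa> L256 by (intro mult_right_mono) (auto simp: L_def)
      also have "\<dots> \<le> wp \<kappa> R ?r"
        using wp_bounds(1)[OF R(1) r \<kappa>(2)] by (simp add: L_def)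
      finally have p: "?r\<^sup>2 \<le> (wp \<kappa> R ?r)\<^sup>2"
        by (intro power_mono) auto
      have "1 \<le> (R * L) * (1 * (1 / (5 * R)))"
        using R L256 by (simp add: field_simps)
      also have "\<dots> \<le> \<kappa> * (?r * bracket_inv (?r - R))"
        using o R L256 \<kappa> bracket_inv_shift_ge[OF R(1) r] by (intro mult_mono) (auto simp: L_def)
      finally have q: "1 \<le> wq \<kappa> R ?r"
        by (simp add: wq_def)
      have "?r\<^sup>2 * 1 \<le> (wp \<kappa> R ?r)\<^sup>2 * wq \<kappa> R ?r"
        using p q by (intro mult_mono) auto
      then show "1/2 \<le> ?r \<and> ?r \<le> 2 * R \<and> \<phi> (R + 1) \<le> \<phi> ?r \<and> ?r\<^sup>2 \<le> (wp \<kappa> R ?r)\<^sup>2 * wq \<kappa> R ?r"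
        using o R(1) anti[of ?r "R + 1", OF r(1)] by auto
    qed
    also have "\<dots> \<le> 32 * (A1 + A2 + 5184 + 432 * real CARD('n))\<^sup>2 * (exp (2 * \<phi> (1/4)) * (Kc * (LINT x:ball c 1|lborel. (cmod (v x))\<^sup>2))
      + 9 * R\<^sup>2 * exp (2 * \<phi> (2 * R)) * (Kc * (C0\<^sup>2 * (unit_ball_vol n * (4 * R) ^ CARD('n)))))"
    proof (intro mult_left_mono add_mono)
      have fin: "emeasure lborel (cball c (4 * R)) < top"
        using emeasure_bounded_finite[OF bounded_cball[of c "4 * R"]] by simp
      note int = H2_approx_integrable(1)[OF H2 compact_cball continuous_on_const[of _ 1], simplified]
      have "3/4 \<le> 3 * ((3/4)\<^sup>2 - (1/2 :: real)\<^sup>2)" "1 \<le> 6 * ((3/4)\<^sup>2 - (1/2 :: real)\<^sup>2)"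
        by (simp_all add: power2_eq_square)
      then have "(LINT x:cball c (1/2)|lborel. (\<Sum>i\<in>UNIV. (cmod (G i x))\<^sup>2) + (cmod (v x))\<^sup>2) \<le> Kc * (LINT x:cball c (3/4)|lborel. (cmod (v x))\<^sup>2)"
        unfolding Kc_def n_def by (intro caccioppoli_H1[OF H2 _ _ _ _ AE2 A(1)]) auto
      also have "(LINT x:cball c (3/4)|lborel. (cmod (v x))\<^sup>2) \<le> (LINT x:ball c 1|lborel. (cmod (v x))\<^sup>2)"
        unfolding set_lebesgue_integral_def
      proof (rule integral_mono)
        have "set_integrable lborel (ball c 1) (\<lambda>x. (cmod (v x))\<^sup>2)"
          by (rule set_integrable_subset[OF int[of c 1]]) auto
        then show "integrable lborel (\<lambda>x. indicat_real (ball c 1) x *\<^sub>R (cmod (v x))\<^sup>2)"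
          by (simp add: set_integrable_def)
      qed (use int[of c "3/4"] in \<open>auto simp: set_integrable_def indicator_def\<close>)
      finally show "(LINT x:cball c (1/2)|lborel. (\<Sum>i\<in>UNIV. (cmod (G i x))\<^sup>2) + (cmod (v x))\<^sup>2) \<le> Kc * (LINT x:ball c 1|lborel. (cmod (v x))\<^sup>2)"
        using pos by (simp add: mult_left_mono)
      have "R \<le> R\<^sup>2"
        using R by (simp add: power2_eq_square mult_le_cancel_left1)
      then have "4 * R \<le> 3 * ((4 * R)\<^sup>2 - (3 * R)\<^sup>2)" "1 \<le> 6 * ((4 * R)\<^sup>2 - (3 * R)\<^sup>2)"
        using R by (auto simp: power_mult_distrib)
      then have "(LINT x:cball c (3 * R)|lborel. (\<Sum>i\<in>UNIV. (cmod (G i x))\<^sup>2) + (cmod (v x))\<^sup>2) \<le> Kc * (LINT x:cball c (4 * R)|lborel. (cmod (v x))\<^sup>2)"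
        using R unfolding Kc_def n_def by (intro caccioppoli_H1[OF H2 _ _ _ _ AE2 A(1)]) auto
      also have "(LINT x:cball c (4 * R)|lborel. (cmod (v x))\<^sup>2) \<le> (LINT x:cball c (4 * R)|lborel. C0\<^sup>2)"
        using v(2) C0 int[of c "4 * R"]
        by (intro set_integral_mono) (auto simp: set_integrable_def fin intro!: power_mono integrable_real_indicator)
      also have "\<dots> = C0\<^sup>2 * measure lborel (cball c (4 * R))"
        by (subst set_integral_const) (use fin in auto)
      also have "measure lborel (cball c (4 * R)) = unit_ball_vol n * (4 * R) ^ CARD('n)"
        using content_cball[of "4 * R" c] R(1) by (simp add: n_def)
      finally show "(LINT x:cball c (3 * R)|lborel. (\<Sum>i\<in>UNIV. (cmod (G i x))\<^sup>2) + (cmod (v x))\<^sup>2) \<le> Kc * (C0\<^sup>2 * (unit_ball_vol n * (4 * R) ^ CARD('n)))"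
        using pos by (simp add: mult_left_mono)
    qed auto
    also have "\<dots> = D * (exp (2 * \<phi> (1/4)) * (LINT x:ball c 1|lborel. (cmod (v x))\<^sup>2) + H * R ^ (CARD('n) + 2) * exp (2 * \<phi> (2 * R)))"
      unfolding D_def H_def n_def by (simp add: power_mult_distrib power_add power2_eq_square[of R] algebra_simps)
    finally have main: "exp (2 * \<phi> (R + 1)) * (LINT x:cball 0 1|lborel. (cmod (v x))\<^sup>2) \<le> \<dots>" .
    have mass: "c0 \<le> (LINT x:cball 0 1|lborel. (cmod (v x))\<^sup>2)"
    proof (rule low)
      show "continuous_on UNIV (\<lambda>x. (cmod (v x))\<^sup>2)"
        by (intro continuous_intros v)
      show "\<forall>x. 0 \<le> (cmod (v x))\<^sup>2 \<and> (cmod (v x))\<^sup>2 \<le> C0\<^sup>2"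
        using v(2) by (auto intro!: power_mono)
      show "1 \<le> (cmod (v 0))\<^sup>2"
        using v(3) by simp
      show "\<forall>\<psi> D D2. C2_on UNIV \<psi> D D2 \<longrightarrow> (\<forall>x. 0 \<le> \<psi> x) \<longrightarrow> (\<forall>x. x \<notin> cball 0 1 \<longrightarrow> \<psi> x = 0) \<longrightarrow>
        0 \<le> (LINT x:cball 0 1|lborel. ((\<Sum>i\<in>UNIV. D2 i i x) + \<Gamma> * \<psi> x) * (cmod (v x))\<^sup>2)"
      proof (intro allI impI)
        fix \<psi> D and D2 :: "'n \<Rightarrow> 'n \<Rightarrow> real^'n \<Rightarrow> real"
        assume \<psi>: "C2_on UNIV \<psi> D D2" "\<forall>x. 0 \<le> \<psi> x" "\<forall>x. x \<notin> cball 0 1 \<longrightarrow> \<psi> x = 0"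
        have "0 \<le> (LINT x:cball 0 1|lborel. \<psi> x * (\<Sum>i\<in>UNIV. (cmod (G i x))\<^sup>2))"
          unfolding set_lebesgue_integral_def using \<psi>(2)
          by (intro integral_nonneg_AE AE_I2) (auto intro!: mult_nonneg_nonneg sum_nonneg)
        also have "\<dots> \<le> (LINT x:cball 0 1|lborel. ((\<Sum>i\<in>UNIV. D2 i i x) + \<Gamma> * \<psi> x) * (cmod (v x))\<^sup>2)"
          unfolding \<Gamma>_def using \<psi>(2,3) by (intro H2_approx_subsolution[OF H2 compact_cball \<psi>(1) _ _ AE2]) auto
        finally show "0 \<le> (LINT x:cball 0 1|lborel. ((\<Sum>i\<in>UNIV. D2 i i x) + \<Gamma> * \<psi> x) * (cmod (v x))\<^sup>2)" .
      qed
    qed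
    show "exp (- 2 * R powr \<beta> * ln R ^ 4) \<le> (LINT x:ball c 1|lborel. (cmod (v x))\<^sup>2)"
    proof (rule mass_from_exponents[OF R(1) \<kappa>_def \<beta>(1) c0 pos(2)])
      show "exp (2 * \<phi> (R + 1)) * c0
          \<le> D * (exp (2 * \<phi> (1/4)) * (LINT x:ball c 1|lborel. (cmod (v x))\<^sup>2) + H * R ^ (CARD('n) + 2) * exp (2 * \<phi> (2 * R)))"
        by (rule order_trans[OF mult_left_mono[OF mass] main]) simp
      \<comment> \<open>The gap between the origin and the outer region:
        \<open>ln x \<le> x - 1\<close> gives
        \<open>ln (2 * R) - ln (R + 1) \<ge> 1/3\<close>.\<close>
      have "(R + 1) / (2 * R) > 0"
        using R by simp
      then have "ln ((R + 1) / (2 * R)) \<le> (R + 1) / (2 * R) - 1"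
        by (rule ln_le_minus_one)
      also have "\<dots> \<le> - 1/3"
        using R by (simp add: field_simps)
      finally have "1/3 \<le> ln (2 * R) - ln (R + 1)"
        using R by (simp add: ln_div)
      then have "\<kappa> * ln R * (1/3) \<le> \<kappa> * ln R * (ln (2 * R) - ln (R + 1))"
        using \<kappa> L256 by (intro mult_left_mono) (auto simp: L_def)
      also have "\<dots> \<le> \<phi> (R + 1) - \<phi> (2 * R)"
        using R by (intro weight_potential_diff(1)[OF \<phi> R(1) _ _ _ \<kappa>(2)]) auto
      finally show "\<kappa> * ln R / 3 \<le> \<phi> (R + 1) - \<phi> (2 * R)"
        by simp
      \<comment> \<open>Bounds the length \<open>ln (4 * (R + 1))\<close> of the logarithmic
        interval from 1/4 to \<open>R + 1\<close> by \<open>2 * ln R\<close>; times 5 \<kappa> ln R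
        this is the inner gap.\<close>
      have "4 * (R + 1) \<le> R\<^sup>2"
      proof -
        have "9 * R \<le> R * R"
          using R(1) by (intro mult_right_mono) auto
        then show ?thesis
          unfolding power2_eq_square using R(1) by argo
      qed
      then have "ln (4 * (R + 1)) \<le> ln (R\<^sup>2)"
        using R by (subst ln_le_cancel_iff) auto
      then have ln: "ln (R + 1) - ln (1/4) \<le> 2 * ln R"
        using R ln_mult_pos[of 4 "R + 1"] by (simp add: ln_div ln_realpow)
      have "\<phi> (1/4) - \<phi> (R + 1) \<le> \<kappa> * (5 * ln R) * (ln (R + 1) - ln (1/4))"
        using R by (intro weight_potential_diff(2)[OF \<phi> R(1) _ _ _ \<kappa>(2)]) auto
      also have "\<dots> \<le> \<kappa> * (5 * ln R) * (2 * ln R)"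
        using ln \<kappa> L256 by (intro mult_left_mono) (auto simp: L_def)
      finally show "\<phi> (1/4) - \<phi> (R + 1) \<le> 10 * \<kappa> * (ln R)\<^sup>2"
        by (simp add: power2_eq_square)
    qed (use L L256 in \<open>auto simp: L_def n_def\<close>)
  qed
qed

section \<open>Transfer to weak solutions, and the theorem\<close>

text \<open>Point values are taken from the continuous representative and integrals agree for it and
  \<open>u\<close>. The estimate for the squared mass has twice the exponent stated here, so the
  square root gives exactly this bound.\<close>

lemma M_inf_lower_bound:
  fixes lam :: complex
  assumes A: "0 \<le> A1" "0 \<le> A2" and C0: "C0 > 0"
  shows "\<exists>Lmin. \<forall>(V :: real^'n \<Rightarrow> complex) (W :: real^'n \<Rightarrow> complex^'n) (u :: real^'n \<Rightarrow> complex) v N P R.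
      V \<in> borel_measurable lebesgue \<longrightarrow> W \<in> borel_measurable lebesgue \<longrightarrow>
      (\<forall>x. norm (V x) \<le> A1 * japanese_bracket x powr (- N)) \<longrightarrow>
      (\<forall>x. norm (W x) \<le> A2 * japanese_bracket x powr (- P)) \<longrightarrow>
      weak_solution V W lam u \<longrightarrow> Linf_norm u \<le> ereal C0 \<longrightarrow> continuous_representative u v \<longrightarrow>
      1 \<le> cmod (v 0) \<longrightarrow> 0 \<le> N \<longrightarrow> 0 \<le> P \<longrightarrow> 9 \<le> R \<longrightarrow> Lmin \<le> ln R \<longrightarrow>
      exp (- (R powr beta_0 N P * ln R ^ 4)) \<le> M_inf u R"
proof -
  show ?thesis
    using unit_ball_mass_lower_bound[where 'n = 'n, OF A C0, of lam]
  proof (elim exE, intro exI allI impI)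
    fix Lmin and V :: "real^'n \<Rightarrow> complex" and W :: "real^'n \<Rightarrow> complex^'n" and u v :: "real^'n \<Rightarrow> complex" and N P R :: real
    assume lower: "\<forall>(v :: real^'n \<Rightarrow> complex) G F N P \<beta> R c.
      H2_approx v G F \<longrightarrow>
      (AE x in lborel. cmod (F x + lam * v x) \<le> A2 * japanese_bracket x powr (- P) * sqrt (\<Sum>i\<in>UNIV. (cmod (G i x))\<^sup>2)
         + A1 * japanese_bracket x powr (- N) * cmod (v x)) \<longrightarrow>
      continuous_on UNIV v \<longrightarrow> (\<forall>x. cmod (v x) \<le> C0) \<longrightarrow> 1 \<le> cmod (v 0) \<longrightarrow>
      0 \<le> N \<longrightarrow> 0 \<le> P \<longrightarrow> 1 \<le> \<beta> \<longrightarrow> \<beta> \<le> 2 \<longrightarrow> 2 - 2 * P \<le> \<beta> \<longrightarrow> 4 - 2 * N \<le> 3 * \<beta> \<longrightarrow>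
      9 \<le> R \<longrightarrow> Lmin \<le> ln R \<longrightarrow> norm c = R \<longrightarrow>
      exp (- 2 * R powr \<beta> * ln R ^ 4) \<le> (LINT x:ball c 1|lborel. (cmod (v x))\<^sup>2)"
      and V: "V \<in> borel_measurable lebesgue" "\<forall>x. norm (V x) \<le> A1 * japanese_bracket x powr (- N)"
      and W: "W \<in> borel_measurable lebesgue" "\<forall>x. norm (W x) \<le> A2 * japanese_bracket x powr (- P)"
      and u: "weak_solution V W lam u" "Linf_norm u \<le> ereal C0" "continuous_representative u v"
      and v0: "1 \<le> cmod (v 0)" and NP: "0 \<le> N" "0 \<le> P" and R: "9 \<le> R" "Lmin \<le> ln R"
    have v: "continuous_on UNIV v" and uv: "AE x in lebesgue. u x = v x"
      using u(3) by (auto simp: continuous_representative_def)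
    \<comment> \<open>For the continuous representative the essential bound holds everywhere, since
      a closed set of full measure is the whole space.\<close>
    have "AE x in lebesgue. ereal (cmod (u x)) \<le> ereal C0"
      using esssup_AE[of "\<lambda>x. ereal (cmod (u x))" lebesgue]
      by eventually_elim (rule order_trans[OF _ u(2)[unfolded Linf_norm_def]])
    then have "AE x in lebesgue. x \<in> {x. cmod (v x) \<le> C0}"
      using uv by eventually_elim simp
    moreover have "closed {x. cmod (v x) \<le> C0}"
      by (intro closed_Collect_le continuous_intros v)
    ultimately have vC0: "\<forall>x. cmod (v x) \<le> C0"
      using mem_closed_if_AE_lebesgue by fastforce
    have ab: "A1 * japanese_bracket x powr (- N) \<le> A1" "A2 * japanese_bracket x powr (- P) \<le> A2" for x :: "real^'n"
      using A NP by (auto intro!: mult_left_le japanese_bracket_powr_le_1)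
    obtain G F where H: "H2_approx v G F" "AE x in lborel. cmod (F x + lam * v x)
        \<le> A2 * japanese_bracket x powr (- P) * sqrt (\<Sum>i\<in>UNIV. (cmod (G i x))\<^sup>2) + A1 * japanese_bracket x powr (- N) * cmod (v x)"
      by (rule weak_solution_H2_approx[OF V(1) W(1) spec[OF V(2)] ab(1) spec[OF W(2)] ab(2) u(1) v uv], rule that)
    \<comment> \<open>Nonnegativity of \<open>N\<close> and \<open>P\<close> gives
      \<open>beta_0 N P \<le> 2\<close>; the other three bounds are the members of the
      maximum.\<close>
    have \<beta>: "1 \<le> beta_0 N P" "beta_0 N P \<le> 2" "2 - 2 * P \<le> beta_0 N P" "4 - 2 * N \<le> 3 * beta_0 N P"
      using NP by (auto simp: beta_0_def beta_c_def max_def)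
    show "exp (- (R powr beta_0 N P * ln R ^ 4)) \<le> M_inf u R"
      unfolding M_inf_def
    proof (rule cINF_greatest)
      show "{x0 :: real^'n. norm x0 = R} \<noteq> {}"
        using vector_choose_size[of R] R by auto
      fix c :: "real^'n"
      assume "c \<in> {x0. norm x0 = R}"
      then have "exp (- 2 * R powr beta_0 N P * ln R ^ 4) \<le> (LINT x:ball c 1|lborel. (cmod (v x))\<^sup>2)"
        using lower[rule_format, OF H v vC0[rule_format] v0 NP \<beta> R, of c] by simp
      also have "\<dots> = (LINT x:ball c 1|lebesgue. (cmod (v x))\<^sup>2)"
        unfolding set_lebesgue_integral_def
        by (intro integral_completion[symmetric] borel_measurable_scaleR borel_measurable_indicator)
          (auto intro!: borel_measurable_continuous_onI continuous_intros v)
      also have "\<dots> = (LINT x:ball c 1|lebesgue. (cmod (u x))\<^sup>2)"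
      proof -
        have "u \<in> borel_measurable lebesgue"
          using u(1) by (auto simp: weak_solution_def L2_loc_def)
        moreover have "v \<in> borel_measurable lebesgue"
          using borel_measurable_continuous_onI[OF v] by (intro measurable_completion) simp
        moreover have "(\<lambda>x. indicat_real (ball c 1) x *\<^sub>R (cmod (f x))\<^sup>2) \<in> borel_measurable lebesgue"
          if "f \<in> borel_measurable lebesgue" for f :: "real^'n \<Rightarrow> complex"
          by (intro borel_measurable_scaleR borel_measurable_power measurable_compose[OF that borel_measurable_norm]
              borel_measurable_indicator) simp
        ultimately show ?thesis
          unfolding set_lebesgue_integral_def using uv by (intro integral_cong_AE) auto
      qed
      finally have "sqrt (exp (- 2 * R powr beta_0 N P * ln R ^ 4)) \<le> L2_norm_on (ball c 1) u"
        unfolding L2_norm_on_def by (rule real_sqrt_le_mono)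
      moreover have "exp (- 2 * R powr beta_0 N P * ln R ^ 4) = (exp (- (R powr beta_0 N P * ln R ^ 4)))\<^sup>2"
        by (simp add: power2_eq_square exp_add[symmetric])
      ultimately show "exp (- (R powr beta_0 N P * ln R ^ 4)) \<le> L2_norm_on (ball c 1) u"
        by simp
    qed
  qed
qed

theorem theorem1:
  shows "\<exists>C5>0. \<forall>N\<ge>0. \<forall>P\<ge>0. \<exists>C6>0. \<forall>A1\<ge>0. \<forall>A2\<ge>0. \<exists>C7>0. \<forall>lam::complex. \<forall>C0>0. \<exists>R0>0.
    \<forall>(V :: real^'n \<Rightarrow> complex) (W :: real^'n \<Rightarrow> complex^'n) (u :: real^'n \<Rightarrow> complex) v.
      V \<in> borel_measurable lebesgue \<longrightarrow>
      W \<in> borel_measurable lebesgue \<longrightarrow>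
      (\<forall>x. norm (V x) \<le> A1 * japanese_bracket x powr (- N)) \<longrightarrow>
      (\<forall>x. norm (W x) \<le> A2 * japanese_bracket x powr (- P)) \<longrightarrow>
      weak_solution V W lam u \<longrightarrow>
      Linf_norm u \<le> ereal C0 \<longrightarrow>
      continuous_representative u v \<longrightarrow>
      v 0 \<in> \<real> \<longrightarrow> Re (v 0) \<ge> 1 \<longrightarrow>
      (\<forall>R\<ge>R0.
        (beta_c N P > 1 \<longrightarrow>
           M_inf u R \<ge> C5 * exp (- C7 * R powr beta_0 N P * ln R powr C6)) \<and>
        (beta_c N P < 1 \<longrightarrow>
           M_inf u R \<ge> C5 * exp (- C7 * R * ln R powr (C6 * ln (ln R)))))"
proof -
  \<comment> \<open>The witnesses are \<open>C5 = 1\<close>, \<open>C7 = 1\<close> and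
    \<open>C6 = 4\<close>; all dependence on the data is pushed into \<open>R0\<close>.\<close>
  have *: "\<exists>R0>0. \<forall>(V :: real^'n \<Rightarrow> complex) (W :: real^'n \<Rightarrow> complex^'n) (u :: real^'n \<Rightarrow> complex) v.
      V \<in> borel_measurable lebesgue \<longrightarrow> W \<in> borel_measurable lebesgue \<longrightarrow>
      (\<forall>x. norm (V x) \<le> A1 * japanese_bracket x powr (- N)) \<longrightarrow>
      (\<forall>x. norm (W x) \<le> A2 * japanese_bracket x powr (- P)) \<longrightarrow>
      weak_solution V W lam u \<longrightarrow> Linf_norm u \<le> ereal C0 \<longrightarrow> continuous_representative u v \<longrightarrow>
      v 0 \<in> \<real> \<longrightarrow> Re (v 0) \<ge> 1 \<longrightarrow>
      (\<forall>R\<ge>R0.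
        (beta_c N P > 1 \<longrightarrow> M_inf u R \<ge> 1 * exp (- 1 * R powr beta_0 N P * ln R powr 4)) \<and>
        (beta_c N P < 1 \<longrightarrow> M_inf u R \<ge> 1 * exp (- 1 * R * ln R powr (4 * ln (ln R)))))"
    if N: "N \<ge> 0" and P: "P \<ge> 0" and A: "A1 \<ge> 0" "A2 \<ge> 0" and C0: "C0 > 0" for N P A1 A2 C0 :: real and lam :: complex
    using M_inf_lower_bound[where 'n = 'n, OF A C0, of lam]
  proof (elim exE)
    fix Lmin
    assume lower: "\<forall>(V :: real^'n \<Rightarrow> complex) (W :: real^'n \<Rightarrow> complex^'n) (u :: real^'n \<Rightarrow> complex) v N P R.
      V \<in> borel_measurable lebesgue \<longrightarrow> W \<in> borel_measurable lebesgue \<longrightarrow>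
      (\<forall>x. norm (V x) \<le> A1 * japanese_bracket x powr (- N)) \<longrightarrow>
      (\<forall>x. norm (W x) \<le> A2 * japanese_bracket x powr (- P)) \<longrightarrow>
      weak_solution V W lam u \<longrightarrow> Linf_norm u \<le> ereal C0 \<longrightarrow> continuous_representative u v \<longrightarrow>
      1 \<le> cmod (v 0) \<longrightarrow> 0 \<le> N \<longrightarrow> 0 \<le> P \<longrightarrow> 9 \<le> R \<longrightarrow> Lmin \<le> ln R \<longrightarrow>
      exp (- (R powr beta_0 N P * ln R ^ 4)) \<le> M_inf u R"
    \<comment> \<open>The 8 ensures \<open>R \<ge> 9\<close> through \<open>exp 8 \<ge> 9\<close>,
      and \<open>ln (ln R) \<ge> 1\<close> through \<open>exp 1 \<le> 8\<close>.\<close>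
    define R0 where "R0 = exp (max Lmin 8)"
    have R: "9 \<le> R" "Lmin \<le> ln R" "8 \<le> ln R" if "R0 \<le> R" for R
    proof -
      have "R > 0"
        using that exp_gt_zero[of "max Lmin 8"] unfolding R0_def by linarith
      then have "max Lmin 8 \<le> ln R"
        using that unfolding R0_def by (subst ln_ge_iff)
      then show "Lmin \<le> ln R" "8 \<le> ln R"
        by auto
      have "9 \<le> exp (8 :: real)"
        using exp_ge_add_one_self[of 8] by simp
      also have "\<dots> \<le> R0"
        by (simp add: R0_def)
      finally show "9 \<le> R"
        using that by simp
    qed
    have final: "(beta_c N P > 1 \<longrightarrow> M_inf u R \<ge> 1 * exp (- 1 * R powr beta_0 N P * ln R powr 4)) \<and>
        (beta_c N P < 1 \<longrightarrow> M_inf u R \<ge> 1 * exp (- 1 * R * ln R powr (4 * ln (ln R))))"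
      if R0: "R0 \<le> R" and M: "exp (- (R powr beta_0 N P * ln R ^ 4)) \<le> M_inf u R" for R and u :: "real^'n \<Rightarrow> complex"
    proof (intro conjI impI)
      have l4: "ln R powr 4 = ln R ^ 4"
        using R(3)[OF R0] powr_realpow[of "ln R" 4] by simp
      then show "M_inf u R \<ge> 1 * exp (- 1 * R powr beta_0 N P * ln R powr 4)"
        using M by simp
      assume "beta_c N P < 1"
      then have "R powr beta_0 N P = R"
        using R(1)[OF R0] by (simp add: beta_0_def)
      moreover have "1 \<le> ln (ln R)"
      proof -
        have "exp 1 \<le> ln R"
          using R(3)[OF R0] exp_le by linarith
        then show ?thesis
          using R(3)[OF R0] by (subst ln_ge_iff) auto
      qed
      \<comment> \<open>In case (b) the fourth power of \<open>ln R\<close> is dominated by the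
        larger exponent, as \<open>ln (ln R) \<ge> 1\<close>.\<close>
      then have "ln R powr 4 \<le> ln R powr (4 * ln (ln R))"
        using R(3)[OF R0] by (intro powr_mono) auto
      then have "R * ln R ^ 4 \<le> R * ln R powr (4 * ln (ln R))"
        using R(1)[OF R0] by (simp add: l4)
      ultimately have "exp (- 1 * R * ln R powr (4 * ln (ln R))) \<le> exp (- (R powr beta_0 N P * ln R ^ 4))"
        by simp
      then show "M_inf u R \<ge> 1 * exp (- 1 * R * ln R powr (4 * ln (ln R)))"
        using M by linarith
    qed
    show ?thesis
    proof (rule exI[of _ R0], intro conjI allI impI)
      show "R0 > 0"
        by (simp add: R0_def)
    next
      fix V :: "real^'n \<Rightarrow> complex" and W :: "real^'n \<Rightarrow> complex^'n" and u v :: "real^'n \<Rightarrow> complex" and R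
      assume VW: "V \<in> borel_measurable lebesgue" "W \<in> borel_measurable lebesgue"
        "\<forall>x. norm (V x) \<le> A1 * japanese_bracket x powr (- N)" "\<forall>x. norm (W x) \<le> A2 * japanese_bracket x powr (- P)"
        "weak_solution V W lam u" "Linf_norm u \<le> ereal C0" "continuous_representative u v"
        and v0: "1 \<le> Re (v 0)" and R0: "R0 \<le> R"
      have "1 \<le> cmod (v 0)"
        using v0 complex_Re_le_cmod[of "v 0"] by linarith
      with lower[rule_format, OF VW(1,2) VW(3)[rule_format] VW(4)[rule_format] VW(5-7) _ N P R(1,2)[OF R0]]
      have M: "exp (- (R powr beta_0 N P * ln R ^ 4)) \<le> M_inf u R"
        by simp
      note f = final[OF R0 M]
      show "beta_c N P > 1 \<Longrightarrow> M_inf u R \<ge> 1 * exp (- 1 * R powr beta_0 N P * ln R powr 4)"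
        "beta_c N P < 1 \<Longrightarrow> M_inf u R \<ge> 1 * exp (- 1 * R * ln R powr (4 * ln (ln R)))"
        using f by blast+
    qed
  qed
  show ?thesis
    by (rule exI[of _ 1], rule conjI, simp, intro allI impI, rule exI[of _ 4], rule conjI, simp, intro allI impI,
        rule exI[of _ 1], rule conjI, simp, intro allI impI, rule *)
qed

end
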